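(* Let $m_1,m_2\ge 1$ be integers, let $\mathbf{\Sigma}_{\mathbf{S}_1,\mathbf{S}_2}\succ\mathbf{0}$ be the covariance matrix of the jointly Gaussian zero-mean source vectors $(\mathbf{S}_1,\mathbf{S}_2)$ of sizes $m_1\times 1$ and $m_2\times 1$, let $\mathbf{\Sigma}_{\mathbf{S}_2}$ be the covariance matrix of $\mathbf{S}_2$, let $N_2>N_1>0$, and let $\mathbf{D}_1\succ\mathbf{0}$ ($m_1\times m_1$) and $\mathbf{D}_2\succ\mathbf{0}$ ($m_2\times m_2$). Let $P(\mathbf{D}_1,\mathbf{D}_2)$ be the minimum-power function of the source-channel broadcast problem defined in the context. Then $$P(\mathbf{D}_1,\mathbf{D}_2)\geq\sup_{\mathbf{\Sigma}_{\mathbf{U}_1,\mathbf{U}_2}\succ \mathbf{0}}\left[N_1\frac{|\mathbf{\Sigma}_{\mathbf{S}_1,\mathbf{S}_2}+\mathbf{\Sigma}_{\mathbf{U}_1,\mathbf{U}_2}|}{|\mathbf{D}_1+\mathbf{\Sigma}_{\mathbf{U}_1}|\,|\mathbf{D}_2+\mathbf{\Sigma}_{\mathbf{U}_2}|}+(N_2-N_1)\frac{|\mathbf{\Sigma}_{\mathbf{S}_2}+\mathbf{\Sigma}_{\mathbf{U}_2}|}{|\mathbf{D}_2+\mathbf{\Sigma}_{\mathbf{U}_2}|}-N_2\right],$$ where the supremum is over all positive definite $(m_1+m_2)\times(m_1+m_2)$ matrices $\mathbf{\Sigma}_{\mathbf{U}_1,\mathbf{U}_2}$, and $\mathbf{\Sigma}_{\mathbf{U}_1}$,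 $\mathbf{\Sigma}_{\mathbf{U}_2}$ denote its upper-left $m_1\times m_1$ and lower-right $m_2\times m_2$ diagonal blocks, respectively.
   Context: Notation: $|\cdot|$ is the determinant; $\mathbf{A}\preceq\mathbf{B}$ (resp. $\mathbf{A}\prec\mathbf{B}$) means $\mathbf{B}-\mathbf{A}$ is positive semidefinite (resp. positive definite). Sources and channel: $\mathbf{S}_1,\mathbf{S}_2$ are zero-mean jointly Gaussian random vectors of sizes $m_1\times1$, $m_2\times 1$ with joint covariance matrix $\mathbf{\Sigma}_{\mathbf{S}_1,\mathbf{S}_2}$ (the covariance of the stacked vector $(\mathbf{S}_1^T,\mathbf{S}_2^T)^T$), and $\mathbf{\Sigma}_{\mathbf{S}_i}=\mathbb{E}[\mathbf{S}_i\mathbf{S}_i^T]$. The channel noises $Z_1,Z_2$ are zero-mean Gaussian random variables with variances $N_1,N_2$, where $N_2>N_1>0$, and the pair $(Z_1,Z_2)$ is independent of $(\mathbf{S}_1,\mathbf{S}_2)$. Let $\{(\mathbf{S}_1(t),\mathbf{S}_2(t),Z_1(t),Z_2(t))\}_{t\ge1}$ be i.i.d. copies of $(\mathbf{S}_1,\mathbf{S}_2,Z_1,Z_2)$. Write $\mathbf{S}_i^n=(\mathbf{S}_i(1),\dots,\mathbf{S}_i(n))$, an $m_i\times n$ random matrix, and $Z_i^n=(Z_i(1),\dots,Z_i(n))$, a $1\times n$ row vector. Codes: an $(n,P,\mathbf{D}_1,\mathbf{D}_2)$ source-channel broadcast code consists of a (measurable) encoding function $f:\mathbb{R}^{m_1\times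 n}\times\mathbb{R}^{m_2\times n}\to\mathbb{R}^n$ and two (measurable) decoding functions $g_i:\mathbb{R}^n\to\mathbb{R}^{m_i\times n}$, $i=1,2$, such that $$\tfrac1n\mathbb{E}[X^n(X^n)^T]\le P,\qquad \tfrac1n\mathbb{E}[(\mathbf{S}_i^n-\hat{\mathbf{S}}_i^n)(\mathbf{S}_i^n-\hat{\mathbf{S}}_i^n)^T]\preceq\mathbf{D}_i,\quad i=1,2,$$ where $X^n=f(\mathbf{S}_1^n,\mathbf{S}_2^n)$ (a $1\times n$ row vector), $Y_i^n=X^n+Z_i^n$ and $\hat{\mathbf{S}}_i^n=g_i(Y_i^n)$. The triple $(P,\mathbf{D}_1,\mathbf{D}_2)$ is achievable if there exists an $(n,P,\mathbf{D}_1,\mathbf{D}_2)$ source-channel broadcast code (for some $n\ge1$). $\mathcal{PD}$ is the closure of the set of all achievable triples, and $$P(\mathbf{D}_1,\mathbf{D}_2)=\inf\{P:(P,\mathbf{D}_1,\mathbf{D}_2)\in\mathcal{PD}\}.$$ *)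

theory Defs
  imports "HOL-Probability.Probability"
begin

definition pos_semidef :: "real^'n^'n \<Rightarrow> bool"
  where "pos_semidef A \<longleftrightarrow> transpose A = A \<and> (\<forall>x. 0 \<le> x \<bullet> (A *v x))"

definition pos_def :: "real^'n^'n \<Rightarrow> bool"
  where "pos_def A \<longleftrightarrow> transpose A = A \<and> (\<forall>x. x \<noteq> 0 \<longrightarrow> 0 < x \<bullet> (A *v x))"

definition loewner_le :: "real^'n^'n \<Rightarrow> real^'n^'n \<Rightarrow> bool"
  where "loewner_le A B \<longleftrightarrow> pos_semidef (B - A)"

definition stack :: "real^'a \<Rightarrow> real^'b \<Rightarrow> real^('a + 'b)"
  where "stack x y = (\<chi> i. case i of Inl a \<Rightarrow> x $ a | Inr b \<Rightarrow> y $ b)"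

definition upper_left :: "real^('a::finite + 'b::finite)^('a + 'b) \<Rightarrow> real^'a^'a"
  where "upper_left A = (\<chi> i j. A $ Inl i $ Inl j)"

definition lower_right :: "real^('a::finite + 'b::finite)^('a + 'b) \<Rightarrow> real^'b^'b"
  where "lower_right A = (\<chi> i j. A $ Inr i $ Inr j)"

definition outer :: "real^'n \<Rightarrow> real^'n \<Rightarrow> real^'n^'n"
  where "outer x y = (\<chi> i j. x $ i * y $ j)"

(* E[V V^T]; this is the covariance matrix when V has zero mean. *)
definition second_moment :: "'w measure \<Rightarrow> ('w \<Rightarrow> real^'n) \<Rightarrow> real^'n^'n"
  where "second_moment M V = (\<integral>\<omega>. outer (V \<omega>) (V \<omega>) \<partial>M)"

(* Every linear functional is normal, a constant counting as a normal variable of variance 0.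
   Applied to a pair V = (V1, V2) this is joint Gaussianity of V1 and V2. *)
definition jointly_gaussian :: "'w measure \<Rightarrow> ('w \<Rightarrow> 'v::euclidean_space) \<Rightarrow> bool"
  where "jointly_gaussian M V \<longleftrightarrow>
    V \<in> borel_measurable M \<and>
    (\<forall>a. (\<exists>\<mu> \<sigma>. 0 < \<sigma> \<and> distributed M lborel (\<lambda>\<omega>. a \<bullet> V \<omega>) (normal_density \<mu> \<sigma>)) \<or>
         (\<exists>\<mu>. AE \<omega> in M. a \<bullet> V \<omega> = \<mu>))"

(* Time runs over 0, 1, 2, ...  The joint law of the two noises at one time is arbitrary;
   only their normal marginals are prescribed.  noise_indep is independence of the generated
   sigma-algebras, since indep_var needs both random variables to have the same type. *)
locale gaussian_broadcast = prob_space M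
  for M :: "'w measure"
    and S1 :: "nat \<Rightarrow> 'w \<Rightarrow> real^'m1" and S2 :: "nat \<Rightarrow> 'w \<Rightarrow> real^'m2"
    and Z1 Z2 :: "nat \<Rightarrow> 'w \<Rightarrow> real"
    and N1 N2 :: real +
  assumes source_gaussian: "jointly_gaussian M (\<lambda>\<omega>. (S1 0 \<omega>, S2 0 \<omega>))"
    and source_zero_mean: "expectation (S1 0) = 0" "expectation (S2 0) = 0"
    and noise1: "distributed M lborel (Z1 0) (normal_density 0 (sqrt N1))"
    and noise2: "distributed M lborel (Z2 0) (normal_density 0 (sqrt N2))"
    and noise_indep:
      "indep_set (sets (vimage_algebra (space M) (\<lambda>\<omega>. (S1 0 \<omega>, S2 0 \<omega>)) borel))
                 (sets (vimage_algebra (space M) (\<lambda>\<omega>. (Z1 0 \<omega>, Z2 0 \<omega>)) borel))"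
    and indep_in_time:
      "indep_vars (\<lambda>_. borel) (\<lambda>t \<omega>. (S1 t \<omega>, S2 t \<omega>, Z1 t \<omega>, Z2 t \<omega>)) UNIV"
    and ident_distributed:
      "\<And>t. distr M borel (\<lambda>\<omega>. (S1 t \<omega>, S2 t \<omega>, Z1 t \<omega>, Z2 t \<omega>)) =
            distr M borel (\<lambda>\<omega>. (S1 0 \<omega>, S2 0 \<omega>, Z1 0 \<omega>, Z2 0 \<omega>))"

(* A block of n vectors (an m \<times> n matrix, given by its columns) is an element of the
   extensional product space block_space n. *)
abbreviation block_space :: "nat \<Rightarrow> (nat \<Rightarrow> 'v::topological_space) measure"
  where "block_space n \<equiv> (\<Pi>\<^sub>M t\<in>{..<n}. borel)"

definition block :: "nat \<Rightarrow> (nat \<Rightarrow> 'w \<Rightarrow> 'v) \<Rightarrow> 'w \<Rightarrow> nat \<Rightarrow> 'v"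
  where "block n V \<omega> = (\<lambda>t\<in>{..<n}. V t \<omega>)"

definition channel_output ::
    "nat \<Rightarrow> ('w \<Rightarrow> nat \<Rightarrow> real) \<Rightarrow> (nat \<Rightarrow> 'w \<Rightarrow> real) \<Rightarrow> 'w \<Rightarrow> nat \<Rightarrow> real"
  where "channel_output n X Z \<omega> = (\<lambda>t\<in>{..<n}. X \<omega> t + Z t \<omega>)"

(* The integrability conjuncts here and below state that the expectations are finite: the
   integral of a non-integrable function is 0 by convention. *)
definition meets_power ::
    "'w measure \<Rightarrow> nat \<Rightarrow> ('w \<Rightarrow> nat \<Rightarrow> real) \<Rightarrow> real \<Rightarrow> bool"
  where "meets_power M n X P \<longleftrightarrow>
    integrable M (\<lambda>\<omega>. \<Sum>t<n. (X \<omega> t)\<^sup>2) \<and>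
    (1 / real n) * (\<integral>\<omega>. (\<Sum>t<n. (X \<omega> t)\<^sup>2) \<partial>M) \<le> P"

(* For an m \<times> n matrix E with columns e_t, E E^T is the sum of the e_t e_t^T. *)
definition meets_distortion ::
    "'w measure \<Rightarrow> nat \<Rightarrow> ('w \<Rightarrow> nat \<Rightarrow> real^'m) \<Rightarrow> ('w \<Rightarrow> nat \<Rightarrow> real^'m) \<Rightarrow> real^'m^'m \<Rightarrow> bool"
  where "meets_distortion M n S R D \<longleftrightarrow>
    integrable M (\<lambda>\<omega>. \<Sum>t<n. outer (S \<omega> t - R \<omega> t) (S \<omega> t - R \<omega> t)) \<and>
    loewner_le
      ((1 / real n) *\<^sub>R (\<integral>\<omega>. (\<Sum>t<n. outer (S \<omega> t - R \<omega> t) (S \<omega> t - R \<omega> t)) \<partial>M)) D"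

definition broadcast_code ::
    "'w measure \<Rightarrow> (nat \<Rightarrow> 'w \<Rightarrow> real^'m1) \<Rightarrow> (nat \<Rightarrow> 'w \<Rightarrow> real^'m2) \<Rightarrow>
     (nat \<Rightarrow> 'w \<Rightarrow> real) \<Rightarrow> (nat \<Rightarrow> 'w \<Rightarrow> real) \<Rightarrow>
     nat \<Rightarrow> real \<Rightarrow> real^'m1^'m1 \<Rightarrow> real^'m2^'m2 \<Rightarrow>
     ((nat \<Rightarrow> real^'m1) \<times> (nat \<Rightarrow> real^'m2) \<Rightarrow> nat \<Rightarrow> real) \<Rightarrow>
     ((nat \<Rightarrow> real) \<Rightarrow> nat \<Rightarrow> real^'m1) \<Rightarrow> ((nat \<Rightarrow> real) \<Rightarrow> nat \<Rightarrow> real^'m2) \<Rightarrow> bool"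
  where "broadcast_code M S1 S2 Z1 Z2 n P D1 D2 f g1 g2 \<longleftrightarrow>
    f \<in> block_space n \<Otimes>\<^sub>M block_space n \<rightarrow>\<^sub>M block_space n \<and>
    g1 \<in> block_space n \<rightarrow>\<^sub>M block_space n \<and>
    g2 \<in> block_space n \<rightarrow>\<^sub>M block_space n \<and>
    (let X = (\<lambda>\<omega>. f (block n S1 \<omega>, block n S2 \<omega>)) in
      meets_power M n X P \<and>
      meets_distortion M n (block n S1) (\<lambda>\<omega>. g1 (channel_output n X Z1 \<omega>)) D1 \<and>
      meets_distortion M n (block n S2) (\<lambda>\<omega>. g2 (channel_output n X Z2 \<omega>)) D2)"

definition achievable ::
    "'w measure \<Rightarrow> (nat \<Rightarrow> 'w \<Rightarrow> real^'m1) \<Rightarrow> (nat \<Rightarrow> 'w \<Rightarrow> real^'m2) \<Rightarrow>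
     (nat \<Rightarrow> 'w \<Rightarrow> real) \<Rightarrow> (nat \<Rightarrow> 'w \<Rightarrow> real) \<Rightarrow>
     (real \<times> (real^'m1^'m1) \<times> (real^'m2^'m2)) set"
  where "achievable M S1 S2 Z1 Z2 =
    {(P, D1, D2). \<exists>n\<ge>1. \<exists>f g1 g2. broadcast_code M S1 S2 Z1 Z2 n P D1 D2 f g1 g2}"

definition PD_region ::
    "'w measure \<Rightarrow> (nat \<Rightarrow> 'w \<Rightarrow> real^'m1) \<Rightarrow> (nat \<Rightarrow> 'w \<Rightarrow> real^'m2) \<Rightarrow>
     (nat \<Rightarrow> 'w \<Rightarrow> real) \<Rightarrow> (nat \<Rightarrow> 'w \<Rightarrow> real) \<Rightarrow>
     (real \<times> (real^'m1^'m1) \<times> (real^'m2^'m2)) set"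
  where "PD_region M S1 S2 Z1 Z2 = closure (achievable M S1 S2 Z1 Z2)"

(* Extended-real valued, so that the infimum over an empty set is \<infinity>. *)
definition min_power ::
    "'w measure \<Rightarrow> (nat \<Rightarrow> 'w \<Rightarrow> real^'m1) \<Rightarrow> (nat \<Rightarrow> 'w \<Rightarrow> real^'m2) \<Rightarrow>
     (nat \<Rightarrow> 'w \<Rightarrow> real) \<Rightarrow> (nat \<Rightarrow> 'w \<Rightarrow> real) \<Rightarrow>
     real^'m1^'m1 \<Rightarrow> real^'m2^'m2 \<Rightarrow> ereal"
  where "min_power M S1 S2 Z1 Z2 D1 D2 =
    (INF P\<in>{P. (P, D1, D2) \<in> PD_region M S1 S2 Z1 Z2}. ereal P)"

end

theory Submission
  imports Defs
begin

text \<open>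
  Let \<open>U = U' + s\<^sup>2 I\<close> and add to the sources an independent Gaussian vector of covariance \<open>U\<close>, giving
  \<open>W = (W1, W2)\<close> with entropy determined by \<open>\<Sigma> + U\<close>. Decoder \<open>i\<close> estimates \<open>W\<^sub>i\<close> from \<open>Y\<^sub>i\<close> with error
  covariance at most \<open>D\<^sub>i + U\<^sub>i\<close>, so the conditional entropy of \<open>W2\<close> given \<open>Y2\<close>, and that of \<open>W1\<close> given
  \<open>(W2, Y1)\<close>, are at most Gaussian. Since \<open>Y2\<close> has power at most \<open>P + N2\<close>, and \<open>Y1\<close> given \<open>W\<close> has at least the
  noise entropy, this bounds the entropy of \<open>Y2\<close> given \<open>W2\<close> from above and that of \<open>Y1\<close> given \<open>W2\<close> from
  below. The entropy power inequality for \<open>Y2 = Y1 + noise\<close>, conditional on \<open>W2\<close>, links the two.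

  Each entropy bound is Gibbs' inequality \<open>E ln (r/p) \<le> 0\<close> against a test density \<open>r\<close>. The smoothing
  \<open>s\<^sup>2 I\<close> makes every law involved a mixture of product Gaussians, with positive bounded density and
  integrable logarithm. The entropy power inequality is used in the linearized form
  \<open>h(Y + Z) \<ge> l h(Y) + (1 - l) h(Z) + ((1 - l) ln (1 / (1 - l)) + l ln (1 / l)) / 2\<close>: on the line it follows
  from Gibbs' inequality after transporting a standard normal variable to \<open>Y\<close> and rotating; the
  channel coordinates are then exchanged one at a time. The closure is reached by continuity of
  the determinant.
\<close>

section \<open>The linearized entropy power inequality on the line\<close>

text \<open>The two noises at one time may be coupled in any way, while the argument wants the
  second channel to be a degraded version of the first. A decoder's distortion depends only on the
  joint law of the sources and its own noise, so both channels are realized on one space of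
  independent standard normals, and passing from \<open>N1\<close> to \<open>N2\<close> becomes a
  change of standard deviation on the channel coordinates. Entropies are integrals of logarithms and
  must be finite; second moments (of source, input and error) provide this once every coordinate
  carries Gaussian noise, which the channel has already and the sources receive from the s^2 I
  carved out of U. The linearized inequality is used because it survives averaging over the
  condition; the weight l = a / (a + \<tau>) restores the power form at the end. With k = 2 pi e and
  k \<alpha> the exponential of twice the entropy per use of Y1 given W2, decoder 1 yields N1 hW
  \<le> \<alpha> h2 d1 and decoder 2 yields h2 (\<alpha> + N2 - N1) \<le> d2 (P + N2); eliminating
  \<alpha> gives the bound.\<close>

lemma gibbs:
  assumes N: "prob_space N" and L[measurable]: "L \<in> borel_measurable N"
    and pos: "\<And>x. x \<in> space N \<Longrightarrow> 0 < L x"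
    and le1: "(\<integral>\<^sup>+x. ennreal (L x) \<partial>N) \<le> 1"
    and H: "integrable N H" and HL: "\<And>x. x \<in> space N \<Longrightarrow> H x \<le> ln (L x)"
  shows "(\<integral>x. H x \<partial>N) \<le> (0::real)"
proof -
  interpret prob_space N by fact
  have iL: "integrable N L"
    by (rule integrableI_nonneg)
       (use pos le1 in \<open>auto intro!: AE_I2 less_imp_le le_less_trans[OF le1]\<close>)
  have EL: "(\<integral>x. L x \<partial>N) \<le> 1"
  proof -
    have "ennreal (\<integral>x. L x \<partial>N) = (\<integral>\<^sup>+x. ennreal (L x) \<partial>N)"
      by (rule nn_integral_eq_integral[symmetric, OF iL]) (use pos in \<open>auto intro!: AE_I2 less_imp_le\<close>)
    then have "ennreal (\<integral>x. L x \<partial>N) \<le> ennreal 1" using le1 by simp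
    then show ?thesis by (subst (asm) ennreal_le_iff) auto
  qed
  \<comment> \<open>\<open>ln t \<le> t - 1\<close>. Comparing with a minorant \<open>H\<close>
    spares an integrability proof for \<open>ln L\<close> itself, which in \<open>epi_one\<close>
    contains the logarithm of a sum of derivatives.\<close>
  have "(\<integral>x. H x \<partial>N) \<le> (\<integral>x. L x - 1 \<partial>N)"
    by (rule integral_mono[OF H])
       (use iL pos HL in \<open>auto intro: order_trans[OF _ ln_le_minus_one]\<close>)
  also have "\<dots> = (\<integral>x. L x \<partial>N) - 1" using iL by (simp add: prob_space)
  finally show ?thesis using EL by simp
qed

text \<open>Substitution is exact on compact intervals, and monotone convergence exhausts the line
  by them. Only an inequality is left, since \<open>\<Theta>\<close> may miss part of the line; this
  is the direction that a test density needs.\<close>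

lemma nn_integral_substitution_le:
  fixes \<Theta> \<Theta>' :: "real \<Rightarrow> real" and q :: "real \<Rightarrow> ennreal"
  assumes q[measurable]: "q \<in> borel_measurable borel"
    and d: "\<And>x. (\<Theta> has_real_derivative \<Theta>' x) (at x)"
    and c: "continuous_on UNIV \<Theta>'" and nn: "\<And>x. 0 \<le> \<Theta>' x"
  shows "(\<integral>\<^sup>+x. q (\<Theta> x) * \<Theta>' x \<partial>lborel) \<le> (\<integral>\<^sup>+x. q x \<partial>lborel)"
proof -
  have [measurable]: "\<Theta> \<in> borel_measurable borel"
    using d by (intro borel_measurable_continuous_onI continuous_at_imp_continuous_on ballI)
      (auto intro: DERIV_isCont)
  have [measurable]: "\<Theta>' \<in> borel_measurable borel"
    using c by (rule borel_measurable_continuous_onI)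
  \<comment> \<open>\<open>Suc k\<close> gives every interval, the first included, positive length,
    as the substitution rule requires.\<close>
  define I where "I k = {- real (Suc k)..real (Suc k)}" for k
  have [measurable]: "I k \<in> sets borel" for k by (simp add: I_def)
  have "(\<integral>\<^sup>+x. q (\<Theta> x) * \<Theta>' x \<partial>lborel) = (\<integral>\<^sup>+x. (SUP k. q (\<Theta> x) * \<Theta>' x * indicator (I k) x) \<partial>lborel)"
  proof (intro nn_integral_cong)
    fix x :: real
    obtain k :: nat where k: "\<bar>x\<bar> < real k" using reals_Archimedean2 by blast
    have "q (\<Theta> x) * \<Theta>' x \<le> (SUP k. q (\<Theta> x) * \<Theta>' x * indicator (I k) x)"
      by (rule SUP_upper2[of k]) (use k in \<open>auto simp: I_def indicator_def\<close>)
    moreover have "(SUP k. q (\<Theta> x) * \<Theta>' x * indicator (I k) x) \<le> q (\<Theta> x) * \<Theta>' x"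
      by (rule SUP_least) (auto simp: indicator_def)
    ultimately show "q (\<Theta> x) * \<Theta>' x = (SUP k. q (\<Theta> x) * \<Theta>' x * indicator (I k) x)" by simp
  qed
  also have "\<dots> = (SUP k. (\<integral>\<^sup>+x. q (\<Theta> x) * \<Theta>' x * indicator (I k) x \<partial>lborel))"
    by (intro nn_integral_monotone_convergence_SUP)
       (auto simp: incseq_def le_fun_def I_def indicator_def)
  also have "\<dots> \<le> (\<integral>\<^sup>+x. q x \<partial>lborel)"
  proof (rule SUP_least)
    fix k
    have "(\<integral>\<^sup>+x. q (\<Theta> x) * \<Theta>' x * indicator (I k) x \<partial>lborel)
        = (\<integral>\<^sup>+x. q x * indicator {\<Theta> (- real (Suc k)) .. \<Theta> (real (Suc k))} x \<partial>lborel)"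
      unfolding I_def
      by (rule nn_integral_substitution_aux[symmetric])
         (use d nn in \<open>auto intro: continuous_on_subset[OF c]\<close>)
    also have "\<dots> \<le> (\<integral>\<^sup>+x. q x \<partial>lborel)"
      by (intro nn_integral_mono) (auto simp: indicator_def)
    finally show "(\<integral>\<^sup>+x. q (\<Theta> x) * \<Theta>' x * indicator (I k) x \<partial>lborel) \<le> (\<integral>\<^sup>+x. q x \<partial>lborel)" .
  qed
  finally show ?thesis .
qed

section \<open>Distribution function of a positive continuous density\<close>

context
  fixes \<phi> :: "real \<Rightarrow> real"
  assumes cont: "continuous_on UNIV \<phi>" and pos: "\<And>x. 0 < \<phi> x"
    and one: "(\<integral>\<^sup>+x. ennreal (\<phi> x) \<partial>lborel) = 1"
begin

lemma real_distribution_density: "real_distribution (density lborel \<phi>)"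
proof -
  have [measurable]: "\<phi> \<in> borel_measurable borel"
    using cont by (rule borel_measurable_continuous_onI)
  show ?thesis
    unfolding real_distribution_def real_distribution_axioms_def
    using one by (auto intro!: prob_spaceI simp: emeasure_density)
qed

lemma cdf_density_deriv: "(cdf (density lborel \<phi>) has_real_derivative \<phi> x) (at x)"
proof -
  interpret real_distribution "density lborel \<phi>" by (rule real_distribution_density)
  have m[measurable]: "\<phi> \<in> borel_measurable borel"
    using cont by (rule borel_measurable_continuous_onI)
  define a b where "a = x - 1" and "b = x + 1"
  \<comment> \<open>Near \<open>x\<close> the distribution function is a constant plus an integral
    with a fixed finite lower end, so the fundamental theorem of calculus applies. The half-open and
    the closed interval differ by the null set \<open>{a}\<close>.\<close>
  have F: "cdf (density lborel \<phi>) u = cdf (density lborel \<phi>) a + integral {a..u} \<phi>" if "u \<in> {a..b}" for u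
  proof -
    have ci: "set_integrable lborel {a..u} \<phi>"
      by (rule borel_integrable_atLeastAtMost') (use cont in \<open>auto intro: continuous_on_subset\<close>)
    have "cdf (density lborel \<phi>) u - cdf (density lborel \<phi>) a = measure (density lborel \<phi>) {a<..u}"
      by (cases "a < u") (use that in \<open>auto simp: cdf_diff_eq\<close>)
    also have "\<dots> = measure (density lborel \<phi>) {a..u}"
    proof -
      have "emeasure (density lborel \<phi>) {a<..u} = emeasure (density lborel \<phi>) {a..u}"
      proof (subst (1 2) emeasure_density)
        have "AE t in lborel. t \<noteq> a" by (rule AE_lborel_singleton)
        then show "(\<integral>\<^sup>+t. ennreal (\<phi> t) * indicator {a<..u} t \<partial>lborel) = (\<integral>\<^sup>+t. ennreal (\<phi> t) * indicator {a..u} t \<partial>lborel)"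
          by (intro nn_integral_cong_AE) (auto elim!: eventually_mono simp: indicator_def)
      qed auto
      then show ?thesis by (simp add: measure_def)
    qed
    also have "\<dots> = (LINT t:{a..u}|lborel. \<phi> t)"
    proof -
      have "emeasure (density lborel \<phi>) {a..u} = (\<integral>\<^sup>+t. ennreal (indicator {a..u} t *\<^sub>R \<phi> t) \<partial>lborel)"
        by (subst emeasure_density) (auto intro!: nn_integral_cong simp: indicator_def)
      also have "\<dots> = ennreal (LINT t:{a..u}|lborel. \<phi> t)"
        unfolding set_lebesgue_integral_def
        by (rule nn_integral_eq_integral)
           (use ci pos in \<open>auto simp: set_integrable_def indicator_def less_imp_le intro!: AE_I2\<close>)
      finally show ?thesis
        by (simp add: measure_def set_lebesgue_integral_def integral_nonneg_AE pos less_imp_le)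
    qed
    also have "\<dots> = integral {a..u} \<phi>" by (rule set_borel_integral_eq_integral(2)[OF ci])
    finally show ?thesis by simp
  qed
  have "((\<lambda>u. integral {a..u} \<phi>) has_vector_derivative \<phi> x) (at x within {a..b})"
    by (rule integral_has_vector_derivative) (use cont in \<open>auto simp: a_def b_def intro: continuous_on_subset\<close>)
  then have "((\<lambda>u. cdf (density lborel \<phi>) a + integral {a..u} \<phi>) has_real_derivative \<phi> x) (at x within {a..b})"
    unfolding has_real_derivative_iff_has_vector_derivative
    by (auto intro!: derivative_eq_intros)
  then have "(cdf (density lborel \<phi>) has_real_derivative \<phi> x) (at x within {a..b})"
    by (rule has_field_derivative_transform_within[where d = 1])
       (simp_all add: a_def b_def, rule F[symmetric, unfolded a_def b_def], simp)
  moreover have "at x within {a..b} = at x"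
    by (rule at_within_interior) (auto simp: a_def b_def)
  ultimately show ?thesis by simp
qed

lemma cdf_density_strict_mono: "x < y \<Longrightarrow> cdf (density lborel \<phi>) x < cdf (density lborel \<phi>) y"
  by (rule DERIV_pos_imp_increasing) (use cdf_density_deriv pos in blast)+

lemma cdf_density_range: "0 < cdf (density lborel \<phi>) x" "cdf (density lborel \<phi>) x < 1"
proof -
  interpret real_distribution "density lborel \<phi>" by (rule real_distribution_density)
  show "0 < cdf (density lborel \<phi>) x"
    using cdf_density_strict_mono[of "x - 1" x] cdf_nonneg[of "x-1"] by simp
  show "cdf (density lborel \<phi>) x < 1"
    using cdf_density_strict_mono[of x "x + 1"] cdf_bounded_prob[of "x+1"] by simp
qed

lemma cdf_density_surj:
  assumes "0 < p" "p < 1" shows "\<exists>x. cdf (density lborel \<phi>) x = p"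
proof -
  interpret real_distribution "density lborel \<phi>" by (rule real_distribution_density)
  let ?F = "cdf (density lborel \<phi>)"
  have "eventually (\<lambda>x. ?F x < p) at_bot"
    by (rule order_tendstoD(2)[OF cdf_lim_at_bot]) fact
  then obtain a where a: "?F a < p" by (meson eventually_at_bot_linorder order_refl)
  have "eventually (\<lambda>x. p < ?F x) at_top"
    by (rule order_tendstoD(1)[OF cdf_lim_at_top_prob]) fact
  then obtain b where b: "p < ?F b" by (meson eventually_at_top_linorder order_refl)
  have "a \<le> b" using a b cdf_density_strict_mono[of b a] by (cases "b < a") auto
  then show ?thesis
    using IVT[of ?F a p b] a b cdf_density_deriv by (auto intro: DERIV_isCont)
qed

end

section \<open>The standard normal law: transport and rotation\<close>

abbreviation std_normal :: "real measure" where "std_normal \<equiv> density lborel std_normal_density"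

lemma std_normal_density_props:
  "continuous_on UNIV std_normal_density" "0 < std_normal_density x"
  "(\<integral>\<^sup>+x. ennreal (std_normal_density x) \<partial>lborel) = 1"
proof -
  show "continuous_on UNIV std_normal_density"
    unfolding normal_density_def by (intro continuous_intros) auto
  show "0 < std_normal_density x" by (rule normal_density_pos) simp
  show "(\<integral>\<^sup>+x. ennreal (std_normal_density x) \<partial>lborel) = 1"
    by (subst nn_integral_eq_integral) auto
qed

interpretation std_normal: prob_space std_normal
  using prob_space_normal_density[of 1 0] by simp

text \<open>\<open>T\<close> is the increasing rearrangement: the quantile function of
  \<open>\<phi>\<close> after the normal distribution function. The derivative formula is the change
  of variables \<open>\<phi> (T x) * T' x = std_normal_density x\<close>; through its logarithm the
  entropy of \<open>\<phi>\<close> enters \<open>epi_one\<close>.\<close>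

lemma normal_transport:
  fixes \<phi> :: "real \<Rightarrow> real"
  assumes phi: "continuous_on UNIV \<phi>" "\<And>x. 0 < \<phi> x" "(\<integral>\<^sup>+x. ennreal (\<phi> x) \<partial>lborel) = 1"
  obtains T where "\<And>x. (T has_real_derivative std_normal_density x / \<phi> (T x)) (at x)"
    "distr std_normal borel T = density lborel \<phi>"
proof -
  let ?F = "cdf (density lborel \<phi>)" and ?N = "cdf std_normal"
  note F = cdf_density_strict_mono[OF phi] cdf_density_range[OF phi] cdf_density_surj[OF phi]
    cdf_density_deriv[OF phi]
  note N = cdf_density_strict_mono[OF std_normal_density_props] cdf_density_range[OF std_normal_density_props]
    cdf_density_surj[OF std_normal_density_props] cdf_density_deriv[OF std_normal_density_props]
  \<comment> \<open>The quantile function. It is meaningful for \<open>0 < p < 1\<close> only, and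
    every value of \<open>?N\<close> lies there.\<close>
  define G where "G p = (SOME y. ?F y = p)" for p
  have FG: "?F (G p) = p" if "0 < p" "p < 1" for p
    unfolding G_def using F(4)[OF that] by (rule someI_ex)
  have Finj: "?F x = ?F y \<Longrightarrow> x = y" for x y
    using F(1)[of x y] F(1)[of y x] by (cases x y rule: linorder_cases) auto
  have GF: "G (?F z) = z" for z
    using FG[of "?F z"] F(2,3)[of z] Finj by blast
  define T where "T x = G (?N x)" for x
  have FT: "?F (T x) = ?N x" for x
    unfolding T_def using FG N(2,3) by blast
  have dG: "(G has_real_derivative inverse (\<phi> (G p))) (at p)" if p: "0 < p" "p < 1" for p
  proof (rule DERIV_inverse_function[where f = ?F and a = 0 and b = 1])
    show "(?F has_real_derivative \<phi> (G p)) (at (G p))" by (rule F)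
    show "\<phi> (G p) \<noteq> 0" using phi(2)[of "G p"] by simp
    have "isCont G (?F (G p))"
      by (rule isCont_inverse_function[where d = 1]) (use GF F(5) in \<open>auto intro: DERIV_isCont\<close>)
    then show "isCont G p" by (simp add: FG[OF p])
  qed (use p FG in auto)
  have dT: "(T has_real_derivative std_normal_density x / \<phi> (T x)) (at x)" for x
    unfolding T_def
    using DERIV_chain2[OF dG[OF N(2,3)] N(5)] by (simp add: field_simps)
  have Tcont: "continuous_on UNIV T"
    using dT by (intro continuous_at_imp_continuous_on ballI) (blast intro: DERIV_isCont)
  have Tm[measurable]: "T \<in> borel_measurable borel"
    using Tcont by (rule borel_measurable_continuous_onI)
  have "distr std_normal borel T = density lborel \<phi>"
  proof (rule cdf_unique)
    interpret Nd: real_distribution std_normal by (rule real_distribution_density[OF std_normal_density_props])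
    show "real_distribution (distr std_normal borel T)"
      unfolding real_distribution_def real_distribution_axioms_def
      using std_normal.prob_space_distr[of T borel] by simp
    show "real_distribution (density lborel \<phi>)" by (rule real_distribution_density[OF phi])
    show "cdf (distr std_normal borel T) = ?F"
    proof
      fix y
      obtain s where s: "?N s = ?F y" using N(4)[OF F(2,3)] by blast
      \<comment> \<open>\<open>T\<close> is increasing, so the preimage of a half-line is a
        half-line; comparing through the strictly increasing \<open>?F\<close> and \<open>?N\<close>
        identifies its end \<open>s\<close>.\<close>
      have iff: "T x \<le> y \<longleftrightarrow> x \<le> s" for x
      proof -
        have "T x \<le> y \<longleftrightarrow> ?F (T x) \<le> ?F y"
          using F(1)[of "T x" y] F(1)[of y "T x"] by (cases "T x" y rule: linorder_cases) auto
        also have "\<dots> \<longleftrightarrow> ?N x \<le> ?N s" by (simp add: FT s)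
        also have "\<dots> \<longleftrightarrow> x \<le> s"
          using N(1)[of x s] N(1)[of s x] by (cases x s rule: linorder_cases) auto
        finally show ?thesis .
      qed
      have "cdf (distr std_normal borel T) y = measure std_normal (T -` {..y} \<inter> space std_normal)"
        by (simp add: cdf_def measure_distr)
      also have "T -` {..y} \<inter> space std_normal = {..s}" using iff by auto
      finally show "cdf (distr std_normal borel T) y = ?F y" using s by (simp add: cdf_def)
    qed
  qed
  then show ?thesis using that dT by blast
qed

text \<open>With \<open>c > 0\<close> a rotation is a composition of two one-dimensional affine
  substitutions: \<open>y = (s x + t) / c\<close> at fixed \<open>x\<close>, then
  \<open>x = c g - s t\<close> at fixed \<open>t\<close>. The Jacobians \<open>1 / c\<close> and
  \<open>c\<close> cancel, and the product density depends on \<open>x^2 + y^2\<close> only.\<close>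

lemma std_normal_rotate:
  fixes c s :: real
  assumes c: "0 < c" and cs: "c\<^sup>2 + s\<^sup>2 = 1"
  shows "distr (std_normal \<Otimes>\<^sub>M std_normal) (borel \<Otimes>\<^sub>M borel) (\<lambda>(g, h). (c * g - s * h, s * g + c * h))
    = std_normal \<Otimes>\<^sub>M std_normal"
proof (rule measure_eqI)
  show "sets (distr (std_normal \<Otimes>\<^sub>M std_normal) (borel \<Otimes>\<^sub>M borel) (\<lambda>(g, h). (c * g - s * h, s * g + c * h)))
    = sets (std_normal \<Otimes>\<^sub>M std_normal)"
    by (simp add: cong: sets_pair_measure_cong)
  fix A assume "A \<in> sets (distr (std_normal \<Otimes>\<^sub>M std_normal) (borel \<Otimes>\<^sub>M borel) (\<lambda>(g, h). (c * g - s * h, s * g + c * h)))"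
  then have A[measurable]: "A \<in> sets (borel \<Otimes>\<^sub>M borel)" by simp
  define f where "f g h = (indicator A (g, h) :: ennreal)" for g h :: real
  have f[measurable]: "case_prod f \<in> borel_measurable (borel \<Otimes>\<^sub>M borel)"
    unfolding f_def by measurable
  let ?n = std_normal_density
  let ?M = "std_normal \<Otimes>\<^sub>M std_normal"
  have rho: "ennreal (?n (c * g - s * h)) * ennreal (?n (s * g + c * h)) = ennreal (?n g) * ennreal (?n h)" for g h
  proof -
    have "(c * g - s * h)\<^sup>2 + (s * g + c * h)\<^sup>2 = (c\<^sup>2 + s\<^sup>2) * (g\<^sup>2 + h\<^sup>2)"
      by (simp add: power2_eq_square algebra_simps)
    then have e: "(c * g - s * h)\<^sup>2 + (s * g + c * h)\<^sup>2 = g\<^sup>2 + h\<^sup>2" using cs by simp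
    have nn: "?n x * ?n y = 1 / (2 * pi) * exp (- (x\<^sup>2 + y\<^sup>2) / 2)" for x y
    proof -
      have "?n x * ?n y = (1 / sqrt (2 * pi) * (1 / sqrt (2 * pi))) * (exp (- x\<^sup>2 / 2) * exp (- y\<^sup>2 / 2))"
        unfolding std_normal_density_def by (simp only: mult_ac)
      also have "exp (- x\<^sup>2 / 2) * exp (- y\<^sup>2 / 2) = exp (- (x\<^sup>2 + y\<^sup>2) / 2)"
        by (simp only: exp_add[symmetric]) (simp add: add_divide_distrib[symmetric])
      also have "1 / sqrt (2 * pi) * (1 / sqrt (2 * pi)) = 1 / (2 * pi)" by simp
      finally show ?thesis .
    qed
    show ?thesis
      by (subst (1 2) ennreal_mult[symmetric]) (auto simp only: nn e normal_density_nonneg)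
  qed
  have split: "(\<integral>\<^sup>+p. F (fst p) (snd p) \<partial>?M) = (\<integral>\<^sup>+x. \<integral>\<^sup>+y. ennreal (?n x) * ennreal (?n y) * F x y \<partial>lborel \<partial>lborel)"
    if [measurable]: "case_prod F \<in> borel_measurable (borel \<Otimes>\<^sub>M borel)" for F :: "real \<Rightarrow> real \<Rightarrow> ennreal"
    by (subst std_normal.nn_integral_fst[symmetric])
       (simp_all add: nn_integral_density nn_integral_cmult[symmetric] mult.assoc cong: measurable_cong_sets)
  have "emeasure ?M A = (\<integral>\<^sup>+p. f (fst p) (snd p) \<partial>?M)"
    by (subst nn_integral_indicator[symmetric]) (auto simp: f_def cong: sets_pair_measure_cong)
  also have "\<dots> = (\<integral>\<^sup>+x. \<integral>\<^sup>+y. ennreal (?n x) * ennreal (?n y) * f x y \<partial>lborel \<partial>lborel)"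
    by (rule split) simp
  also have "\<dots> = (\<integral>\<^sup>+x. ennreal (1/c) * (\<integral>\<^sup>+t. ennreal (?n x) * ennreal (?n (s/c * x + 1/c * t)) * f x (s/c * x + 1/c * t) \<partial>lborel) \<partial>lborel)"
  proof (intro nn_integral_cong)
    fix x
    show "(\<integral>\<^sup>+y. ennreal (?n x) * ennreal (?n y) * f x y \<partial>lborel) =
      ennreal (1/c) * (\<integral>\<^sup>+t. ennreal (?n x) * ennreal (?n (s/c * x + 1/c * t)) * f x (s/c * x + 1/c * t) \<partial>lborel)"
      using c nn_integral_real_affine[where c = "1/c" and t = "s/c * x" and f = "\<lambda>y. ennreal (?n x) * ennreal (?n y) * f x y"]
      by simp
  qed
  also have "\<dots> = ennreal (1/c) * (\<integral>\<^sup>+x. (\<integral>\<^sup>+t. ennreal (?n x) * ennreal (?n (s/c * x + 1/c * t)) * f x (s/c * x + 1/c * t) \<partial>lborel) \<partial>lborel)"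
    by (rule nn_integral_cmult) measurable
  also have "\<dots> = ennreal (1/c) * (\<integral>\<^sup>+t. (\<integral>\<^sup>+x. ennreal (?n x) * ennreal (?n (s/c * x + 1/c * t)) * f x (s/c * x + 1/c * t) \<partial>lborel) \<partial>lborel)"
    by (subst lborel_pair.Fubini') auto
  also have "\<dots> = ennreal (1/c) * (\<integral>\<^sup>+t. ennreal c * (\<integral>\<^sup>+g. ennreal (?n g) * ennreal (?n t) * f (c * g - s * t) (s * g + c * t) \<partial>lborel) \<partial>lborel)"
  proof (intro arg_cong[where f = "\<lambda>u. ennreal (1/c) * u"] nn_integral_cong)
    fix t
    have e: "s/c * (c * g - s * t) + 1/c * t = s * g + c * t" for g
    proof -
      have "s/c * (c * g - s * t) + 1/c * t = s * g + (1 - s\<^sup>2) * t / c"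
        using c by (simp add: field_simps power2_eq_square)
      also have "1 - s\<^sup>2 = c\<^sup>2" using cs by simp
      finally show ?thesis using c by (simp add: power2_eq_square)
    qed
    have e2: "- s * t + c * g = c * g - s * t" for g by simp
    show "(\<integral>\<^sup>+x. ennreal (?n x) * ennreal (?n (s/c * x + 1/c * t)) * f x (s/c * x + 1/c * t) \<partial>lborel)
      = ennreal c * (\<integral>\<^sup>+g. ennreal (?n g) * ennreal (?n t) * f (c * g - s * t) (s * g + c * t) \<partial>lborel)"
      using c nn_integral_real_affine[where c = c and t = "- s * t" and
        f = "\<lambda>x. ennreal (?n x) * ennreal (?n (s/c * x + 1/c * t)) * f x (s/c * x + 1/c * t)"]
      by (simp only: e e2 rho abs_of_pos) simp
  qed
  also have "\<dots> = ennreal (1/c) * (ennreal c * (\<integral>\<^sup>+t. (\<integral>\<^sup>+g. ennreal (?n g) * ennreal (?n t) * f (c * g - s * t) (s * g + c * t) \<partial>lborel) \<partial>lborel))"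
    by (subst nn_integral_cmult) auto
  also have "\<dots> = (\<integral>\<^sup>+t. (\<integral>\<^sup>+g. ennreal (?n g) * ennreal (?n t) * f (c * g - s * t) (s * g + c * t) \<partial>lborel) \<partial>lborel)"
    using c by (simp add: mult.assoc[symmetric] ennreal_mult[symmetric])
  also have "\<dots> = (\<integral>\<^sup>+g. (\<integral>\<^sup>+t. ennreal (?n g) * ennreal (?n t) * f (c * g - s * t) (s * g + c * t) \<partial>lborel) \<partial>lborel)"
    by (subst lborel_pair.Fubini') auto
  also have "\<dots> = (\<integral>\<^sup>+p. f (c * fst p - s * snd p) (s * fst p + c * snd p) \<partial>?M)"
    by (subst split[where F = "\<lambda>g t. f (c * g - s * t) (s * g + c * t)"]) auto
  also have "\<dots> = (\<integral>\<^sup>+p. indicator A p \<partial>distr ?M (borel \<Otimes>\<^sub>M borel) (\<lambda>(g, h). (c * g - s * h, s * g + c * h)))"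
    by (subst nn_integral_distr) (auto simp: f_def case_prod_beta cong: measurable_cong_sets sets_pair_measure_cong)
  also have "\<dots> = emeasure (distr ?M (borel \<Otimes>\<^sub>M borel) (\<lambda>(g, h). (c * g - s * h, s * g + c * h))) A"
    by (rule nn_integral_indicator) simp
  finally show "emeasure (distr ?M (borel \<Otimes>\<^sub>M borel) (\<lambda>(g, h). (c * g - s * h, s * g + c * h))) A = emeasure ?M A" ..
qed

text \<open>With \<open>h\<close> the differential entropy and \<open>Z\<close> of variance \<open>\<tau>\<close>, the linearized inequality reads
  \<open>- h(Y + Z) \<le> - l h(Y) + epi_const l \<tau>\<close>.\<close>

definition epi_const :: "real \<Rightarrow> real \<Rightarrow> real" where
  "epi_const l \<tau> = l / 2 * ln l - (1 - l) / 2 * ln (2 * pi * exp 1 * \<tau> / (1 - l))"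

lemma ln_std_normal_density: "ln (std_normal_density x) = - ln (2 * pi) / 2 - x\<^sup>2 / 2"
proof -
  have "ln (1 / sqrt (2 * pi)) = - ln (2 * pi) / 2" by (simp add: ln_div ln_sqrt)
  then show ?thesis unfolding std_normal_density_def by (subst ln_mult) auto
qed

lemma std_normal_second_moment:
  "integrable std_normal (\<lambda>x. x\<^sup>2)" "(\<integral>x. x\<^sup>2 \<partial>std_normal) = 1"
  "integrable std_normal (\<lambda>x. x)" "(\<integral>x. x \<partial>std_normal) = 0"
proof -
  have h: "has_bochner_integral lborel (\<lambda>x. std_normal_density x * x ^ (2 * 1)) (fact (2 * 1) / (2 ^ 1 * fact 1))"
    by (rule std_normal_moment_even)
  show "integrable std_normal (\<lambda>x. x\<^sup>2)"
    using integrable.intros[OF h] by (subst integrable_density) auto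
  show "(\<integral>x. x\<^sup>2 \<partial>std_normal) = 1"
    using has_bochner_integral_integral_eq[OF h] by (subst integral_density) (auto simp: fact_numeral)
  have h: "has_bochner_integral lborel (\<lambda>x. std_normal_density x * x) 0"
    using normal_moment_nz_1[of 1 0] by simp
  show "integrable std_normal (\<lambda>x. x)"
    using integrable.intros[OF h] by (subst integrable_density) auto
  show "(\<integral>x. x \<partial>std_normal) = 0"
    using has_bochner_integral_integral_eq[OF h] by (subst integral_density) auto
qed

lemma ln_std_normal_density_integral:
  "integrable std_normal (\<lambda>x. ln (std_normal_density x))"
  "(\<integral>x. ln (std_normal_density x) \<partial>std_normal) = - ln (2 * pi * exp 1) / 2"
  using std_normal_second_moment std_normal.prob_space
  by (simp_all add: ln_std_normal_density ln_mult add_divide_distrib)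

text \<open>Concavity of the logarithm; in \<open>epi_one\<close> it separates a derivative that
  mixes the unknown slope \<open>T'\<close> with the known constant \<open>\<rho>\<close>.\<close>

lemma ln_weighted_arith_geo:
  fixes a b l :: real
  assumes "0 < a" "0 < b" "0 < l" "l < 1"
  shows "l * ln a + (1 - l) * ln b \<le> ln (l * a + (1 - l) * b)"
proof -
  have "concave_on {0<..} (ln :: real \<Rightarrow> real)" by (rule ln_concave)
  then have "convex_on {0<..} (\<lambda>x. - ln x :: real)" by (simp add: concave_on_def)
  from convex_onD[OF this, of "1 - l" a b] assms show ?thesis by (simp add: algebra_simps)
qed

section \<open>Functions of one factor of a product space\<close>

lemma
  fixes g :: "'b \<Rightarrow> 'c::{banach, second_countable_topology}"
  assumes N1: "prob_space N1" and N2: "prob_space N2"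
  shows integrable_pair_fst: "integrable N1 g \<Longrightarrow> integrable (N1 \<Otimes>\<^sub>M N2) (\<lambda>p. g (fst p))"
    and integral_pair_fst: "g \<in> borel_measurable N1 \<Longrightarrow> (\<integral>p. g (fst p) \<partial>(N1 \<Otimes>\<^sub>M N2)) = (\<integral>x. g x \<partial>N1)"
proof -
  have d: "distr (N1 \<Otimes>\<^sub>M N2) N1 fst = N1" by (rule prob_space.distr_pair_fst[OF N2])
  show "integrable (N1 \<Otimes>\<^sub>M N2) (\<lambda>p. g (fst p))" if "integrable N1 g"
    using that by (subst (asm) d[symmetric], subst (asm) integrable_distr_eq) auto
  show "(\<integral>p. g (fst p) \<partial>(N1 \<Otimes>\<^sub>M N2)) = (\<integral>x. g x \<partial>N1)" if "g \<in> borel_measurable N1"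
    using that by (subst (2) d[symmetric], subst integral_distr) auto
qed

lemma
  fixes g :: "'b \<Rightarrow> 'c::{banach, second_countable_topology}"
  assumes N1: "prob_space N1" and N2: "prob_space N2"
  shows integrable_pair_snd: "integrable N2 g \<Longrightarrow> integrable (N1 \<Otimes>\<^sub>M N2) (\<lambda>p. g (snd p))"
    and integral_pair_snd: "g \<in> borel_measurable N2 \<Longrightarrow> (\<integral>p. g (snd p) \<partial>(N1 \<Otimes>\<^sub>M N2)) = (\<integral>x. g x \<partial>N2)"
proof -
  interpret pair_prob_space N1 N2 using N1 N2 by (simp add: pair_prob_space_def pair_sigma_finite_def prob_space_imp_sigma_finite)
  interpret P: pair_prob_space N2 N1 using N1 N2 by (simp add: pair_prob_space_def pair_sigma_finite_def prob_space_imp_sigma_finite)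
  show "integrable (N1 \<Otimes>\<^sub>M N2) (\<lambda>p. g (snd p))" if "integrable N2 g"
    using integrable_pair_fst[OF N2 N1 that] by (subst integrable_product_swap_iff[symmetric]) (simp add: case_prod_beta')
  show "(\<integral>p. g (snd p) \<partial>(N1 \<Otimes>\<^sub>M N2)) = (\<integral>x. g x \<partial>N2)" if [measurable]: "g \<in> borel_measurable N2"
    by (subst integral_pair_fst[OF N2 N1 that, symmetric], subst P.integral_product_swap[symmetric]) (auto simp: case_prod_beta')
qed

text \<open>Write the variable with density \<open>\<phi>\<close> as \<open>T\<close> of a standard
  normal, and obtain the pair of normals by rotating another pair \<open>(g, h)\<close>. For fixed
  \<open>h\<close> the sum becomes an increasing function \<open>\<Theta>\<close> of
  \<open>g\<close> alone, so \<open>q (\<Theta> g) * \<Theta>' g\<close> is a subdensity in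
  \<open>g\<close> and Gibbs' inequality applies against the standard normal. Rotation invariance
  then undoes the rotation in the expectation. \<open>q\<close> is an arbitrary subdensity rather
  than the density of the sum; this freedom serves \<open>epi_step\<close>, where the two sides are
  conditioned differently.\<close>

lemma epi_one:
  fixes \<phi> q :: "real \<Rightarrow> real" and \<rho> l :: real
  assumes phi: "continuous_on UNIV \<phi>" "\<And>x. 0 < \<phi> x" "(\<integral>\<^sup>+x. ennreal (\<phi> x) \<partial>lborel) = 1"
    and q[measurable]: "q \<in> borel_measurable borel" and qpos: "\<And>x. 0 < q x"
    and q1: "(\<integral>\<^sup>+x. ennreal (q x) \<partial>lborel) \<le> 1"
    and rho: "0 < \<rho>" and l: "0 < l" "l < 1"
    and i1: "integrable (density lborel \<phi>) (\<lambda>y. ln (\<phi> y))"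
    and i2: "integrable (density lborel \<phi> \<Otimes>\<^sub>M std_normal) (\<lambda>p. ln (q (fst p + \<rho> * snd p)))"
  shows "(\<integral>p. ln (q (fst p + \<rho> * snd p)) \<partial>(density lborel \<phi> \<Otimes>\<^sub>M std_normal))
    \<le> l * (\<integral>y. ln (\<phi> y) \<partial>density lborel \<phi>) + epi_const l (\<rho>\<^sup>2)"
proof -
  let ?n = std_normal_density and ?N = std_normal and ?D = "density lborel \<phi>"
  obtain T where T: "\<And>x. (T has_real_derivative ?n x / \<phi> (T x)) (at x)"
    and TD: "distr ?N borel T = ?D"
    using normal_transport[OF phi] by blast
  have Tcont: "continuous_on UNIV T"
    using T by (intro continuous_at_imp_continuous_on ballI) (blast intro: DERIV_isCont)
  have [measurable]: "T \<in> borel_measurable borel" "\<phi> \<in> borel_measurable borel"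
    using Tcont phi(1) by (auto intro: borel_measurable_continuous_onI)
  define T' where "T' x = ?n x / \<phi> (T x)" for x
  have T'pos: "0 < T' x" for x using std_normal_density_props(2) phi(2) by (simp add: T'_def)
  have T'cont: "continuous_on UNIV T'"
    unfolding T'_def using std_normal_density_props(1) Tcont phi
    by (intro continuous_intros) (auto intro: continuous_on_compose2 simp: less_imp_neq[THEN not_sym])
  have [measurable]: "T' \<in> borel_measurable borel" using T'cont by (rule borel_measurable_continuous_onI)
  have lnT': "ln (T' x) = ln (?n x) - ln (\<phi> (T x))" for x
    unfolding T'_def by (rule ln_divide_pos) (use std_normal_density_props(2) phi(2) in auto)
  interpret D: prob_space ?D using real_distribution_density[OF phi] by (simp add: real_distribution_def)
  interpret NN: pair_prob_space ?N ?N by standard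
  interpret DN: pair_prob_space ?D ?N by standard
  \<comment> \<open>The angle is chosen so that
    \<open>c T' + s \<rho> = l (T' / c) + (1 - l) (\<rho> / s)\<close>, a convex combination with
    the weights of the claim.\<close>
  define c s where "c = sqrt l" and "s = sqrt (1 - l)"
  have c: "0 < c" and s: "0 < s" and c2: "c\<^sup>2 = l" and s2: "s\<^sup>2 = 1 - l"
    using l by (auto simp: c_def s_def)
  define R where "R = (\<lambda>(g, h). (c * g - s * h, s * g + c * h))"
  have R: "distr (?N \<Otimes>\<^sub>M ?N) (borel \<Otimes>\<^sub>M borel) R = ?N \<Otimes>\<^sub>M ?N"
    unfolding R_def by (rule std_normal_rotate) (use c c2 s2 in auto)
  have [measurable]: "R \<in> borel \<Otimes>\<^sub>M borel \<rightarrow>\<^sub>M borel \<Otimes>\<^sub>M borel" unfolding R_def by measurable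
  have rot: "integrable (?N \<Otimes>\<^sub>M ?N) (\<lambda>p. f (R p)) \<longleftrightarrow> integrable (?N \<Otimes>\<^sub>M ?N) f"
     "(\<integral>p. f (R p) \<partial>(?N \<Otimes>\<^sub>M ?N)) = (\<integral>p. f p \<partial>(?N \<Otimes>\<^sub>M ?N))"
    if [measurable]: "f \<in> borel_measurable (borel \<Otimes>\<^sub>M borel)" for f :: "real \<times> real \<Rightarrow> real"
    by (subst (2) R[symmetric], subst integrable_distr_eq, auto cong: measurable_cong_sets sets_pair_measure_cong)
       (subst (2) R[symmetric], subst integral_distr, auto cong: measurable_cong_sets sets_pair_measure_cong)
  have DN: "distr (?N \<Otimes>\<^sub>M ?N) (borel \<Otimes>\<^sub>M borel) (\<lambda>p. (T (fst p), snd p)) = ?D \<Otimes>\<^sub>M ?N"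
  proof -
    have "distr (?N \<Otimes>\<^sub>M ?N) (borel \<Otimes>\<^sub>M borel) (\<lambda>(x, y). (T x, y)) = distr ?N borel T \<Otimes>\<^sub>M distr ?N borel (\<lambda>x. x)"
      by (rule pair_measure_distr[symmetric])
         (use std_normal.prob_space_distr[of "\<lambda>x. x" borel] in \<open>auto intro: prob_space_imp_sigma_finite\<close>)
    also have "distr ?N borel (\<lambda>x. x) = ?N"
      by (rule distr_id2) simp
    finally show ?thesis by (simp add: TD case_prod_beta')
  qed
  define u where "u p = ln (q (T (fst p) + \<rho> * snd p))" for p :: "real \<times> real"
  have [measurable]: "u \<in> borel_measurable (borel \<Otimes>\<^sub>M borel)" unfolding u_def by measurable
  have u: "integrable (?N \<Otimes>\<^sub>M ?N) u"
    "(\<integral>p. u p \<partial>(?N \<Otimes>\<^sub>M ?N)) = (\<integral>p. ln (q (fst p + \<rho> * snd p)) \<partial>(?D \<Otimes>\<^sub>M ?N))"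
    using i2 unfolding u_def DN[symmetric]
    by (subst (asm) integrable_distr_eq, auto simp: integral_distr cong: measurable_cong_sets sets_pair_measure_cong)
  have v: "integrable ?N (\<lambda>x. ln (\<phi> (T x)))" "(\<integral>x. ln (\<phi> (T x)) \<partial>?N) = (\<integral>y. ln (\<phi> y) \<partial>?D)"
    using i1 unfolding TD[symmetric]
    by (subst (asm) integrable_distr_eq, auto simp: integral_distr)
  have ft: "integrable (?N \<Otimes>\<^sub>M ?N) (\<lambda>p. g (fst p))" "(\<integral>p. g (fst p) \<partial>(?N \<Otimes>\<^sub>M ?N)) = (\<integral>x. g x \<partial>?N)"
    if "integrable ?N g" for g :: "real \<Rightarrow> real"
    using that by (auto intro!: integrable_pair_fst integral_pair_fst std_normal.prob_space_axioms)
  \<comment> \<open>The part of the exponent that is a function of the rotated pair; by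
    \<open>rot\<close> its expectation may be taken at the unrotated pair.\<close>
  define w where "w p = u p + l * ln (T' (fst p))" for p :: "real \<times> real"
  have [measurable]: "w \<in> borel_measurable (borel \<Otimes>\<^sub>M borel)" unfolding w_def by measurable
  have w: "integrable (?N \<Otimes>\<^sub>M ?N) w"
    "(\<integral>p. w p \<partial>(?N \<Otimes>\<^sub>M ?N)) = (\<integral>p. ln (q (fst p + \<rho> * snd p)) \<partial>(?D \<Otimes>\<^sub>M ?N))
       + l * (- ln (2 * pi * exp 1) / 2 - (\<integral>y. ln (\<phi> y) \<partial>?D))"
    unfolding w_def lnT'
    using u ft[OF v(1)] ft[OF ln_std_normal_density_integral(1)] ln_std_normal_density_integral(2) v(2)
    by auto
  define k where "k = (1 - l) / 2 * ln (\<rho>\<^sup>2 / (1 - l)) - l / 2 * ln l"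
  define H where "H p = w (R p) + k - ln (?n (fst p))" for p :: "real \<times> real"
  define \<Theta>' where "\<Theta>' p = c * T' (fst (R p)) + s * \<rho>" for p
  define L where "L p = q (T (fst (R p)) + \<rho> * snd (R p)) * \<Theta>' p / ?n (fst p)" for p
  have \<Theta>'pos: "0 < \<Theta>' p" for p unfolding \<Theta>'_def using c s rho T'pos by (simp add: add_pos_pos)
  have [measurable]: "\<Theta>' \<in> borel_measurable (borel \<Otimes>\<^sub>M borel)" unfolding \<Theta>'_def by measurable
  have [measurable]: "L \<in> borel_measurable (borel \<Otimes>\<^sub>M borel)" unfolding L_def by measurable
  have "(\<integral>p. H p \<partial>(?N \<Otimes>\<^sub>M ?N)) \<le> 0"
  proof (rule gibbs)
    show "prob_space (?N \<Otimes>\<^sub>M ?N)" by (rule NN.prob_space_axioms)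
    show "L \<in> borel_measurable (?N \<Otimes>\<^sub>M ?N)" by (simp cong: measurable_cong_sets sets_pair_measure_cong)
    show "0 < L p" for p unfolding L_def using qpos \<Theta>'pos std_normal_density_props(2) by simp
    show "integrable (?N \<Otimes>\<^sub>M ?N) H"
      unfolding H_def using w rot[of w] ft[OF ln_std_normal_density_integral(1)] by auto
    show "H p \<le> ln (L p)" for p
    proof -
      have "l * ln (T' (fst (R p)) / c) + (1 - l) * ln (\<rho> / s) \<le> ln (l * (T' (fst (R p)) / c) + (1 - l) * (\<rho> / s))"
        by (rule ln_weighted_arith_geo) (use c s rho T'pos l in auto)
      also have "l * (T' (fst (R p)) / c) + (1 - l) * (\<rho> / s) = \<Theta>' p"
        unfolding s2[symmetric] unfolding c2[symmetric] \<Theta>'_def using c s by (simp add: power2_eq_square)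
      finally have a: "l * ln (T' (fst (R p)) / c) + (1 - l) * ln (\<rho> / s) \<le> ln (\<Theta>' p)" .
      have b: "ln (T' (fst (R p)) / c) = ln (T' (fst (R p))) - ln l / 2"
        using T'pos[of "fst (R p)"] c l by (subst ln_divide_pos) (auto simp: c_def ln_sqrt)
      have d: "ln (\<rho> / s) = ln (\<rho>\<^sup>2 / (1 - l)) / 2"
        using rho s l by (subst (1 2) ln_divide_pos) (auto simp: s_def ln_sqrt ln_realpow diff_divide_distrib)
      have "ln (L p) = ln (q (T (fst (R p)) + \<rho> * snd (R p))) + ln (\<Theta>' p) - ln (?n (fst p))"
        unfolding L_def using qpos[THEN less_imp_neq] \<Theta>'pos[of p] std_normal_density_props(2)[of "fst p"]
        by (simp add: ln_div ln_mult less_imp_neq[symmetric])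
      then show ?thesis using a unfolding b d H_def w_def k_def u_def by (simp add: algebra_simps)
    qed
    show "(\<integral>\<^sup>+p. ennreal (L p) \<partial>(?N \<Otimes>\<^sub>M ?N)) \<le> 1"
    proof -
      have "(\<integral>\<^sup>+p. ennreal (L p) \<partial>(?N \<Otimes>\<^sub>M ?N)) = (\<integral>\<^sup>+h. \<integral>\<^sup>+g. ennreal (L (g, h)) \<partial>?N \<partial>?N)"
        by (subst NN.nn_integral_snd[symmetric]) (auto cong: measurable_cong_sets sets_pair_measure_cong)
      \<comment> \<open>The inner integral is bounded for each \<open>h\<close> separately: only
        \<open>g\<close> moves along \<open>\<Theta>\<close>.\<close>
      also have "\<dots> \<le> (\<integral>\<^sup>+h. 1 \<partial>?N)"
      proof (intro nn_integral_mono)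
        fix h
        define \<Theta> where "\<Theta> g = T (c * g - s * h) + \<rho> * (s * g + c * h)" for g
        define \<Theta>1 where "\<Theta>1 g = c * T' (c * g - s * h) + s * \<rho>" for g
        have \<Theta>1: "\<Theta>1 g = \<Theta>' (g, h)" for g by (simp add: \<Theta>1_def \<Theta>'_def R_def)
        have "(\<integral>\<^sup>+g. ennreal (L (g, h)) \<partial>?N) = (\<integral>\<^sup>+g. ennreal (q (\<Theta> g)) * ennreal (\<Theta>1 g) \<partial>lborel)"
        proof (subst nn_integral_density)
          show "(\<integral>\<^sup>+g. ennreal (?n g) * ennreal (L (g, h)) \<partial>lborel) = (\<integral>\<^sup>+g. ennreal (q (\<Theta> g)) * ennreal (\<Theta>1 g) \<partial>lborel)"
          proof (intro nn_integral_cong)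
            fix g
            have "?n g * L (g, h) = q (\<Theta> g) * \<Theta>1 g"
              using std_normal_density_props(2)[of g] by (simp add: L_def \<Theta>_def \<Theta>1 R_def)
            then show "ennreal (?n g) * ennreal (L (g, h)) = ennreal (q (\<Theta> g)) * ennreal (\<Theta>1 g)"
              using qpos \<Theta>'pos by (simp add: ennreal_mult'[symmetric] less_imp_le \<Theta>1)
          qed
        qed auto
        also have "\<dots> \<le> (\<integral>\<^sup>+x. ennreal (q x) \<partial>lborel)"
        proof (rule nn_integral_substitution_le)
          show "(\<Theta> has_real_derivative \<Theta>1 g) (at g)" for g
            unfolding \<Theta>_def \<Theta>1_def
            by (rule derivative_eq_intros DERIV_chain2[OF T] refl | simp add: T'_def)+
          show "continuous_on UNIV \<Theta>1"
            unfolding \<Theta>1_def by (intro continuous_intros continuous_on_compose2[OF T'cont]) auto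
          show "0 \<le> \<Theta>1 g" for g using \<Theta>'pos[of "(g, h)"] by (simp add: \<Theta>1)
        qed simp
        finally show "(\<integral>\<^sup>+g. ennreal (L (g, h)) \<partial>?N) \<le> 1" using q1 by simp
      qed
      also have "\<dots> = 1" using std_normal.emeasure_space_1 by simp
      finally show ?thesis .
    qed
  qed
  also have "(\<integral>p. H p \<partial>(?N \<Otimes>\<^sub>M ?N)) = (\<integral>p. w p \<partial>(?N \<Otimes>\<^sub>M ?N)) + k + ln (2 * pi * exp 1) / 2"
    unfolding H_def using w(1) rot[of w] ft[OF ln_std_normal_density_integral(1)] ln_std_normal_density_integral(2)
    by (simp add: NN.prob_space)
  finally have "(\<integral>p. ln (q (fst p + \<rho> * snd p)) \<partial>(?D \<Otimes>\<^sub>M ?N))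
     \<le> l * (\<integral>y. ln (\<phi> y) \<partial>?D) - (1 - l) / 2 * ln (2 * pi * exp 1) - k"
    unfolding w(2) by (simp add: algebra_simps diff_divide_distrib)
  also have "\<dots> = l * (\<integral>y. ln (\<phi> y) \<partial>?D) + epi_const l (\<rho>\<^sup>2)"
  proof -
    have "ln (2 * pi * exp 1 * \<rho>\<^sup>2 / (1 - l)) = ln (2 * pi * exp 1) + ln (\<rho>\<^sup>2 / (1 - l))"
      using rho l ln_mult[of "2 * pi * exp 1" "\<rho>\<^sup>2 / (1 - l)"] by simp
    then show ?thesis unfolding epi_const_def k_def by (simp add: algebra_simps)
  qed
  finally show ?thesis .
qed

section \<open>Gaussian mixtures\<close>

abbreviation lborel_on :: "'i set \<Rightarrow> ('i \<Rightarrow> real) measure" where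
  "lborel_on J \<equiv> Pi\<^sub>M J (\<lambda>_. lborel)"

abbreviation std_on :: "'i set \<Rightarrow> ('i \<Rightarrow> real) measure" where
  "std_on J \<equiv> Pi\<^sub>M J (\<lambda>_. std_normal)"

interpretation lborel_on: product_sigma_finite "\<lambda>_::'i. lborel :: real measure" by standard
interpretation std_on: product_sigma_finite "\<lambda>_::'i. std_normal" by standard

lemma prob_space_std_on: "prob_space (std_on J)"
  by (intro prob_space_PiM std_normal.prob_space_axioms)

lemma PiM_component_measurable:
  assumes "g \<in> N \<rightarrow>\<^sub>M Pi\<^sub>M I (\<lambda>_. L)" "i \<in> I" "sets L = sets (borel :: real measure)"
  shows "(\<lambda>p. g p i) \<in> borel_measurable N"
  using measurable_compose[OF assms(1) measurable_component_singleton, OF assms(2)] assms(3)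
  by (simp cong: measurable_cong_sets)

lemma normal_affine: "0 < s \<Longrightarrow> distr std_normal borel (\<lambda>z. m + s * z) = density lborel (normal_density m s)"
proof -
  assume s: "0 < s"
  have "distributed std_normal lborel (\<lambda>z. z) std_normal_density"
    unfolding distributed_def by (auto intro!: distr_id2 simp: distr_id2)
  from std_normal.normal_density_affine[OF this _ , of s m] s
  show ?thesis by (simp add: distributed_def distr_cong[OF refl _ refl, of borel lborel])
qed

lemma normal_density_mean_measurable[measurable]:
  assumes [measurable]: "f \<in> borel_measurable N" "g \<in> borel_measurable N"
  shows "(\<lambda>p. normal_density (f p) s (g p)) \<in> borel_measurable N"
  unfolding normal_density_def by measurable

text \<open>Conditional density, given \<open>\<omega>\<close>, of the coordinates in
  \<open>J\<close> when independent normals of standard deviations \<open>\<sigma> i\<close> are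
  added to the centres \<open>x i \<omega>\<close>. The deviation depends on the coordinate because
  source and channel coordinates are smoothed by different amounts.\<close>

definition gkern :: "('i \<Rightarrow> 'w \<Rightarrow> real) \<Rightarrow> ('i \<Rightarrow> real) \<Rightarrow> 'i set \<Rightarrow> 'w \<Rightarrow> ('i \<Rightarrow> real) \<Rightarrow> real" where
  "gkern x \<sigma> J \<omega> v = (\<Prod>i\<in>J. normal_density (x i \<omega>) (\<sigma> i) (v i))"

definition mix :: "'w measure \<Rightarrow> ('i \<Rightarrow> 'w \<Rightarrow> real) \<Rightarrow> ('i \<Rightarrow> real) \<Rightarrow> 'i set \<Rightarrow> ('i \<Rightarrow> real) \<Rightarrow> real" where
  "mix M x \<sigma> J v = (\<integral>\<omega>. gkern x \<sigma> J \<omega> v \<partial>M)"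

definition mixlaw :: "'w measure \<Rightarrow> ('i \<Rightarrow> 'w \<Rightarrow> real) \<Rightarrow> ('i \<Rightarrow> real) \<Rightarrow> 'i set \<Rightarrow> ('i \<Rightarrow> real) measure" where
  "mixlaw M x \<sigma> J = density (lborel_on J) (mix M x \<sigma> J)"

lemma sets_mixlaw[measurable_cong, simp]: "sets (mixlaw M x \<sigma> J) = sets (lborel_on J)"
  by (simp add: mixlaw_def)

lemma space_mixlaw[simp]: "space (mixlaw M x \<sigma> J) = space (lborel_on J)"
  by (simp add: mixlaw_def)

lemma gkern_insert:
  "finite J \<Longrightarrow> c \<notin> J \<Longrightarrow> gkern x \<sigma> (insert c J) \<omega> (v(c := y)) = normal_density (x c \<omega>) (\<sigma> c) y * gkern x \<sigma> J \<omega> v"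
  unfolding gkern_def by (simp, intro disjI2 prod.cong) auto

lemma gkern_cong: "(\<And>i. i \<in> J \<Longrightarrow> v i = w i) \<Longrightarrow> gkern x \<sigma> J \<omega> v = gkern x \<sigma> J \<omega> w"
  unfolding gkern_def by (intro prod.cong) auto

lemma mix_cong: "(\<And>i. i \<in> J \<Longrightarrow> v i = w i) \<Longrightarrow> mix M x \<sigma> J v = mix M x \<sigma> J w"
  unfolding mix_def by (intro Bochner_Integration.integral_cong gkern_cong refl)

text \<open>The noise is drawn on a set \<open>I\<close> containing \<open>J\<close>, so that the
  laws on all subsets of \<open>I\<close> are images of one and the same experiment.\<close>

lemma gkern_law:
  fixes x :: "'i \<Rightarrow> 'w \<Rightarrow> real"
  assumes J: "finite J" and \<sigma>: "\<And>i. 0 < \<sigma> i" and I: "finite I" "J \<subseteq> I"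
  shows "density (lborel_on J) (\<lambda>v. ennreal (gkern x \<sigma> J \<omega> v))
    = distr (std_on I) (lborel_on J) (\<lambda>\<zeta>. \<lambda>i\<in>J. x i \<omega> + \<sigma> i * \<zeta> i)"
proof -
  interpret P: product_prob_space "\<lambda>i. density lborel (normal_density (x i \<omega>) (\<sigma> i))"
    by (simp add: product_prob_space_def product_prob_space_axioms_def product_sigma_finite_def
      prob_space_normal_density \<sigma> prob_space_imp_sigma_finite)
  have m[measurable]: "gkern x \<sigma> J \<omega> \<in> borel_measurable (lborel_on J)"
    unfolding gkern_def by measurable
  have 1: "density (lborel_on J) (\<lambda>v. ennreal (gkern x \<sigma> J \<omega> v)) = Pi\<^sub>M J (\<lambda>i. density lborel (normal_density (x i \<omega>) (\<sigma> i)))"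
  proof (rule P.PiM_eqI[OF J])
    show "sets (density (lborel_on J) (\<lambda>v. ennreal (gkern x \<sigma> J \<omega> v))) = sets (Pi\<^sub>M J (\<lambda>i. density lborel (normal_density (x i \<omega>) (\<sigma> i))))"
      by (auto intro!: sets_PiM_cong)
    fix A assume A: "\<And>i. i \<in> J \<Longrightarrow> A i \<in> sets (density lborel (normal_density (x i \<omega>) (\<sigma> i)))"
    then have A'[measurable]: "\<And>i. i \<in> J \<Longrightarrow> A i \<in> sets borel" by simp
    have [measurable]: "Pi\<^sub>E J A \<in> sets (lborel_on J)" using A' J by (intro sets_PiM_I_finite) auto
    have "emeasure (density (lborel_on J) (\<lambda>v. ennreal (gkern x \<sigma> J \<omega> v))) (Pi\<^sub>E J A)
      = (\<integral>\<^sup>+v. ennreal (gkern x \<sigma> J \<omega> v) * indicator (Pi\<^sub>E J A) v \<partial>lborel_on J)"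
      by (subst emeasure_density) auto
    also have "\<dots> = (\<integral>\<^sup>+v. (\<Prod>i\<in>J. ennreal (normal_density (x i \<omega>) (\<sigma> i) (v i)) * indicator (A i) (v i)) \<partial>lborel_on J)"
    proof (intro nn_integral_cong)
      fix v assume v: "v \<in> space (lborel_on J)"
      have "indicator (Pi\<^sub>E J A) v = (\<Prod>i\<in>J. indicator (A i) (v i) :: ennreal)"
        using v J by (auto simp: indicator_def space_PiM PiE_iff prod_zero_iff)
      then show "ennreal (gkern x \<sigma> J \<omega> v) * indicator (Pi\<^sub>E J A) v
        = (\<Prod>i\<in>J. ennreal (normal_density (x i \<omega>) (\<sigma> i) (v i)) * indicator (A i) (v i))"
        by (simp add: gkern_def prod_ennreal prod.distrib)
    qed
    also have "\<dots> = (\<Prod>i\<in>J. \<integral>\<^sup>+y. ennreal (normal_density (x i \<omega>) (\<sigma> i) y) * indicator (A i) y \<partial>lborel)"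
      by (rule lborel_on.product_nn_integral_prod[OF J]) simp
    also have "\<dots> = (\<Prod>i\<in>J. emeasure (density lborel (normal_density (x i \<omega>) (\<sigma> i))) (A i))"
      by (intro prod.cong refl) (simp add: emeasure_density)
    finally show "emeasure (density (lborel_on J) (\<lambda>v. ennreal (gkern x \<sigma> J \<omega> v))) (Pi\<^sub>E J A)
      = (\<Prod>i\<in>J. emeasure (density lborel (normal_density (x i \<omega>) (\<sigma> i))) (A i))" .
  qed
  have 2: "distr (std_on J) (lborel_on J) (\<lambda>\<zeta>. \<lambda>i\<in>J. x i \<omega> + \<sigma> i * \<zeta> i) = Pi\<^sub>M J (\<lambda>i. density lborel (normal_density (x i \<omega>) (\<sigma> i)))"
  proof (rule P.PiM_eqI[OF J])
    show "sets (distr (std_on J) (lborel_on J) (\<lambda>\<zeta>. \<lambda>i\<in>J. x i \<omega> + \<sigma> i * \<zeta> i)) = sets (Pi\<^sub>M J (\<lambda>i. density lborel (normal_density (x i \<omega>) (\<sigma> i))))"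
      by (auto intro!: sets_PiM_cong)
    fix A assume A: "\<And>i. i \<in> J \<Longrightarrow> A i \<in> sets (density lborel (normal_density (x i \<omega>) (\<sigma> i)))"
    then have A'[measurable]: "\<And>i. i \<in> J \<Longrightarrow> A i \<in> sets borel" by simp
    have [measurable]: "Pi\<^sub>E J A \<in> sets (lborel_on J)" using A' J by (intro sets_PiM_I_finite) auto
    have "emeasure (distr (std_on J) (lborel_on J) (\<lambda>\<zeta>. \<lambda>i\<in>J. x i \<omega> + \<sigma> i * \<zeta> i)) (Pi\<^sub>E J A)
      = emeasure (std_on J) (Pi\<^sub>E J (\<lambda>i. (\<lambda>z. x i \<omega> + \<sigma> i * z) -` A i))"
      by (subst emeasure_distr) (auto intro!: arg_cong[where f = "emeasure (std_on J)"] simp: space_PiM PiE_iff cong: measurable_cong_sets)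
    also have "\<dots> = (\<Prod>i\<in>J. emeasure std_normal ((\<lambda>z. x i \<omega> + \<sigma> i * z) -` A i))"
      using J A' by (intro std_on.emeasure_PiM) (auto intro!: measurable_sets_borel[where M = borel])
    also have "\<dots> = (\<Prod>i\<in>J. emeasure (density lborel (normal_density (x i \<omega>) (\<sigma> i))) (A i))"
    proof (intro prod.cong refl)
      fix i assume "i \<in> J"
      then have "A i \<in> sets borel" by (rule A')
      then show "emeasure std_normal ((\<lambda>z. x i \<omega> + \<sigma> i * z) -` A i) = emeasure (density lborel (normal_density (x i \<omega>) (\<sigma> i))) (A i)"
        unfolding normal_affine[OF \<sigma>, symmetric] by (subst emeasure_distr) auto
    qed
    finally show "emeasure (distr (std_on J) (lborel_on J) (\<lambda>\<zeta>. \<lambda>i\<in>J. x i \<omega> + \<sigma> i * \<zeta> i)) (Pi\<^sub>E J A)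
      = (\<Prod>i\<in>J. emeasure (density lborel (normal_density (x i \<omega>) (\<sigma> i))) (A i))" .
  qed
  \<comment> \<open>The noise coordinates outside \<open>J\<close> are integrated out.\<close>
  interpret S: product_prob_space "\<lambda>_::'i. std_normal" by standard
  have 3: "distr (std_on I) (lborel_on J) (\<lambda>\<zeta>. \<lambda>i\<in>J. x i \<omega> + \<sigma> i * \<zeta> i)
    = distr (std_on J) (lborel_on J) (\<lambda>\<zeta>. \<lambda>i\<in>J. x i \<omega> + \<sigma> i * \<zeta> i)"
  proof -
    have c: "(\<lambda>\<zeta>. \<zeta> i) \<in> borel_measurable (std_on J)" if "i \<in> J" for i
      by (rule PiM_component_measurable[OF measurable_ident_sets[OF refl]]) (use that in auto)
    have m: "(\<lambda>\<zeta>. \<lambda>i\<in>J. x i \<omega> + \<sigma> i * \<zeta> i) \<in> std_on J \<rightarrow>\<^sub>M lborel_on J"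
      using c by (intro measurable_restrict) auto
    have r: "(\<lambda>f. restrict f J) \<in> std_on I \<rightarrow>\<^sub>M std_on J"
      using I(2) by (rule measurable_restrict_subset)
    have "distr (std_on J) (lborel_on J) (\<lambda>\<zeta>. \<lambda>i\<in>J. x i \<omega> + \<sigma> i * \<zeta> i)
      = distr (distr (std_on I) (std_on J) (\<lambda>f. restrict f J)) (lborel_on J) (\<lambda>\<zeta>. \<lambda>i\<in>J. x i \<omega> + \<sigma> i * \<zeta> i)"
      by (subst S.distr_restrict[OF I(2,1), symmetric]) (rule refl)
    also have "\<dots> = distr (std_on I) (lborel_on J) (\<lambda>\<zeta>. \<lambda>i\<in>J. x i \<omega> + \<sigma> i * \<zeta> i)"
      by (subst distr_distr[OF m r]) (rule distr_cong, auto)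
    finally show ?thesis by simp
  qed
  show ?thesis using 1 2 3 by simp
qed

lemma std_on_component:
  assumes "i \<in> J"
  shows "distr (std_on J) std_normal (\<lambda>\<zeta>. \<zeta> i) = std_normal"
  using distr_PiM_component[where M = "\<lambda>_. std_normal" and I = J and i = i] assms std_normal.prob_space_axioms by simp

lemma std_on_moments:
  assumes "i \<in> J"
  shows "integrable (std_on J) (\<lambda>\<zeta>. (\<zeta> i)\<^sup>2)" "(\<integral>\<zeta>. (\<zeta> i)\<^sup>2 \<partial>std_on J) = 1"
    "integrable (std_on J) (\<lambda>\<zeta>. \<zeta> i)" "(\<integral>\<zeta>. \<zeta> i \<partial>std_on J) = 0"
proof -
  have m: "(\<lambda>\<zeta>. \<zeta> i) \<in> std_on J \<rightarrow>\<^sub>M std_normal"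
    using assms by (rule measurable_component_singleton)
  note c = std_on_component[OF assms]
  have i: "integrable (std_on J) (\<lambda>\<zeta>. f (\<zeta> i))" "(\<integral>\<zeta>. f (\<zeta> i) \<partial>std_on J) = (\<integral>z. f z \<partial>std_normal)"
    if "integrable std_normal f" for f :: "real \<Rightarrow> real"
  proof -
    show "integrable (std_on J) (\<lambda>\<zeta>. f (\<zeta> i))"
      using that by (subst (asm) c[symmetric], subst (asm) integrable_distr_eq[OF m]) auto
    show "(\<integral>\<zeta>. f (\<zeta> i) \<partial>std_on J) = (\<integral>z. f z \<partial>std_normal)"
      using that by (subst c[symmetric], subst integral_distr[OF m]) auto
  qed
  show "integrable (std_on J) (\<lambda>\<zeta>. (\<zeta> i)\<^sup>2)" "(\<integral>\<zeta>. (\<zeta> i)\<^sup>2 \<partial>std_on J) = 1"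
    "integrable (std_on J) (\<lambda>\<zeta>. \<zeta> i)" "(\<integral>\<zeta>. \<zeta> i \<partial>std_on J) = 0"
    using i[OF std_normal_second_moment(1)] i[OF std_normal_second_moment(3)] std_normal_second_moment by auto
qed

text \<open>Square integrability of the centres is the analytic input: it confines the logarithm of
  the mixture density to quadratic growth and gives the mixture law finite second moments. The
  centres may depend on each other in any way, which is how an arbitrary encoder fits in.\<close>

locale gauss_mixture = prob_space M for M :: "'w measure" +
  fixes x :: "'i \<Rightarrow> 'w \<Rightarrow> real"
  assumes x_measurable[measurable]: "\<And>i. x i \<in> borel_measurable M"
    and x_square: "\<And>i. integrable M (\<lambda>\<omega>. (x i \<omega>)\<^sup>2)"
begin

context
  fixes \<sigma> :: "'i \<Rightarrow> real" assumes \<sigma>: "\<And>i. 0 < \<sigma> i"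
begin

definition "kbound J = (\<Prod>i\<in>J. 1 / sqrt (2 * pi * (\<sigma> i)\<^sup>2))"

lemma gkern_pos: "0 < gkern x \<sigma> J \<omega> v"
  unfolding gkern_def by (intro prod_pos normal_density_pos \<sigma>)

lemma normal_density_le: "normal_density m s y \<le> 1 / sqrt (2 * pi * s\<^sup>2)"
  unfolding normal_density_def by (simp add: mult_left_le divide_right_mono)

lemma gkern_le: "gkern x \<sigma> J \<omega> v \<le> kbound J"
  unfolding gkern_def kbound_def
  by (intro prod_mono) (simp add: normal_density_le)

lemma gkern_measurable[measurable]:
  assumes [measurable]: "f \<in> N \<rightarrow>\<^sub>M M" "g \<in> N \<rightarrow>\<^sub>M lborel_on J"
  shows "(\<lambda>p. gkern x \<sigma> J (f p) (g p)) \<in> borel_measurable N"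
proof -
  have [measurable]: "(\<lambda>p. g p i) \<in> borel_measurable N" if "i \<in> J" for i
    by (rule PiM_component_measurable[OF assms(2) that]) simp
  show ?thesis unfolding gkern_def by measurable
qed

lemma gkern_measurable1[measurable]: "(\<lambda>\<omega>. gkern x \<sigma> J \<omega> v) \<in> borel_measurable M"
  unfolding gkern_def by measurable

lemma integrable_gkern: "integrable M (\<lambda>\<omega>. gkern x \<sigma> J \<omega> v)"
  by (rule integrable_const_bound[where B = "kbound J"])
     (use gkern_le less_imp_le[OF gkern_pos] in \<open>auto intro!: AE_I2\<close>)

lemma mix_measurable[measurable]: "mix M x \<sigma> J \<in> borel_measurable (lborel_on J)"
  unfolding mix_def by measurable

lemma mix_nn: "ennreal (mix M x \<sigma> J v) = (\<integral>\<^sup>+\<omega>. ennreal (gkern x \<sigma> J \<omega> v) \<partial>M)"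
  unfolding mix_def
  by (rule nn_integral_eq_integral[symmetric]) (auto intro: integrable_gkern less_imp_le[OF gkern_pos])

lemma mix_le: "mix M x \<sigma> J v \<le> kbound J"
  unfolding mix_def
  by (rule integral_le_const) (auto intro: integrable_gkern gkern_le)

lemma ln_gkern: "finite J \<Longrightarrow> ln (gkern x \<sigma> J \<omega> v)
    = (\<Sum>i\<in>J. - ln (2 * pi * (\<sigma> i)\<^sup>2) / 2 - (v i - x i \<omega>)\<^sup>2 / (2 * (\<sigma> i)\<^sup>2))"
  unfolding gkern_def
proof (subst ln_prod)
  assume "finite J"
  show "(\<Sum>i\<in>J. ln (normal_density (x i \<omega>) (\<sigma> i) (v i)))
    = (\<Sum>i\<in>J. - ln (2 * pi * (\<sigma> i)\<^sup>2) / 2 - (v i - x i \<omega>)\<^sup>2 / (2 * (\<sigma> i)\<^sup>2))"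
  proof (intro sum.cong refl)
    fix i
    have "ln (1 / sqrt (2 * pi * (\<sigma> i)\<^sup>2)) = - ln (2 * pi * (\<sigma> i)\<^sup>2) / 2"
      using \<sigma>[of i] by (subst ln_divide_pos) (auto simp: ln_sqrt)
    then show "ln (normal_density (x i \<omega>) (\<sigma> i) (v i)) = - ln (2 * pi * (\<sigma> i)\<^sup>2) / 2 - (v i - x i \<omega>)\<^sup>2 / (2 * (\<sigma> i)\<^sup>2)"
      unfolding normal_density_def using \<sigma>[of i] by (subst ln_mult_pos) auto
  qed
qed (use normal_density_pos[OF \<sigma>] in \<open>auto simp: less_imp_neq[symmetric]\<close>)

lemma ln_gkern_ge: "finite J \<Longrightarrow>
  (\<Sum>i\<in>J. - ln (2 * pi * (\<sigma> i)\<^sup>2) / 2 - (x i \<omega>)\<^sup>2 / (\<sigma> i)\<^sup>2) - (\<Sum>i\<in>J. (v i)\<^sup>2 / (\<sigma> i)\<^sup>2) \<le> ln (gkern x \<sigma> J \<omega> v)"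
  unfolding ln_gkern sum_subtractf[symmetric]
proof (intro sum_mono)
  fix i
  have "(v i - x i \<omega>)\<^sup>2 \<le> 2 * ((x i \<omega>)\<^sup>2 + (v i)\<^sup>2)"
    using zero_le_power2[of "v i + x i \<omega>"] by (simp add: power2_eq_square algebra_simps)
  then have "(v i - x i \<omega>)\<^sup>2 / (2 * (\<sigma> i)\<^sup>2) \<le> (2 * ((x i \<omega>)\<^sup>2 + (v i)\<^sup>2)) / (2 * (\<sigma> i)\<^sup>2)"
    by (rule divide_right_mono) simp
  then show "- ln (2 * pi * (\<sigma> i)\<^sup>2) / 2 - (x i \<omega>)\<^sup>2 / (\<sigma> i)\<^sup>2 - (v i)\<^sup>2 / (\<sigma> i)\<^sup>2
     \<le> - ln (2 * pi * (\<sigma> i)\<^sup>2) / 2 - (v i - x i \<omega>)\<^sup>2 / (2 * (\<sigma> i)\<^sup>2)"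
    by (simp add: add_divide_distrib)
qed

text \<open>A lower bound for the mean of \<open>ln (gkern x \<sigma> J \<omega> v)\<close> at
  \<open>v = 0\<close>, obtained from \<open>(v - x)^2 \<le> 2 v^2 + 2 x^2\<close>.\<close>

definition "lnbound J = (\<integral>\<omega>. (\<Sum>i\<in>J. - ln (2 * pi * (\<sigma> i)\<^sup>2) / 2 - (x i \<omega>)\<^sup>2 / (\<sigma> i)\<^sup>2) \<partial>M)"

text \<open>Jensen's inequality for the exponential: a mixture is at least the exponential of the
  mean log-kernel. Together with the upper bound \<open>kbound\<close> it confines
  \<open>ln (mix M x \<sigma> J v)\<close> to quadratic growth in \<open>v\<close>.\<close>

lemma mix_ge:
  assumes "finite J"
  shows "exp (lnbound J - (\<Sum>i\<in>J. (v i)\<^sup>2 / (\<sigma> i)\<^sup>2)) \<le> mix M x \<sigma> J v"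
proof -
  let ?f = "\<lambda>\<omega>. (\<Sum>i\<in>J. - ln (2 * pi * (\<sigma> i)\<^sup>2) / 2 - (x i \<omega>)\<^sup>2 / (\<sigma> i)\<^sup>2)"
  let ?s = "(\<Sum>i\<in>J. (v i)\<^sup>2 / (\<sigma> i)\<^sup>2)" and ?c = "lnbound J - (\<Sum>i\<in>J. (v i)\<^sup>2 / (\<sigma> i)\<^sup>2)"
  have f: "integrable M ?f"
    by (intro Bochner_Integration.integrable_sum Bochner_Integration.integrable_diff integrable_divide x_square) auto
  \<comment> \<open>The tangent of \<open>exp\<close> at \<open>?c\<close>. Since \<open>?c\<close>
    is the mean of \<open>?f \<omega> - ?s\<close>, the linear term integrates to zero.\<close>
  have "exp ?c = (\<integral>\<omega>. exp ?c * (1 + (?f \<omega> - ?s - ?c)) \<partial>M)"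
    using f by (simp add: prob_space lnbound_def)
  also have "\<dots> \<le> (\<integral>\<omega>. gkern x \<sigma> J \<omega> v \<partial>M)"
  proof (intro integral_mono integrable_gkern)
    fix \<omega>
    have "exp ?c * (1 + (?f \<omega> - ?s - ?c)) \<le> exp ?c * exp (?f \<omega> - ?s - ?c)"
      by (intro mult_left_mono) (auto simp: exp_ge_add_one_self)
    also have "\<dots> = exp (?f \<omega> - ?s)" by (simp add: exp_add[symmetric])
    also have "\<dots> \<le> gkern x \<sigma> J \<omega> v"
      using ln_gkern_ge[OF assms, of \<omega> v] gkern_pos[of J \<omega> v] by (simp add: ln_ge_iff)
    finally show "exp ?c * (1 + (?f \<omega> - ?s - ?c)) \<le> gkern x \<sigma> J \<omega> v" .
  qed (use f in auto)
  finally show ?thesis by (simp add: mix_def)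
qed

lemma mix_pos: "finite J \<Longrightarrow> 0 < mix M x \<sigma> J v"
  using mix_ge[of J v] exp_gt_zero less_le_trans by blast

lemma abs_ln_mix_le:
  assumes "finite J"
  shows "\<bar>ln (mix M x \<sigma> J v)\<bar> \<le> \<bar>lnbound J\<bar> + \<bar>ln (kbound J)\<bar> + (\<Sum>i\<in>J. (v i)\<^sup>2 / (\<sigma> i)\<^sup>2)"
proof -
  have "lnbound J - (\<Sum>i\<in>J. (v i)\<^sup>2 / (\<sigma> i)\<^sup>2) \<le> ln (mix M x \<sigma> J v)"
    using mix_ge[OF assms, of v] mix_pos[OF assms] by (simp add: ln_ge_iff)
  moreover have "ln (mix M x \<sigma> J v) \<le> ln (kbound J)"
    using mix_le[of J v] mix_pos[OF assms, of v] by (simp add: ln_mono)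
  moreover have "0 \<le> (\<Sum>i\<in>J. (v i)\<^sup>2 / (\<sigma> i)\<^sup>2)" by (intro sum_nonneg) simp
  ultimately show ?thesis by linarith
qed

lemma mix_insert_measurable[measurable]:
  assumes "u \<in> space (lborel_on J)"
  shows "(\<lambda>y. mix M x \<sigma> (insert c J) (u(c := y))) \<in> borel_measurable borel"
proof -
  have "(\<lambda>y. u(c := y)) \<in> borel \<rightarrow>\<^sub>M lborel_on (insert c J)"
    using assms by (intro measurable_fun_upd[where J = J]) (auto)
  from measurable_compose[OF this mix_measurable] show ?thesis .
qed

text \<open>Marginalization by exchanging integrals: each kernel has unit mass in the new
  coordinate. This normalizes the conditional densities in \<open>epi_step\<close>.\<close>

lemma mix_insert_nn:
  assumes "finite J" "c \<notin> J"
  shows "(\<integral>\<^sup>+y. ennreal (mix M x \<sigma> (insert c J) (v(c := y))) \<partial>lborel) = ennreal (mix M x \<sigma> J v)"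
proof -
  interpret MB: pair_sigma_finite M lborel ..
  have "(\<integral>\<^sup>+y. ennreal (mix M x \<sigma> (insert c J) (v(c := y))) \<partial>lborel)
    = (\<integral>\<^sup>+y. \<integral>\<^sup>+\<omega>. ennreal (normal_density (x c \<omega>) (\<sigma> c) y) * ennreal (gkern x \<sigma> J \<omega> v) \<partial>M \<partial>lborel)"
    unfolding mix_nn gkern_insert[OF assms] by (simp add: ennreal_mult less_imp_le[OF gkern_pos])
  also have "\<dots> = (\<integral>\<^sup>+\<omega>. \<integral>\<^sup>+y. ennreal (normal_density (x c \<omega>) (\<sigma> c) y) * ennreal (gkern x \<sigma> J \<omega> v) \<partial>lborel \<partial>M)"
    by (subst MB.Fubini') (auto simp: normal_density_def)
  also have "\<dots> = (\<integral>\<^sup>+\<omega>. ennreal (gkern x \<sigma> J \<omega> v) \<partial>M)"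
  proof (intro nn_integral_cong)
    fix \<omega>
    have "(\<integral>\<^sup>+y. ennreal (normal_density (x c \<omega>) (\<sigma> c) y) \<partial>lborel) = 1"
      using \<sigma> by (subst nn_integral_eq_integral) auto
    then show "(\<integral>\<^sup>+y. ennreal (normal_density (x c \<omega>) (\<sigma> c) y) * ennreal (gkern x \<sigma> J \<omega> v) \<partial>lborel) = ennreal (gkern x \<sigma> J \<omega> v)"
      by (subst nn_integral_multc) auto
  qed
  finally show ?thesis by (simp add: mix_nn)
qed

text \<open>Dominated convergence, the peak of the kernel being a constant majorant.
  \<open>epi_one\<close> needs the continuity to differentiate the distribution function of the new
  coordinate.\<close>

lemma mix_insert_cont:
  assumes "finite J" "c \<notin> J"
  shows "continuous_on UNIV (\<lambda>y. mix M x \<sigma> (insert c J) (v(c := y)))"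
  unfolding mix_def gkern_insert[OF assms]
proof (intro continuous_at_imp_continuous_on ballI, unfold continuous_at_sequentially comp_def, intro allI impI)
  fix y and s :: "nat \<Rightarrow> real" assume s: "s \<longlonglongrightarrow> y"
  have c: "isCont (normal_density m (\<sigma> c)) y" for m
    unfolding normal_density_def using \<sigma>[of c] by (intro continuous_intros) auto
  show "(\<lambda>n. \<integral>\<omega>. normal_density (x c \<omega>) (\<sigma> c) (s n) * gkern x \<sigma> J \<omega> v \<partial>M)
    \<longlonglongrightarrow> (\<integral>\<omega>. normal_density (x c \<omega>) (\<sigma> c) y * gkern x \<sigma> J \<omega> v \<partial>M)"
  proof (rule integral_dominated_convergence[where w = "\<lambda>_. kbound (insert c J)"])
    show "AE \<omega> in M. (\<lambda>n. normal_density (x c \<omega>) (\<sigma> c) (s n) * gkern x \<sigma> J \<omega> v)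
      \<longlonglongrightarrow> normal_density (x c \<omega>) (\<sigma> c) y * gkern x \<sigma> J \<omega> v"
      using isCont_tendsto_compose[OF c s] by (intro AE_I2 tendsto_mult) auto
    show "AE \<omega> in M. norm (normal_density (x c \<omega>) (\<sigma> c) (s n) * gkern x \<sigma> J \<omega> v) \<le> kbound (insert c J)" for n
      using gkern_le[of "insert c J" _ "v(c := s n)"] less_imp_le[OF gkern_pos[of "insert c J" _ "v(c := s n)"]]
      by (intro AE_I2) (simp add: gkern_insert[OF assms])
  qed (auto simp: normal_density_def)
qed

lemma mix_measurable'[measurable]:
  assumes "J \<subseteq> I" shows "mix M x \<sigma> J \<in> borel_measurable (lborel_on I)"
proof -
  have "mix M x \<sigma> J = (\<lambda>v. mix M x \<sigma> J (restrict v J))"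
    by (intro ext mix_cong) simp
  moreover have "\<dots> \<in> borel_measurable (lborel_on I)"
    by (rule measurable_compose[OF measurable_restrict_subset[OF assms] mix_measurable])
  ultimately show ?thesis by simp
qed

lemma shift_measurable:
  assumes "J \<subseteq> I"
  shows "(\<lambda>(\<omega>, \<zeta>). \<lambda>i\<in>J. x i \<omega> + \<sigma> i * \<zeta> i) \<in> M \<Otimes>\<^sub>M std_on I \<rightarrow>\<^sub>M lborel_on J"
proof -
  have [measurable]: "(\<lambda>p. snd p i) \<in> borel_measurable (M \<Otimes>\<^sub>M std_on I)" if "i \<in> J" for i
    by (rule PiM_component_measurable[OF measurable_snd]) (use that assms in auto)
  show ?thesis unfolding case_prod_beta by measurable
qed

text \<open>Two views of one law: the density serves for logarithms, the image of \<open>M\<close>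
  times normals for moments, marginals and the addition of further noise.\<close>

lemma mixlaw_eq:
  assumes J: "J \<subseteq> I" and I: "finite I"
  shows "mixlaw M x \<sigma> J = distr (M \<Otimes>\<^sub>M std_on I) (lborel_on J) (\<lambda>(\<omega>, \<zeta>). \<lambda>i\<in>J. x i \<omega> + \<sigma> i * \<zeta> i)"
proof (rule measure_eqI)
  have fJ: "finite J" using J I by (rule finite_subset)
  interpret B: finite_product_sigma_finite "\<lambda>_. lborel :: real measure" J by standard (rule fJ)
  interpret MJ: pair_sigma_finite M "lborel_on J" by standard
  interpret S: prob_space "std_on I" by (rule prob_space_std_on)
  fix A assume "A \<in> sets (mixlaw M x \<sigma> J)"
  then have A[measurable]: "A \<in> sets (lborel_on J)" by simp
  have "emeasure (mixlaw M x \<sigma> J) A = (\<integral>\<^sup>+v. \<integral>\<^sup>+\<omega>. ennreal (gkern x \<sigma> J \<omega> v) * indicator A v \<partial>M \<partial>lborel_on J)"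
    unfolding mixlaw_def by (subst emeasure_density) (auto simp: mix_nn nn_integral_multc simp del: measurable_lborel1)
  also have "\<dots> = (\<integral>\<^sup>+\<omega>. \<integral>\<^sup>+v. ennreal (gkern x \<sigma> J \<omega> v) * indicator A v \<partial>lborel_on J \<partial>M)"
    by (rule MJ.Fubini') measurable
  also have "\<dots> = (\<integral>\<^sup>+\<omega>. emeasure (distr (std_on I) (lborel_on J) (\<lambda>\<zeta>. \<lambda>i\<in>J. x i \<omega> + \<sigma> i * \<zeta> i)) A \<partial>M)"
  proof (intro nn_integral_cong)
    fix \<omega> assume "\<omega> \<in> space M"
    then have [measurable]: "gkern x \<sigma> J \<omega> \<in> borel_measurable (lborel_on J)" by measurable
    show "(\<integral>\<^sup>+v. ennreal (gkern x \<sigma> J \<omega> v) * indicator A v \<partial>lborel_on J)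
      = emeasure (distr (std_on I) (lborel_on J) (\<lambda>\<zeta>. \<lambda>i\<in>J. x i \<omega> + \<sigma> i * \<zeta> i)) A"
      by (subst gkern_law[where x = x and \<omega> = \<omega>, OF fJ \<sigma> I J, symmetric], subst emeasure_density) auto
  qed
  also have "\<dots> = (\<integral>\<^sup>+\<omega>. \<integral>\<^sup>+\<zeta>. indicator A (\<lambda>i\<in>J. x i \<omega> + \<sigma> i * \<zeta> i) \<partial>std_on I \<partial>M)"
  proof (intro nn_integral_cong)
    fix \<omega> assume "\<omega> \<in> space M"
    have m: "(\<lambda>\<zeta>. \<lambda>i\<in>J. x i \<omega> + \<sigma> i * \<zeta> i) \<in> std_on I \<rightarrow>\<^sub>M lborel_on J"
      using measurable_compose[OF measurable_Pair1'[OF \<open>\<omega> \<in> space M\<close>] shift_measurable[OF J]] by simp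
    show "emeasure (distr (std_on I) (lborel_on J) (\<lambda>\<zeta>. \<lambda>i\<in>J. x i \<omega> + \<sigma> i * \<zeta> i)) A
      = (\<integral>\<^sup>+\<zeta>. indicator A (\<lambda>i\<in>J. x i \<omega> + \<sigma> i * \<zeta> i) \<partial>std_on I)"
      by (subst nn_integral_distr[OF m, symmetric]) (simp_all add: A del: measurable_lborel1)
  qed
  also have "\<dots> = (\<integral>\<^sup>+p. indicator A ((\<lambda>(\<omega>, \<zeta>). \<lambda>i\<in>J. x i \<omega> + \<sigma> i * \<zeta> i) p) \<partial>(M \<Otimes>\<^sub>M std_on I))"
    using measurable_compose[OF shift_measurable[OF J] borel_measurable_indicator[OF A]]
    by (subst S.nn_integral_fst[symmetric]) (simp_all add: case_prod_beta)
  also have "\<dots> = emeasure (distr (M \<Otimes>\<^sub>M std_on I) (lborel_on J) (\<lambda>(\<omega>, \<zeta>). \<lambda>i\<in>J. x i \<omega> + \<sigma> i * \<zeta> i)) A"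
    by (subst nn_integral_distr[OF shift_measurable[OF J], symmetric]) (simp_all add: A del: measurable_lborel1)
  finally show "emeasure (mixlaw M x \<sigma> J) A = emeasure (distr (M \<Otimes>\<^sub>M std_on I) (lborel_on J) (\<lambda>(\<omega>, \<zeta>). \<lambda>i\<in>J. x i \<omega> + \<sigma> i * \<zeta> i)) A" .
qed simp

lemma prob_space_mixlaw: assumes "finite J" shows "prob_space (mixlaw M x \<sigma> J)"
proof -
  interpret S: prob_space "std_on J" by (rule prob_space_std_on)
  interpret P: pair_prob_space M "std_on J" ..
  show ?thesis
    unfolding mixlaw_eq[OF order_refl assms] by (rule P.prob_space_distr[OF shift_measurable[OF order_refl]])
qed

lemma mixlaw_restrict:
  assumes J: "J \<subseteq> I" and I: "finite I"
  shows "distr (mixlaw M x \<sigma> I) (lborel_on J) (\<lambda>v. restrict v J) = mixlaw M x \<sigma> J"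
  unfolding mixlaw_eq[OF J I] mixlaw_eq[OF order_refl I]
  using J by (subst distr_distr[OF measurable_restrict_subset[OF J] shift_measurable])
    (auto intro!: distr_cong simp: comp_def fun_eq_iff restrict_def)

lemma square_shift_integrable:
  assumes "i \<in> I"
  shows "integrable (M \<Otimes>\<^sub>M std_on I) (\<lambda>p. (x i (fst p) + r * snd p i)\<^sup>2)"
proof (rule Bochner_Integration.integrable_bound)
  show "integrable (M \<Otimes>\<^sub>M std_on I) (\<lambda>p. 2 * (x i (fst p))\<^sup>2 + 2 * r\<^sup>2 * (snd p i)\<^sup>2)"
    using x_square[of i] std_on_moments[OF assms] prob_space_axioms
    by (intro Bochner_Integration.integrable_add integrable_mult_right
      integrable_pair_fst[OF _ prob_space_std_on] integrable_pair_snd[OF _ prob_space_std_on]) auto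
  have [measurable]: "(\<lambda>p. snd p i) \<in> borel_measurable (M \<Otimes>\<^sub>M std_on I)"
    by (rule PiM_component_measurable[OF measurable_snd]) (use assms in auto)
  show "(\<lambda>p. (x i (fst p) + r * snd p i)\<^sup>2) \<in> borel_measurable (M \<Otimes>\<^sub>M std_on I)" by measurable
  have "(a + b)\<^sup>2 \<le> 2 * a\<^sup>2 + 2 * b\<^sup>2" for a b :: real
    using zero_le_power2[of "a - b"] by (simp add: power2_eq_square algebra_simps)
  from this[of "x i a" "r * b" for a b]
  show "AE p in M \<Otimes>\<^sub>M std_on I. norm ((x i (fst p) + r * snd p i)\<^sup>2) \<le> norm (2 * (x i (fst p))\<^sup>2 + 2 * r\<^sup>2 * (snd p i)\<^sup>2)"
    by (auto simp: power_mult_distrib mult.assoc)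
qed

lemma mixlaw_square:
  assumes "finite J" "i \<in> J"
  shows "integrable (mixlaw M x \<sigma> J) (\<lambda>v. (v i)\<^sup>2)"
  unfolding mixlaw_eq[OF order_refl assms(1)]
  using square_shift_integrable[OF assms(2), of "\<sigma> i"] assms(2)
  by (subst integrable_distr_eq[OF shift_measurable]) (auto simp: case_prod_beta)

end

text \<open>Quadratic growth of the logarithm against the finite second moments of the law.\<close>

lemma integrable_ln_mix:
  assumes \<sigma>: "\<And>i. 0 < \<sigma> i" and \<tau>: "\<And>i. 0 < \<tau> i" and I: "finite I" and J: "J \<subseteq> I"
  shows "integrable (mixlaw M x \<sigma> I) (\<lambda>v. ln (mix M x \<tau> J v))"
proof (rule Bochner_Integration.integrable_bound)
  interpret P: prob_space "mixlaw M x \<sigma> I" by (rule prob_space_mixlaw[OF \<sigma> I])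
  have fJ: "finite J" using J I by (rule finite_subset)
  show "integrable (mixlaw M x \<sigma> I) (\<lambda>v. \<bar>lnbound \<tau> J\<bar> + \<bar>ln (kbound \<tau> J)\<bar> + (\<Sum>i\<in>J. (v i)\<^sup>2 / (\<tau> i)\<^sup>2))"
    using J by (intro Bochner_Integration.integrable_add Bochner_Integration.integrable_sum integrable_divide mixlaw_square \<sigma> I) auto
  have [measurable]: "mix M x \<tau> J \<in> borel_measurable (mixlaw M x \<sigma> I)"
    using mix_measurable'[OF \<tau> J] by (simp add: measurable_cong_sets[OF sets_mixlaw refl])
  show "(\<lambda>v. ln (mix M x \<tau> J v)) \<in> borel_measurable (mixlaw M x \<sigma> I)" by measurable
  show "AE v in mixlaw M x \<sigma> I. norm (ln (mix M x \<tau> J v)) \<le> norm (\<bar>lnbound \<tau> J\<bar> + \<bar>ln (kbound \<tau> J)\<bar> + (\<Sum>i\<in>J. (v i)\<^sup>2 / (\<tau> i)\<^sup>2))"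
    using abs_ln_mix_le[OF \<tau> fJ] by (intro AE_I2) (auto intro: order_trans[OF _ abs_ge_self])
qed

end

section \<open>The conditional entropy power inequality\<close>

text \<open>\<open>epi_one\<close> at almost every \<open>a\<close>, averaged over \<open>A\<close>;
  being linear in the integrals of logarithms, the inequality survives the averaging. What needs
  care is that integrability over \<open>B\<close> passes to almost every fibre
  \<open>D a\<close>.\<close>

lemma epi_conditional:
  fixes A :: "'a measure" and \<phi> q :: "'a \<times> real \<Rightarrow> real"
  assumes A: "prob_space A"
    and phi_m[measurable]: "\<phi> \<in> borel_measurable (A \<Otimes>\<^sub>M lborel)"
    and q_m[measurable]: "q \<in> borel_measurable (A \<Otimes>\<^sub>M lborel)"
    and phi: "\<And>a. a \<in> space A \<Longrightarrow> continuous_on UNIV (\<lambda>y. \<phi> (a, y))" "\<And>a y. a \<in> space A \<Longrightarrow> 0 < \<phi> (a, y)"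
      "\<And>a. a \<in> space A \<Longrightarrow> (\<integral>\<^sup>+y. ennreal (\<phi> (a, y)) \<partial>lborel) = 1"
    and q: "\<And>a y. a \<in> space A \<Longrightarrow> 0 < q (a, y)"
      "\<And>a. a \<in> space A \<Longrightarrow> (\<integral>\<^sup>+y. ennreal (q (a, y)) \<partial>lborel) \<le> 1"
    and rho: "0 < \<rho>" and l: "0 < l" "l < 1"
    and B_def: "B = density (A \<Otimes>\<^sub>M lborel) (\<lambda>p. ennreal (\<phi> p))"
    and i1: "integrable B (\<lambda>p. ln (\<phi> p))"
    and i2: "integrable (B \<Otimes>\<^sub>M std_normal) (\<lambda>p. ln (q (fst (fst p), snd (fst p) + \<rho> * snd p)))"
  shows "(\<integral>p. ln (q (fst (fst p), snd (fst p) + \<rho> * snd p)) \<partial>(B \<Otimes>\<^sub>M std_normal))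
    \<le> l * (\<integral>p. ln (\<phi> p) \<partial>B) + epi_const l (\<rho>\<^sup>2)"
proof -
  interpret A: prob_space A by fact
  interpret AL: pair_sigma_finite A lborel ..
  have setsB[measurable_cong]: "sets B = sets (A \<Otimes>\<^sub>M lborel)" by (simp add: B_def)
  have B1: "prob_space B"
  proof
    have "emeasure B (space B) = (\<integral>\<^sup>+p. ennreal (\<phi> p) \<partial>(A \<Otimes>\<^sub>M lborel))"
      unfolding B_def space_density
      by (subst emeasure_density[OF _ sets.top]) (auto intro!: nn_integral_cong)
    also have "\<dots> = (\<integral>\<^sup>+a. \<integral>\<^sup>+y. ennreal (\<phi> (a, y)) \<partial>lborel \<partial>A)"
      by (subst lborel.nn_integral_fst[symmetric]) auto
    also have "\<dots> = (\<integral>\<^sup>+a. 1 \<partial>A)" by (intro nn_integral_cong) (simp add: phi)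
    finally show "emeasure B (space B) = 1" by (simp add: A.emeasure_space_1)
  qed
  interpret B: prob_space B by fact
  interpret BN: pair_prob_space B std_normal ..
  define D where "D a = density lborel (\<lambda>y. ennreal (\<phi> (a, y)))" for a
  have setsD[measurable_cong]: "sets (D a) = sets borel" for a by (simp add: D_def)
  have [measurable]: "(\<lambda>y. \<phi> (a, y)) \<in> borel_measurable borel" "(\<lambda>y. q (a, y)) \<in> borel_measurable borel" if "a \<in> space A" for a
    using measurable_compose[OF measurable_Pair1'[OF that] phi_m] measurable_compose[OF measurable_Pair1'[OF that] q_m] by auto
  have D1: "prob_space (D a)" if "a \<in> space A" for a
    using real_distribution_density[OF phi(1,2,3)] that by (auto simp: D_def real_distribution_def)
  have Bint: "integrable A (\<lambda>a. \<integral>y. h (a, y) \<partial>D a)" "(\<integral>p. h p \<partial>B) = (\<integral>a. \<integral>y. h (a, y) \<partial>D a \<partial>A)"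
    "AE a in A. integrable (D a) (\<lambda>y. h (a, y))"
    if h: "integrable B h" for h :: "'a \<times> real \<Rightarrow> real"
  proof -
    have hm[measurable]: "h \<in> borel_measurable (A \<Otimes>\<^sub>M lborel)" using h by (simp add: B_def)
    have nn: "AE p in A \<Otimes>\<^sub>M lborel. 0 \<le> \<phi> p"
      by (rule AE_I2) (auto simp: space_pair_measure less_imp_le phi)
    have i: "integrable (A \<Otimes>\<^sub>M lborel) (\<lambda>p. \<phi> p * h p)"
      using h unfolding B_def by (subst (asm) integrable_real_density) (use nn in auto)
    have e: "(\<integral>y. h (a, y) \<partial>D a) = (\<integral>y. \<phi> (a, y) * h (a, y) \<partial>lborel)"
      "integrable (D a) (\<lambda>y. h (a, y)) = integrable lborel (\<lambda>y. \<phi> (a, y) * h (a, y))" if a: "a \<in> space A" for a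
    proof -
      have [measurable]: "(\<lambda>y. h (a, y)) \<in> borel_measurable lborel"
        using measurable_compose[OF measurable_Pair1'[OF a] hm] by auto
      show "(\<integral>y. h (a, y) \<partial>D a) = (\<integral>y. \<phi> (a, y) * h (a, y) \<partial>lborel)"
        unfolding D_def by (subst integral_real_density) (use a phi in \<open>auto intro!: AE_I2 simp: less_imp_le\<close>)
      show "integrable (D a) (\<lambda>y. h (a, y)) = integrable lborel (\<lambda>y. \<phi> (a, y) * h (a, y))"
        unfolding D_def by (subst integrable_real_density) (use a phi in \<open>auto intro!: AE_I2 simp: less_imp_le\<close>)
    qed
    show "integrable A (\<lambda>a. \<integral>y. h (a, y) \<partial>D a)"
      using AL.integrable_fst'[OF i] by (rule Bochner_Integration.integrable_cong[THEN iffD1, rotated 2]) (auto simp: e)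
    show "(\<integral>p. h p \<partial>B) = (\<integral>a. \<integral>y. h (a, y) \<partial>D a \<partial>A)"
      unfolding B_def
      by (subst integral_real_density) (use nn in \<open>auto simp: AL.integral_fst'[OF i, symmetric] e cong: Bochner_Integration.integral_cong\<close>)
    show "AE a in A. integrable (D a) (\<lambda>y. h (a, y))"
      using AL.AE_integrable_fst'[OF i] AE_space by eventually_elim (simp add: e)
  qed
  define F where "F p = ln (q (fst (fst p), snd (fst p) + \<rho> * snd p))" for p :: "('a \<times> real) \<times> real"
  have Fm[measurable]: "F \<in> borel_measurable (B \<Otimes>\<^sub>M std_normal)"
    using i2 unfolding F_def[abs_def] by (rule borel_measurable_integrable)
  have iF: "integrable (B \<Otimes>\<^sub>M std_normal) F" using i2 by (simp add: F_def[abs_def])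
  define G where "G a = (\<integral>p. F ((a, fst p), snd p) \<partial>(D a \<Otimes>\<^sub>M std_normal))" for a
  \<comment> \<open>The converse direction of Fubini's theorem on each fibre: first integrability in
    \<open>z\<close>, then integrability in \<open>y\<close> of the norm. What comes from
    \<open>B\<close> is known only where \<open>\<phi> p > 0\<close>, and that is everywhere on the
    fibres over \<open>space A\<close>.\<close>
  have ik: "AE a in A. integrable (D a \<Otimes>\<^sub>M std_normal) (\<lambda>p. F ((a, fst p), snd p))"
  proof -
    have "integrable B (\<lambda>p. \<integral>z. norm (F (p, z)) \<partial>std_normal)"
      using BN.integrable_fst'[OF integrable_norm[OF iF]] by simp
    from Bint(3)[OF this]
    have 1: "AE a in A. integrable (D a) (\<lambda>y. \<integral>z. norm (F ((a, y), z)) \<partial>std_normal)" .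
    have "AE p in B. integrable std_normal (\<lambda>z. F (p, z))" using BN.AE_integrable_fst'[OF iF] .
    then have "AE p in A \<Otimes>\<^sub>M lborel. 0 < \<phi> p \<longrightarrow> integrable std_normal (\<lambda>z. F (p, z))"
      unfolding B_def by (subst (asm) AE_density) auto
    then have "AE a in A. AE y in lborel. 0 < \<phi> (a, y) \<longrightarrow> integrable std_normal (\<lambda>z. F ((a, y), z))"
      by (rule AL.AE_pair)
    with 1 AE_space show ?thesis
    proof eventually_elim
      case (elim a)
      interpret Da: prob_space "D a" by (rule D1[OF elim(2)])
      interpret DN: pair_prob_space "D a" std_normal ..
      have a: "(\<lambda>p. ((a, fst p), snd p)) \<in> D a \<Otimes>\<^sub>M std_normal \<rightarrow>\<^sub>M B \<Otimes>\<^sub>M std_normal"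
        using elim(2) by measurable
      show ?case
      proof (rule DN.Fubini_integrable)
        show "(\<lambda>p. F ((a, fst p), snd p)) \<in> borel_measurable (D a \<Otimes>\<^sub>M std_normal)"
          using measurable_compose[OF a Fm] .
        show "integrable (D a) (\<lambda>x. \<integral>y. norm (F ((a, fst (x, y)), snd (x, y))) \<partial>std_normal)" using elim(1) by simp
        show "AE x in D a. integrable std_normal (\<lambda>y. F ((a, fst (x, y)), snd (x, y)))"
          using elim(2,3) unfolding D_def by (subst AE_density) auto
      qed
    qed
  qed
  have Geq: "AE a in A. (\<integral>y. (\<integral>z. F ((a, y), z) \<partial>std_normal) \<partial>D a) = G a"
    using ik AE_space
  proof eventually_elim
    case (elim a)
    interpret Da: prob_space "D a" by (rule D1[OF elim(2)])
    interpret DN: pair_prob_space "D a" std_normal ..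
    show ?case unfolding G_def using DN.integral_fst'[OF elim(1)] by simp
  qed
  have iH: "integrable B (\<lambda>p. \<integral>z. F (p, z) \<partial>std_normal)" using BN.integrable_fst'[OF iF] .
  have "(\<integral>p. F p \<partial>(B \<Otimes>\<^sub>M std_normal)) = (\<integral>p. (\<integral>z. F (p, z) \<partial>std_normal) \<partial>B)"
    using BN.integral_fst'[OF iF] by simp
  also have "\<dots> = (\<integral>a. (\<integral>y. (\<integral>z. F ((a, y), z) \<partial>std_normal) \<partial>D a) \<partial>A)" by (rule Bint(2)[OF iH])
  also have "\<dots> \<le> (\<integral>a. l * (\<integral>y. ln (\<phi> (a, y)) \<partial>D a) + epi_const l (\<rho>\<^sup>2) \<partial>A)"
  proof (rule integral_mono_AE)
    show "integrable A (\<lambda>a. \<integral>y. (\<integral>z. F ((a, y), z) \<partial>std_normal) \<partial>D a)" by (rule Bint(1)[OF iH])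
    show "integrable A (\<lambda>a. l * (\<integral>y. ln (\<phi> (a, y)) \<partial>D a) + epi_const l (\<rho>\<^sup>2))"
      using Bint(1)[OF i1] by auto
    show "AE a in A. (\<integral>y. (\<integral>z. F ((a, y), z) \<partial>std_normal) \<partial>D a) \<le> l * (\<integral>y. ln (\<phi> (a, y)) \<partial>D a) + epi_const l (\<rho>\<^sup>2)"
      using Geq ik Bint(3)[OF i1] AE_space
    proof eventually_elim
      case (elim a)
      have "(\<integral>p. ln (q (a, fst p + \<rho> * snd p)) \<partial>(density lborel (\<lambda>y. ennreal (\<phi> (a, y))) \<Otimes>\<^sub>M std_normal))
        \<le> l * (\<integral>y. ln (\<phi> (a, y)) \<partial>density lborel (\<lambda>y. ennreal (\<phi> (a, y)))) + epi_const l (\<rho>\<^sup>2)"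
        by (rule epi_one[where \<phi> = "\<lambda>y. \<phi> (a, y)" and q = "\<lambda>y. q (a, y)"])
           (use elim phi q rho l in \<open>auto simp: D_def F_def\<close>)
      then show ?case using elim(1) by (simp add: G_def F_def D_def)
    qed
  qed
  also have "\<dots> = l * (\<integral>a. (\<integral>y. ln (\<phi> (a, y)) \<partial>D a) \<partial>A) + epi_const l (\<rho>\<^sup>2)"
    using Bint(1)[OF i1] by (simp add: A.prob_space)
  finally show ?thesis unfolding F_def Bint(2)[OF i1] .
qed

text \<open>The sum is the first component of a rotation in each coordinate plane: after factoring
  over \<open>J\<close>, \<open>std_normal_rotate\<close> applies and the second component
  integrates to one.\<close>

lemma std_on_rotate:
  fixes c s :: "'i \<Rightarrow> real"
  assumes J: "finite J" and c: "\<And>i. 0 < c i" and cs: "\<And>i. (c i)\<^sup>2 + (s i)\<^sup>2 = 1"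
  shows "distr (std_on J \<Otimes>\<^sub>M std_on J) (std_on J) (\<lambda>p. \<lambda>i\<in>J. c i * fst p i + s i * snd p i) = std_on J"
proof (rule std_on.PiM_eqI[OF J])
  interpret S: prob_space "std_on J" by (rule prob_space_std_on)
  have [measurable]: "(\<lambda>p. fst p i) \<in> borel_measurable (std_on J \<Otimes>\<^sub>M std_on J)"
    "(\<lambda>p. snd p i) \<in> borel_measurable (std_on J \<Otimes>\<^sub>M std_on J)" if "i \<in> J" for i
    by (rule PiM_component_measurable[OF measurable_fst] PiM_component_measurable[OF measurable_snd], use that in auto)+
  have m: "(\<lambda>p. \<lambda>i\<in>J. c i * fst p i + s i * snd p i) \<in> std_on J \<Otimes>\<^sub>M std_on J \<rightarrow>\<^sub>M std_on J"
    by (intro measurable_restrict) simp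
  fix A assume A: "\<And>i. i \<in> J \<Longrightarrow> A i \<in> sets (std_normal)"
  then have A'[measurable]: "\<And>i. i \<in> J \<Longrightarrow> A i \<in> sets borel" by simp
  have [measurable]: "Pi\<^sub>E J A \<in> sets (std_on J)" using A J by (intro sets_PiM_I_finite) auto
  have one: "(\<integral>\<^sup>+y. \<integral>\<^sup>+z. indicator (A i) (c i * y + s i * z) \<partial>std_normal \<partial>std_normal) = emeasure std_normal (A i)" if i: "i \<in> J" for i
  proof -
    have [measurable]: "A i \<in> sets borel" using i by simp
    \<comment> \<open>The sign of \<open>s\<close> is reversed, since the rotation lemma has
      \<open>c g - s h\<close> as its first component.\<close>
    have R: "distr (std_normal \<Otimes>\<^sub>M std_normal) (borel \<Otimes>\<^sub>M borel) (\<lambda>(g, h). (c i * g - (- s i) * h, (- s i) * g + c i * h))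
      = std_normal \<Otimes>\<^sub>M std_normal"
      using std_normal_rotate[OF c, of i "- s i"] cs by simp
    have "(\<integral>\<^sup>+y. \<integral>\<^sup>+z. indicator (A i) (c i * y + s i * z) \<partial>std_normal \<partial>std_normal)
      = (\<integral>\<^sup>+p. indicator (A i) (c i * fst p + s i * snd p) \<partial>(std_normal \<Otimes>\<^sub>M std_normal))"
      by (subst std_normal.nn_integral_fst[symmetric]) auto
    also have "\<dots> = (\<integral>\<^sup>+p. indicator (A i) (fst p) \<partial>distr (std_normal \<Otimes>\<^sub>M std_normal) (borel \<Otimes>\<^sub>M borel) (\<lambda>(g, h). (c i * g - (- s i) * h, (- s i) * g + c i * h)))"
      by (subst nn_integral_distr) (auto simp: case_prod_beta cong: measurable_cong_sets sets_pair_measure_cong)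
    also have "\<dots> = (\<integral>\<^sup>+y. \<integral>\<^sup>+z. indicator (A i) y \<partial>std_normal \<partial>std_normal)"
      unfolding R by (subst std_normal.nn_integral_fst[symmetric]) (auto cong: measurable_cong_sets sets_pair_measure_cong)
    also have "\<dots> = emeasure std_normal (A i)"
      using std_normal.emeasure_space_1 by simp
    finally show ?thesis .
  qed
  have "emeasure (distr (std_on J \<Otimes>\<^sub>M std_on J) (std_on J) (\<lambda>p. \<lambda>i\<in>J. c i * fst p i + s i * snd p i)) (Pi\<^sub>E J A)
    = (\<integral>\<^sup>+p. indicator (Pi\<^sub>E J A) (\<lambda>i\<in>J. c i * fst p i + s i * snd p i) \<partial>(std_on J \<Otimes>\<^sub>M std_on J))"
    by (subst nn_integral_distr[OF m, symmetric]) auto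
  also have "\<dots> = (\<integral>\<^sup>+y. \<integral>\<^sup>+z. indicator (Pi\<^sub>E J A) (\<lambda>i\<in>J. c i * y i + s i * z i) \<partial>std_on J \<partial>std_on J)"
    using measurable_compose[OF m borel_measurable_indicator[of "Pi\<^sub>E J A"]]
    by (subst S.nn_integral_fst[symmetric]) auto
  also have "\<dots> = (\<integral>\<^sup>+y. \<integral>\<^sup>+z. (\<Prod>i\<in>J. indicator (A i) (c i * y i + s i * z i)) \<partial>std_on J \<partial>std_on J)"
    using J by (intro nn_integral_cong) (auto simp: indicator_def PiE_iff prod_zero_iff)
  also have "\<dots> = (\<integral>\<^sup>+y. (\<Prod>i\<in>J. \<integral>\<^sup>+z. indicator (A i) (c i * y i + s i * z) \<partial>std_normal) \<partial>std_on J)"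
    by (intro nn_integral_cong std_on.product_nn_integral_prod[OF J]) simp
  also have "\<dots> = (\<Prod>i\<in>J. \<integral>\<^sup>+y. \<integral>\<^sup>+z. indicator (A i) (c i * y + s i * z) \<partial>std_normal \<partial>std_normal)"
    by (rule std_on.product_nn_integral_prod[OF J]) simp
  also have "\<dots> = (\<Prod>i\<in>J. emeasure std_normal (A i))" by (intro prod.cong refl one)
  finally show "emeasure (distr (std_on J \<Otimes>\<^sub>M std_on J) (std_on J) (\<lambda>p. \<lambda>i\<in>J. c i * fst p i + s i * snd p i)) (Pi\<^sub>E J A)
    = (\<Prod>i\<in>J. emeasure std_normal (A i))" .
qed simp

text \<open>The negative differential entropy of the mixture law.\<close>

definition nent :: "'w measure \<Rightarrow> ('i \<Rightarrow> 'w \<Rightarrow> real) \<Rightarrow> ('i \<Rightarrow> real) \<Rightarrow> 'i set \<Rightarrow> real" where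
  "nent M x \<sigma> J = (\<integral>v. ln (mix M x \<sigma> J v) \<partial>mixlaw M x \<sigma> J)"

lemma nn_integral_distr':
  "T \<in> M \<rightarrow>\<^sub>M M' \<Longrightarrow> f \<in> borel_measurable M' \<Longrightarrow> integral\<^sup>N (distr M M' T) f = (\<integral>\<^sup>+x. f (T x) \<partial>M)"
  by (rule nn_integral_distr) simp_all

context gauss_mixture
begin

lemma mixlaw_nn:
  assumes \<sigma>: "\<And>i. 0 < \<sigma> i" and J: "finite J" and f: "f \<in> borel_measurable (lborel_on J)"
  shows "(\<integral>\<^sup>+v. f v \<partial>mixlaw M x \<sigma> J) = (\<integral>\<^sup>+\<omega>. \<integral>\<^sup>+\<zeta>. f (\<lambda>i\<in>J. x i \<omega> + \<sigma> i * \<zeta> i) \<partial>std_on J \<partial>M)"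
proof -
  interpret S: prob_space "std_on J" by (rule prob_space_std_on)
  note s = shift_measurable[where \<sigma> = \<sigma> and J = J, OF \<sigma> order_refl]
  show ?thesis
    unfolding mixlaw_eq[OF \<sigma> order_refl J]
    using measurable_compose[OF s f]
    by (subst nn_integral_distr'[OF s f], subst S.nn_integral_fst[symmetric]) (auto simp: case_prod_beta)
qed

lemma add_noise_measurable:
  assumes "J \<subseteq> I" "J \<subseteq> I'"
  shows "(\<lambda>p. \<lambda>i\<in>J. fst p i + \<rho> i * snd p i) \<in> mixlaw M x \<sigma> I \<Otimes>\<^sub>M std_on I' \<rightarrow>\<^sub>M lborel_on J"
proof -
  have "(\<lambda>p. fst p i) \<in> borel_measurable (mixlaw M x \<sigma> I \<Otimes>\<^sub>M std_on I')" if "i \<in> J" for i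
    by (rule PiM_component_measurable[OF measurable_compose[OF measurable_fst measurable_ident_sets[OF sets_mixlaw]]])
      (use assms that in auto)
  moreover have "(\<lambda>p. snd p i) \<in> borel_measurable (mixlaw M x \<sigma> I \<Otimes>\<^sub>M std_on I')" if "i \<in> J" for i
    by (rule PiM_component_measurable[OF measurable_snd]) (use assms that in auto)
  ultimately show ?thesis by (intro measurable_restrict) auto
qed

text \<open>\<open>\<sigma> i * \<eta> i + \<rho> i * \<zeta> i\<close> is
  \<open>\<sigma>' i\<close> times a standard normal obtained by rotation. A coordinate with
  \<open>\<rho> i = 0\<close> stays as it is, so noise may be added to part of the
  coordinates.\<close>

lemma mixlaw_conv:
  assumes \<sigma>: "\<And>i. 0 < \<sigma> i" and J: "finite J" and s: "\<And>i. \<sigma>' i = sqrt ((\<sigma> i)\<^sup>2 + (\<rho> i)\<^sup>2)"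
  shows "distr (mixlaw M x \<sigma> J \<Otimes>\<^sub>M std_on J) (lborel_on J) (\<lambda>p. \<lambda>i\<in>J. fst p i + \<rho> i * snd p i) = mixlaw M x \<sigma>' J"
proof (rule measure_eqI)
  interpret S: prob_space "std_on J" by (rule prob_space_std_on)
  have \<sigma>'2: "(\<sigma>' i)\<^sup>2 = (\<sigma> i)\<^sup>2 + (\<rho> i)\<^sup>2" for i by (simp add: s)
  have \<sigma>': "0 < \<sigma>' i" for i using \<sigma>[of i] by (simp add: s add_pos_nonneg)
  fix A assume "A \<in> sets (distr (mixlaw M x \<sigma> J \<Otimes>\<^sub>M std_on J) (lborel_on J) (\<lambda>p. \<lambda>i\<in>J. fst p i + \<rho> i * snd p i))"
  then have A: "A \<in> sets (lborel_on J)" by simp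
  define f :: "('i \<Rightarrow> real) \<Rightarrow> ennreal" where "f = indicator A"
  have f: "f \<in> borel_measurable (lborel_on J)" unfolding f_def using A by (rule borel_measurable_indicator)
  note m = add_noise_measurable[where J = J and \<rho> = \<rho> and \<sigma> = \<sigma>, OF order_refl order_refl]
  let ?r = "\<lambda>p. \<lambda>i\<in>J. \<sigma> i / \<sigma>' i * fst p i + \<rho> i / \<sigma>' i * snd p i"
  have R: "distr (std_on J \<Otimes>\<^sub>M std_on J) (std_on J) ?r = std_on J"
  proof (rule std_on_rotate[where c = "\<lambda>i. \<sigma> i / \<sigma>' i" and s = "\<lambda>i. \<rho> i / \<sigma>' i", OF J])
    show "0 < \<sigma> i / \<sigma>' i" for i using \<sigma> \<sigma>' by simp
    show "(\<sigma> i / \<sigma>' i)\<^sup>2 + (\<rho> i / \<sigma>' i)\<^sup>2 = 1" for i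
      using \<sigma>'[of i] by (simp add: power_divide \<sigma>'2[symmetric] add_divide_distrib[symmetric])
  qed
  have rm: "?r \<in> std_on J \<Otimes>\<^sub>M std_on J \<rightarrow>\<^sub>M std_on J"
  proof -
    have "(\<lambda>p. fst p i) \<in> borel_measurable (std_on J \<Otimes>\<^sub>M std_on J)"
      "(\<lambda>p. snd p i) \<in> borel_measurable (std_on J \<Otimes>\<^sub>M std_on J)" if "i \<in> J" for i
      by (rule PiM_component_measurable[OF measurable_fst] PiM_component_measurable[OF measurable_snd], use that in auto)+
    then show ?thesis by (intro measurable_restrict) auto
  qed
  have "emeasure (distr (mixlaw M x \<sigma> J \<Otimes>\<^sub>M std_on J) (lborel_on J) (\<lambda>p. \<lambda>i\<in>J. fst p i + \<rho> i * snd p i)) A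
    = (\<integral>\<^sup>+p. f (\<lambda>i\<in>J. fst p i + \<rho> i * snd p i) \<partial>(mixlaw M x \<sigma> J \<Otimes>\<^sub>M std_on J))"
    by (subst nn_integral_distr'[OF m f, symmetric]) (simp add: f_def A del: measurable_lborel1)
  also have "\<dots> = (\<integral>\<^sup>+v. \<integral>\<^sup>+\<zeta>. f (\<lambda>i\<in>J. v i + \<rho> i * \<zeta> i) \<partial>std_on J \<partial>mixlaw M x \<sigma> J)"
    using measurable_compose[OF m f] by (subst S.nn_integral_fst[symmetric]) auto
  also have "\<dots> = (\<integral>\<^sup>+\<omega>. \<integral>\<^sup>+\<eta>. \<integral>\<^sup>+\<zeta>. f (\<lambda>i\<in>J. (\<lambda>i\<in>J. x i \<omega> + \<sigma> i * \<eta> i) i + \<rho> i * \<zeta> i) \<partial>std_on J \<partial>std_on J \<partial>M)"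
  proof (rule mixlaw_nn[OF \<sigma> J])
    have "(\<lambda>v. \<integral>\<^sup>+\<zeta>. f (\<lambda>i\<in>J. v i + \<rho> i * \<zeta> i) \<partial>std_on J) \<in> borel_measurable (mixlaw M x \<sigma> J)"
      using S.borel_measurable_nn_integral_fst[OF measurable_compose[OF m f]] by simp
    then show "(\<lambda>v. \<integral>\<^sup>+\<zeta>. f (\<lambda>i\<in>J. v i + \<rho> i * \<zeta> i) \<partial>std_on J) \<in> borel_measurable (lborel_on J)"
      by (simp cong: measurable_cong_sets[OF sets_mixlaw refl])
  qed
  also have "\<dots> = (\<integral>\<^sup>+\<omega>. \<integral>\<^sup>+\<zeta>. f (\<lambda>i\<in>J. x i \<omega> + \<sigma>' i * \<zeta> i) \<partial>std_on J \<partial>M)"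
  proof (rule nn_integral_cong)
    fix \<omega> assume w: "\<omega> \<in> space M"
    define g where "g \<zeta> = f (\<lambda>i\<in>J. x i \<omega> + \<sigma>' i * \<zeta> i)" for \<zeta>
    have gm: "g \<in> borel_measurable (std_on J)"
      unfolding g_def
      using measurable_compose[OF measurable_compose[OF measurable_Pair1'[OF w] shift_measurable[OF \<sigma>' order_refl]] f]
      by (simp add: case_prod_beta)
    have "(\<lambda>i\<in>J. (\<lambda>i\<in>J. x i \<omega> + \<sigma> i * \<eta> i) i + \<rho> i * \<zeta> i) = (\<lambda>i\<in>J. x i \<omega> + \<sigma>' i * ?r (\<eta>, \<zeta>) i)" for \<eta> \<zeta>
      using \<sigma>' by (intro ext) (auto simp: field_simps less_imp_neq[symmetric])
    then have "(\<integral>\<^sup>+\<eta>. \<integral>\<^sup>+\<zeta>. f (\<lambda>i\<in>J. (\<lambda>i\<in>J. x i \<omega> + \<sigma> i * \<eta> i) i + \<rho> i * \<zeta> i) \<partial>std_on J \<partial>std_on J)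
      = (\<integral>\<^sup>+\<eta>. \<integral>\<^sup>+\<zeta>. g (?r (\<eta>, \<zeta>)) \<partial>std_on J \<partial>std_on J)" by (simp only: g_def)
    also have "\<dots> = (\<integral>\<^sup>+p. g (?r p) \<partial>(std_on J \<Otimes>\<^sub>M std_on J))"
      using measurable_compose[OF rm gm] by (subst S.nn_integral_fst[symmetric]) simp_all
    also have "\<dots> = (\<integral>\<^sup>+\<zeta>. g \<zeta> \<partial>distr (std_on J \<Otimes>\<^sub>M std_on J) (std_on J) ?r)"
      by (rule nn_integral_distr'[OF rm gm, symmetric])
    finally show "(\<integral>\<^sup>+\<eta>. \<integral>\<^sup>+\<zeta>. f (\<lambda>i\<in>J. (\<lambda>i\<in>J. x i \<omega> + \<sigma> i * \<eta> i) i + \<rho> i * \<zeta> i) \<partial>std_on J \<partial>std_on J)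
      = (\<integral>\<^sup>+\<zeta>. f (\<lambda>i\<in>J. x i \<omega> + \<sigma>' i * \<zeta> i) \<partial>std_on J)" by (simp only: R g_def)
  qed
  also have "\<dots> = (\<integral>\<^sup>+v. f v \<partial>mixlaw M x \<sigma>' J)" by (rule mixlaw_nn[OF \<sigma>' J f, symmetric])
  finally show "emeasure (distr (mixlaw M x \<sigma> J \<Otimes>\<^sub>M std_on J) (lborel_on J) (\<lambda>p. \<lambda>i\<in>J. fst p i + \<rho> i * snd p i)) A
    = emeasure (mixlaw M x \<sigma>' J) A"
    using A by (simp add: f_def)
qed simp

lemma nent_restrict:
  assumes \<sigma>: "\<And>i. 0 < \<sigma> i" and I: "finite I" and J: "J \<subseteq> I"
  shows "(\<integral>v. ln (mix M x \<sigma> J v) \<partial>mixlaw M x \<sigma> I) = nent M x \<sigma> J"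
proof -
  have r: "(\<lambda>v. restrict v J) \<in> mixlaw M x \<sigma> I \<rightarrow>\<^sub>M lborel_on J"
    using measurable_restrict_subset[OF J] by (simp cong: measurable_cong_sets[OF sets_mixlaw refl])
  have g: "(\<lambda>v. ln (mix M x \<sigma> J v)) \<in> borel_measurable (lborel_on J)"
    using mix_measurable[where \<sigma> = \<sigma> and J = J, OF \<sigma>] by (rule borel_measurable_ln)
  show ?thesis
    unfolding nent_def mixlaw_restrict[OF \<sigma> J I, symmetric]
    by (subst integral_distr[OF r g])
       (auto intro!: Bochner_Integration.integral_cong arg_cong[where f = ln] mix_cong)
qed

text \<open>\<open>\<phi>\<close> is the conditional density of coordinate \<open>c\<close> given
  those in \<open>J\<close>. The spectator \<open>N\<close> is carried along because
  \<open>epi_step\<close> conditions on the coordinates in \<open>J\<close> together with the noise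
  still to be added to them.\<close>

lemma mixlaw_disintegrate:
  fixes c :: 'i and N :: "'b measure"
  assumes \<sigma>: "\<And>i. 0 < \<sigma> i" and J: "finite J" "c \<notin> J" and N: "prob_space N"
  defines "A \<equiv> mixlaw M x \<sigma> J \<Otimes>\<^sub>M N"
  defines "\<phi> \<equiv> \<lambda>p. mix M x \<sigma> (insert c J) ((fst (fst p))(c := snd p)) / mix M x \<sigma> J (fst (fst p))"
  defines "h \<equiv> \<lambda>p. ((restrict (fst p) J, snd p), fst p c)"
  shows "\<phi> \<in> borel_measurable (A \<Otimes>\<^sub>M lborel)"
    and "h \<in> mixlaw M x \<sigma> (insert c J) \<Otimes>\<^sub>M N \<rightarrow>\<^sub>M A \<Otimes>\<^sub>M lborel"
    and "density (A \<Otimes>\<^sub>M lborel) (\<lambda>p. ennreal (\<phi> p)) = distr (mixlaw M x \<sigma> (insert c J) \<Otimes>\<^sub>M N) (A \<Otimes>\<^sub>M lborel) h"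
proof -
  interpret N: prob_space N by fact
  interpret mJ: prob_space "mixlaw M x \<sigma> J" by (rule prob_space_mixlaw[OF \<sigma> J(1)])
  interpret NL: pair_sigma_finite N lborel ..
  interpret A: pair_prob_space "mixlaw M x \<sigma> J" N ..
  have fi: "finite (insert c J)" using J by simp
  have u1: "(\<lambda>p. (fst (fst p))(c := snd p)) \<in> A \<Otimes>\<^sub>M lborel \<rightarrow>\<^sub>M lborel_on (insert c J)"
    unfolding A_def
    by (rule measurable_fun_upd[where J = J])
       (auto intro!: measurable_compose[OF measurable_compose[OF measurable_fst measurable_fst] measurable_ident_sets[OF sets_mixlaw]])
  have u2: "(\<lambda>p. fst (fst p)) \<in> A \<Otimes>\<^sub>M lborel \<rightarrow>\<^sub>M lborel_on J"
    unfolding A_def by (rule measurable_compose[OF measurable_compose[OF measurable_fst measurable_fst] measurable_ident_sets[OF sets_mixlaw]])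
  show phi_m: "\<phi> \<in> borel_measurable (A \<Otimes>\<^sub>M lborel)"
    unfolding \<phi>_def
    by (intro borel_measurable_divide measurable_compose[OF u1 mix_measurable[OF \<sigma>]] measurable_compose[OF u2 mix_measurable[OF \<sigma>]])
  have f1: "fst \<in> mixlaw M x \<sigma> (insert c J) \<Otimes>\<^sub>M N \<rightarrow>\<^sub>M lborel_on (insert c J)"
    by (rule measurable_compose[OF measurable_fst measurable_ident_sets[OF sets_mixlaw]])
  have r1: "(\<lambda>p. restrict (fst p) J) \<in> mixlaw M x \<sigma> (insert c J) \<Otimes>\<^sub>M N \<rightarrow>\<^sub>M mixlaw M x \<sigma> J"
    using measurable_compose[OF f1 measurable_restrict_subset[of J "insert c J"]]
    by (auto simp: measurable_cong_sets[OF refl sets_mixlaw])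
  have c1: "(\<lambda>p. fst p c) \<in> borel_measurable (mixlaw M x \<sigma> (insert c J) \<Otimes>\<^sub>M N)"
    by (rule PiM_component_measurable[OF f1]) auto
  show h_m: "h \<in> mixlaw M x \<sigma> (insert c J) \<Otimes>\<^sub>M N \<rightarrow>\<^sub>M A \<Otimes>\<^sub>M lborel"
    unfolding h_def A_def using r1 c1 by (intro measurable_Pair measurable_snd) auto
  show "density (A \<Otimes>\<^sub>M lborel) (\<lambda>p. ennreal (\<phi> p)) = distr (mixlaw M x \<sigma> (insert c J) \<Otimes>\<^sub>M N) (A \<Otimes>\<^sub>M lborel) h"
  proof (rule measure_eqI)
    fix E assume "E \<in> sets (density (A \<Otimes>\<^sub>M lborel) (\<lambda>p. ennreal (\<phi> p)))"
    then have E: "E \<in> sets (A \<Otimes>\<^sub>M lborel)" by simp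
    define f :: "(('i \<Rightarrow> real) \<times> 'b) \<times> real \<Rightarrow> ennreal" where "f = indicator E"
    have f[measurable]: "f \<in> borel_measurable (A \<Otimes>\<^sub>M lborel)" unfolding f_def using E by (rule borel_measurable_indicator)
    note phi_m[measurable]
    have mixpos: "0 < mix M x \<sigma> J u" for u by (rule mix_pos[OF \<sigma> J(1)])
    have f': "(\<lambda>p. f ((u, fst p), snd p)) \<in> borel_measurable (N \<Otimes>\<^sub>M lborel)" if "u \<in> space (lborel_on J)" for u
      using that unfolding A_def by (intro measurable_compose[OF _ f]) (auto simp: A_def)
    have mu: "(\<lambda>y. mix M x \<sigma> (insert c J) (u(c := y))) \<in> borel_measurable borel" if "u \<in> space (lborel_on J)" for u
      by (rule mix_insert_measurable[OF \<sigma> that])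
    have fa: "(\<lambda>q. \<integral>\<^sup>+y. ennreal (\<phi> (q, y)) * f (q, y) \<partial>lborel) \<in> borel_measurable A" by measurable
    have fb: "(\<lambda>u. \<integral>\<^sup>+\<zeta>. \<integral>\<^sup>+y. ennreal (\<phi> ((u, \<zeta>), y)) * f ((u, \<zeta>), y) \<partial>lborel \<partial>N) \<in> borel_measurable (mixlaw M x \<sigma> J)"
      using N.borel_measurable_nn_integral_fst[OF fa[unfolded A_def]] by simp
    have "emeasure (density (A \<Otimes>\<^sub>M lborel) (\<lambda>p. ennreal (\<phi> p))) E = (\<integral>\<^sup>+p. ennreal (\<phi> p) * f p \<partial>(A \<Otimes>\<^sub>M lborel))"
      using E by (subst emeasure_density) (auto simp: f_def)
    also have "\<dots> = (\<integral>\<^sup>+q. \<integral>\<^sup>+y. ennreal (\<phi> (q, y)) * f (q, y) \<partial>lborel \<partial>A)"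
      by (subst lborel.nn_integral_fst[symmetric]) auto
    also have "\<dots> = (\<integral>\<^sup>+u. \<integral>\<^sup>+\<zeta>. \<integral>\<^sup>+y. ennreal (\<phi> ((u, \<zeta>), y)) * f ((u, \<zeta>), y) \<partial>lborel \<partial>N \<partial>mixlaw M x \<sigma> J)"
      using fa unfolding A_def by (subst N.nn_integral_fst[symmetric]) auto
    also have "\<dots> = (\<integral>\<^sup>+u. ennreal (mix M x \<sigma> J u) * (\<integral>\<^sup>+\<zeta>. \<integral>\<^sup>+y. ennreal (\<phi> ((u, \<zeta>), y)) * f ((u, \<zeta>), y) \<partial>lborel \<partial>N) \<partial>lborel_on J)"
      unfolding mixlaw_def
      by (rule nn_integral_density)
         (use fb mix_measurable[where \<sigma> = \<sigma> and J = J, OF \<sigma>] in \<open>auto simp: measurable_cong_sets[OF sets_mixlaw refl]\<close>)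
    \<comment> \<open>The weight \<open>mix M x \<sigma> J u\<close> of the base law cancels the
      denominator of \<open>\<phi>\<close>.\<close>
    also have "\<dots> = (\<integral>\<^sup>+u. \<integral>\<^sup>+y. ennreal (mix M x \<sigma> (insert c J) (u(c := y))) * (\<integral>\<^sup>+\<zeta>. f ((u, \<zeta>), y) \<partial>N) \<partial>lborel \<partial>lborel_on J)"
    proof (intro nn_integral_cong)
      fix u assume u: "u \<in> space (lborel_on J)"
      note [measurable] = f'[OF u] mu[OF u]
      have ph: "ennreal (\<phi> ((u, \<zeta>), y)) = ennreal (1 / mix M x \<sigma> J u) * ennreal (mix M x \<sigma> (insert c J) (u(c := y)))" for \<zeta> y
        using mixpos[of u] mix_pos[OF \<sigma> fi] by (simp add: \<phi>_def ennreal_mult'[symmetric])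
      have f2: "(\<lambda>y. f ((u, \<zeta>), y)) \<in> borel_measurable lborel" if "\<zeta> \<in> space N" for \<zeta>
        using measurable_compose[OF measurable_Pair1'[OF that] f'[OF u]] by simp
      have f3: "(\<lambda>\<zeta>. f ((u, \<zeta>), y)) \<in> borel_measurable N" for y
        using measurable_compose[OF measurable_Pair2'[of y lborel N] f'[OF u]] by simp
      have "(\<integral>\<^sup>+\<zeta>. \<integral>\<^sup>+y. ennreal (\<phi> ((u, \<zeta>), y)) * f ((u, \<zeta>), y) \<partial>lborel \<partial>N)
        = (\<integral>\<^sup>+y. \<integral>\<^sup>+\<zeta>. ennreal (\<phi> ((u, \<zeta>), y)) * f ((u, \<zeta>), y) \<partial>N \<partial>lborel)"
        unfolding ph using f'[OF u] mu[OF u] by (subst NL.Fubini') (auto simp: case_prod_beta)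
      also have "\<dots> = (\<integral>\<^sup>+y. ennreal (1 / mix M x \<sigma> J u) * (ennreal (mix M x \<sigma> (insert c J) (u(c := y))) * (\<integral>\<^sup>+\<zeta>. f ((u, \<zeta>), y) \<partial>N)) \<partial>lborel)"
        unfolding ph mult.assoc using f3 by (intro nn_integral_cong) (simp add: nn_integral_cmult)
      also have "\<dots> = ennreal (1 / mix M x \<sigma> J u) * (\<integral>\<^sup>+y. ennreal (mix M x \<sigma> (insert c J) (u(c := y))) * (\<integral>\<^sup>+\<zeta>. f ((u, \<zeta>), y) \<partial>N) \<partial>lborel)"
      proof (rule nn_integral_cmult)
        have "(\<lambda>y. \<integral>\<^sup>+\<zeta>. f ((u, \<zeta>), y) \<partial>N) \<in> borel_measurable lborel"
          using N.borel_measurable_nn_integral_fst[OF measurable_pair_swap[OF f'[OF u]]] by (simp add: case_prod_beta)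
        then show "(\<lambda>y. ennreal (mix M x \<sigma> (insert c J) (u(c := y))) * (\<integral>\<^sup>+\<zeta>. f ((u, \<zeta>), y) \<partial>N)) \<in> borel_measurable lborel"
          using mu[OF u] by auto
      qed
      finally show "ennreal (mix M x \<sigma> J u) * (\<integral>\<^sup>+\<zeta>. \<integral>\<^sup>+y. ennreal (\<phi> ((u, \<zeta>), y)) * f ((u, \<zeta>), y) \<partial>lborel \<partial>N)
        = (\<integral>\<^sup>+y. ennreal (mix M x \<sigma> (insert c J) (u(c := y))) * (\<integral>\<^sup>+\<zeta>. f ((u, \<zeta>), y) \<partial>N) \<partial>lborel)"
        using mixpos[of u] by (simp add: mult.assoc[symmetric] ennreal_mult'[symmetric])
    qed
    also have "\<dots> = (\<integral>\<^sup>+u. \<integral>\<^sup>+y. ennreal (mix M x \<sigma> (insert c J) (u(c := y))) * (\<integral>\<^sup>+\<zeta>. f (h (u(c := y), \<zeta>)) \<partial>N) \<partial>lborel \<partial>lborel_on J)"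
    proof (intro nn_integral_cong)
      fix u y assume "u \<in> space (lborel_on J)"
      then have "restrict (u(c := y)) J = u" using J(2) by (auto simp: space_PiM PiE_def extensional_def fun_eq_iff)
      then show "ennreal (mix M x \<sigma> (insert c J) (u(c := y))) * (\<integral>\<^sup>+\<zeta>. f ((u, \<zeta>), y) \<partial>N)
        = ennreal (mix M x \<sigma> (insert c J) (u(c := y))) * (\<integral>\<^sup>+\<zeta>. f (h (u(c := y), \<zeta>)) \<partial>N)" by (simp add: h_def)
    qed
    also have "\<dots> = (\<integral>\<^sup>+v. ennreal (mix M x \<sigma> (insert c J) v) * (\<integral>\<^sup>+\<zeta>. f (h (v, \<zeta>)) \<partial>N) \<partial>lborel_on (insert c J))"
    proof (rule lborel_on.product_nn_integral_insert[OF J, symmetric])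
      have "(\<lambda>v. \<integral>\<^sup>+\<zeta>. f (h (v, \<zeta>)) \<partial>N) \<in> borel_measurable (mixlaw M x \<sigma> (insert c J))"
        using N.borel_measurable_nn_integral_fst[OF measurable_compose[OF h_m f]] by simp
      then show "(\<lambda>v. ennreal (mix M x \<sigma> (insert c J) v) * (\<integral>\<^sup>+\<zeta>. f (h (v, \<zeta>)) \<partial>N)) \<in> borel_measurable (lborel_on (insert c J))"
        using mix_measurable[where \<sigma> = \<sigma> and J = "insert c J", OF \<sigma>] by (auto simp: measurable_cong_sets[OF sets_mixlaw refl])
    qed
    also have "\<dots> = (\<integral>\<^sup>+v. \<integral>\<^sup>+\<zeta>. f (h (v, \<zeta>)) \<partial>N \<partial>mixlaw M x \<sigma> (insert c J))"
    proof -
      have "(\<lambda>v. \<integral>\<^sup>+\<zeta>. f (h (v, \<zeta>)) \<partial>N) \<in> borel_measurable (mixlaw M x \<sigma> (insert c J))"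
        using N.borel_measurable_nn_integral_fst[OF measurable_compose[OF h_m f]] by simp
      then show ?thesis
        unfolding mixlaw_def using mix_measurable[where \<sigma> = \<sigma> and J = "insert c J", OF \<sigma>]
        by (subst nn_integral_density) (auto simp: mixlaw_def)
    qed
    also have "\<dots> = (\<integral>\<^sup>+p. f (h p) \<partial>(mixlaw M x \<sigma> (insert c J) \<Otimes>\<^sub>M N))"
      using measurable_compose[OF h_m f] by (subst N.nn_integral_fst[symmetric]) auto
    also have "\<dots> = emeasure (distr (mixlaw M x \<sigma> (insert c J) \<Otimes>\<^sub>M N) (A \<Otimes>\<^sub>M lborel) h) E"
      by (subst nn_integral_distr'[OF h_m f, symmetric]) (use E in \<open>simp add: f_def\<close>)
    finally show "emeasure (density (A \<Otimes>\<^sub>M lborel) (\<lambda>p. ennreal (\<phi> p))) E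
      = emeasure (distr (mixlaw M x \<sigma> (insert c J) \<Otimes>\<^sub>M N) (A \<Otimes>\<^sub>M lborel) h) E" .
  qed simp
qed

end

context gauss_mixture
begin

text \<open>By the chain rule each difference is minus the conditional entropy of coordinate
  \<open>c\<close> given \<open>J\<close>. On the left the condition is the noisier vector on
  \<open>J\<close>; \<open>epi_conditional\<close> works instead with the pair of the original
  vector and its noise, and takes as test density \<open>q\<close> the conditional density at
  \<open>\<sigma>'\<close> evaluated at their sum \<open>t\<close>. A subdensity for each pair
  suffices, so the fact that finer conditioning lowers entropy needs no separate proof.\<close>

lemma epi_step:
  assumes \<sigma>: "\<And>i. 0 < \<sigma> i" and J: "finite J" "c \<notin> J"
    and s: "\<And>i. \<sigma>' i = sqrt ((\<sigma> i)\<^sup>2 + (\<rho> i)\<^sup>2)" and rho: "0 < \<rho> c" and l: "0 < l" "l < 1"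
  shows "nent M x \<sigma>' (insert c J) - nent M x \<sigma>' J
    \<le> l * (nent M x \<sigma> (insert c J) - nent M x \<sigma> J) + epi_const l ((\<rho> c)\<^sup>2)"
proof -
  have \<sigma>': "0 < \<sigma>' i" for i using \<sigma>[of i] by (simp add: s add_pos_nonneg)
  define J' where "J' = insert c J"
  have fJ': "finite J'" and JJ': "J \<subseteq> J'" and cJ': "c \<in> J'" using J by (auto simp: J'_def)
  interpret S: prob_space "std_on J" by (rule prob_space_std_on)
  interpret mJ: prob_space "mixlaw M x \<sigma> J" by (rule prob_space_mixlaw[OF \<sigma> J(1)])
  interpret mJ': prob_space "mixlaw M x \<sigma> J'" by (rule prob_space_mixlaw[OF \<sigma> fJ'])
  define A where "A = mixlaw M x \<sigma> J \<Otimes>\<^sub>M std_on J"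
  interpret A: pair_prob_space "mixlaw M x \<sigma> J" "std_on J" ..
  define K where "K = mixlaw M x \<sigma> J' \<Otimes>\<^sub>M std_on J"
  interpret K: pair_prob_space "mixlaw M x \<sigma> J'" "std_on J" ..
  have K1: "prob_space K" unfolding K_def by (rule K.prob_space_axioms)
  interpret KN: pair_prob_space K std_normal using K1 std_normal.prob_space_axioms
    by (simp add: pair_prob_space_def pair_sigma_finite_def prob_space_imp_sigma_finite)
  define \<phi> :: "(('i \<Rightarrow> real) \<times> ('i \<Rightarrow> real)) \<times> real \<Rightarrow> real"
    where "\<phi> = (\<lambda>p. mix M x \<sigma> J' ((fst (fst p))(c := snd p)) / mix M x \<sigma> J (fst (fst p)))"
  define h :: "('i \<Rightarrow> real) \<times> ('i \<Rightarrow> real) \<Rightarrow> (('i \<Rightarrow> real) \<times> ('i \<Rightarrow> real)) \<times> real"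
    where "h = (\<lambda>p. ((restrict (fst p) J, snd p), fst p c))"
  have dis: "\<phi> \<in> borel_measurable (A \<Otimes>\<^sub>M lborel)" "h \<in> K \<rightarrow>\<^sub>M A \<Otimes>\<^sub>M lborel"
    "density (A \<Otimes>\<^sub>M lborel) (\<lambda>p. ennreal (\<phi> p)) = distr K (A \<Otimes>\<^sub>M lborel) h"
    unfolding \<phi>_def h_def A_def K_def J'_def by (rule mixlaw_disintegrate[OF \<sigma> J S.prob_space_axioms])+
  define t where "t = (\<lambda>p :: ('i \<Rightarrow> real) \<times> ('i \<Rightarrow> real). \<lambda>i\<in>J. fst p i + \<rho> i * snd p i)"
  define q where "q = (\<lambda>p. mix M x \<sigma>' J' ((t (fst p))(c := snd p)) / mix M x \<sigma>' J (t (fst p)))"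
  define B where "B = density (A \<Otimes>\<^sub>M lborel) (\<lambda>p. ennreal (\<phi> p))"
  have B_eq: "B = distr K (A \<Otimes>\<^sub>M lborel) h" unfolding B_def by (rule dis(3))
  have t_m: "t \<in> A \<rightarrow>\<^sub>M lborel_on J"
    unfolding A_def t_def by (rule add_noise_measurable) auto
  have q_m: "q \<in> borel_measurable (A \<Otimes>\<^sub>M lborel)"
  proof -
    have 1: "(\<lambda>p. t (fst p)) \<in> A \<Otimes>\<^sub>M lborel \<rightarrow>\<^sub>M lborel_on J"
      by (rule measurable_compose[OF measurable_fst t_m])
    have 2: "(\<lambda>p. (t (fst p))(c := snd p)) \<in> A \<Otimes>\<^sub>M lborel \<rightarrow>\<^sub>M lborel_on J'"
      unfolding J'_def by (rule measurable_fun_upd[OF _ 1]) auto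
    show ?thesis unfolding q_def
      by (intro borel_measurable_divide measurable_compose[OF 2 mix_measurable[OF \<sigma>']] measurable_compose[OF 1 mix_measurable[OF \<sigma>']])
  qed
  \<comment> \<open>Both \<open>\<phi>\<close> and \<open>q\<close> are quotients of this kind, so
    the normalization of a conditional density is shown once for any deviations
    \<open>\<tau>\<close>.\<close>
  have quot: "(\<integral>\<^sup>+y. ennreal (mix M x \<tau> J' (u(c := y)) / mix M x \<tau> J u) \<partial>lborel) = 1"
    if \<tau>: "\<And>i. 0 < \<tau> i" and u: "u \<in> space (lborel_on J)" for \<tau> u
  proof -
    have p: "0 < mix M x \<tau> J u" by (rule mix_pos[OF \<tau> J(1)])
    have "(\<integral>\<^sup>+y. ennreal (mix M x \<tau> J' (u(c := y)) / mix M x \<tau> J u) \<partial>lborel)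
      = (\<integral>\<^sup>+y. ennreal (1 / mix M x \<tau> J u) * ennreal (mix M x \<tau> J' (u(c := y))) \<partial>lborel)"
      using p mix_pos[OF \<tau> fJ'] by (intro nn_integral_cong) (simp add: ennreal_mult'[symmetric])
    also have "\<dots> = ennreal (1 / mix M x \<tau> J u) * ennreal (mix M x \<tau> J u)"
      unfolding J'_def using mix_insert_measurable[where c = c, OF \<tau> u]
      by (subst nn_integral_cmult) (auto simp: mix_insert_nn[OF \<tau> J])
    also have "\<dots> = 1" using p by (simp add: ennreal_mult'[symmetric])
    finally show ?thesis .
  qed
  have spA: "fst a \<in> space (lborel_on J)" "t a \<in> space (lborel_on J)" if "a \<in> space A" for a
    using that measurable_space[OF t_m that] by (auto simp: A_def space_pair_measure)
  have hrestr: "mix M x \<sigma> J' ((restrict v J)(c := v c)) = mix M x \<sigma> J' v" "mix M x \<sigma> J (restrict v J) = mix M x \<sigma> J v" for v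
    by (rule mix_cong, auto simp: J'_def)+
  have lnphi: "ln (\<phi> (h k)) = ln (mix M x \<sigma> J' (fst k)) - ln (mix M x \<sigma> J (fst k))" for k
    unfolding \<phi>_def h_def fst_conv snd_conv hrestr
    by (rule ln_divide_pos[OF mix_pos[OF \<sigma> fJ'] mix_pos[OF \<sigma> J(1)]])
  have iln: "integrable (mixlaw M x \<sigma> J') (\<lambda>v. ln (mix M x \<sigma> J' v) - ln (mix M x \<sigma> J v))"
    using integrable_ln_mix[OF \<sigma> \<sigma> fJ' order_refl] integrable_ln_mix[OF \<sigma> \<sigma> fJ' JJ'] by auto
  have lnphi_m: "(\<lambda>p. ln (\<phi> p)) \<in> borel_measurable (A \<Otimes>\<^sub>M lborel)"
    using dis(1) by (rule borel_measurable_ln)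
  have i1: "integrable B (\<lambda>p. ln (\<phi> p))"
    unfolding B_eq integrable_distr_eq[OF dis(2) lnphi_m] lnphi unfolding K_def
    by (rule integrable_pair_fst[OF mJ'.prob_space_axioms S.prob_space_axioms iln])
  have v1: "(\<integral>p. ln (\<phi> p) \<partial>B) = nent M x \<sigma> J' - nent M x \<sigma> J"
  proof -
    have "(\<integral>p. ln (\<phi> p) \<partial>B) = (\<integral>v. ln (mix M x \<sigma> J' v) - ln (mix M x \<sigma> J v) \<partial>mixlaw M x \<sigma> J')"
      unfolding B_eq integral_distr[OF dis(2) lnphi_m] lnphi unfolding K_def
      by (rule integral_pair_fst[OF mJ'.prob_space_axioms S.prob_space_axioms borel_measurable_integrable[OF iln]])
    also have "\<dots> = nent M x \<sigma> J' - nent M x \<sigma> J"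
      using integrable_ln_mix[OF \<sigma> \<sigma> fJ' order_refl] integrable_ln_mix[OF \<sigma> \<sigma> fJ' JJ']
      by (simp add: nent_restrict[OF \<sigma> fJ' JJ'] nent_restrict[OF \<sigma> fJ' order_refl])
    finally show ?thesis .
  qed
  define F where "F = (\<lambda>p. ln (q (fst (fst p), snd (fst p) + \<rho> c * snd p)))"
  define g where "g = (\<lambda>v. ln (mix M x \<sigma>' J' v) - ln (mix M x \<sigma>' J v))"
  \<comment> \<open>\<open>r\<close> adds noise to all coordinates of \<open>J'\<close>, that at
    \<open>c\<close> from the extra standard normal and the rest from \<open>std_on J\<close>; its
    law is therefore the mixture at \<open>\<sigma>'\<close>, by \<open>mixlaw_conv\<close>.\<close>
  define r where "r = (\<lambda>p :: (('i \<Rightarrow> real) \<times> ('i \<Rightarrow> real)) \<times> real. (t (fst p))(c := fst (fst p) c + \<rho> c * snd p))"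
  have r_m: "r \<in> K \<Otimes>\<^sub>M std_normal \<rightarrow>\<^sub>M lborel_on J'"
  proof -
    have t': "t \<in> K \<rightarrow>\<^sub>M lborel_on J" unfolding K_def t_def by (rule add_noise_measurable) (use JJ' in auto)
    have "(\<lambda>p. fst (fst p) c) \<in> borel_measurable (K \<Otimes>\<^sub>M std_normal)"
      by (rule PiM_component_measurable[where I = J' and L = lborel])
         (auto simp: K_def cJ' intro!: measurable_compose[OF measurable_compose[OF measurable_fst measurable_fst] measurable_ident_sets[OF sets_mixlaw]])
    then show ?thesis unfolding r_def J'_def
      by (intro measurable_fun_upd[OF _ measurable_compose[OF measurable_fst t']]) auto
  qed
  have r_law: "distr (K \<Otimes>\<^sub>M std_normal) (lborel_on J') r = mixlaw M x \<sigma>' J'"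
  proof (rule measure_eqI)
    fix E assume "E \<in> sets (distr (K \<Otimes>\<^sub>M std_normal) (lborel_on J') r)"
    then have E: "E \<in> sets (lborel_on J')" by simp
    define f :: "('i \<Rightarrow> real) \<Rightarrow> ennreal" where "f = indicator E"
    have f: "f \<in> borel_measurable (lborel_on J')" unfolding f_def using E by (rule borel_measurable_indicator)
    have am: "(\<lambda>p. \<lambda>i\<in>J'. fst p i + \<rho> i * snd p i) \<in> mixlaw M x \<sigma> J' \<Otimes>\<^sub>M std_on J' \<rightarrow>\<^sub>M lborel_on J'"
      by (rule add_noise_measurable) auto
    interpret S': prob_space "std_on J'" by (rule prob_space_std_on)
    have "emeasure (distr (K \<Otimes>\<^sub>M std_normal) (lborel_on J') r) E = (\<integral>\<^sup>+p. f (r p) \<partial>(K \<Otimes>\<^sub>M std_normal))"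
      by (subst nn_integral_distr'[OF r_m f, symmetric]) (use E in \<open>simp add: f_def del: measurable_lborel1\<close>)
    also have "\<dots> = (\<integral>\<^sup>+k. \<integral>\<^sup>+z. f (r (k, z)) \<partial>std_normal \<partial>K)"
      using measurable_compose[OF r_m f] by (subst std_normal.nn_integral_fst[symmetric]) auto
    also have "\<dots> = (\<integral>\<^sup>+v. \<integral>\<^sup>+\<zeta>. \<integral>\<^sup>+z. f (r ((v, \<zeta>), z)) \<partial>std_normal \<partial>std_on J \<partial>mixlaw M x \<sigma> J')"
    proof -
      have "(\<lambda>k. \<integral>\<^sup>+z. f (r (k, z)) \<partial>std_normal) \<in> borel_measurable K"
        using std_normal.borel_measurable_nn_integral_fst[OF measurable_compose[OF r_m f]] by simp
      then show ?thesis unfolding K_def by (subst S.nn_integral_fst[symmetric]) auto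
    qed
    also have "\<dots> = (\<integral>\<^sup>+v. \<integral>\<^sup>+\<zeta>. f (\<lambda>i\<in>J'. v i + \<rho> i * \<zeta> i) \<partial>std_on J' \<partial>mixlaw M x \<sigma> J')"
    proof (rule nn_integral_cong)
      fix v assume v: "v \<in> space (mixlaw M x \<sigma> J')"
      have fm: "(\<lambda>\<zeta>. f (\<lambda>i\<in>J'. v i + \<rho> i * \<zeta> i)) \<in> borel_measurable (std_on (insert c J))"
        using measurable_compose[OF measurable_compose[OF measurable_Pair1'[OF v] am] f] by (simp add: J'_def)
      have e: "(\<lambda>i\<in>J'. v i + \<rho> i * (\<zeta>(c := z)) i) = r ((v, \<zeta>), z)" for \<zeta> z
        using J(2) by (auto simp: r_def t_def J'_def fun_eq_iff)
      have "(\<integral>\<^sup>+\<zeta>. f (\<lambda>i\<in>J'. v i + \<rho> i * \<zeta> i) \<partial>std_on J')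
        = (\<integral>\<^sup>+\<zeta>. \<integral>\<^sup>+z. f (\<lambda>i\<in>J'. v i + \<rho> i * (\<zeta>(c := z)) i) \<partial>std_normal \<partial>std_on J)"
        using std_on.product_nn_integral_insert[OF J fm] by (simp add: J'_def)
      then show "(\<integral>\<^sup>+\<zeta>. \<integral>\<^sup>+z. f (r ((v, \<zeta>), z)) \<partial>std_normal \<partial>std_on J) = (\<integral>\<^sup>+\<zeta>. f (\<lambda>i\<in>J'. v i + \<rho> i * \<zeta> i) \<partial>std_on J')"
        by (simp only: e)
    qed
    also have "\<dots> = (\<integral>\<^sup>+p. f (\<lambda>i\<in>J'. fst p i + \<rho> i * snd p i) \<partial>(mixlaw M x \<sigma> J' \<Otimes>\<^sub>M std_on J'))"
      using measurable_compose[OF am f] by (subst S'.nn_integral_fst[symmetric]) auto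
    also have "\<dots> = emeasure (mixlaw M x \<sigma>' J') E"
      unfolding mixlaw_conv[OF \<sigma> fJ' s, symmetric]
      by (subst nn_integral_distr'[OF am f, symmetric]) (use E in \<open>simp add: f_def del: measurable_lborel1\<close>)
    finally show "emeasure (distr (K \<Otimes>\<^sub>M std_normal) (lborel_on J') r) E = emeasure (mixlaw M x \<sigma>' J') E" .
  qed simp
  have BN: "B \<Otimes>\<^sub>M std_normal = distr (K \<Otimes>\<^sub>M std_normal) ((A \<Otimes>\<^sub>M lborel) \<Otimes>\<^sub>M borel) (\<lambda>(k, z). (h k, z))"
  proof -
    have "distr K (A \<Otimes>\<^sub>M lborel) h \<Otimes>\<^sub>M distr std_normal borel (\<lambda>z. z) = distr (K \<Otimes>\<^sub>M std_normal) ((A \<Otimes>\<^sub>M lborel) \<Otimes>\<^sub>M borel) (\<lambda>(k, z). (h k, z))"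
      by (rule pair_measure_distr[OF dis(2)])
         (use std_normal.prob_space_distr[of "\<lambda>x. x" borel] in \<open>auto intro: prob_space_imp_sigma_finite\<close>)
    moreover have "distr std_normal borel (\<lambda>z. z) = std_normal" by (rule distr_id2) simp
    ultimately show ?thesis by (simp add: B_eq)
  qed
  have hz_m: "(\<lambda>(k, z). (h k, z)) \<in> K \<Otimes>\<^sub>M std_normal \<rightarrow>\<^sub>M (A \<Otimes>\<^sub>M lborel) \<Otimes>\<^sub>M borel"
    unfolding case_prod_beta' by (intro measurable_Pair measurable_compose[OF measurable_fst dis(2)]) simp
  have F_m: "F \<in> borel_measurable ((A \<Otimes>\<^sub>M lborel) \<Otimes>\<^sub>M borel)"
  proof -
    have "(\<lambda>p. (fst (fst p), snd (fst p) + \<rho> c * snd p)) \<in> (A \<Otimes>\<^sub>M lborel) \<Otimes>\<^sub>M borel \<rightarrow>\<^sub>M A \<Otimes>\<^sub>M lborel"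
      by measurable
    from measurable_compose[OF this q_m] show ?thesis unfolding F_def by (rule borel_measurable_ln)
  qed
  have Fg: "F ((\<lambda>(k, z). (h k, z)) p) = g (r p)" for p
  proof -
    obtain v \<zeta> z where p: "p = ((v, \<zeta>), z)" by (metis prod.collapse)
    have t1: "t (restrict v J, \<zeta>) = t (v, \<zeta>)" by (auto simp: t_def fun_eq_iff)
    \<comment> \<open>The density on \<open>J\<close> does not see coordinate \<open>c\<close>, so
      it may be evaluated at the full point \<open>r p\<close>.\<close>
    have t2: "mix M x \<sigma>' J (t (v, \<zeta>)) = mix M x \<sigma>' J ((t (v, \<zeta>))(c := y))" for y
      using J(2) by (intro mix_cong) auto
    have "F ((\<lambda>(k, z). (h k, z)) p) = ln (mix M x \<sigma>' J' (r p) / mix M x \<sigma>' J (t (v, \<zeta>)))"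
      unfolding F_def p by (simp add: h_def q_def r_def t1)
    also have "mix M x \<sigma>' J (t (v, \<zeta>)) = mix M x \<sigma>' J (r p)"
      unfolding r_def p by (simp add: t2[symmetric])
    also have "ln (mix M x \<sigma>' J' (r p) / mix M x \<sigma>' J (r p)) = g (r p)"
      unfolding g_def by (rule ln_divide_pos[OF mix_pos[OF \<sigma>' fJ'] mix_pos[OF \<sigma>' J(1)]])
    finally show ?thesis .
  qed
  have ig: "integrable (mixlaw M x \<sigma>' J') g"
    unfolding g_def using integrable_ln_mix[OF \<sigma>' \<sigma>' fJ' order_refl] integrable_ln_mix[OF \<sigma>' \<sigma>' fJ' JJ'] by auto
  have g_m: "g \<in> borel_measurable (lborel_on J')"
    using borel_measurable_integrable[OF ig] by (simp cong: measurable_cong_sets[OF sets_mixlaw refl])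
  have i2: "integrable (B \<Otimes>\<^sub>M std_normal) F"
    unfolding BN integrable_distr_eq[OF hz_m F_m] Fg
    using ig unfolding r_law[symmetric] integrable_distr_eq[OF r_m g_m] .
  have v2: "(\<integral>p. F p \<partial>(B \<Otimes>\<^sub>M std_normal)) = nent M x \<sigma>' J' - nent M x \<sigma>' J"
  proof -
    have "(\<integral>p. F p \<partial>(B \<Otimes>\<^sub>M std_normal)) = (\<integral>v. g v \<partial>mixlaw M x \<sigma>' J')"
      unfolding BN integral_distr[OF hz_m F_m] Fg r_law[symmetric] integral_distr[OF r_m g_m] ..
    also have "\<dots> = nent M x \<sigma>' J' - nent M x \<sigma>' J"
      unfolding g_def
      using integrable_ln_mix[OF \<sigma>' \<sigma>' fJ' order_refl] integrable_ln_mix[OF \<sigma>' \<sigma>' fJ' JJ']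
      by (simp add: nent_restrict[OF \<sigma>' fJ' JJ'] nent_restrict[OF \<sigma>' fJ' order_refl])
    finally show ?thesis .
  qed
  have "(\<integral>p. F p \<partial>(B \<Otimes>\<^sub>M std_normal)) \<le> l * (\<integral>p. ln (\<phi> p) \<partial>B) + epi_const l ((\<rho> c)\<^sup>2)"
    unfolding F_def
  proof (rule epi_conditional[OF _ dis(1) q_m _ _ _ _ _ rho l B_def i1])
    show "prob_space A" unfolding A_def by (rule A.prob_space_axioms)
    show "continuous_on UNIV (\<lambda>y. \<phi> (a, y))" for a
      unfolding \<phi>_def J'_def fst_conv snd_conv
      using mix_pos[where \<sigma> = \<sigma> and v = "fst a", OF \<sigma> J(1)] by (intro continuous_intros mix_insert_cont[OF \<sigma> J]) auto
    show "0 < \<phi> (a, y)" for a y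
      unfolding \<phi>_def using mix_pos[OF \<sigma> J(1)] mix_pos[OF \<sigma> fJ'] by simp
    show "0 < q (a, y)" for a y
      unfolding q_def using mix_pos[OF \<sigma>' J(1)] mix_pos[OF \<sigma>' fJ'] by simp
    show "(\<integral>\<^sup>+y. ennreal (\<phi> (a, y)) \<partial>lborel) = 1" if "a \<in> space A" for a
      unfolding \<phi>_def using quot[OF \<sigma> spA(1)[OF that]] by simp
    show "(\<integral>\<^sup>+y. ennreal (q (a, y)) \<partial>lborel) \<le> 1" if "a \<in> space A" for a
      unfolding q_def using quot[OF \<sigma>' spA(2)[OF that]] by simp
    show "integrable (B \<Otimes>\<^sub>M std_normal) (\<lambda>p. ln (q (fst (fst p), snd (fst p) + \<rho> c * snd p)))"
      using i2 by (simp add: F_def)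
  qed
  then show ?thesis unfolding v1 v2 J'_def .
qed

text \<open>The increments over \<open>C\<close> telescope, and each is bounded by
  \<open>epi_step\<close> with the coordinates already treated moved into the conditioning
  set.\<close>

lemma conditional_epi:
  assumes \<sigma>: "\<And>i. 0 < \<sigma> i" and B: "finite B" and C: "finite C" "C \<inter> B = {}"
    and s: "\<And>i. \<sigma>' i = sqrt ((\<sigma> i)\<^sup>2 + (\<rho> i)\<^sup>2)" and rho: "0 < \<tau>" "\<And>c. c \<in> C \<Longrightarrow> \<rho> c = sqrt \<tau>" and l: "0 < l" "l < 1"
  shows "nent M x \<sigma>' (B \<union> C) - nent M x \<sigma>' B
    \<le> l * (nent M x \<sigma> (B \<union> C) - nent M x \<sigma> B) + real (card C) * epi_const l \<tau>"
  using C rho(2)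
proof (induction C rule: finite_induct)
  case (insert c C)
  have "nent M x \<sigma>' (insert c (B \<union> C)) - nent M x \<sigma>' (B \<union> C)
    \<le> l * (nent M x \<sigma> (insert c (B \<union> C)) - nent M x \<sigma> (B \<union> C)) + epi_const l ((\<rho> c)\<^sup>2)"
    by (rule epi_step[OF \<sigma> _ _ s _ l]) (use insert B rho in auto)
  moreover have "nent M x \<sigma>' (B \<union> C) - nent M x \<sigma>' B
    \<le> l * (nent M x \<sigma> (B \<union> C) - nent M x \<sigma> B) + real (card C) * epi_const l \<tau>"
    by (rule insert.IH) (use insert in auto)
  moreover have "epi_const l ((\<rho> c)\<^sup>2) = epi_const l \<tau>" using insert rho by simp
  ultimately show ?case using insert(1,2) by (simp add: algebra_simps)
qed simp

end

section \<open>The converse for Gaussian mixtures\<close>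

lemma gkern_cong_std: "(\<And>i. i \<in> J \<Longrightarrow> \<sigma> i = \<tau> i) \<Longrightarrow> gkern x \<sigma> J = gkern x \<tau> J"
  unfolding gkern_def by (intro ext prod.cong) auto

lemma nent_cong_std: "(\<And>i. i \<in> J \<Longrightarrow> \<sigma> i = \<tau> i) \<Longrightarrow> nent M x \<sigma> J = nent M x \<tau> J"
  unfolding nent_def mixlaw_def mix_def[abs_def] using gkern_cong_std[of J \<sigma> \<tau> x] by simp

text \<open>A conditional subdensity of \<open>A\<close> given \<open>D\<close> times a subdensity
  on \<open>D\<close>: test densities of this shape turn Gibbs' inequality into the chain
  rule.\<close>

lemma nn_integral_kernel_le_1:
  fixes r :: "('i \<Rightarrow> real) \<Rightarrow> real"
  assumes fin: "finite A" "finite D" and dis: "A \<inter> D = {}"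
    and r: "r \<in> borel_measurable (lborel_on (A \<union> D))"
    and G: "G \<in> borel_measurable (lborel_on D)" "\<And>v. 0 \<le> G v"
    and r1: "\<And>y. y \<in> space (lborel_on D) \<Longrightarrow> (\<integral>\<^sup>+w. ennreal (r (merge A D (w, y))) \<partial>lborel_on A) \<le> 1"
    and G1: "(\<integral>\<^sup>+y. ennreal (G y) \<partial>lborel_on D) \<le> 1"
  shows "(\<integral>\<^sup>+v. ennreal (r v * G (restrict v D)) \<partial>lborel_on (A \<union> D)) \<le> 1"
proof -
  have dis': "D \<inter> A = {}" using dis by auto
  have Gr: "(\<lambda>v. G (restrict v D)) \<in> borel_measurable (lborel_on (A \<union> D))"
    by (rule measurable_compose[OF measurable_restrict_subset G(1)]) auto
  have m: "(\<lambda>v. ennreal (r v * G (restrict v D))) \<in> borel_measurable (lborel_on (D \<union> A))"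
    using r Gr by (simp add: Un_commute)
  have "(\<integral>\<^sup>+v. ennreal (r v * G (restrict v D)) \<partial>lborel_on (A \<union> D))
    = (\<integral>\<^sup>+y. \<integral>\<^sup>+w. ennreal (r (merge D A (y, w)) * G (restrict (merge D A (y, w)) D)) \<partial>lborel_on A \<partial>lborel_on D)"
    using lborel_on.product_nn_integral_fold[OF dis' fin(2,1) m] by (simp add: Un_commute)
  also have "\<dots> \<le> (\<integral>\<^sup>+y. ennreal (G y) \<partial>lborel_on D)"
  proof (rule nn_integral_mono)
    fix y assume y: "y \<in> space (lborel_on D)"
    have e: "restrict (merge D A (y, w)) D = y" for w
      using y by (auto simp: merge_def space_PiM PiE_def extensional_def fun_eq_iff)
    have rm: "(\<lambda>w. r (merge A D (w, y))) \<in> borel_measurable (lborel_on A)"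
      using measurable_compose[OF measurable_compose[OF measurable_Pair2'[OF y] measurable_merge] r] by simp
    have "(\<integral>\<^sup>+w. ennreal (r (merge D A (y, w)) * G (restrict (merge D A (y, w)) D)) \<partial>lborel_on A)
      = (\<integral>\<^sup>+w. ennreal (r (merge A D (w, y))) * ennreal (G y) \<partial>lborel_on A)"
      unfolding e unfolding merge_commute[OF dis'] using G(2) by (simp add: ennreal_mult'')
    also have "\<dots> = (\<integral>\<^sup>+w. ennreal (r (merge A D (w, y))) \<partial>lborel_on A) * ennreal (G y)"
      using rm by (subst nn_integral_multc) auto
    also have "\<dots> \<le> 1 * ennreal (G y)" by (rule mult_right_mono[OF r1[OF y]]) simp
    finally show "(\<integral>\<^sup>+w. ennreal (r (merge D A (y, w)) * G (restrict (merge D A (y, w)) D)) \<partial>lborel_on A) \<le> ennreal (G y)"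
      by simp
  qed
  finally show ?thesis using G1 by simp
qed

lemma ln_normal_density: "0 < s \<Longrightarrow> ln (normal_density m s y) = - ln (2 * pi * s\<^sup>2) / 2 - (y - m)\<^sup>2 / (2 * s\<^sup>2)"
proof -
  assume s: "0 < s"
  have "ln (1 / sqrt (2 * pi * s\<^sup>2)) = - ln (2 * pi * s\<^sup>2) / 2"
    using s by (subst ln_divide_pos) (auto simp: ln_sqrt)
  then show ?thesis unfolding normal_density_def using s by (subst ln_mult_pos) auto
qed

context gauss_mixture
begin

lemma mix_nn_integral:
  assumes \<sigma>: "\<And>i. 0 < \<sigma> i" and J: "finite J"
  shows "(\<integral>\<^sup>+v. ennreal (mix M x \<sigma> J v) \<partial>lborel_on J) = 1"
proof -
  interpret P: prob_space "mixlaw M x \<sigma> J" by (rule prob_space_mixlaw[OF \<sigma> J])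
  have "(\<integral>\<^sup>+v. ennreal (mix M x \<sigma> J v) \<partial>lborel_on J) = emeasure (mixlaw M x \<sigma> J) (space (lborel_on J))"
    unfolding mixlaw_def using mix_measurable[where \<sigma> = \<sigma> and J = J, OF \<sigma>]
    by (subst emeasure_density[OF _ sets.top]) (auto intro!: nn_integral_cong)
  then show ?thesis using P.emeasure_space_1 by simp
qed

text \<open>Gibbs' inequality for the ratio of \<open>r\<close> to the mixture density: against the
  mixture law that density cancels, leaving the Lebesgue integral of \<open>r\<close>.\<close>

lemma gibbs_mixlaw:
  assumes \<sigma>: "\<And>i. 0 < \<sigma> i" and J: "finite J"
    and r: "r \<in> borel_measurable (lborel_on J)" "\<And>v. v \<in> space (lborel_on J) \<Longrightarrow> 0 < r v"
      "(\<integral>\<^sup>+v. ennreal (r v) \<partial>lborel_on J) \<le> 1" "integrable (mixlaw M x \<sigma> J) (\<lambda>v. ln (r v))"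
  shows "(\<integral>v. ln (r v) \<partial>mixlaw M x \<sigma> J) \<le> nent M x \<sigma> J"
proof -
  have p: "0 < mix M x \<sigma> J v" for v by (rule mix_pos[OF \<sigma> J])
  note mm[measurable] = mix_measurable[where \<sigma> = \<sigma> and J = J, OF \<sigma>]
  note r(1)[measurable]
  have i: "integrable (mixlaw M x \<sigma> J) (\<lambda>v. ln (mix M x \<sigma> J v))"
    by (rule integrable_ln_mix[OF \<sigma> \<sigma> J order_refl])
  have "(\<integral>v. ln (r v) - ln (mix M x \<sigma> J v) \<partial>mixlaw M x \<sigma> J) \<le> 0"
  proof (rule gibbs[where L = "\<lambda>v. r v / mix M x \<sigma> J v"])
    show "prob_space (mixlaw M x \<sigma> J)" by (rule prob_space_mixlaw[OF \<sigma> J])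
    show "(\<lambda>v. r v / mix M x \<sigma> J v) \<in> borel_measurable (mixlaw M x \<sigma> J)"
      by (simp cong: measurable_cong_sets[OF sets_mixlaw refl])
    show "(\<integral>\<^sup>+v. ennreal (r v / mix M x \<sigma> J v) \<partial>mixlaw M x \<sigma> J) \<le> 1"
    proof -
      have "(\<integral>\<^sup>+v. ennreal (r v / mix M x \<sigma> J v) \<partial>mixlaw M x \<sigma> J) = (\<integral>\<^sup>+v. ennreal (r v) \<partial>lborel_on J)"
        unfolding mixlaw_def
      proof (subst nn_integral_density)
        show "(\<integral>\<^sup>+v. ennreal (mix M x \<sigma> J v) * ennreal (r v / mix M x \<sigma> J v) \<partial>lborel_on J) = (\<integral>\<^sup>+v. ennreal (r v) \<partial>lborel_on J)"
          by (intro nn_integral_cong)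
             (use p r(2) in \<open>auto simp: ennreal_mult'[symmetric] less_imp_le less_imp_neq[symmetric]\<close>)
      qed auto
      then show ?thesis using r(3) by simp
    qed
  qed (use p r i in \<open>auto simp: ln_divide_pos\<close>)
  then show ?thesis using r(4) i by (simp add: nent_def)
qed

text \<open>The joint law of \<open>\<omega>\<close> and the noisy vector; unlike
  \<open>mixlaw\<close> it keeps \<open>\<omega>\<close>, on which the kernel of the channel noise
  depends.\<close>

lemma gkern_nn:
  assumes \<sigma>: "\<And>i. 0 < \<sigma> i" and I: "finite I"
    and F: "(\<lambda>p. F (fst p) (snd p)) \<in> borel_measurable (M \<Otimes>\<^sub>M lborel_on I)"
  shows "(\<integral>\<^sup>+p. F (fst p) (\<lambda>i\<in>I. x i (fst p) + \<sigma> i * snd p i) \<partial>(M \<Otimes>\<^sub>M std_on I))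
    = (\<integral>\<^sup>+\<omega>. \<integral>\<^sup>+v. ennreal (gkern x \<sigma> I \<omega> v) * F \<omega> v \<partial>lborel_on I \<partial>M)"
proof -
  interpret S: prob_space "std_on I" by (rule prob_space_std_on)
  have s: "(\<lambda>p. \<lambda>i\<in>I. x i (fst p) + \<sigma> i * snd p i) \<in> M \<Otimes>\<^sub>M std_on I \<rightarrow>\<^sub>M lborel_on I"
    using shift_measurable[where \<sigma> = \<sigma> and J = I, OF \<sigma> order_refl] by (simp add: case_prod_beta')
  have m: "(\<lambda>p. F (fst p) (\<lambda>i\<in>I. x i (fst p) + \<sigma> i * snd p i)) \<in> borel_measurable (M \<Otimes>\<^sub>M std_on I)"
    using measurable_compose[OF measurable_Pair[OF measurable_fst s] F] by simp
  show ?thesis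
  proof (subst S.nn_integral_fst[OF m, symmetric], intro nn_integral_cong, unfold fst_conv snd_conv)
    fix \<omega> assume w: "\<omega> \<in> space M"
    have s': "(\<lambda>\<zeta>. \<lambda>i\<in>I. x i \<omega> + \<sigma> i * \<zeta> i) \<in> std_on I \<rightarrow>\<^sub>M lborel_on I"
      using measurable_compose[OF measurable_Pair1'[OF w] s] by simp
    have F': "F \<omega> \<in> borel_measurable (lborel_on I)"
      using measurable_compose[OF measurable_Pair1'[OF w] F] by simp
    have g: "gkern x \<sigma> I \<omega> \<in> borel_measurable (lborel_on I)"
      by (rule gkern_measurable[where f = "\<lambda>_. \<omega>" and \<sigma> = \<sigma>, OF \<sigma>]) (use w in auto)
    have "(\<integral>\<^sup>+\<zeta>. F \<omega> (\<lambda>i\<in>I. x i \<omega> + \<sigma> i * \<zeta> i) \<partial>std_on I)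
      = (\<integral>\<^sup>+v. F \<omega> v \<partial>distr (std_on I) (lborel_on I) (\<lambda>\<zeta>. \<lambda>i\<in>I. x i \<omega> + \<sigma> i * \<zeta> i))"
      by (rule nn_integral_distr'[OF s' F', symmetric])
    also have "\<dots> = (\<integral>\<^sup>+v. ennreal (gkern x \<sigma> I \<omega> v) * F \<omega> v \<partial>lborel_on I)"
      unfolding gkern_law[where x = x and \<omega> = \<omega>, OF I \<sigma> I order_refl, symmetric]
      using g F' by (subst nn_integral_density) auto
    finally show "(\<integral>\<^sup>+\<zeta>. F \<omega> (\<lambda>i\<in>I. x i \<omega> + \<sigma> i * \<zeta> i) \<partial>std_on I)
      = (\<integral>\<^sup>+v. ennreal (gkern x \<sigma> I \<omega> v) * F \<omega> v \<partial>lborel_on I)" .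
  qed
qed

text \<open>Conditioning on \<open>\<omega>\<close> as well leaves only the noise of the coordinates
  in \<open>C\<close>. The gap is the conditional mutual information of \<open>\<omega>\<close> and
  those coordinates given the ones in \<open>W\<close>, and its nonnegativity is Gibbs' inequality
  for the likelihood ratio \<open>F\<close>.\<close>

lemma nent_noise:
  assumes \<sigma>: "\<And>i. 0 < \<sigma> i" and W: "finite W" and C: "finite C" "W \<inter> C = {}"
  shows "nent M x \<sigma> (W \<union> C) \<le> nent M x \<sigma> W - (\<Sum>c\<in>C. ln (2 * pi * exp 1 * (\<sigma> c)\<^sup>2) / 2)"
proof -
  define I where "I = W \<union> C"
  have I: "finite I" "W \<subseteq> I" "C \<subseteq> I" using W C by (auto simp: I_def)
  interpret S: prob_space "std_on I" by (rule prob_space_std_on)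
  interpret P: pair_prob_space M "std_on I" ..
  interpret MB: pair_sigma_finite M "lborel_on I"
  proof -
    interpret B: finite_product_sigma_finite "\<lambda>_. lborel :: real measure" I by standard (rule I(1))
    show "pair_sigma_finite M (lborel_on I)" ..
  qed
  define V where "V = (\<lambda>p. \<lambda>i\<in>I. x i (fst p) + \<sigma> i * snd p i)"
  have V_m[measurable]: "V \<in> M \<Otimes>\<^sub>M std_on I \<rightarrow>\<^sub>M lborel_on I"
    using shift_measurable[where \<sigma> = \<sigma> and J = I, OF \<sigma> order_refl] by (simp add: V_def case_prod_beta')
  have V_law: "mixlaw M x \<sigma> I = distr (M \<Otimes>\<^sub>M std_on I) (lborel_on I) V"
    using mixlaw_eq[where \<sigma> = \<sigma>, OF \<sigma> order_refl I(1)] by (simp add: V_def case_prod_beta')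
  have pI: "0 < mix M x \<sigma> I v" and pW: "0 < mix M x \<sigma> W v" for v
    by (rule mix_pos[OF \<sigma> I(1)] mix_pos[OF \<sigma> W])+
  note mI[measurable] = mix_measurable[where \<sigma> = \<sigma> and J = I, OF \<sigma>]
  note mW[measurable] = mix_measurable'[where \<sigma> = \<sigma>, OF \<sigma> I(2)]
  have gC[measurable]: "(\<lambda>p. gkern x \<sigma> C (fst p) (snd p)) \<in> borel_measurable (M \<Otimes>\<^sub>M lborel_on I)"
  proof -
    have "(\<lambda>p. gkern x \<sigma> C (fst p) (restrict (snd p) C)) \<in> borel_measurable (M \<Otimes>\<^sub>M lborel_on I)"
      by (rule gkern_measurable[where \<sigma> = \<sigma>, OF \<sigma> measurable_fst measurable_compose[OF measurable_snd measurable_restrict_subset[OF I(3)]]])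
    then show ?thesis by (simp add: gkern_cong[where v = "restrict u C" and w = u for u] cong: gkern_cong)
  qed
  define F where "F \<omega> v = mix M x \<sigma> I v / (mix M x \<sigma> W v * gkern x \<sigma> C \<omega> v)" for \<omega> v
  have F_m: "(\<lambda>p. F (fst p) (snd p)) \<in> borel_measurable (M \<Otimes>\<^sub>M lborel_on I)" unfolding F_def by measurable
  define H where "H p = ln (mix M x \<sigma> I (V p)) - ln (mix M x \<sigma> W (V p)) - ln (gkern x \<sigma> C (fst p) (V p))" for p
  have gkern_V: "ln (gkern x \<sigma> C (fst p) (V p)) = (\<Sum>c\<in>C. - ln (2 * pi * (\<sigma> c)\<^sup>2) / 2 - (snd p c)\<^sup>2 / 2)" for p
    unfolding ln_gkern[OF \<sigma> C(1)]
  proof (intro sum.cong refl)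
    fix c assume "c \<in> C"
    then have "V p c - x c (fst p) = \<sigma> c * snd p c" using I(3) by (auto simp: V_def)
    then show "- ln (2 * pi * (\<sigma> c)\<^sup>2) / 2 - (V p c - x c (fst p))\<^sup>2 / (2 * (\<sigma> c)\<^sup>2) = - ln (2 * pi * (\<sigma> c)\<^sup>2) / 2 - (snd p c)\<^sup>2 / 2"
      using \<sigma>[of c] by (simp add: power_mult_distrib)
  qed
  have z: "integrable (M \<Otimes>\<^sub>M std_on I) (\<lambda>p. (snd p c)\<^sup>2)" "(\<integral>p. (snd p c)\<^sup>2 \<partial>(M \<Otimes>\<^sub>M std_on I)) = 1" if "c \<in> C" for c
  proof -
    have c: "c \<in> I" using that I by auto
    show "integrable (M \<Otimes>\<^sub>M std_on I) (\<lambda>p. (snd p c)\<^sup>2)"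
      by (rule integrable_pair_snd[OF prob_space_axioms prob_space_std_on std_on_moments(1)[OF c]])
    show "(\<integral>p. (snd p c)\<^sup>2 \<partial>(M \<Otimes>\<^sub>M std_on I)) = 1"
      using integral_pair_snd[OF prob_space_axioms prob_space_std_on borel_measurable_integrable[OF std_on_moments(1)[OF c]]]
        std_on_moments(2)[OF c] by simp
  qed
  have tr: "integrable (M \<Otimes>\<^sub>M std_on I) (\<lambda>p. ln (mix M x \<sigma> K (V p)))"
    "(\<integral>p. ln (mix M x \<sigma> K (V p)) \<partial>(M \<Otimes>\<^sub>M std_on I)) = nent M x \<sigma> K" if K: "K \<subseteq> I" for K
  proof -
    have m: "(\<lambda>v. ln (mix M x \<sigma> K v)) \<in> borel_measurable (lborel_on I)"
      using mix_measurable'[where \<sigma> = \<sigma>, OF \<sigma> K] by (rule borel_measurable_ln)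
    show "integrable (M \<Otimes>\<^sub>M std_on I) (\<lambda>p. ln (mix M x \<sigma> K (V p)))"
      using integrable_ln_mix[where \<sigma> = \<sigma> and \<tau> = \<sigma>, OF \<sigma> \<sigma> I(1) K] unfolding V_law integrable_distr_eq[OF V_m m] .
    show "(\<integral>p. ln (mix M x \<sigma> K (V p)) \<partial>(M \<Otimes>\<^sub>M std_on I)) = nent M x \<sigma> K"
      using nent_restrict[where \<sigma> = \<sigma>, OF \<sigma> I(1) K] unfolding V_law integral_distr[OF V_m m] .
  qed
  have "(\<integral>p. H p \<partial>(M \<Otimes>\<^sub>M std_on I)) \<le> 0"
  proof (rule gibbs[where L = "\<lambda>p. F (fst p) (V p)"])
    show "prob_space (M \<Otimes>\<^sub>M std_on I)" by (rule P.prob_space_axioms)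
    show "(\<lambda>p. F (fst p) (V p)) \<in> borel_measurable (M \<Otimes>\<^sub>M std_on I)"
      using measurable_compose[OF measurable_Pair[OF measurable_fst V_m] F_m] by simp
    show "0 < F (fst p) (V p)" for p
      unfolding F_def using pI pW gkern_pos[OF \<sigma>] by simp
    show "integrable (M \<Otimes>\<^sub>M std_on I) H"
      unfolding H_def gkern_V using tr(1)[OF order_refl] tr(1)[OF I(2)] z(1) by auto
    show "H p \<le> ln (F (fst p) (V p))" for p
      unfolding F_def H_def using pI[of "V p"] pW[of "V p"] gkern_pos[where \<sigma> = \<sigma> and J = C and \<omega> = "fst p" and v = "V p", OF \<sigma>]
      by (simp add: ln_divide_pos ln_mult_pos)
    \<comment> \<open>Given \<open>\<omega>\<close> the two groups are independent, so the factor on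
      \<open>C\<close> cancels in \<open>F\<close> and the factor on \<open>W\<close> averages over
      \<open>\<omega>\<close> to \<open>mix M x \<sigma> W v\<close>.\<close>
    have split: "gkern x \<sigma> I \<omega> v = gkern x \<sigma> W \<omega> v * gkern x \<sigma> C \<omega> v" for \<omega> v
      unfolding gkern_def I_def using W C by (intro prod.union_disjoint) auto
    have gW[measurable]: "(\<lambda>p. gkern x \<sigma> W (fst p) (snd p)) \<in> borel_measurable (M \<Otimes>\<^sub>M lborel_on I)"
    proof -
      have "(\<lambda>p. gkern x \<sigma> W (fst p) (restrict (snd p) W)) \<in> borel_measurable (M \<Otimes>\<^sub>M lborel_on I)"
        by (rule gkern_measurable[where \<sigma> = \<sigma>, OF \<sigma> measurable_fst measurable_compose[OF measurable_snd measurable_restrict_subset[OF I(2)]]])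
      then show ?thesis by (simp add: gkern_cong[where v = "restrict u W" and w = u for u] cong: gkern_cong)
    qed
    have "(\<integral>\<^sup>+p. ennreal (F (fst p) (V p)) \<partial>(M \<Otimes>\<^sub>M std_on I))
      = (\<integral>\<^sup>+\<omega>. \<integral>\<^sup>+v. ennreal (gkern x \<sigma> I \<omega> v) * ennreal (F \<omega> v) \<partial>lborel_on I \<partial>M)"
      unfolding V_def using F_m by (intro gkern_nn[OF \<sigma> I(1)]) auto
    also have "\<dots> = (\<integral>\<^sup>+\<omega>. \<integral>\<^sup>+v. ennreal (gkern x \<sigma> W \<omega> v) * ennreal (mix M x \<sigma> I v / mix M x \<sigma> W v) \<partial>lborel_on I \<partial>M)"
    proof (intro nn_integral_cong)
      fix \<omega> v
      have g: "0 < gkern x \<sigma> C \<omega> v" "0 < gkern x \<sigma> W \<omega> v" by (rule gkern_pos[OF \<sigma>])+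
      have "gkern x \<sigma> I \<omega> v * F \<omega> v = gkern x \<sigma> W \<omega> v * (mix M x \<sigma> I v / mix M x \<sigma> W v)"
        unfolding split F_def using g pW[of v] by (simp add: field_simps)
      then show "ennreal (gkern x \<sigma> I \<omega> v) * ennreal (F \<omega> v) = ennreal (gkern x \<sigma> W \<omega> v) * ennreal (mix M x \<sigma> I v / mix M x \<sigma> W v)"
        using g by (simp add: split ennreal_mult'[symmetric])
    qed
    also have "\<dots> = (\<integral>\<^sup>+v. \<integral>\<^sup>+\<omega>. ennreal (gkern x \<sigma> W \<omega> v) * ennreal (mix M x \<sigma> I v / mix M x \<sigma> W v) \<partial>M \<partial>lborel_on I)"
      by (rule MB.Fubini'[symmetric]) (use gW in measurable)
    also have "\<dots> = (\<integral>\<^sup>+v. ennreal (mix M x \<sigma> I v) \<partial>lborel_on I)"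
    proof (intro nn_integral_cong)
      fix v
      have "(\<integral>\<^sup>+\<omega>. ennreal (gkern x \<sigma> W \<omega> v) * ennreal (mix M x \<sigma> I v / mix M x \<sigma> W v) \<partial>M)
        = ennreal (mix M x \<sigma> W v) * ennreal (mix M x \<sigma> I v / mix M x \<sigma> W v)"
        unfolding mix_nn[where \<sigma> = \<sigma> and J = W, OF \<sigma>] by (rule nn_integral_multc) (use gkern_measurable1[where \<sigma> = \<sigma>, OF \<sigma>] in auto)
      also have "\<dots> = ennreal (mix M x \<sigma> I v)" using pW[of v] by (simp add: ennreal_mult'[symmetric])
      finally show "(\<integral>\<^sup>+\<omega>. ennreal (gkern x \<sigma> W \<omega> v) * ennreal (mix M x \<sigma> I v / mix M x \<sigma> W v) \<partial>M) = ennreal (mix M x \<sigma> I v)" .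
    qed
    finally show "(\<integral>\<^sup>+p. ennreal (F (fst p) (V p)) \<partial>(M \<Otimes>\<^sub>M std_on I)) \<le> 1"
      by (simp add: mix_nn_integral[OF \<sigma> I(1)])
  qed
  also have "(\<integral>p. H p \<partial>(M \<Otimes>\<^sub>M std_on I)) = nent M x \<sigma> I - nent M x \<sigma> W - (\<Sum>c\<in>C. - ln (2 * pi * (\<sigma> c)\<^sup>2) / 2 - 1 / 2)"
    unfolding H_def gkern_V using tr[OF order_refl] tr[OF I(2)] z P.prob_space by simp
  also have "(\<Sum>c\<in>C. - ln (2 * pi * (\<sigma> c)\<^sup>2) / 2 - 1 / 2) = - (\<Sum>c\<in>C. ln (2 * pi * exp 1 * (\<sigma> c)\<^sup>2) / 2)"
    unfolding sum_negf[symmetric]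
  proof (intro sum.cong refl)
    fix c
    have "ln (2 * pi * exp 1 * (\<sigma> c)\<^sup>2) = ln (2 * pi * (\<sigma> c)\<^sup>2) + ln (exp 1)"
      using \<sigma>[of c] by (subst ln_mult_pos[symmetric]) (auto simp: mult_ac)
    then show "- ln (2 * pi * (\<sigma> c)\<^sup>2) / 2 - 1 / 2 = - (ln (2 * pi * exp 1 * (\<sigma> c)\<^sup>2) / 2)"
      by (simp add: add_divide_distrib)
  qed
  finally show ?thesis by (simp add: I_def)
qed

text \<open>The scalar step from the linear family to the power form. At
  \<open>l = a / (a + \<tau>)\<close> both \<open>a / l\<close> and \<open>\<tau> / (1 - l)\<close>
  equal \<open>a + \<tau>\<close>, and the bound collapses to a single logarithm.\<close>

lemma entropy_power_bound:
  fixes a \<tau> H1 H2 :: real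
  assumes "0 < \<tau>" and a: "H1 = ln (2 * pi * exp 1 * a)" "0 < a"
    and H: "\<And>l. 0 < l \<Longrightarrow> l < 1 \<Longrightarrow> - H2 / 2 \<le> l * (- H1 / 2) + epi_const l \<tau>"
  shows "ln (2 * pi * exp 1 * (a + \<tau>)) \<le> H2"
proof -
  define l where "l = a / (a + \<tau>)"
  define k :: real where "k = 2 * pi * exp 1"
  have k: "0 < k" by (simp add: k_def)
  have l: "0 < l" "l < 1" using assms by (auto simp: l_def field_simps)
  have 1: "\<tau> / (1 - l) = a + \<tau>" and 2: "a = l * (a + \<tau>)"
    using assms by (auto simp: l_def field_simps)
  have p: "0 < a + \<tau>" using assms by simp
  have 3: "ln (k * \<tau> / (1 - l)) = ln k + ln (a + \<tau>)"
    using 1 k p by (metis ln_mult_pos times_divide_eq_right)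
  have "H1 = ln k + (ln l + ln (a + \<tau>))"
    unfolding a(1) k_def[symmetric] using k p l a(2) by (subst 2) (simp add: ln_mult_pos)
  then have "- H2 / 2 \<le> l * (- (ln k + (ln l + ln (a + \<tau>))) / 2) + (l / 2 * ln l - (1 - l) / 2 * (ln k + ln (a + \<tau>)))"
    using H[OF l] 3 by (simp add: epi_const_def k_def)
  also have "\<dots> = - (ln k + ln (a + \<tau>)) / 2" by (simp add: field_simps)
  finally show ?thesis using k p by (simp add: ln_mult_pos k_def[symmetric])
qed

text \<open>\<open>A\<close> and \<open>B\<close> index the smoothed first and second source,
  \<open>C\<close> the channel. With \<open>\<sigma>\<close> the channel coordinates are the output
  of the better channel, with \<open>\<sigma>'\<close> that of the worse one; the source coordinates
  are the same in both. \<open>r1\<close> tests the first source given the second source and output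
  1, \<open>r2\<close> the second source given output 2. The factors \<open>2 * pi * exp 1\<close>
  per dimension are left inside \<open>d1\<close>, \<open>d2\<close>, \<open>hW\<close> and
  \<open>h2\<close>; they cancel in \<open>code_bound\<close>.\<close>

theorem mixture_converse:
  assumes fin: "finite A" "finite B" "finite C" and dis: "A \<inter> B = {}" "A \<inter> C = {}" "B \<inter> C = {}"
    and n: "n = card C" "0 < n"
    and N: "0 < N1" "N1 < N2" and s: "0 < s"
  defines "\<sigma> \<equiv> \<lambda>i. if i \<in> C then sqrt N1 else s" and "\<sigma>' \<equiv> \<lambda>i. if i \<in> C then sqrt N2 else s"
  assumes pow: "(\<Sum>c\<in>C. \<integral>\<omega>. (x c \<omega>)\<^sup>2 \<partial>M) \<le> real n * P"
    and r1: "r1 \<in> borel_measurable (lborel_on (A \<union> (B \<union> C)))" "\<And>v. 0 < r1 v"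
      "\<And>y. y \<in> space (lborel_on (B \<union> C)) \<Longrightarrow> (\<integral>\<^sup>+w. ennreal (r1 (merge A (B \<union> C) (w, y))) \<partial>lborel_on A) \<le> 1"
      "integrable (mixlaw M x \<sigma> (A \<union> (B \<union> C))) (\<lambda>v. ln (r1 v))"
      "(\<integral>v. ln (r1 v) \<partial>mixlaw M x \<sigma> (A \<union> (B \<union> C))) \<ge> - real n / 2 * ln d1"
    and r2: "r2 \<in> borel_measurable (lborel_on (B \<union> C))" "\<And>v. 0 < r2 v"
      "\<And>y. y \<in> space (lborel_on C) \<Longrightarrow> (\<integral>\<^sup>+w. ennreal (r2 (merge B C (w, y))) \<partial>lborel_on B) \<le> 1"
      "integrable (mixlaw M x \<sigma>' (B \<union> C)) (\<lambda>v. ln (r2 v))"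
      "(\<integral>v. ln (r2 v) \<partial>mixlaw M x \<sigma>' (B \<union> C)) \<ge> - real n / 2 * ln d2"
    and p12: "nent M x \<sigma> (A \<union> B) = - real n / 2 * ln hW"
    and p2: "nent M x \<sigma> B = - real n / 2 * ln h2"
    and pos: "0 < d1" "0 < d2" "0 < hW" "0 < h2"
  shows "N1 * (hW / (d1 * d2)) + (N2 - N1) * (h2 / d2) - N2 \<le> P"
proof -
  have \<sigma>: "0 < \<sigma> i" and \<sigma>': "0 < \<sigma>' i" for i using N s by (auto simp: \<sigma>_def \<sigma>'_def)
  have BC: "finite (B \<union> C)" and I: "finite (A \<union> (B \<union> C))" using fin by auto
  define k :: real where "k = 2 * pi * exp 1"
  have k: "0 < k" by (simp add: k_def)
  \<comment> \<open>Makes \<open>P + N2\<close> positive, so that it can serve as a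
    variance.\<close>
  have P0: "0 \<le> P"
  proof -
    have "0 \<le> (\<Sum>c\<in>C. \<integral>\<omega>. (x c \<omega>)\<^sup>2 \<partial>M)" by (intro sum_nonneg integral_nonneg_AE) auto
    then show ?thesis using pow n(2) by (smt (verit) of_nat_0_less_iff zero_le_mult_iff)
  qed
  \<comment> \<open>Chain rule at \<open>\<sigma>\<close>: the entropy of the first source given the
    rest is at most \<open>real n / 2 * ln d1\<close>. The test density is \<open>r1\<close> times
    the true density of the rest.\<close>
  have b: "nent M x \<sigma> (B \<union> C) + (\<integral>v. ln (r1 v) \<partial>mixlaw M x \<sigma> (A \<union> (B \<union> C))) \<le> nent M x \<sigma> (A \<union> (B \<union> C))"
  proof -
    have J: "B \<union> C \<subseteq> A \<union> (B \<union> C)" by auto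
    have pk: "0 < mix M x \<sigma> (B \<union> C) v" for v by (rule mix_pos[OF \<sigma> BC])
    have mk: "mix M x \<sigma> (B \<union> C) (restrict v (B \<union> C)) = mix M x \<sigma> (B \<union> C) v" for v by (rule mix_cong) auto
    let ?r = "\<lambda>v. r1 v * mix M x \<sigma> (B \<union> C) v"
    have i: "integrable (mixlaw M x \<sigma> (A \<union> (B \<union> C))) (\<lambda>v. ln (mix M x \<sigma> (B \<union> C) v))"
      by (rule integrable_ln_mix[where \<sigma> = \<sigma> and \<tau> = \<sigma>, OF \<sigma> \<sigma> I J])
    have l: "ln (?r v) = ln (r1 v) + ln (mix M x \<sigma> (B \<union> C) v)" for v by (rule ln_mult_pos[OF r1(2) pk])
    have "(\<integral>v. ln (?r v) \<partial>mixlaw M x \<sigma> (A \<union> (B \<union> C))) \<le> nent M x \<sigma> (A \<union> (B \<union> C))"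
    proof (rule gibbs_mixlaw[OF \<sigma> I])
      show "?r \<in> borel_measurable (lborel_on (A \<union> (B \<union> C)))"
        by (rule borel_measurable_times[OF r1(1) mix_measurable'[where \<sigma> = \<sigma>, OF \<sigma> J]])
      show "0 < ?r v" for v using r1(2) pk by simp
      show "integrable (mixlaw M x \<sigma> (A \<union> (B \<union> C))) (\<lambda>v. ln (?r v))" unfolding l using r1(4) i by auto
      have "(\<integral>\<^sup>+v. ennreal (r1 v * mix M x \<sigma> (B \<union> C) (restrict v (B \<union> C))) \<partial>lborel_on (A \<union> (B \<union> C))) \<le> 1"
        by (rule nn_integral_kernel_le_1)
           (use fin dis r1 mix_measurable[where \<sigma> = \<sigma> and J = "B \<union> C", OF \<sigma>] mix_nn_integral[OF \<sigma> BC] pk in \<open>auto simp: less_imp_le\<close>)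
      then show "(\<integral>\<^sup>+v. ennreal (?r v) \<partial>lborel_on (A \<union> (B \<union> C))) \<le> 1" unfolding mk .
    qed
    moreover have "(\<integral>v. ln (?r v) \<partial>mixlaw M x \<sigma> (A \<union> (B \<union> C))) = (\<integral>v. ln (r1 v) \<partial>mixlaw M x \<sigma> (A \<union> (B \<union> C))) + nent M x \<sigma> (B \<union> C)"
      unfolding l using r1(4) i nent_restrict[where \<sigma> = \<sigma>, OF \<sigma> I J] by simp
    ultimately show ?thesis by simp
  qed
  \<comment> \<open>Given both sources, output 1 has at least the entropy of its noise of variance
    \<open>N1\<close>.\<close>
  have c: "nent M x \<sigma> (A \<union> (B \<union> C)) \<le> nent M x \<sigma> (A \<union> B) - real n * (ln (k * N1) / 2)"
  proof -
    have "nent M x \<sigma> ((A \<union> B) \<union> C) \<le> nent M x \<sigma> (A \<union> B) - (\<Sum>c\<in>C. ln (2 * pi * exp 1 * (\<sigma> c)\<^sup>2) / 2)"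
      by (rule nent_noise[OF \<sigma>]) (use fin dis in auto)
    also have "(\<Sum>c\<in>C. ln (2 * pi * exp 1 * (\<sigma> c)\<^sup>2) / 2) = (\<Sum>c\<in>C. ln (k * N1) / 2)"
      by (rule sum.cong) (use N in \<open>auto simp: \<sigma>_def k_def\<close>)
    finally show ?thesis by (simp add: n Un_assoc)
  qed
  \<comment> \<open>Chain rule at \<open>\<sigma>'\<close>: output 2 is tested by a Gaussian of
    variance \<open>P + N2\<close>, the second source by \<open>r2\<close>.\<close>
  have a: "- real n / 2 * ln d2 - real n / 2 * ln (k * (P + N2)) \<le> nent M x \<sigma>' (B \<union> C)"
  proof -
    define Q where "Q = P + N2"
    have Q: "0 < Q" using P0 N by (simp add: Q_def)
    \<comment> \<open>One variance common to all coordinates: the logarithm is then linear in the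
      total of the squares, and the constraint on the average power suffices.\<close>
    define G where "G v = (\<Prod>c\<in>C. normal_density 0 (sqrt Q) (v c))" for v :: "'i \<Rightarrow> real"
    have Gpos: "0 < G v" for v unfolding G_def using Q by (intro prod_pos normal_density_pos) simp
    have Gr: "G (restrict v C) = G v" for v unfolding G_def by (rule prod.cong) auto
    have Gm: "G \<in> borel_measurable (lborel_on C)" unfolding G_def by measurable
    have GmBC: "G \<in> borel_measurable (lborel_on (B \<union> C))"
      using measurable_compose[OF measurable_restrict_subset[of C "B \<union> C"] Gm] by (simp add: Gr)
    have G1: "(\<integral>\<^sup>+y. ennreal (G y) \<partial>lborel_on C) \<le> 1"
    proof -
      have "(\<integral>\<^sup>+y. ennreal (G y) \<partial>lborel_on C) = (\<integral>\<^sup>+y. (\<Prod>c\<in>C. ennreal (normal_density 0 (sqrt Q) (y c))) \<partial>lborel_on C)"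
        unfolding G_def by (simp add: prod_ennreal)
      also have "\<dots> = (\<Prod>c\<in>C. \<integral>\<^sup>+y. ennreal (normal_density 0 (sqrt Q) y) \<partial>lborel)"
        by (rule lborel_on.product_nn_integral_prod[OF fin(3)]) simp
      also have "\<dots> = 1" using Q by (subst nn_integral_eq_integral) auto
      finally show ?thesis by simp
    qed
    have lnG: "ln (G v) = (\<Sum>c\<in>C. - ln (2 * pi * Q) / 2 - (v c)\<^sup>2 / (2 * Q))" for v
      unfolding G_def using Q fin(3) normal_density_pos[of "sqrt Q"]
      by (subst ln_prod) (auto simp: ln_normal_density less_imp_neq[symmetric])
    have sq: "integrable (mixlaw M x \<sigma>' (B \<union> C)) (\<lambda>v. (v c)\<^sup>2)"
      "(\<integral>v. (v c)\<^sup>2 \<partial>mixlaw M x \<sigma>' (B \<union> C)) = (\<integral>\<omega>. (x c \<omega>)\<^sup>2 \<partial>M) + N2" if c: "c \<in> C" for c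
    proof -
      have c': "c \<in> B \<union> C" using c by simp
      show "integrable (mixlaw M x \<sigma>' (B \<union> C)) (\<lambda>v. (v c)\<^sup>2)" by (rule mixlaw_square[OF \<sigma>' BC c'])
      interpret S: prob_space "std_on (B \<union> C)" by (rule prob_space_std_on)
      interpret PP: pair_prob_space M "std_on (B \<union> C)" ..
      have x1: "integrable M (x c)" by (rule square_integrable_imp_integrable[OF x_measurable x_square])
      have vm: "(\<lambda>v. (v c)\<^sup>2) \<in> borel_measurable (lborel_on (B \<union> C))" using c' by measurable
      note z = std_on_moments[OF c']
      have i1: "integrable (M \<Otimes>\<^sub>M std_on (B \<union> C)) (\<lambda>p. (x c (fst p))\<^sup>2)"
        by (rule integrable_pair_fst[OF prob_space_axioms S.prob_space_axioms x_square])
      have i2: "integrable (M \<Otimes>\<^sub>M std_on (B \<union> C)) (\<lambda>p. (snd p c)\<^sup>2)"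
        by (rule integrable_pair_snd[OF prob_space_axioms S.prob_space_axioms z(1)])
      \<comment> \<open>The cross term of the square: the noise coordinate is centred and
        independent of \<open>x c\<close>.\<close>
      have i3: "integrable (M \<Otimes>\<^sub>M std_on (B \<union> C)) (\<lambda>(a, b). x c a * b c)"
        and v3: "(\<integral>p. (case p of (a, b) \<Rightarrow> x c a * b c) \<partial>(M \<Otimes>\<^sub>M std_on (B \<union> C))) = 0"
      proof -
        show i3: "integrable (M \<Otimes>\<^sub>M std_on (B \<union> C)) (\<lambda>(a, b). x c a * b c)"
        proof (rule Bochner_Integration.integrable_bound[OF Bochner_Integration.integrable_add[OF i1 i2]])
          have [measurable]: "(\<lambda>p. snd p c) \<in> borel_measurable (M \<Otimes>\<^sub>M std_on (B \<union> C))"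
            by (rule PiM_component_measurable[OF measurable_snd c']) simp
          show "(\<lambda>(a, b). x c a * b c) \<in> borel_measurable (M \<Otimes>\<^sub>M std_on (B \<union> C))"
            unfolding case_prod_beta' by measurable
          have "\<bar>u * w\<bar> \<le> u\<^sup>2 + w\<^sup>2" for u w :: real
            using sum_squares_bound[of "\<bar>u\<bar>" "\<bar>w\<bar>"] abs_ge_zero[of "u * w"]
            unfolding abs_mult power2_abs mult.assoc by linarith
          then show "AE p in M \<Otimes>\<^sub>M std_on (B \<union> C). norm (case p of (a, b) \<Rightarrow> x c a * b c) \<le> norm ((x c (fst p))\<^sup>2 + (snd p c)\<^sup>2)"
            by (auto simp: case_prod_beta)
        qed
        show "(\<integral>p. (case p of (a, b) \<Rightarrow> x c a * b c) \<partial>(M \<Otimes>\<^sub>M std_on (B \<union> C))) = 0"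
          using PP.integral_fst'[OF i3] z(4) by simp
      qed
      have "(\<integral>v. (v c)\<^sup>2 \<partial>mixlaw M x \<sigma>' (B \<union> C)) = (\<integral>p. (x c (fst p) + \<sigma>' c * snd p c)\<^sup>2 \<partial>(M \<Otimes>\<^sub>M std_on (B \<union> C)))"
        unfolding mixlaw_eq[where \<sigma> = \<sigma>', OF \<sigma>' order_refl BC]
        using c' by (subst integral_distr[OF shift_measurable[where \<sigma> = \<sigma>', OF \<sigma>' order_refl] vm]) (auto simp: case_prod_beta)
      also have "\<dots> = (\<integral>p. (x c (fst p))\<^sup>2 + (\<sigma>' c)\<^sup>2 * (snd p c)\<^sup>2 + 2 * \<sigma>' c * (case p of (a, b) \<Rightarrow> x c a * b c) \<partial>(M \<Otimes>\<^sub>M std_on (B \<union> C)))"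
        by (rule Bochner_Integration.integral_cong) (auto simp: power2_eq_square algebra_simps)
      also have "\<dots> = (\<integral>\<omega>. (x c \<omega>)\<^sup>2 \<partial>M) + (\<sigma>' c)\<^sup>2"
        using i1 i2 i3 v3 z(2) integral_pair_fst[OF prob_space_axioms S.prob_space_axioms borel_measurable_integrable[OF x_square]]
          integral_pair_snd[OF prob_space_axioms S.prob_space_axioms borel_measurable_integrable[OF z(1)]] by simp
      finally show "(\<integral>v. (v c)\<^sup>2 \<partial>mixlaw M x \<sigma>' (B \<union> C)) = (\<integral>\<omega>. (x c \<omega>)\<^sup>2 \<partial>M) + N2"
        using c N by (simp add: \<sigma>'_def)
    qed
    interpret ml: prob_space "mixlaw M x \<sigma>' (B \<union> C)" by (rule prob_space_mixlaw[OF \<sigma>' BC])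
    have iG: "integrable (mixlaw M x \<sigma>' (B \<union> C)) (\<lambda>v. ln (G v))" unfolding lnG using sq(1) by auto
    have "- real n / 2 * ln (k * Q) \<le> (\<integral>v. ln (G v) \<partial>mixlaw M x \<sigma>' (B \<union> C))"
    proof -
      have "(\<integral>v. ln (G v) \<partial>mixlaw M x \<sigma>' (B \<union> C)) = (\<Sum>c\<in>C. - ln (2 * pi * Q) / 2 - ((\<integral>\<omega>. (x c \<omega>)\<^sup>2 \<partial>M) + N2) / (2 * Q))"
        unfolding lnG using sq ml.prob_space by simp
      also have "\<dots> = - real n / 2 * ln (2 * pi * Q) - ((\<Sum>c\<in>C. \<integral>\<omega>. (x c \<omega>)\<^sup>2 \<partial>M) + real n * N2) / (2 * Q)"
        by (simp add: sum_subtractf n sum.distrib sum_divide_distrib[symmetric])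
      finally have e: "(\<integral>v. ln (G v) \<partial>mixlaw M x \<sigma>' (B \<union> C)) = - real n / 2 * ln (2 * pi * Q) - ((\<Sum>c\<in>C. \<integral>\<omega>. (x c \<omega>)\<^sup>2 \<partial>M) + real n * N2) / (2 * Q)" .
      have "((\<Sum>c\<in>C. \<integral>\<omega>. (x c \<omega>)\<^sup>2 \<partial>M) + real n * N2) / (2 * Q) \<le> (real n * P + real n * N2) / (2 * Q)"
        using pow Q by (intro divide_right_mono) auto
      also have "\<dots> = real n / 2" unfolding distrib_left[symmetric] Q_def[symmetric] using Q by simp
      finally have f: "((\<Sum>c\<in>C. \<integral>\<omega>. (x c \<omega>)\<^sup>2 \<partial>M) + real n * N2) / (2 * Q) \<le> real n / 2" .
      have "ln (k * Q) = ln (2 * pi * Q) + ln (exp 1)"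
        using Q unfolding k_def by (subst ln_mult_pos[symmetric]) (auto simp: mult_ac)
      then show ?thesis using e f by (simp add: algebra_simps add_divide_distrib)
    qed
    moreover have "(\<integral>v. ln (r2 v * G v) \<partial>mixlaw M x \<sigma>' (B \<union> C)) \<le> nent M x \<sigma>' (B \<union> C)"
    proof (rule gibbs_mixlaw[OF \<sigma>' BC])
      show "(\<lambda>v. r2 v * G v) \<in> borel_measurable (lborel_on (B \<union> C))"
        by (rule borel_measurable_times[OF r2(1) GmBC])
      show "0 < r2 v * G v" for v using r2(2) Gpos by simp
      show "integrable (mixlaw M x \<sigma>' (B \<union> C)) (\<lambda>v. ln (r2 v * G v))"
        unfolding ln_mult_pos[OF r2(2) Gpos] using r2(4) iG by auto
      have "(\<integral>\<^sup>+v. ennreal (r2 v * G (restrict v C)) \<partial>lborel_on (B \<union> C)) \<le> 1"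
        by (rule nn_integral_kernel_le_1) (use fin dis r2 Gm G1 Gpos in \<open>auto simp: less_imp_le\<close>)
      then show "(\<integral>\<^sup>+v. ennreal (r2 v * G v) \<partial>lborel_on (B \<union> C)) \<le> 1" unfolding Gr .
    qed
    ultimately show ?thesis
      unfolding ln_mult_pos[OF r2(2) Gpos] using r2(4,5) iG by (simp add: Q_def)
  qed
  \<comment> \<open>Twice the entropy per channel use of output 1, respectively output 2, given the
    second source. The subtracted term may be taken at \<open>\<sigma>\<close> in both, as the
    deviations agree on \<open>B\<close>.\<close>
  define H1 where "H1 = - (2 / real n) * (nent M x \<sigma> (B \<union> C) - nent M x \<sigma> B)"
  define H2 where "H2 = - (2 / real n) * (nent M x \<sigma>' (B \<union> C) - nent M x \<sigma> B)"
  have n0: "real n \<noteq> 0" using n by simp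
  have nH: "nent M x \<sigma> (B \<union> C) = - real n / 2 * H1 - real n / 2 * ln h2"
    "nent M x \<sigma>' (B \<union> C) = - real n / 2 * H2 - real n / 2 * ln h2"
  proof -
    have r: "- real n / 2 * (- (2 / real n) * u) = u" for u using n0 by simp
    show "nent M x \<sigma> (B \<union> C) = - real n / 2 * H1 - real n / 2 * ln h2"
      "nent M x \<sigma>' (B \<union> C) = - real n / 2 * H2 - real n / 2 * ln h2"
      unfolding H1_def H2_def r using p2 by simp_all
  qed
  \<comment> \<open>The entropy power: the variance of a normal variable whose entropy is
    \<open>H1 / 2\<close>.\<close>
  define \<alpha> where "\<alpha> = exp H1 / k"
  have \<alpha>: "0 < \<alpha>" "H1 = ln (k * \<alpha>)" using k by (simp_all add: \<alpha>_def)
  have d: "ln (k * (\<alpha> + (N2 - N1))) \<le> H2"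
    unfolding k_def
  proof (rule entropy_power_bound)
    show "0 < N2 - N1" using N by simp
    show "H1 = ln (2 * pi * exp 1 * \<alpha>)" "0 < \<alpha>" using \<alpha> by (simp_all add: k_def)
    fix l :: real assume l: "0 < l" "l < 1"
    \<comment> \<open>No noise is added on \<open>B\<close>, and variance \<open>N2 - N1\<close> on
      \<open>C\<close>: in law, output 2 is a degraded copy of output 1.\<close>
    define \<rho> where "\<rho> i = (if i \<in> C then sqrt (N2 - N1) else 0)" for i
    have "nent M x \<sigma>' (B \<union> C) - nent M x \<sigma>' B
      \<le> l * (nent M x \<sigma> (B \<union> C) - nent M x \<sigma> B) + real (card C) * epi_const l (N2 - N1)"
      by (rule conditional_epi[where \<rho> = \<rho>, OF \<sigma>])
         (use fin dis N s l in \<open>auto simp: \<sigma>_def \<sigma>'_def \<rho>_def\<close>)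
    moreover have "nent M x \<sigma>' B = nent M x \<sigma> B"
      by (rule nent_cong_std) (use dis in \<open>auto simp: \<sigma>_def \<sigma>'_def\<close>)
    ultimately have "real n * (- H2 / 2) \<le> real n * (l * (- H1 / 2) + epi_const l (N2 - N1))"
      using n p2 by (simp add: nH algebra_simps)
    then show "- H2 / 2 \<le> l * (- H1 / 2) + epi_const l (N2 - N1)"
      using n(2) by (subst (asm) mult_le_cancel_left_pos) auto
  qed
  have Q: "0 < P + N2" using P0 N by simp
  \<comment> \<open>Decoder 2: \<open>a\<close> bounds \<open>H2\<close> from above and
    \<open>d\<close> bounds it from below.\<close>
  have A: "h2 * (\<alpha> + (N2 - N1)) \<le> d2 * (P + N2)"
  proof -
    have "real n / 2 * (H2 + ln h2) \<le> real n / 2 * (ln d2 + ln (k * (P + N2)))"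
      using a by (simp add: nH algebra_simps)
    then have "H2 + ln h2 \<le> ln d2 + ln (k * (P + N2))" using n(2) by (subst (asm) mult_le_cancel_left_pos) auto
    then have "ln (k * (\<alpha> + (N2 - N1))) + ln h2 \<le> ln d2 + ln (k * (P + N2))" using d by linarith
    then have "ln ((k * (\<alpha> + (N2 - N1))) * h2) \<le> ln (d2 * (k * (P + N2)))"
      using k \<alpha> N pos Q by (simp add: ln_mult_pos)
    then have "(k * (\<alpha> + (N2 - N1))) * h2 \<le> d2 * (k * (P + N2))"
      using k \<alpha> N pos Q by (subst (asm) ln_le_cancel_iff) auto
    then have "k * (h2 * (\<alpha> + (N2 - N1))) \<le> k * (d2 * (P + N2))" by (simp add: mult_ac)
    then show ?thesis using k by (subst (asm) mult_le_cancel_left_pos) auto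
  qed
  \<comment> \<open>Decoder 1: \<open>b\<close> and \<open>c\<close> bound \<open>H1\<close>, hence
    \<open>\<alpha>\<close>, from below.\<close>
  have B: "N1 * hW \<le> \<alpha> * h2 * d1"
  proof -
    have "real n / 2 * (ln hW + ln (k * N1)) \<le> real n / 2 * (H1 + ln h2 + ln d1)"
      using b c r1(5) by (simp add: nH p12 algebra_simps add_divide_distrib)
    then have "ln hW + ln (k * N1) \<le> H1 + ln h2 + ln d1" using n(2) by (subst (asm) mult_le_cancel_left_pos) auto
    then have "ln (hW * (k * N1)) \<le> ln ((k * \<alpha>) * h2 * d1)"
      unfolding \<alpha>(2) using k \<alpha>(1) N pos by (simp add: ln_mult_pos)
    then have "hW * (k * N1) \<le> (k * \<alpha>) * h2 * d1"
      using k \<alpha>(1) N pos by (subst (asm) ln_le_cancel_iff) auto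
    then have "k * (N1 * hW) \<le> k * (\<alpha> * h2 * d1)" by (simp add: mult_ac)
    then show ?thesis using k by (subst (asm) mult_le_cancel_left_pos) auto
  qed
  have "N1 * (hW / (d1 * d2)) = N1 * hW / d1 / d2" by simp
  also have "\<dots> \<le> \<alpha> * h2 / d2"
    using B pos by (intro divide_right_mono) (auto simp: pos_divide_le_eq)
  finally have "N1 * (hW / (d1 * d2)) + (N2 - N1) * (h2 / d2) \<le> h2 * (\<alpha> + (N2 - N1)) / d2"
    by (simp add: algebra_simps add_divide_distrib diff_divide_distrib)
  also have "\<dots> \<le> P + N2" using A pos by (simp add: pos_divide_le_eq mult.commute)
  finally show ?thesis by simp
qed

end

section \<open>Linear changes of variables\<close>

lemma prod_Basis_vec:
  fixes f :: "real^'n \<Rightarrow> 'b::comm_monoid_mult"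
  shows "(\<Prod>b\<in>Basis. f b) = (\<Prod>k\<in>UNIV. f (axis k 1))"
proof -
  have B: "(Basis :: (real^'n) set) = (\<lambda>k. axis k 1) ` UNIV" by (auto simp: Basis_vec_def)
  have "inj (\<lambda>k::'n. axis k (1::real))" by (auto simp: inj_on_def axis_eq_axis)
  then show ?thesis unfolding B by (subst prod.reindex) auto
qed

lemma borel_measurable_vec:
  fixes f :: "'a \<Rightarrow> real^'n"
  assumes "\<And>k. (\<lambda>x. f x $ k) \<in> borel_measurable M"
  shows "f \<in> borel_measurable M"
  by (rule borel_measurable_euclidean_space[THEN iffD2]) (use assms in \<open>auto simp: Basis_vec_def inner_axis\<close>)

text \<open>Lebesgue measure is determined by boxes. An arbitrary injective index map
  \<open>e\<close> serves permutations of coordinates as well as the coordinates of one source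
  vector inside a larger index set.\<close>

lemma lborel_vec:
  fixes e :: "'n::finite \<Rightarrow> 'i"
  assumes e: "inj e"
  shows "(\<lambda>v. \<chi> k. v (e k)) \<in> lborel_on (range e) \<rightarrow>\<^sub>M borel"
    and "distr (lborel_on (range e)) borel (\<lambda>v. \<chi> k. v (e k)) = (lborel :: (real^'n) measure)"
proof -
  let ?h = "\<lambda>v. \<chi> k. v (e k)"
  show h: "?h \<in> lborel_on (range e) \<rightarrow>\<^sub>M borel"
    by (rule borel_measurable_vec) simp
  show "distr (lborel_on (range e)) borel ?h = lborel"
  proof (rule lborel_eqI[symmetric])
    fix l u :: "real^'n" assume le: "\<And>b. b \<in> Basis \<Longrightarrow> l \<bullet> b \<le> u \<bullet> b"
    have le': "l $ k \<le> u $ k" for k using le[of "axis k 1"] by (simp add: inner_axis axis_in_Basis_iff)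
    have ie: "the_inv e (e k) = k" for k using e by (rule the_inv_f_f)
    have eq: "?h -` box l u \<inter> space (lborel_on (range e)) = Pi\<^sub>E (range e) (\<lambda>i. {l $ (the_inv e i) <..< u $ (the_inv e i)})"
      by (auto simp: mem_box_cart space_PiM PiE_iff ie)
    have "emeasure (distr (lborel_on (range e)) borel ?h) (box l u)
      = emeasure (lborel_on (range e)) (Pi\<^sub>E (range e) (\<lambda>i. {l $ (the_inv e i) <..< u $ (the_inv e i)}))"
      using emeasure_distr[OF h, of "box l u"] unfolding eq by simp
    also have "\<dots> = (\<Prod>i\<in>range e. emeasure lborel {l $ (the_inv e i) <..< u $ (the_inv e i)})"
      by (rule lborel_on.emeasure_PiM) auto
    also have "\<dots> = (\<Prod>k\<in>UNIV. emeasure lborel {l $ k <..< u $ k})"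
      using e by (subst prod.reindex) (auto simp: ie)
    also have "\<dots> = (\<Prod>k\<in>UNIV. ennreal (u $ k - l $ k))" using le' by simp
    also have "\<dots> = ennreal (\<Prod>k\<in>UNIV. u $ k - l $ k)" using le' by (intro prod_ennreal) simp
    also have "(\<Prod>k\<in>UNIV. u $ k - l $ k) = (\<Prod>b\<in>Basis. (u - l) \<bullet> b)"
      by (simp add: prod_Basis_vec inner_axis)
    finally show "emeasure (distr (lborel_on (range e)) borel ?h) (box l u) = (\<Prod>b\<in>Basis. (u - l) \<bullet> b)" .
  qed simp
qed

lemma nn_integral_vec:
  fixes e :: "'n::finite \<Rightarrow> 'i" and F :: "real^'n \<Rightarrow> ennreal"
  assumes "inj e" "F \<in> borel_measurable borel"
  shows "(\<integral>\<^sup>+v. F (\<chi> k. v (e k)) \<partial>lborel_on (range e)) = (\<integral>\<^sup>+x. F x \<partial>lborel)"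
  by (subst lborel_vec(2)[OF assms(1), symmetric], rule nn_integral_distr'[symmetric, OF lborel_vec(1)[OF assms(1)] assms(2)])

lemma matrix_vector_mult_measurable[measurable]:
  fixes A :: "real^'n^'m" shows "(\<lambda>x. A *v x) \<in> borel_measurable borel"
  by (intro borel_measurable_continuous_onI linear_continuous_on linear_linear[THEN iffD2] matrix_vector_mul_linear)

text \<open>Matrices are generated by diagonal ones, transpositions and shears, apart from those
  with a zero row. For each generator the formula is a scaling, a relabelling or a one-dimensional
  translation.\<close>

lemma nn_integral_matrix:
  fixes A :: "real^'n^'n" and F :: "real^'n \<Rightarrow> ennreal"
  assumes "det A \<noteq> 0" "F \<in> borel_measurable borel"
  shows "ennreal \<bar>det A\<bar> * (\<integral>\<^sup>+x. F (A *v x) \<partial>lborel) = (\<integral>\<^sup>+x. F x \<partial>lborel)"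
proof -
  \<comment> \<open>Singular matrices satisfy \<open>P\<close> vacuously, which disposes of zero
    rows; quantifying over all \<open>F\<close> inside \<open>P\<close> lets the claim pass to
    products.\<close>
  define P :: "real^'n^'n \<Rightarrow> bool" where "P A \<longleftrightarrow> (det A \<noteq> 0 \<longrightarrow> (\<forall>F\<in>borel_measurable borel. ennreal \<bar>det A\<bar> * (\<integral>\<^sup>+x. F (A *v x) \<partial>lborel) = (\<integral>\<^sup>+x. F x \<partial>lborel)))" for A
  have "P A"
  proof (rule induct_matrix_elementary)
    fix A B assume AB: "P A" "P B"
    show "P (A ** B)" unfolding P_def
    proof (intro impI ballI)
      fix F :: "real^'n \<Rightarrow> ennreal" assume d: "det (A ** B) \<noteq> 0" and F[measurable]: "F \<in> borel_measurable borel"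
      have dA: "det A \<noteq> 0" and dB: "det B \<noteq> 0" using d by (auto simp: det_mul)
      have "ennreal \<bar>det (A ** B)\<bar> * (\<integral>\<^sup>+x. F ((A ** B) *v x) \<partial>lborel)
        = ennreal \<bar>det A\<bar> * (ennreal \<bar>det B\<bar> * (\<integral>\<^sup>+x. F (A *v (B *v x)) \<partial>lborel))"
        by (simp add: det_mul abs_mult ennreal_mult mult.assoc matrix_vector_mul_assoc)
      also have "ennreal \<bar>det B\<bar> * (\<integral>\<^sup>+x. F (A *v (B *v x)) \<partial>lborel) = (\<integral>\<^sup>+x. F (A *v x) \<partial>lborel)"
        using AB(2) dB measurable_compose[OF matrix_vector_mult_measurable F] by (auto simp: P_def)
      also have "ennreal \<bar>det A\<bar> * (\<integral>\<^sup>+x. F (A *v x) \<partial>lborel) = (\<integral>\<^sup>+x. F x \<partial>lborel)"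
        using AB(1) dA F by (auto simp: P_def)
      finally show "ennreal \<bar>det (A ** B)\<bar> * (\<integral>\<^sup>+x. F ((A ** B) *v x) \<partial>lborel) = (\<integral>\<^sup>+x. F x \<partial>lborel)" .
    qed
  next
    fix A :: "real^'n^'n" and i assume "row i A = 0"
    then have "det A = 0" by (rule det_zero_row)
    then show "P A" by (simp add: P_def)
  next
    fix A :: "real^'n^'n" assume dg: "\<And>i j. i \<noteq> j \<Longrightarrow> A $ i $ j = 0"
    show "P A" unfolding P_def
    proof (intro impI ballI)
      fix F :: "real^'n \<Rightarrow> ennreal" assume d: "det A \<noteq> 0" and F[measurable]: "F \<in> borel_measurable borel"
      have detA: "det A = (\<Prod>k\<in>UNIV. A $ k $ k)" by (rule det_diagonal) (use dg in auto)
      then have nz: "A $ k $ k \<noteq> 0" for k using d by (auto simp: prod_zero_iff)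
      \<comment> \<open>The diagonal entry belonging to a basis vector, in the form that the affine
        change of variables expects.\<close>
      define c where "c b = b \<bullet> (A *v b)" for b :: "real^'n"
      have cax: "c (axis k 1) = A $ k $ k" for k
        by (simp add: c_def inner_axis' matrix_vector_mult_basis column_def)
      have T: "0 + (\<Sum>j\<in>Basis. (c j * (x \<bullet> j)) *\<^sub>R j) = A *v x" for x :: "real^'n"
      proof (rule euclidean_eqI)
        fix b :: "real^'n" assume b: "b \<in> Basis"
        then obtain k where k: "b = axis k 1" by (auto simp: Basis_vec_def)
        have "(0 + (\<Sum>j\<in>Basis. (c j * (x \<bullet> j)) *\<^sub>R j)) \<bullet> b = c b * (x \<bullet> b)"
          using b by (simp add: inner_sum_left_Basis)
        also have "\<dots> = (\<Sum>j\<in>UNIV. A $ k $ j * x $ j)"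
          unfolding k cax by (subst sum.remove[of _ k]) (auto simp: inner_axis dg intro!: sum.neutral)
        also have "\<dots> = (A *v x) \<bullet> b" unfolding k by (simp add: inner_axis matrix_vector_mult_def)
        finally show "(0 + (\<Sum>j\<in>Basis. (c j * (x \<bullet> j)) *\<^sub>R j)) \<bullet> b = (A *v x) \<bullet> b" .
      qed
      have cnz: "c j \<noteq> 0" if "j \<in> Basis" for j using that nz cax by (auto simp: Basis_vec_def)
      have "(\<integral>\<^sup>+x. F x \<partial>lborel) = (\<integral>\<^sup>+x. F x \<partial>density (distr lborel borel (\<lambda>x. A *v x)) (\<lambda>_. (\<Prod>j\<in>Basis. \<bar>c j\<bar>)))"
        using lborel_affine_euclidean[of c 0, OF cnz] unfolding T by simp
      also have "\<dots> = ennreal (\<Prod>j\<in>Basis. \<bar>c j\<bar>) * (\<integral>\<^sup>+x. F (A *v x) \<partial>lborel)"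
        by (simp add: nn_integral_density nn_integral_cmult nn_integral_distr')
      also have "(\<Prod>j\<in>Basis. \<bar>c j\<bar>) = \<bar>det A\<bar>" unfolding prod_Basis_vec cax detA by (simp add: abs_prod)
      finally show "ennreal \<bar>det A\<bar> * (\<integral>\<^sup>+x. F (A *v x) \<partial>lborel) = (\<integral>\<^sup>+x. F x \<partial>lborel)" ..
    qed
  next
    fix m n :: 'n assume "m \<noteq> n"
    define S :: "real^'n^'n" where "S = (\<chi> i j. mat 1 $ i $ Transposition.transpose m n j)"
    have Sx: "S *v x = (\<chi> k. x $ Transposition.transpose m n k)" for x
    proof (subst vec_eq_iff, rule allI)
      fix i
      have tr: "i = Transposition.transpose m n j \<longleftrightarrow> Transposition.transpose m n i = j" for j
        by (metis transpose_involutory)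
      have "(S *v x) $ i = (\<Sum>j\<in>UNIV. (if i = Transposition.transpose m n j then 1 else 0) * x $ j)"
        unfolding S_def matrix_vector_mult_def by (simp add: mat_def)
      also have "\<dots> = (\<Sum>j\<in>UNIV. if Transposition.transpose m n i = j then x $ j else 0)"
        unfolding tr by (rule sum.cong) auto
      finally have "(S *v x) $ i = (\<Sum>j\<in>UNIV. if Transposition.transpose m n i = j then x $ j else 0)" .
      then show "(S *v x) $ i = (\<chi> k. x $ Transposition.transpose m n k) $ i" by simp
    qed
    have dS: "\<bar>det S\<bar> = 1"
    proof -
      have "S = (\<chi> i. mat 1 $ Transposition.transpose m n i)"
        by (auto simp: S_def vec_eq_iff mat_def)
      then have "det S = of_int (sign (Transposition.transpose m n)) * det (mat 1 :: real^'n^'n)"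
        using det_permute_rows[of "Transposition.transpose m n" "mat 1 :: real^'n^'n"] by (simp add: permutes_swap_id)
      then show ?thesis by (simp add: sign_def)
    qed
    show "P (\<chi> i j. mat 1 $ i $ Transposition.transpose m n j)" unfolding P_def S_def[symmetric]
    proof (intro impI ballI)
      fix F :: "real^'n \<Rightarrow> ennreal" assume F: "F \<in> borel_measurable borel"
      \<comment> \<open>Both sides are one integral over the coordinate family, read through two
        index maps.\<close>
      have "(\<integral>\<^sup>+x. F x \<partial>lborel) = (\<integral>\<^sup>+v. F (\<chi> k. v (Transposition.transpose m n k)) \<partial>lborel_on (range (Transposition.transpose m n)))"
        by (rule nn_integral_vec[symmetric]) (auto simp: F bij_is_inj)
      also have "range (Transposition.transpose m n) = range (\<lambda>k::'n. k)"
        using bij_is_surj[OF bij_transpose[of m n]] by simp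
      also have "(\<integral>\<^sup>+v. F (\<chi> k. v (Transposition.transpose m n k)) \<partial>lborel_on (range (\<lambda>k. k)))
        = (\<integral>\<^sup>+v. (\<lambda>x. F (S *v x)) (\<chi> k. v k) \<partial>lborel_on (range (\<lambda>k. k)))" by (simp add: Sx)
      also have "\<dots> = (\<integral>\<^sup>+x. F (S *v x) \<partial>lborel)"
        by (rule nn_integral_vec) (auto intro: measurable_compose[OF matrix_vector_mult_measurable F])
      finally show "ennreal \<bar>det S\<bar> * (\<integral>\<^sup>+x. F (S *v x) \<partial>lborel) = (\<integral>\<^sup>+x. F x \<partial>lborel)" by (simp add: dS)
    qed
  next
    fix m n :: 'n and c :: real assume mn: "m \<noteq> n"
    define S :: "real^'n^'n" where "S = (\<chi> i j. if i = m \<and> j = n then c else of_bool (i = j))"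
    have Sx: "S *v x = (\<chi> k. if k = m then x $ m + c * x $ n else x $ k)" for x
    proof (subst vec_eq_iff, rule allI)
      fix i
      have "(S *v x) $ i = (\<Sum>j\<in>UNIV. (if i = j then x $ j else 0) + (if j = n then (if i = m then c * x $ n else 0) else 0))"
        unfolding S_def matrix_vector_mult_def using mn by (auto intro!: sum.cong)
      then show "(S *v x) $ i = (\<chi> k. if k = m then x $ m + c * x $ n else x $ k) $ i" by (simp add: sum.distrib)
    qed
    have dS: "det S = 1"
    proof -
      have "det (\<chi> k. if k = m then row m (mat 1 :: real^'n^'n) + c *s row n (mat 1) else row k (mat 1)) = det (mat 1 :: real^'n^'n)"
        by (rule det_row_operation[OF mn])
      moreover have "(\<chi> k. if k = m then row m (mat 1 :: real^'n^'n) + c *s row n (mat 1) else row k (mat 1)) = S"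
        using mn by (auto simp: S_def vec_eq_iff row_def mat_def)
      ultimately show ?thesis by simp
    qed
    show "P (\<chi> i j. if i = m \<and> j = n then c else of_bool (i = j))" unfolding P_def S_def[symmetric]
    proof (intro impI ballI)
      fix F :: "real^'n \<Rightarrow> ennreal" assume F[measurable]: "F \<in> borel_measurable borel"
      \<comment> \<open>With the coordinates other than \<open>m\<close> held fixed, the shear is a
        translation in coordinate \<open>m\<close>.\<close>
      let ?U = "UNIV - {m} :: 'n set"
      have ins: "insert m ?U = range (\<lambda>k::'n. k)" by auto
      have vm: "(\<lambda>v. \<chi> k. v k) \<in> lborel_on (insert m ?U) \<rightarrow>\<^sub>M (borel :: (real^'n) measure)"
        unfolding ins by (rule lborel_vec) simp
      note SF = measurable_compose[OF matrix_vector_mult_measurable F]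
      have "(\<integral>\<^sup>+x. F (S *v x) \<partial>lborel) = (\<integral>\<^sup>+v. F (S *v (\<chi> k. v k)) \<partial>lborel_on (insert m ?U))"
        unfolding ins using nn_integral_vec[of "\<lambda>k. k" "\<lambda>x. F (S *v x)"] SF by simp
      also have "\<dots> = (\<integral>\<^sup>+u. \<integral>\<^sup>+y. F (S *v (\<chi> k. (u(m := y)) k)) \<partial>lborel \<partial>lborel_on ?U)"
        by (rule lborel_on.product_nn_integral_insert[OF _ _ measurable_compose[OF vm SF]]) auto
      also have "\<dots> = (\<integral>\<^sup>+u. \<integral>\<^sup>+y. F (\<chi> k. (u(m := y)) k) \<partial>lborel \<partial>lborel_on ?U)"
      proof (rule nn_integral_cong)
        fix u assume u: "u \<in> space (lborel_on ?U)"
        have "(\<lambda>y. u(m := y)) \<in> borel \<rightarrow>\<^sub>M lborel_on (insert m ?U)"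
          using u by (intro measurable_fun_upd[where J = ?U]) auto
        from measurable_compose[OF measurable_compose[OF this vm] F]
        have m1: "(\<lambda>y. F (\<chi> k. (u(m := y)) k)) \<in> borel_measurable borel" .
        have "S *v (\<chi> k. (u(m := y)) k) = (\<chi> k. (u(m := c * u n + 1 * y)) k)" for y
          using mn by (auto simp: Sx vec_eq_iff)
        then show "(\<integral>\<^sup>+y. F (S *v (\<chi> k. (u(m := y)) k)) \<partial>lborel) = (\<integral>\<^sup>+y. F (\<chi> k. (u(m := y)) k) \<partial>lborel)"
          using nn_integral_real_affine[OF m1, of 1 "c * u n"] by simp
      qed
      also have "\<dots> = (\<integral>\<^sup>+v. F (\<chi> k. v k) \<partial>lborel_on (insert m ?U))"
        by (rule lborel_on.product_nn_integral_insert[OF _ _ measurable_compose[OF vm F], symmetric]) auto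
      also have "\<dots> = (\<integral>\<^sup>+x. F x \<partial>lborel)"
        unfolding ins using nn_integral_vec[of "\<lambda>k. k" F] F by simp
      finally show "ennreal \<bar>det S\<bar> * (\<integral>\<^sup>+x. F (S *v x) \<partial>lborel) = (\<integral>\<^sup>+x. F x \<partial>lborel)" by (simp add: dS)
    qed
  qed
  then show ?thesis using assms by (auto simp: P_def)
qed

lemma lborel_matrix:
  fixes A :: "real^'n^'n"
  assumes "det A \<noteq> 0"
  shows "lborel = density (distr lborel borel (\<lambda>x. A *v x)) (\<lambda>_. ennreal \<bar>det A\<bar>)"
proof (rule measure_eqI)
  fix X :: "(real^'n) set" assume "X \<in> sets lborel"
  then have X[measurable]: "X \<in> sets borel" by simp
  show "emeasure lborel X = emeasure (density (distr lborel borel (\<lambda>x. A *v x)) (\<lambda>_. ennreal \<bar>det A\<bar>)) X"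
  proof -
    have "emeasure (density (distr lborel borel (\<lambda>x. A *v x)) (\<lambda>_. ennreal \<bar>det A\<bar>)) X
      = (\<integral>\<^sup>+x. ennreal \<bar>det A\<bar> * indicator X x \<partial>distr lborel borel (\<lambda>x. A *v x))"
      by (rule emeasure_density) auto
    also have "\<dots> = ennreal \<bar>det A\<bar> * (\<integral>\<^sup>+x. indicator X (A *v x) \<partial>lborel)"
      by (subst nn_integral_distr') (auto intro!: nn_integral_cmult)
    also have "\<dots> = (\<integral>\<^sup>+x. indicator X x \<partial>lborel)" by (rule nn_integral_matrix[OF assms]) simp
    finally show ?thesis by simp
  qed
qed simp

text \<open>For Fourier integrals, which are complex-valued.\<close>

lemma integral_matrix:
  fixes A :: "real^'n^'n" and F :: "real^'n \<Rightarrow> complex"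
  assumes "det A \<noteq> 0" "F \<in> borel_measurable borel"
  shows "(\<integral>x. F x \<partial>lborel) = \<bar>det A\<bar> *\<^sub>R (\<integral>x. F (A *v x) \<partial>lborel)"
  using assms(2)
  by (subst lborel_matrix[OF assms(1)])
     (simp add: integral_density integral_distr)

section \<open>Whitening and Gaussian densities\<close>

text \<open>If \<open>K\<close> is a covariance matrix, its inverse is
  \<open>B ** transpose B\<close>, so \<open>transpose B\<close> sends a vector of covariance
  \<open>K\<close> to one of covariance \<open>mat 1\<close>. Any such \<open>B\<close> will do in
  place of a symmetric square root of the inverse.\<close>

definition whitens :: "real^'n^'n \<Rightarrow> real^'n^'n \<Rightarrow> bool" where
  "whitens B K \<longleftrightarrow> transpose B ** K ** B = mat 1"

lemma column_inner: "column k B \<bullet> x = (transpose B *v x) $ k" for B :: "real^'n^'n"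
  by (simp add: column_def inner_vec_def matrix_vector_mult_def transpose_def)

lemma whitens_column:
  assumes "whitens B K"
  shows "column i B \<bullet> (K *v column j B) = (if i = j then 1 else 0)"
proof -
  have "column i B \<bullet> (K *v column j B) = (transpose B *v (K *v (B *v axis j 1))) $ i"
    by (simp add: column_inner matrix_vector_mult_basis)
  also have "\<dots> = ((transpose B ** K ** B) *v axis j 1) $ i"
    by (simp add: matrix_vector_mul_assoc matrix_mul_assoc)
  finally show ?thesis using assms by (simp add: whitens_def axis_def)
qed

lemma inner_matrix_left: "(A *v x) \<bullet> y = x \<bullet> (transpose A *v y)" for A :: "real^'n^'m"
  by (metis dot_lmul_matrix inner_commute transpose_matrix_vector)

lemma whitens_quadratic:
  assumes "whitens B K" shows "(B *v y) \<bullet> (K *v (B *v y)) = y \<bullet> y"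
proof -
  have "(B *v y) \<bullet> (K *v (B *v y)) = y \<bullet> (transpose B *v (K *v (B *v y)))"
    by (rule inner_matrix_left)
  also have "\<dots> = y \<bullet> ((transpose B ** K ** B) *v y)"
    by (simp only: matrix_vector_mul_assoc matrix_mul_assoc)
  finally show ?thesis using assms by (simp add: whitens_def)
qed

lemma whitens_det:
  fixes B :: "real^'n^'n"
  assumes "whitens B K"
  shows "(det B)\<^sup>2 * det K = 1" "det B \<noteq> 0" "0 < det K" "ln \<bar>det B\<bar> = - ln (det K) / 2"
proof -
  have "det (transpose B ** K ** B) = det (mat 1 :: real^'n^'n)" using assms by (simp add: whitens_def)
  then show 1: "(det B)\<^sup>2 * det K = 1" by (simp add: det_mul power2_eq_square mult_ac)
  then show nz: "det B \<noteq> 0" by auto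
  have K: "det K = 1 / (det B)\<^sup>2" using 1 nz by (simp add: field_simps)
  show "0 < det K" unfolding K using nz by simp
  have "(det B)\<^sup>2 = \<bar>det B\<bar> * \<bar>det B\<bar>" by (simp add: power2_eq_square)
  then have "ln ((det B)\<^sup>2) = 2 * ln \<bar>det B\<bar>" using nz by (simp only:) (subst ln_mult_pos, auto)
  then show "ln \<bar>det B\<bar> = - ln (det K) / 2" unfolding K using nz by (simp add: ln_div)
qed

text \<open>Gram-Schmidt for the inner product given by \<open>K\<close>, adding one column at a
  time.\<close>

lemma whitening_exists:
  fixes K :: "real^'n^'n"
  assumes K: "pos_def K"
  shows "\<exists>B. whitens B K"
proof -
  have sym: "x \<bullet> (K *v y) = y \<bullet> (K *v x)" for x y
    using K unfolding pos_def_def by (metis dot_lmul_matrix inner_commute transpose_matrix_vector)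
  have "\<exists>b :: 'n \<Rightarrow> real^'n. \<forall>i\<in>J. \<forall>j\<in>J. b i \<bullet> (K *v b j) = (if i = j then 1 else 0)" for J :: "'n set"
    using finite[of J]
  proof (induction J rule: finite_induct)
    case (insert k J)
    then obtain b :: "'n \<Rightarrow> real^'n" where b: "\<And>i j. i \<in> J \<Longrightarrow> j \<in> J \<Longrightarrow> b i \<bullet> (K *v b j) = (if i = j then 1 else 0)" by blast
    \<comment> \<open>Fewer than \<open>CARD('n)\<close> vectors \<open>K *v b j\<close> leave a
      nonzero \<open>v\<close> orthogonal to all of them, that is, orthogonal to the
      \<open>b j\<close> in the inner product of \<open>K\<close>.\<close>
    let ?S = "(\<lambda>j. K *v b j) ` J"
    have "card J < CARD('n)" using insert by (intro psubset_card_mono) auto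
    then have "dim ?S < DIM(real^'n)"
      using dim_le_card'[of ?S] card_image_le[OF insert(1), of "\<lambda>j. K *v b j"] insert(1) by simp
    then obtain v where v: "v \<noteq> 0" "\<And>y. y \<in> span ?S \<Longrightarrow> orthogonal v y"
      using orthogonal_to_subspace_exists by blast
    have vo: "v \<bullet> (K *v b j) = 0" if "j \<in> J" for j
      using v(2)[OF span_base, of "K *v b j"] that by (auto simp: orthogonal_def)
    define q where "q = v \<bullet> (K *v v)"
    have q: "0 < q" using K v(1) by (simp add: q_def pos_def_def)
    define b' where "b' i = (if i = k then (1 / sqrt q) *\<^sub>R v else b i)" for i
    have "\<forall>i\<in>insert k J. \<forall>j\<in>insert k J. b' i \<bullet> (K *v b' j) = (if i = j then 1 else 0)"
    proof (intro ballI)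
      fix i j assume ij: "i \<in> insert k J" "j \<in> insert k J"
      have kk: "((1 / sqrt q) *\<^sub>R v) \<bullet> (K *v ((1 / sqrt q) *\<^sub>R v)) = 1"
        using q by (simp add: matrix_vector_mult_scaleR q_def[symmetric])
      have kj: "((1 / sqrt q) *\<^sub>R v) \<bullet> (K *v b j) = 0" "b j \<bullet> (K *v ((1 / sqrt q) *\<^sub>R v)) = 0" if "j \<in> J" for j
        using vo[OF that] sym[of "b j" v] by (simp_all add: matrix_vector_mult_scaleR)
      show "b' i \<bullet> (K *v b' j) = (if i = j then 1 else 0)"
        using ij insert(2) kk kj b by (auto simp: b'_def)
    qed
    then show ?case by blast
  qed simp
  from this[of UNIV] obtain b :: "'n \<Rightarrow> real^'n" where b: "\<And>i j. b i \<bullet> (K *v b j) = (if i = j then 1 else 0)" by blast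
  define B :: "real^'n^'n" where "B = (\<chi> i j. b j $ i)"
  have col: "column j B = b j" for j by (simp add: B_def column_def vec_eq_iff)
  have "(transpose B ** K ** B) $ i $ j = (mat 1 :: real^'n^'n) $ i $ j" for i j
  proof -
    have "(transpose B ** K ** B) $ i $ j = ((transpose B ** K ** B) *v axis j 1) $ i"
      by (simp add: matrix_vector_mult_basis column_def)
    also have "\<dots> = (transpose B *v (K *v (B *v axis j 1))) $ i" by (simp add: matrix_vector_mul_assoc matrix_mul_assoc)
    also have "\<dots> = b i \<bullet> (K *v b j)" unfolding column_inner[symmetric] matrix_vector_mult_basis col ..
    finally show ?thesis by (simp add: b mat_def)
  qed
  then show ?thesis by (auto simp: whitens_def vec_eq_iff)
qed

text \<open>If \<open>B\<close> whitens \<open>K\<close>, this is the centred normal density of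
  covariance \<open>K\<close>, written as a product over the whitened coordinates; its logarithm is
  then a constant minus half a sum of squares of linear forms.\<close>

definition gdens :: "real^'n^'n \<Rightarrow> real^'n \<Rightarrow> real" where
  "gdens B x = \<bar>det B\<bar> * (\<Prod>k\<in>UNIV. std_normal_density (column k B \<bullet> x))"

lemma gdens_pos: "det B \<noteq> 0 \<Longrightarrow> 0 < gdens B x"
  unfolding gdens_def by (intro mult_pos_pos prod_pos std_normal_density_props(2)) auto

lemma gdens_measurable[measurable]: "gdens B \<in> borel_measurable borel"
  unfolding gdens_def by measurable

lemma ln_gdens:
  fixes B :: "real^'n^'n"
  assumes "det B \<noteq> 0"
  shows "ln (gdens B x) = ln \<bar>det B\<bar> - real CARD('n) / 2 * ln (2 * pi) - (\<Sum>k\<in>UNIV. (column k B \<bullet> x)\<^sup>2) / 2"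
proof -
  have "ln (gdens B x) = ln \<bar>det B\<bar> + (\<Sum>k\<in>UNIV. ln (std_normal_density (column k B \<bullet> x)))"
    unfolding gdens_def using assms std_normal_density_props(2)
    by (subst ln_mult_pos) (auto intro!: prod_pos ln_prod simp: less_imp_neq[symmetric])
  then show ?thesis by (simp add: ln_std_normal_density sum_subtractf sum_divide_distrib)
qed

lemma gdens_nn:
  fixes B :: "real^'n^'n"
  assumes B: "det B \<noteq> 0"
  shows "(\<integral>\<^sup>+x. ennreal (gdens B (x - m)) \<partial>lborel) = 1"
proof -
  define F :: "real^'n \<Rightarrow> ennreal" where "F y = (\<Prod>k\<in>UNIV. ennreal (std_normal_density (y $ k - column k B \<bullet> m)))" for y
  have F[measurable]: "F \<in> borel_measurable borel" unfolding F_def by measurable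
  have "(\<integral>\<^sup>+x. ennreal (gdens B (x - m)) \<partial>lborel) = (\<integral>\<^sup>+x. ennreal \<bar>det (transpose B)\<bar> * F (transpose B *v x) \<partial>lborel)"
    unfolding gdens_def F_def column_inner[symmetric] inner_diff_right
    by (simp add: det_transpose ennreal_mult' prod_ennreal)
  also have "\<dots> = ennreal \<bar>det (transpose B)\<bar> * (\<integral>\<^sup>+x. F (transpose B *v x) \<partial>lborel)"
    by (rule nn_integral_cmult) (simp add: measurable_compose[OF matrix_vector_mult_measurable F] del: transpose_matrix_vector)
  also have "\<dots> = (\<integral>\<^sup>+x. F x \<partial>lborel)" by (rule nn_integral_matrix) (use B in \<open>auto simp: det_transpose\<close>)
  also have "\<dots> = (\<integral>\<^sup>+v. F (\<chi> k. v k) \<partial>lborel_on (range (\<lambda>k. k)))" by (rule nn_integral_vec[symmetric]) auto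
  also have "\<dots> = (\<integral>\<^sup>+v. (\<Prod>k\<in>range (\<lambda>k. k). ennreal (std_normal_density (v k - column k B \<bullet> m))) \<partial>lborel_on (range (\<lambda>k. k)))"
    by (simp add: F_def)
  also have "\<dots> = (\<Prod>k\<in>range (\<lambda>k. k). \<integral>\<^sup>+y. ennreal (std_normal_density (y - column k B \<bullet> m)) \<partial>lborel)"
    by (rule lborel_on.product_nn_integral_prod) auto
  also have "\<dots> = (\<Prod>k\<in>range (\<lambda>k::'n. k). 1)"
  proof (rule prod.cong)
    fix k
    have "(\<integral>\<^sup>+y. ennreal (std_normal_density (y - column k B \<bullet> m)) \<partial>lborel) = (\<integral>\<^sup>+y. ennreal (std_normal_density y) \<partial>lborel)"
      by (subst nn_integral_real_affine[where c = 1 and t = "column k B \<bullet> m"]) auto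
    then show "(\<integral>\<^sup>+y. ennreal (std_normal_density (y - column k B \<bullet> m)) \<partial>lborel) = 1"
      by (simp add: std_normal_density_props(3))
  qed simp
  finally show ?thesis by simp
qed

text \<open>Injectivity of the uncurried \<open>e\<close> says that each block has full dimension
  and that different blocks are disjoint, so the integral splits off one block at a time. The
  centres \<open>m t\<close> are free: later they are decoder outputs.\<close>

lemma gdens_block:
  fixes e :: "'t \<Rightarrow> 'n::finite \<Rightarrow> 'i" and B :: "real^'n^'n"
  assumes B: "det B \<noteq> 0" and T: "finite T" and e: "inj (\<lambda>(t, k). e t k)"
  shows "(\<lambda>v. \<Prod>t\<in>T. gdens B ((\<chi> k. v (e t k)) - m t)) \<in> borel_measurable (lborel_on (\<Union>t\<in>T. range (e t)))"
    and "(\<integral>\<^sup>+v. ennreal (\<Prod>t\<in>T. gdens B ((\<chi> k. v (e t k)) - m t)) \<partial>lborel_on (\<Union>t\<in>T. range (e t))) = 1"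
proof -
  have blk: "(\<lambda>v. \<chi> k. v (e t k)) \<in> lborel_on J \<rightarrow>\<^sub>M borel" if "range (e t) \<subseteq> J" for t J
    using that by (intro borel_measurable_vec) (auto simp: image_subset_iff)
  have meas: "(\<lambda>v. \<Prod>t\<in>T. gdens B ((\<chi> k. v (e t k)) - m t)) \<in> borel_measurable (lborel_on J)"
    if "\<And>t. t \<in> T \<Longrightarrow> range (e t) \<subseteq> J" for T J
    using that by (intro borel_measurable_prod measurable_compose[OF borel_measurable_diff gdens_measurable] blk) auto
  show "(\<lambda>v. \<Prod>t\<in>T. gdens B ((\<chi> k. v (e t k)) - m t)) \<in> borel_measurable (lborel_on (\<Union>t\<in>T. range (e t)))"
    by (rule meas) auto
  show "(\<integral>\<^sup>+v. ennreal (\<Prod>t\<in>T. gdens B ((\<chi> k. v (e t k)) - m t)) \<partial>lborel_on (\<Union>t\<in>T. range (e t))) = 1"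
    using T
  proof (induction T rule: finite_induct)
    case empty
    interpret P: prob_space "lborel_on {} :: ('i \<Rightarrow> real) measure"
      by (simp add: PiM_empty prob_spaceI)
    show ?case using P.emeasure_space_1 by simp
  next
    case (insert t T)
    let ?I = "\<Union>t\<in>T. range (e t)" and ?J = "range (e t)"
    have et: "inj (e t)" using e by (force simp: inj_def)
    have dis: "?I \<inter> ?J = {}" using e insert(2) by (force simp: inj_def)
    have U: "(\<Union>t\<in>insert t T. range (e t)) = ?I \<union> ?J" by auto
    have m1: "(\<lambda>v. ennreal (\<Prod>t\<in>insert t T. gdens B ((\<chi> k. v (e t k)) - m t))) \<in> borel_measurable (lborel_on (?I \<union> ?J))"
      by (rule measurable_compose[OF meas measurable_ennreal]) auto
    have mg: "merge ?I ?J (x, y) (e s k) = (if s = t then y (e s k) else x (e s k))" if "s \<in> insert t T" for s k x y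
    proof -
      have "e s k \<notin> ?I" if "s = t" using that e insert(2) by (force simp: inj_def)
      then show ?thesis using \<open>s \<in> insert t T\<close> by (auto simp: merge_def)
    qed
    have pos: "0 \<le> gdens B z" for z using gdens_pos[OF B, of z] by simp
    have "(\<integral>\<^sup>+v. ennreal (\<Prod>t\<in>insert t T. gdens B ((\<chi> k. v (e t k)) - m t)) \<partial>lborel_on (?I \<union> ?J))
      = (\<integral>\<^sup>+x. \<integral>\<^sup>+y. ennreal (\<Prod>s\<in>insert t T. gdens B ((\<chi> k. merge ?I ?J (x, y) (e s k)) - m s)) \<partial>lborel_on ?J \<partial>lborel_on ?I)"
      using insert(1) by (intro lborel_on.product_nn_integral_fold[OF dis _ _ m1]) auto
    also have "\<dots> = (\<integral>\<^sup>+x. \<integral>\<^sup>+y. ennreal (\<Prod>s\<in>T. gdens B ((\<chi> k. x (e s k)) - m s)) * ennreal (gdens B ((\<chi> k. y (e t k)) - m t)) \<partial>lborel_on ?J \<partial>lborel_on ?I)"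
    proof (intro nn_integral_cong)
      fix x y
      have "(\<Prod>s\<in>insert t T. gdens B ((\<chi> k. merge ?I ?J (x, y) (e s k)) - m s))
        = gdens B ((\<chi> k. y (e t k)) - m t) * (\<Prod>s\<in>T. gdens B ((\<chi> k. x (e s k)) - m s))"
      proof (subst prod.insert[OF insert(1,2)], rule arg_cong2[where f = "(*)"])
        show "gdens B ((\<chi> k. merge ?I ?J (x, y) (e t k)) - m t) = gdens B ((\<chi> k. y (e t k)) - m t)" by (simp add: mg)
        have "(\<chi> k. merge ?I ?J (x, y) (e s k)) = (\<chi> k. x (e s k))" if "s \<in> T" for s
          using that insert(2) by (subst vec_eq_iff) (auto simp: mg)
        then show "(\<Prod>s\<in>T. gdens B ((\<chi> k. merge ?I ?J (x, y) (e s k)) - m s)) = (\<Prod>s\<in>T. gdens B ((\<chi> k. x (e s k)) - m s))"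
          by (intro prod.cong) auto
      qed
      then show "ennreal (\<Prod>s\<in>insert t T. gdens B ((\<chi> k. merge ?I ?J (x, y) (e s k)) - m s))
        = ennreal (\<Prod>s\<in>T. gdens B ((\<chi> k. x (e s k)) - m s)) * ennreal (gdens B ((\<chi> k. y (e t k)) - m t))"
        using pos by (simp add: ennreal_mult prod_nonneg mult.commute)
    qed
    also have "\<dots> = (\<integral>\<^sup>+x. ennreal (\<Prod>s\<in>T. gdens B ((\<chi> k. x (e s k)) - m s)) * (\<integral>\<^sup>+y. ennreal (gdens B ((\<chi> k. y (e t k)) - m t)) \<partial>lborel_on ?J) \<partial>lborel_on ?I)"
      using measurable_compose[OF borel_measurable_diff[OF blk[OF order_refl, of t] borel_measurable_const] gdens_measurable]
      by (intro nn_integral_cong nn_integral_cmult) auto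
    also have "(\<integral>\<^sup>+y. ennreal (gdens B ((\<chi> k. y (e t k)) - m t)) \<partial>lborel_on ?J) = 1"
      using nn_integral_vec[OF et, of "\<lambda>x. ennreal (gdens B (x - m t))"] by (simp add: gdens_nn[OF B])
    finally show ?case using insert.IH by (simp only: U mult_1_right)
  qed
qed

lemma std_normal_fourier:
  fixes t :: "real^'n"
  shows "integrable lborel (\<lambda>x :: real^'n. iexp (t \<bullet> x) * complex_of_real (\<Prod>k\<in>UNIV. std_normal_density (x $ k)))"
    and "(\<integral>x. iexp (t \<bullet> x) * complex_of_real (\<Prod>k\<in>UNIV. std_normal_density (x $ k)) \<partial>lborel) = complex_of_real (exp (- (t \<bullet> t) / 2))"
proof -
  let ?f = "\<lambda>x :: real^'n. iexp (t \<bullet> x) * complex_of_real (\<Prod>k\<in>UNIV. std_normal_density (x $ k))"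
  let ?g = "\<lambda>k y. iexp (t $ k * y) * complex_of_real (std_normal_density y)"
  let ?h = "\<lambda>v :: 'n \<Rightarrow> real. \<chi> k. v k"
  have h: "?h \<in> lborel_on (range (\<lambda>k. k)) \<rightarrow>\<^sub>M (borel :: (real^'n) measure)"
    and d: "distr (lborel_on (range (\<lambda>k. k))) borel ?h = lborel"
    using lborel_vec[of "\<lambda>k::'n. k"] by simp_all
  have fm: "?f \<in> borel_measurable borel" by measurable
  have gi: "integrable lborel (?g k)" for k
    by (rule Bochner_Integration.integrable_bound[OF integrable_normal_density[of 1 0]]) (auto simp: norm_mult)
  have gv: "(\<integral>y. ?g k y \<partial>lborel) = complex_of_real (exp (- (t $ k)\<^sup>2 / 2))" for k
  proof -
    have "char std_normal_distribution (t $ k) = (\<integral>y. std_normal_density y *\<^sub>R iexp (t $ k * y) \<partial>lborel)"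
      unfolding char_def by (subst integral_density) auto
    also have "\<dots> = (\<integral>y. ?g k y \<partial>lborel)" by (simp add: scaleR_conv_of_real mult.commute)
    finally show ?thesis by (simp add: char_std_normal_distribution)
  qed
  have fg: "?f (?h v) = (\<Prod>k\<in>range (\<lambda>k. k). ?g k (v k))" for v
    by (simp add: inner_vec_def prod.distrib exp_sum sum_distrib_left)
  show "integrable lborel ?f"
    unfolding d[symmetric] integrable_distr_eq[OF h fm] fg
    by (rule lborel_on.product_integrable_prod) (use gi in auto)
  show "(\<integral>x. ?f x \<partial>lborel) = complex_of_real (exp (- (t \<bullet> t) / 2))"
  proof -
    have "(\<integral>x. ?f x \<partial>lborel) = (\<integral>v. (\<Prod>k\<in>range (\<lambda>k. k). ?g k (v k)) \<partial>lborel_on (range (\<lambda>k. k)))"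
      by (subst d[symmetric], subst integral_distr[OF h fm]) (simp only: fg)
    also have "\<dots> = (\<Prod>k\<in>range (\<lambda>k. k). \<integral>y. ?g k y \<partial>lborel)"
      by (rule lborel_on.product_integral_prod) (use gi in auto)
    also have "\<dots> = (\<Prod>k\<in>UNIV. complex_of_real (exp (- (t $ k)\<^sup>2 / 2)))" unfolding gv by simp
    also have "\<dots> = complex_of_real (exp (- (t \<bullet> t) / 2))"
      unfolding of_real_prod[symmetric] exp_sum[OF finite, symmetric]
      by (simp add: inner_vec_def power2_eq_square sum_divide_distrib sum_negf)
    finally show ?thesis .
  qed
qed

lemma prod_normal_density:
  fixes w q :: "real^'n"
  assumes "0 < s"
  shows "(\<Prod>k\<in>UNIV. normal_density (q $ k) s (w $ k))
    = (1 / (s * sqrt (2 * pi))) ^ CARD('n) * exp (- (((w - q) /\<^sub>R s) \<bullet> ((w - q) /\<^sub>R s)) / 2)"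
proof -
  have "normal_density (q $ k) s (w $ k) = 1 / (s * sqrt (2 * pi)) * exp (- (((w - q) /\<^sub>R s) $ k)\<^sup>2 / 2)" for k
    unfolding normal_density_def using assms
    by (simp add: real_sqrt_mult field_simps power_mult_distrib power_divide)
  then have "(\<Prod>k\<in>UNIV. normal_density (q $ k) s (w $ k))
     = (1 / (s * sqrt (2 * pi))) ^ CARD('n) * (\<Prod>k\<in>UNIV. exp (- (((w - q) /\<^sub>R s) $ k)\<^sup>2 / 2))"
    by (simp only: prod.distrib prod_constant)
  also have "(\<Prod>k\<in>UNIV. exp (- (((w - q) /\<^sub>R s) $ k)\<^sup>2 / 2)) = exp (- (((w - q) /\<^sub>R s) \<bullet> ((w - q) /\<^sub>R s)) / 2)"
    unfolding exp_sum[OF finite, symmetric]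
    by (simp add: inner_vec_def power2_eq_square sum_divide_distrib sum_negf)
  finally show ?thesis .
qed

lemma prod_std_normal_density:
  fixes x :: "real^'n"
  shows "(\<Prod>k\<in>UNIV. std_normal_density (x $ k)) = (1 / sqrt (2 * pi)) ^ CARD('n) * exp (- (x \<bullet> x) / 2)"
proof -
  have "(\<Prod>k\<in>UNIV. std_normal_density (x $ k)) = (1 / sqrt (2 * pi)) ^ CARD('n) * (\<Prod>k\<in>UNIV. exp (- (x $ k)\<^sup>2 / 2))"
    unfolding std_normal_density_def by (simp only: prod.distrib prod_constant)
  also have "(\<Prod>k\<in>UNIV. exp (- (x $ k)\<^sup>2 / 2)) = exp (- (x \<bullet> x) / 2)"
    unfolding exp_sum[OF finite, symmetric]
    by (simp add: inner_vec_def power2_eq_square sum_divide_distrib sum_negf)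
  finally show ?thesis .
qed

text \<open>Fourier inversion of the smoothing kernel: only the characteristic function of \<open>Q\<close> enters,
  so no density of \<open>Q\<close> is needed.\<close>

lemma smoothed_gaussian_density:
  fixes Q :: "'w \<Rightarrow> real^'n" and C B :: "real^'n^'n"
  assumes M: "prob_space M" and Q[measurable]: "Q \<in> borel_measurable M"
    and char: "\<And>\<xi>. (\<integral>\<omega>. iexp (\<xi> \<bullet> Q \<omega>) \<partial>M) = complex_of_real (exp (- (\<xi> \<bullet> (C *v \<xi>)) / 2))"
    and s: "0 < s" and B: "whitens B (C + s\<^sup>2 *\<^sub>R mat 1)"
  shows "(\<integral>\<omega>. (\<Prod>k\<in>UNIV. normal_density (Q \<omega> $ k) s (w $ k)) \<partial>M) = gdens B w"
proof -
  interpret M: prob_space M by fact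
  interpret MB: pair_sigma_finite M "lborel :: (real^'n) measure" ..
  let ?K = "C + s\<^sup>2 *\<^sub>R mat 1"
  define c where "c = (1 / (s * sqrt (2 * pi))) ^ CARD('n)"
  define \<phi> :: "real^'n \<Rightarrow> real" where "\<phi> x = (\<Prod>k\<in>UNIV. std_normal_density (x $ k))" for x
  have phi_m[measurable]: "\<phi> \<in> borel_measurable borel" unfolding \<phi>_def by measurable
  have phi_pos: "0 \<le> \<phi> x" for x unfolding \<phi>_def by (intro prod_nonneg) simp
  have phi_i: "integrable lborel (\<lambda>x. complex_of_real (\<phi> x))"
    using std_normal_fourier(1)[of 0] by (simp add: \<phi>_def)
  have phi_e: "\<phi> x = (1 / sqrt (2 * pi)) ^ CARD('n) * exp (- (x \<bullet> x) / 2)" for x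
    unfolding \<phi>_def by (rule prod_std_normal_density)
  have det: "det B \<noteq> 0" by (rule whitens_det(2)[OF B])
  define G where "G \<omega> x = iexp (((w - Q \<omega>) /\<^sub>R s) \<bullet> x) * complex_of_real (\<phi> x)" for \<omega> x
  have G_m: "case_prod G \<in> borel_measurable (M \<Otimes>\<^sub>M lborel)" unfolding G_def by measurable
  have G_i: "integrable (M \<Otimes>\<^sub>M lborel) (case_prod G)"
  proof (rule Bochner_Integration.integrable_bound[OF _ G_m])
    have "(\<integral>\<^sup>+p. ennreal (norm (complex_of_real (\<phi> (snd p)))) \<partial>(M \<Otimes>\<^sub>M lborel)) = (\<integral>\<^sup>+\<omega>. \<integral>\<^sup>+x. ennreal (norm (complex_of_real (\<phi> x))) \<partial>lborel \<partial>M)"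
      by (subst lborel.nn_integral_fst[symmetric]) auto
    also have "\<dots> < \<infinity>" using phi_i by (simp add: integrable_iff_bounded M.emeasure_space_1)
    finally show "integrable (M \<Otimes>\<^sub>M lborel) (\<lambda>p. complex_of_real (\<phi> (snd p)))"
      by (intro integrableI_bounded) auto
    show "AE p in M \<Otimes>\<^sub>M lborel. norm (case_prod G p) \<le> norm (complex_of_real (\<phi> (snd p)))"
      by (auto simp: G_def norm_mult case_prod_beta)
  qed
  \<comment> \<open>The normal kernel is itself a Fourier transform: up to the constant
    \<open>c\<close>, that of \<open>\<phi>\<close> at \<open>(w - Q \<omega>) / s\<close>. After
    exchanging the integrals only the characteristic function of \<open>Q\<close> remains.\<close>
  have kern: "complex_of_real (\<Prod>k\<in>UNIV. normal_density (Q \<omega> $ k) s (w $ k)) = complex_of_real c * (\<integral>x. G \<omega> x \<partial>lborel)" for \<omega>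
    unfolding prod_normal_density[OF s] c_def G_def \<phi>_def std_normal_fourier(2) by simp
  \<comment> \<open>\<open>A\<close> is \<open>s\<close> times \<open>B\<close>. Substituting
    \<open>A *v y\<close> turns the quadratic exponents of \<open>\<phi>\<close> and of the
    characteristic function together into \<open>y \<bullet> y\<close>, because \<open>B\<close>
    whitens \<open>C\<close> plus s^2 I.\<close>
  define A where "A = (\<chi> i. s *s B $ i)"
  have A: "det A = s ^ CARD('n) * det B"
    unfolding A_def using det_rows_mul[of "\<lambda>_. s" "\<lambda>i. B $ i"] by simp
  have Av: "A *v y = s *\<^sub>R (B *v y)" for y
    by (simp add: A_def vec_eq_iff matrix_vector_mult_def sum_distrib_left mult.assoc)
  define F where "F x = iexp ((w /\<^sub>R s) \<bullet> x) * complex_of_real (\<phi> x * exp (- ((x /\<^sub>R s) \<bullet> (C *v (x /\<^sub>R s))) / 2))" for x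
  have F_m: "F \<in> borel_measurable borel"
  proof -
    have [measurable]: "(\<lambda>x. C *v (x /\<^sub>R s)) \<in> borel_measurable borel"
      by (rule measurable_compose[OF _ matrix_vector_mult_measurable]) simp
    show ?thesis unfolding F_def by measurable
  qed
  have "complex_of_real (\<integral>\<omega>. (\<Prod>k\<in>UNIV. normal_density (Q \<omega> $ k) s (w $ k)) \<partial>M) = (\<integral>\<omega>. complex_of_real c * (\<integral>x. G \<omega> x \<partial>lborel) \<partial>M)"
    unfolding kern[symmetric] by (rule integral_complex_of_real[symmetric])
  also have "\<dots> = complex_of_real c * (\<integral>\<omega>. (\<integral>x. G \<omega> x \<partial>lborel) \<partial>M)" by simp
  also have "(\<integral>\<omega>. (\<integral>x. G \<omega> x \<partial>lborel) \<partial>M) = (\<integral>x. (\<integral>\<omega>. G \<omega> x \<partial>M) \<partial>lborel)"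
    by (rule MB.Fubini_integral[OF G_i, symmetric])
  also have "\<dots> = (\<integral>x. F x \<partial>lborel)"
  proof (rule Bochner_Integration.integral_cong)
    fix x
    have "G \<omega> x = (iexp ((w /\<^sub>R s) \<bullet> x) * complex_of_real (\<phi> x)) * iexp ((- x /\<^sub>R s) \<bullet> Q \<omega>)" for \<omega>
      unfolding G_def by (simp add: exp_add[symmetric] inner_commute inner_diff_left algebra_simps exp_diff[symmetric] exp_minus[symmetric] diff_divide_distrib mult_exp_exp)
    then have "(\<integral>\<omega>. G \<omega> x \<partial>M) = (iexp ((w /\<^sub>R s) \<bullet> x) * complex_of_real (\<phi> x)) * (\<integral>\<omega>. iexp ((- x /\<^sub>R s) \<bullet> Q \<omega>) \<partial>M)"
      by (simp only: integral_mult_right_zero)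
    also have "\<dots> = F x"
      unfolding char F_def by (simp add: matrix_vector_mult_scaleR linear_neg[OF matrix_vector_mul_linear] mult.assoc)
    finally show "(\<integral>\<omega>. G \<omega> x \<partial>M) = F x" .
  qed simp
  also have "\<dots> = \<bar>det A\<bar> *\<^sub>R (\<integral>y. F (A *v y) \<partial>lborel)"
    by (rule integral_matrix[OF _ F_m]) (use A s det in auto)
  also have "(\<integral>y. F (A *v y) \<partial>lborel) = (\<integral>y. iexp ((transpose B *v w) \<bullet> y) * complex_of_real (\<phi> y) \<partial>lborel)"
  proof (rule Bochner_Integration.integral_cong)
    fix y
    have 1: "(w /\<^sub>R s) \<bullet> (A *v y) = (transpose B *v w) \<bullet> y"
      unfolding Av using s inner_matrix_left[of "transpose B" w y] by (simp add: transpose_transpose)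
    have 2: "(A *v y) /\<^sub>R s = B *v y" unfolding Av using s by simp
    have "(B *v y) \<bullet> (?K *v (B *v y)) = y \<bullet> y" by (rule whitens_quadratic[OF B])
    then have "(B *v y) \<bullet> (C *v (B *v y)) + s\<^sup>2 * ((B *v y) \<bullet> (B *v y)) = y \<bullet> y"
      by (simp add: matrix_vector_mult_add_rdistrib scaleR_matrix_vector_assoc[symmetric] inner_add_right)
    then have "- ((A *v y) \<bullet> (A *v y)) / 2 + - ((B *v y) \<bullet> (C *v (B *v y))) / 2 = - (y \<bullet> y) / 2"
      unfolding Av by (simp add: power2_eq_square algebra_simps)
    then have 3: "\<phi> (A *v y) * exp (- ((B *v y) \<bullet> (C *v (B *v y))) / 2) = \<phi> y"
      unfolding phi_e mult.assoc exp_add[symmetric] by simp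
    show "F (A *v y) = iexp ((transpose B *v w) \<bullet> y) * complex_of_real (\<phi> y)"
      unfolding F_def 1 2 3 ..
  qed simp
  also have "\<dots> = complex_of_real (exp (- ((transpose B *v w) \<bullet> (transpose B *v w)) / 2))"
    unfolding \<phi>_def by (rule std_normal_fourier(2))
  finally have "complex_of_real (\<integral>\<omega>. (\<Prod>k\<in>UNIV. normal_density (Q \<omega> $ k) s (w $ k)) \<partial>M)
    = complex_of_real (c * (\<bar>det A\<bar> * exp (- ((transpose B *v w) \<bullet> (transpose B *v w)) / 2)))"
    by (simp add: scaleR_conv_of_real)
  then have "(\<integral>\<omega>. (\<Prod>k\<in>UNIV. normal_density (Q \<omega> $ k) s (w $ k)) \<partial>M)
    = c * (\<bar>det A\<bar> * exp (- ((transpose B *v w) \<bullet> (transpose B *v w)) / 2))" by (simp only: of_real_eq_iff)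
  also have "c * \<bar>det A\<bar> = \<bar>det B\<bar> * (1 / sqrt (2 * pi)) ^ CARD('n)"
    unfolding A c_def using s by (simp add: abs_mult power_mult_distrib power_divide)
  then have "c * (\<bar>det A\<bar> * exp (- ((transpose B *v w) \<bullet> (transpose B *v w)) / 2)) = gdens B w"
    unfolding gdens_def column_inner prod_std_normal_density by (simp only: mult.assoc[symmetric])
  finally show ?thesis .
qed

section \<open>Centred Gaussian vectors and their linear forms\<close>

definition gauss :: "real^'n^'n \<Rightarrow> (real^'n) measure" where
  "gauss B = density lborel (\<lambda>u. ennreal (gdens B u))"

lemma sets_gauss[measurable_cong, simp]: "sets (gauss B) = sets borel"
  by (simp add: gauss_def)

lemma prob_space_gauss: "det B \<noteq> 0 \<Longrightarrow> prob_space (gauss B)"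
  using gdens_nn[of B 0] by (auto intro!: prob_spaceI simp: gauss_def emeasure_density)

text \<open>Solving \<open>B *v \<eta> = \<xi>\<close> reduces to the standard normal transform at
  \<open>\<eta>\<close>. The second claim makes the square root of the form meaningful as a standard
  deviation in \<open>gauss_linear_law\<close>.\<close>

lemma gauss_char:
  fixes B U :: "real^'n^'n"
  assumes B: "whitens B U"
  shows "(\<integral>u. iexp (\<xi> \<bullet> u) \<partial>gauss B) = complex_of_real (exp (- (\<xi> \<bullet> (U *v \<xi>)) / 2))"
    and "0 \<le> \<xi> \<bullet> (U *v \<xi>)"
proof -
  have det: "det B \<noteq> 0" by (rule whitens_det(2)[OF B])
  obtain B' where inv: "B ** B' = mat 1"
    using det by (auto simp: invertible_det_nz[symmetric] invertible_def)
  define \<eta> where "\<eta> = B' *v \<xi>"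
  have B\<eta>: "B *v \<eta> = \<xi>" unfolding \<eta>_def by (simp add: matrix_vector_mul_assoc inv)
  have q: "\<xi> \<bullet> (U *v \<xi>) = \<eta> \<bullet> \<eta>" using whitens_quadratic[OF B, of \<eta>] by (simp add: B\<eta>)
  then show "0 \<le> \<xi> \<bullet> (U *v \<xi>)" by simp
  define F where "F y = iexp (\<eta> \<bullet> y) * complex_of_real (\<Prod>k\<in>UNIV. std_normal_density (y $ k))" for y :: "real^'n"
  have Fm: "F \<in> borel_measurable borel" unfolding F_def by measurable
  have "(\<integral>u. iexp (\<xi> \<bullet> u) \<partial>gauss B) = (\<integral>u. gdens B u *\<^sub>R iexp (\<xi> \<bullet> u) \<partial>lborel)"
    unfolding gauss_def by (subst integral_density) (auto intro!: AE_I2 less_imp_le[OF gdens_pos] det)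
  also have "\<dots> = (\<integral>u. \<bar>det (transpose B)\<bar> *\<^sub>R F (transpose B *v u) \<partial>lborel)"
  proof (rule Bochner_Integration.integral_cong)
    fix u
    have "\<eta> \<bullet> (transpose B *v u) = \<xi> \<bullet> u" using inner_matrix_left[of B \<eta> u] by (simp only: B\<eta>)
    then show "gdens B u *\<^sub>R iexp (\<xi> \<bullet> u) = \<bar>det (transpose B)\<bar> *\<^sub>R F (transpose B *v u)"
      unfolding F_def gdens_def column_inner by (simp add: det_transpose scaleR_conv_of_real mult_ac del: transpose_matrix_vector)
  qed simp
  also have "\<dots> = (\<integral>y. F y \<partial>lborel)"
    using integral_matrix[of "transpose B" F] det Fm by (simp add: det_transpose del: transpose_matrix_vector)
  also have "\<dots> = complex_of_real (exp (- (\<eta> \<bullet> \<eta>) / 2))" unfolding F_def by (rule std_normal_fourier(2))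
  finally show "(\<integral>u. iexp (\<xi> \<bullet> u) \<partial>gauss B) = complex_of_real (exp (- (\<xi> \<bullet> (U *v \<xi>)) / 2))" by (simp add: q)
qed

text \<open>Equal characteristic functions. Moments of linear forms are thereby those of a scaled
  standard normal; the degenerate form \<open>b = 0\<close> is included, since the right side is an
  image measure and not a density.\<close>

lemma gauss_linear_law:
  fixes B U :: "real^'n^'n"
  assumes B: "whitens B U"
  shows "distr (gauss B) borel (\<lambda>u. b \<bullet> u) = distr std_normal borel (\<lambda>z. sqrt (b \<bullet> (U *v b)) * z)"
proof (rule Levy_uniqueness)
  interpret G: prob_space "gauss B" by (rule prob_space_gauss[OF whitens_det(2)[OF B]])
  let ?s = "sqrt (b \<bullet> (U *v b))"
  show "real_distribution (distr (gauss B) borel (\<lambda>u. b \<bullet> u))"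
    unfolding real_distribution_def real_distribution_axioms_def using G.prob_space_distr[of "\<lambda>u. b \<bullet> u" borel] by simp
  show "real_distribution (distr std_normal borel (\<lambda>z. ?s * z))"
    unfolding real_distribution_def real_distribution_axioms_def using std_normal.prob_space_distr[of "\<lambda>z. ?s * z" borel] by simp
  show "char (distr (gauss B) borel (\<lambda>u. b \<bullet> u)) = char (distr std_normal borel (\<lambda>z. ?s * z))"
  proof
    fix t
    have 1: "char (distr (gauss B) borel (\<lambda>u. b \<bullet> u)) t = complex_of_real (exp (- ((t *\<^sub>R b) \<bullet> (U *v (t *\<^sub>R b))) / 2))"
      unfolding char_def using gauss_char(1)[OF B, of "t *\<^sub>R b"] by (subst integral_distr) auto
    have "char (distr std_normal borel (\<lambda>z. ?s * z)) t = char std_normal_distribution (t * ?s)"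
      unfolding char_def by (subst integral_distr) (auto simp: mult_ac)
    also have "\<dots> = complex_of_real (exp (- (t * ?s)\<^sup>2 / 2))" by (simp add: char_std_normal_distribution)
    also have "(t * ?s)\<^sup>2 = (t *\<^sub>R b) \<bullet> (U *v (t *\<^sub>R b))"
      using gauss_char(2)[OF B, of b] by (simp add: power_mult_distrib matrix_vector_mult_scaleR power2_eq_square)
    finally show "char (distr (gauss B) borel (\<lambda>u. b \<bullet> u)) t = char (distr std_normal borel (\<lambda>z. ?s * z)) t" by (simp add: 1)
  qed
qed

lemma gauss_moments:
  fixes B U :: "real^'n^'n"
  assumes B: "whitens B U"
  shows "integrable (gauss B) (\<lambda>u. (b \<bullet> u)\<^sup>2)" "(\<integral>u. (b \<bullet> u)\<^sup>2 \<partial>gauss B) = b \<bullet> (U *v b)"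
    "integrable (gauss B) (\<lambda>u. b \<bullet> u)" "(\<integral>u. b \<bullet> u \<partial>gauss B) = 0"
proof -
  have tr: "integrable (gauss B) (\<lambda>u. f (b \<bullet> u)) = integrable std_normal (\<lambda>z. f (sqrt (b \<bullet> (U *v b)) * z))"
    "(\<integral>u. f (b \<bullet> u) \<partial>gauss B) = (\<integral>z. f (sqrt (b \<bullet> (U *v b)) * z) \<partial>std_normal)"
    if [measurable]: "f \<in> borel_measurable borel" for f :: "real \<Rightarrow> real"
  proof -
    have "integrable (distr (gauss B) borel (\<lambda>u. b \<bullet> u)) f = integrable (distr std_normal borel (\<lambda>z. sqrt (b \<bullet> (U *v b)) * z)) f"
      by (simp only: gauss_linear_law[OF B])
    then show "integrable (gauss B) (\<lambda>u. f (b \<bullet> u)) = integrable std_normal (\<lambda>z. f (sqrt (b \<bullet> (U *v b)) * z))"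
      by (subst (asm) (1 2) integrable_distr_eq) auto
    have "(\<integral>y. f y \<partial>distr (gauss B) borel (\<lambda>u. b \<bullet> u)) = (\<integral>y. f y \<partial>distr std_normal borel (\<lambda>z. sqrt (b \<bullet> (U *v b)) * z))"
      by (simp only: gauss_linear_law[OF B])
    then show "(\<integral>u. f (b \<bullet> u) \<partial>gauss B) = (\<integral>z. f (sqrt (b \<bullet> (U *v b)) * z) \<partial>std_normal)"
      by (subst (asm) (1 2) integral_distr) auto
  qed
  have sq: "(\<lambda>y::real. y\<^sup>2) \<in> borel_measurable borel" and idm: "(\<lambda>y::real. y) \<in> borel_measurable borel" by simp_all
  show "integrable (gauss B) (\<lambda>u. (b \<bullet> u)\<^sup>2)"
    unfolding tr(1)[OF sq] power_mult_distrib by (intro integrable_mult_right std_normal_second_moment(1))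
  show "(\<integral>u. (b \<bullet> u)\<^sup>2 \<partial>gauss B) = b \<bullet> (U *v b)"
    unfolding tr(2)[OF sq] power_mult_distrib real_sqrt_pow2[OF gauss_char(2)[OF B]]
    using std_normal_second_moment(2) by simp
  show "integrable (gauss B) (\<lambda>u. b \<bullet> u)"
    unfolding tr(1)[OF idm] by (intro integrable_mult_right std_normal_second_moment(3))
  show "(\<integral>u. b \<bullet> u \<partial>gauss B) = 0"
    unfolding tr(2)[OF idm] using std_normal_second_moment(4) by simp
qed

text \<open>A pair of blocks regrouped as a block of pairs. In \<open>joint_block_law\<close> it is
  read backwards, to separate the sources from the noises.\<close>

lemma zip_PiM:
  assumes I: "finite I" and N1: "prob_space N1" and N2: "prob_space N2"
  shows "distr (Pi\<^sub>M I (\<lambda>_. N1) \<Otimes>\<^sub>M Pi\<^sub>M I (\<lambda>_. N2)) (Pi\<^sub>M I (\<lambda>_. N1 \<Otimes>\<^sub>M N2)) (\<lambda>p. \<lambda>i\<in>I. (fst p i, snd p i))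
    = Pi\<^sub>M I (\<lambda>_. N1 \<Otimes>\<^sub>M N2)"
proof -
  interpret N1: prob_space N1 by fact
  interpret N2: prob_space N2 by fact
  interpret N12: pair_prob_space N1 N2 ..
  interpret P1: product_sigma_finite "\<lambda>_. N1" by standard
  interpret P2: product_sigma_finite "\<lambda>_. N2" by standard
  interpret P12: product_sigma_finite "\<lambda>_. N1 \<Otimes>\<^sub>M N2" by standard
  interpret Q2: prob_space "Pi\<^sub>M I (\<lambda>_. N2)" by (intro prob_space_PiM N2)
  show ?thesis
  proof (rule P12.PiM_eqI[OF I])
    have m: "(\<lambda>p. \<lambda>i\<in>I. (fst p i, snd p i)) \<in> Pi\<^sub>M I (\<lambda>_. N1) \<Otimes>\<^sub>M Pi\<^sub>M I (\<lambda>_. N2) \<rightarrow>\<^sub>M Pi\<^sub>M I (\<lambda>_. N1 \<Otimes>\<^sub>M N2)"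
      by (intro measurable_restrict measurable_Pair measurable_compose[OF measurable_fst measurable_component_singleton]
        measurable_compose[OF measurable_snd measurable_component_singleton])
    fix A assume A[measurable]: "\<And>i. i \<in> I \<Longrightarrow> A i \<in> sets (N1 \<Otimes>\<^sub>M N2)"
    have PA: "Pi\<^sub>E I A \<in> sets (Pi\<^sub>M I (\<lambda>_. N1 \<Otimes>\<^sub>M N2))" using A I by (intro sets_PiM_I_finite) auto
    have fm: "(\<lambda>p. indicator (Pi\<^sub>E I A) (\<lambda>i\<in>I. (fst p i, snd p i)) :: ennreal) \<in> borel_measurable (Pi\<^sub>M I (\<lambda>_. N1) \<Otimes>\<^sub>M Pi\<^sub>M I (\<lambda>_. N2))"
      by (rule measurable_compose[OF m borel_measurable_indicator[OF PA]])
    have "emeasure (distr (Pi\<^sub>M I (\<lambda>_. N1) \<Otimes>\<^sub>M Pi\<^sub>M I (\<lambda>_. N2)) (Pi\<^sub>M I (\<lambda>_. N1 \<Otimes>\<^sub>M N2)) (\<lambda>p. \<lambda>i\<in>I. (fst p i, snd p i))) (Pi\<^sub>E I A)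
      = (\<integral>\<^sup>+p. indicator (Pi\<^sub>E I A) (\<lambda>i\<in>I. (fst p i, snd p i)) \<partial>(Pi\<^sub>M I (\<lambda>_. N1) \<Otimes>\<^sub>M Pi\<^sub>M I (\<lambda>_. N2)))"
      by (subst nn_integral_distr'[OF m borel_measurable_indicator[OF PA], symmetric]) (simp add: PA)
    also have "\<dots> = (\<integral>\<^sup>+u. \<integral>\<^sup>+v. indicator (Pi\<^sub>E I A) (\<lambda>i\<in>I. (u i, v i)) \<partial>Pi\<^sub>M I (\<lambda>_. N2) \<partial>Pi\<^sub>M I (\<lambda>_. N1))"
      using fm by (subst Q2.nn_integral_fst[symmetric]) auto
    also have "\<dots> = (\<integral>\<^sup>+u. \<integral>\<^sup>+v. (\<Prod>i\<in>I. indicator (A i) (u i, v i)) \<partial>Pi\<^sub>M I (\<lambda>_. N2) \<partial>Pi\<^sub>M I (\<lambda>_. N1))"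
      using I by (intro nn_integral_cong) (auto simp: indicator_def PiE_iff prod_zero_iff)
    also have "\<dots> = (\<integral>\<^sup>+u. (\<Prod>i\<in>I. \<integral>\<^sup>+z. indicator (A i) (u i, z) \<partial>N2) \<partial>Pi\<^sub>M I (\<lambda>_. N1))"
    proof (intro nn_integral_cong P2.product_nn_integral_prod[OF I])
      fix u i assume "u \<in> space (Pi\<^sub>M I (\<lambda>_. N1))" "i \<in> I"
      then have "u i \<in> space N1" by (auto simp: space_PiM)
      then show "(\<lambda>z. indicator (A i) (u i, z) :: ennreal) \<in> borel_measurable N2"
        using measurable_compose[OF measurable_Pair1' borel_measurable_indicator[OF A[OF \<open>i \<in> I\<close>]]] by blast
    qed
    also have "\<dots> = (\<Prod>i\<in>I. \<integral>\<^sup>+y. \<integral>\<^sup>+z. indicator (A i) (y, z) \<partial>N2 \<partial>N1)"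
      by (rule P1.product_nn_integral_prod[OF I]) (rule N2.borel_measurable_nn_integral_fst, rule borel_measurable_indicator, rule A)
    also have "\<dots> = (\<Prod>i\<in>I. emeasure (N1 \<Otimes>\<^sub>M N2) (A i))"
      using A by (intro prod.cong refl) (simp add: N2.nn_integral_fst)
    finally show "emeasure (distr (Pi\<^sub>M I (\<lambda>_. N1) \<Otimes>\<^sub>M Pi\<^sub>M I (\<lambda>_. N2)) (Pi\<^sub>M I (\<lambda>_. N1 \<Otimes>\<^sub>M N2)) (\<lambda>p. \<lambda>i\<in>I. (fst p i, snd p i))) (Pi\<^sub>E I A)
      = (\<Prod>i\<in>I. emeasure (N1 \<Otimes>\<^sub>M N2) (A i))" .
  qed simp
qed

section \<open>Second moments of sums of uncorrelated terms\<close>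

lemma integrable_mult_L2:
  fixes f g :: "'a \<Rightarrow> real"
  assumes f: "f \<in> borel_measurable N" "integrable N (\<lambda>x. (f x)\<^sup>2)"
    and g: "g \<in> borel_measurable N" "integrable N (\<lambda>x. (g x)\<^sup>2)"
  shows "integrable N (\<lambda>x. f x * g x)"
proof (rule Bochner_Integration.integrable_bound[OF Bochner_Integration.integrable_add[OF f(2) g(2)]])
  show "(\<lambda>x. f x * g x) \<in> borel_measurable N" using f g by auto
  have "\<bar>u * w\<bar> \<le> u\<^sup>2 + w\<^sup>2" for u w :: real
    using sum_squares_bound[of "\<bar>u\<bar>" "\<bar>w\<bar>"] abs_ge_zero[of "u * w"]
    unfolding abs_mult power2_abs mult.assoc by linarith
  then show "AE x in N. norm (f x * g x) \<le> norm ((f x)\<^sup>2 + (g x)\<^sup>2)" by auto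
qed

lemma orthogonal_sum_square:
  fixes f g :: "'a \<Rightarrow> real"
  assumes f: "f \<in> borel_measurable N" "integrable N (\<lambda>x. (f x)\<^sup>2)"
    and g: "g \<in> borel_measurable N" "integrable N (\<lambda>x. (g x)\<^sup>2)"
    and o: "(\<integral>x. f x * g x \<partial>N) = 0"
  shows "integrable N (\<lambda>x. (f x + g x)\<^sup>2)"
    and "(\<integral>x. (f x + g x)\<^sup>2 \<partial>N) = (\<integral>x. (f x)\<^sup>2 \<partial>N) + (\<integral>x. (g x)\<^sup>2 \<partial>N)"
proof -
  have e: "(f x + g x)\<^sup>2 = (f x)\<^sup>2 + (g x)\<^sup>2 + 2 * (f x * g x)" for x
    by (simp add: power2_eq_square algebra_simps)
  show "integrable N (\<lambda>x. (f x + g x)\<^sup>2)" unfolding e using f g integrable_mult_L2[OF f g] by auto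
  show "(\<integral>x. (f x + g x)\<^sup>2 \<partial>N) = (\<integral>x. (f x)\<^sup>2 \<partial>N) + (\<integral>x. (g x)\<^sup>2 \<partial>N)"
    unfolding e using f g integrable_mult_L2[OF f g] o by simp
qed

lemma std_component_measurable:
  "i \<in> I \<Longrightarrow> (\<lambda>p. snd p i) \<in> borel_measurable (N \<Otimes>\<^sub>M std_on I)"
  by (rule PiM_component_measurable[OF measurable_snd]) auto

text \<open>\<open>indep\<close> expresses independence from coordinate \<open>k\<close> without
  sigma-algebras: integrating over that coordinate first annihilates the cross term.\<close>

lemma add_std_coordinate:
  fixes q :: "'a \<times> ('i \<Rightarrow> real) \<Rightarrow> real"
  assumes N: "prob_space N" and I: "finite I" "k \<in> I"
    and q: "q \<in> borel_measurable (N \<Otimes>\<^sub>M std_on I)" "integrable (N \<Otimes>\<^sub>M std_on I) (\<lambda>p. (q p)\<^sup>2)"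
    and indep: "\<And>\<omega> \<zeta> y. q (\<omega>, \<zeta>(k := y)) = q (\<omega>, \<zeta>)"
  shows "integrable (N \<Otimes>\<^sub>M std_on I) (\<lambda>p. (q p + c * snd p k)\<^sup>2)"
    and "(\<integral>p. (q p + c * snd p k)\<^sup>2 \<partial>(N \<Otimes>\<^sub>M std_on I)) = (\<integral>p. (q p)\<^sup>2 \<partial>(N \<Otimes>\<^sub>M std_on I)) + c\<^sup>2"
proof -
  interpret N: prob_space N by fact
  interpret S: prob_space "std_on I" by (rule prob_space_std_on)
  interpret NS: pair_prob_space N "std_on I" ..
  have z: "(\<lambda>p. c * snd p k) \<in> borel_measurable (N \<Otimes>\<^sub>M std_on I)"
    by (intro borel_measurable_times borel_measurable_const std_component_measurable I(2))
  have z2: "integrable (N \<Otimes>\<^sub>M std_on I) (\<lambda>p. (c * snd p k)\<^sup>2)"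
    unfolding power_mult_distrib
    by (intro integrable_mult_right integrable_pair_snd[OF N S.prob_space_axioms] std_on_moments(1)[OF I(2)])
  have v2: "(\<integral>p. (c * snd p k)\<^sup>2 \<partial>(N \<Otimes>\<^sub>M std_on I)) = c\<^sup>2"
    using integral_pair_snd[OF N S.prob_space_axioms borel_measurable_integrable[OF std_on_moments(1)[OF I(2)]]] std_on_moments(2)[OF I(2)]
    by (simp add: power_mult_distrib)
  have i: "integrable (N \<Otimes>\<^sub>M std_on I) (\<lambda>p. q p * (c * snd p k))" by (rule integrable_mult_L2[OF q z z2])
  have J: "insert k (I - {k}) = I" "finite (I - {k})" "k \<notin> I - {k}" using I by auto
  have "(\<integral>p. q p * (c * snd p k) \<partial>(N \<Otimes>\<^sub>M std_on I)) = (\<integral>\<omega>. (\<integral>\<zeta>. q (\<omega>, \<zeta>) * (c * \<zeta> k) \<partial>std_on I) \<partial>N)"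
    using NS.integral_fst'[OF i] by simp
  also have "\<dots> = (\<integral>\<omega>. 0 \<partial>N)"
  proof (rule integral_cong_AE)
    show "(\<lambda>\<omega>. \<integral>\<zeta>. q (\<omega>, \<zeta>) * (c * \<zeta> k) \<partial>std_on I) \<in> borel_measurable N"
      using borel_measurable_integrable[OF NS.integrable_fst'[OF i]] by simp
    show "AE \<omega> in N. (\<integral>\<zeta>. q (\<omega>, \<zeta>) * (c * \<zeta> k) \<partial>std_on I) = 0"
      using NS.AE_integrable_fst'[OF i]
    proof eventually_elim
      case (elim \<omega>)
      then have i': "integrable (std_on (insert k (I - {k}))) (\<lambda>\<zeta>. q (\<omega>, \<zeta>) * (c * \<zeta> k))" by (simp only: J(1) fst_conv snd_conv)
      have "(\<integral>\<zeta>. q (\<omega>, \<zeta>) * (c * \<zeta> k) \<partial>std_on I) = (\<integral>\<zeta>. \<integral>y. q (\<omega>, \<zeta>(k := y)) * (c * (\<zeta>(k := y)) k) \<partial>std_normal \<partial>std_on (I - {k}))"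
        using std_on.product_integral_insert[OF J(2,3) i'] by (simp only: J(1))
      also have "\<dots> = 0" unfolding indep using std_normal_second_moment(4) by simp
      finally show ?case .
    qed
  qed simp
  finally have o: "(\<integral>p. q p * (c * snd p k) \<partial>(N \<Otimes>\<^sub>M std_on I)) = 0" by simp
  show "integrable (N \<Otimes>\<^sub>M std_on I) (\<lambda>p. (q p + c * snd p k)\<^sup>2)" by (rule orthogonal_sum_square(1)[OF q z z2 o])
  show "(\<integral>p. (q p + c * snd p k)\<^sup>2 \<partial>(N \<Otimes>\<^sub>M std_on I)) = (\<integral>p. (q p)\<^sup>2 \<partial>(N \<Otimes>\<^sub>M std_on I)) + c\<^sup>2"
    using orthogonal_sum_square(2)[OF q z z2 o] by (simp add: v2)
qed

lemma add_std_coordinates: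
  fixes q :: "'a \<times> ('i \<Rightarrow> real) \<Rightarrow> real"
  assumes N: "prob_space N" and I: "finite I" "K \<subseteq> I"
    and q: "q \<in> borel_measurable (N \<Otimes>\<^sub>M std_on I)" "integrable (N \<Otimes>\<^sub>M std_on I) (\<lambda>p. (q p)\<^sup>2)"
    and indep: "\<And>\<omega> \<zeta> y k. k \<in> K \<Longrightarrow> q (\<omega>, \<zeta>(k := y)) = q (\<omega>, \<zeta>)"
  shows "integrable (N \<Otimes>\<^sub>M std_on I) (\<lambda>p. (q p + (\<Sum>k\<in>K. c k * snd p k))\<^sup>2)"
    and "(\<integral>p. (q p + (\<Sum>k\<in>K. c k * snd p k))\<^sup>2 \<partial>(N \<Otimes>\<^sub>M std_on I)) = (\<integral>p. (q p)\<^sup>2 \<partial>(N \<Otimes>\<^sub>M std_on I)) + (\<Sum>k\<in>K. (c k)\<^sup>2)"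
proof -
  have "finite K" using I by (rule rev_finite_subset)
  then have "integrable (N \<Otimes>\<^sub>M std_on I) (\<lambda>p. (q p + (\<Sum>k\<in>K. c k * snd p k))\<^sup>2) \<and>
    (\<integral>p. (q p + (\<Sum>k\<in>K. c k * snd p k))\<^sup>2 \<partial>(N \<Otimes>\<^sub>M std_on I)) = (\<integral>p. (q p)\<^sup>2 \<partial>(N \<Otimes>\<^sub>M std_on I)) + (\<Sum>k\<in>K. (c k)\<^sup>2)"
    using I(2) indep
  proof (induction K rule: finite_induct)
    case (insert k K)
    let ?q = "\<lambda>p. q p + (\<Sum>k\<in>K. c k * snd p k)"
    have IH: "integrable (N \<Otimes>\<^sub>M std_on I) (\<lambda>p. (?q p)\<^sup>2)"
      "(\<integral>p. (?q p)\<^sup>2 \<partial>(N \<Otimes>\<^sub>M std_on I)) = (\<integral>p. (q p)\<^sup>2 \<partial>(N \<Otimes>\<^sub>M std_on I)) + (\<Sum>k\<in>K. (c k)\<^sup>2)"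
      using insert.IH insert.prems by auto
    have qm: "?q \<in> borel_measurable (N \<Otimes>\<^sub>M std_on I)"
      using insert.prems(1)
      by (intro borel_measurable_add q(1) borel_measurable_sum borel_measurable_times std_component_measurable) auto
    have dep: "?q (\<omega>, \<zeta>(k := y)) = ?q (\<omega>, \<zeta>)" for \<omega> \<zeta> y
    proof -
      have "(\<Sum>i\<in>K. c i * (\<zeta>(k := y)) i) = (\<Sum>i\<in>K. c i * \<zeta> i)" using insert(2) by (intro sum.cong) auto
      moreover have "q (\<omega>, \<zeta>(k := y)) = q (\<omega>, \<zeta>)" by (rule insert.prems(2)) simp
      ultimately show ?thesis by (simp only: snd_conv)
    qed
    have k: "k \<in> I" using insert by simp
    have e: "q p + (\<Sum>k\<in>insert k K. c k * snd p k) = ?q p + c k * snd p k" for p using insert by simp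
    show ?case
      unfolding e using add_std_coordinate[OF N I(1) k qm IH(1) dep, of "c k"] IH(2) insert(1,2) by simp
  qed (use q in simp)
  then show "integrable (N \<Otimes>\<^sub>M std_on I) (\<lambda>p. (q p + (\<Sum>k\<in>K. c k * snd p k))\<^sup>2)"
    "(\<integral>p. (q p + (\<Sum>k\<in>K. c k * snd p k))\<^sup>2 \<partial>(N \<Otimes>\<^sub>M std_on I)) = (\<integral>p. (q p)\<^sup>2 \<partial>(N \<Otimes>\<^sub>M std_on I)) + (\<Sum>k\<in>K. (c k)\<^sup>2)" by auto
qed

text \<open>The smoothing sits on the middle factor because it belongs to the base space of the
  mixture, while the error \<open>p\<close> depends on the outer two factors, sources and channel
  noise. The centred \<open>h\<close> makes the cross term vanish.\<close>

lemma add_independent_middle: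
  fixes p :: "'a \<times> 'c \<Rightarrow> real" and h :: "'b \<Rightarrow> real"
  assumes M: "prob_space M" and G: "prob_space G" and S: "prob_space S"
    and p: "p \<in> borel_measurable (M \<Otimes>\<^sub>M S)" "integrable (M \<Otimes>\<^sub>M S) (\<lambda>u. (p u)\<^sup>2)"
    and h: "h \<in> borel_measurable G" "integrable G (\<lambda>u. (h u)\<^sup>2)" "(\<integral>u. h u \<partial>G) = 0"
  shows "integrable ((M \<Otimes>\<^sub>M G) \<Otimes>\<^sub>M S) (\<lambda>u. (p (fst (fst u), snd u) + h (snd (fst u)))\<^sup>2)"
    and "(\<integral>u. (p (fst (fst u), snd u) + h (snd (fst u)))\<^sup>2 \<partial>((M \<Otimes>\<^sub>M G) \<Otimes>\<^sub>M S)) = (\<integral>u. (p u)\<^sup>2 \<partial>(M \<Otimes>\<^sub>M S)) + (\<integral>u. (h u)\<^sup>2 \<partial>G)"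
proof -
  interpret M: prob_space M by fact
  interpret G: prob_space G by fact
  interpret S: prob_space S by fact
  interpret MG: pair_prob_space M G ..
  interpret MS: pair_prob_space M S ..
  interpret T: pair_prob_space "M \<Otimes>\<^sub>M G" S ..
  let ?T = "(M \<Otimes>\<^sub>M G) \<Otimes>\<^sub>M S"
  let ?r = "\<lambda>u. (fst (fst u), snd u)"
  have r: "?r \<in> ?T \<rightarrow>\<^sub>M M \<Otimes>\<^sub>M S" by measurable
  have law: "distr ?T (M \<Otimes>\<^sub>M S) ?r = M \<Otimes>\<^sub>M S"
  proof -
    have "distr (M \<Otimes>\<^sub>M G) M fst \<Otimes>\<^sub>M distr S S (\<lambda>z. z) = distr ?T (M \<Otimes>\<^sub>M S) (\<lambda>(x, y). (fst x, y))"
      by (rule pair_measure_distr) (auto intro!: prob_space_imp_sigma_finite S simp: distr_id2)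
    then show ?thesis by (simp add: G.distr_pair_fst distr_id2 case_prod_beta')
  qed
  have sq: "(\<lambda>u. (p u)\<^sup>2) \<in> borel_measurable (M \<Otimes>\<^sub>M S)" using p by simp
  have pr: "(\<lambda>u. p (?r u)) \<in> borel_measurable ?T" by (rule measurable_compose[OF r p(1)])
  have p2: "integrable ?T (\<lambda>u. (p (?r u))\<^sup>2)" "(\<integral>u. (p (?r u))\<^sup>2 \<partial>?T) = (\<integral>u. (p u)\<^sup>2 \<partial>(M \<Otimes>\<^sub>M S))"
    using p(2) integrable_distr_eq[OF r sq] integral_distr[OF r sq] by (simp_all add: law)
  have hr: "(\<lambda>u. h (snd (fst u))) \<in> borel_measurable ?T" using h(1) by measurable
  have MG1: "prob_space (M \<Otimes>\<^sub>M G)" by (rule MG.prob_space_axioms)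
  have h2': "integrable (M \<Otimes>\<^sub>M G) (\<lambda>v. (h (snd v))\<^sup>2)"
    by (rule integrable_pair_snd[OF M G h(2)])
  have h2: "integrable ?T (\<lambda>u. (h (snd (fst u)))\<^sup>2)" "(\<integral>u. (h (snd (fst u)))\<^sup>2 \<partial>?T) = (\<integral>u. (h u)\<^sup>2 \<partial>G)"
    using integrable_pair_fst[OF MG1 S h2'] integral_pair_fst[OF MG1 S borel_measurable_integrable[OF h2']]
      integral_pair_snd[OF M G borel_measurable_integrable[OF h(2)]] by simp_all
  have i: "integrable ?T (\<lambda>u. p (?r u) * h (snd (fst u)))" by (rule integrable_mult_L2[OF pr p2(1) hr h2(1)])
  have i2: "integrable (M \<Otimes>\<^sub>M G) (\<lambda>v. (\<integral>s. p (fst v, s) \<partial>S) * h (snd v))"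
    using T.integrable_fst'[OF i] by simp
  have "(\<integral>u. p (?r u) * h (snd (fst u)) \<partial>?T) = (\<integral>v. (\<integral>s. p (fst v, s) \<partial>S) * h (snd v) \<partial>(M \<Otimes>\<^sub>M G))"
    using T.integral_fst'[OF i] by simp
  also have "\<dots> = (\<integral>m. (\<integral>s. p (m, s) \<partial>S) * (\<integral>g. h g \<partial>G) \<partial>M)"
    using MG.integral_fst'[OF i2] by simp
  also have "\<dots> = 0" by (simp add: h(3))
  finally have o: "(\<integral>u. p (?r u) * h (snd (fst u)) \<partial>?T) = 0" .
  show "integrable ?T (\<lambda>u. (p (?r u) + h (snd (fst u)))\<^sup>2)" by (rule orthogonal_sum_square(1)[OF pr p2(1) hr h2(1) o])
  show "(\<integral>u. (p (?r u) + h (snd (fst u)))\<^sup>2 \<partial>?T) = (\<integral>u. (p u)\<^sup>2 \<partial>(M \<Otimes>\<^sub>M S)) + (\<integral>u. (h u)\<^sup>2 \<partial>G)"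
    using orthogonal_sum_square(2)[OF pr p2(1) hr h2(1) o] p2(2) h2(2) by simp
qed

section \<open>Joint laws of sources and noise\<close>

lemma borel_measurable_vec_nth[measurable]:
  fixes f :: "'a \<Rightarrow> real^'n"
  assumes "f \<in> borel_measurable N"
  shows "(\<lambda>x. f x $ k) \<in> borel_measurable N"
  by (rule measurable_compose[OF assms borel_measurable_continuous_onI]) (intro continuous_intros)

lemma sets_pair_borel:
  fixes \<mu> :: "'s::second_countable_topology measure" and \<nu> :: "'t::second_countable_topology measure"
  assumes "sets \<mu> = sets borel" "sets \<nu> = sets borel"
  shows "sets (\<mu> \<Otimes>\<^sub>M \<nu>) = sets borel"
  unfolding sets_pair_measure_cong[OF assms] by (rule arg_cong[OF borel_prod])

text \<open>Independence over time makes the sequence of pairs a product law; each pair being a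
  product as well, the source block and the noise block are independent.\<close>

lemma (in prob_space) joint_block_law:
  fixes s :: "nat \<Rightarrow> 'a \<Rightarrow> 's::second_countable_topology" and z :: "nat \<Rightarrow> 'a \<Rightarrow> real"
  assumes n: "0 < n"
    and ind: "indep_vars (\<lambda>_. borel) (\<lambda>t \<omega>. (s t \<omega>, z t \<omega>)) {..<n}"
    and law: "\<And>t. t < n \<Longrightarrow> distr M borel (\<lambda>\<omega>. (s t \<omega>, z t \<omega>)) = \<mu> \<Otimes>\<^sub>M \<nu>"
    and \<mu>: "prob_space \<mu>" "sets \<mu> = sets borel" and \<nu>: "prob_space \<nu>" "sets \<nu> = sets borel"
  shows "distr M (Pi\<^sub>M {..<n} (\<lambda>_. \<mu>) \<Otimes>\<^sub>M Pi\<^sub>M {..<n} (\<lambda>_. \<nu>)) (\<lambda>\<omega>. (\<lambda>t\<in>{..<n}. s t \<omega>, \<lambda>t\<in>{..<n}. z t \<omega>))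
    = Pi\<^sub>M {..<n} (\<lambda>_. \<mu>) \<Otimes>\<^sub>M Pi\<^sub>M {..<n} (\<lambda>_. \<nu>)"
proof -
  let ?I = "{..<n}"
  let ?PP = "Pi\<^sub>M ?I (\<lambda>_. \<mu>) \<Otimes>\<^sub>M Pi\<^sub>M ?I (\<lambda>_. \<nu>)" and ?Q = "Pi\<^sub>M ?I (\<lambda>_. \<mu> \<Otimes>\<^sub>M \<nu>)"
  let ?R = "\<lambda>\<omega>. \<lambda>t\<in>?I. (s t \<omega>, z t \<omega>)"
  let ?zip = "\<lambda>p. \<lambda>i\<in>?I. (fst p i, snd p i)" and ?unzip = "\<lambda>q. (\<lambda>i\<in>?I. fst (q i), \<lambda>i\<in>?I. snd (q i))"
  have b: "sets (\<mu> \<Otimes>\<^sub>M \<nu>) = sets borel"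
    by (rule sets_pair_borel[OF \<mu>(2) \<nu>(2)])
  have R_t: "(\<lambda>\<omega>. (s t \<omega>, z t \<omega>)) \<in> M \<rightarrow>\<^sub>M borel" if "t \<in> ?I" for t
    using ind that by (auto simp: indep_vars_def)
  have R_m: "?R \<in> M \<rightarrow>\<^sub>M ?Q"
    by (intro measurable_restrict) (use R_t b in \<open>auto cong: measurable_cong_sets\<close>)
  have unzip_m: "?unzip \<in> ?Q \<rightarrow>\<^sub>M ?PP"
  proof -
    have "(\<lambda>q. q t) \<in> ?Q \<rightarrow>\<^sub>M \<mu> \<Otimes>\<^sub>M \<nu>" if "t \<in> ?I" for t
      by (rule measurable_component_singleton[OF that])
    note 1 = measurable_compose[OF this measurable_fst] and 2 = measurable_compose[OF this measurable_snd]
    show ?thesis by (intro measurable_Pair measurable_restrict 1 2)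
  qed
  have zip_m: "?zip \<in> ?PP \<rightarrow>\<^sub>M ?Q"
  proof -
    have 1: "(\<lambda>p. fst p t) \<in> ?PP \<rightarrow>\<^sub>M \<mu>" and 2: "(\<lambda>p. snd p t) \<in> ?PP \<rightarrow>\<^sub>M \<nu>" if "t \<in> ?I" for t
      by (rule measurable_compose[OF measurable_fst measurable_component_singleton[OF that]]
        measurable_compose[OF measurable_snd measurable_component_singleton[OF that]])+
    show ?thesis by (intro measurable_restrict measurable_Pair 1 2)
  qed
  have R_law: "distr M ?Q ?R = ?Q"
  proof -
    have "distr M ?Q ?R = distr M (Pi\<^sub>M ?I (\<lambda>_. borel)) ?R"
      by (rule distr_cong[OF refl _ refl], rule sets_PiM_cong[OF refl b])
    also have "\<dots> = Pi\<^sub>M ?I (\<lambda>t. distr M borel (\<lambda>\<omega>. (s t \<omega>, z t \<omega>)))"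
      using indep_vars_iff_distr_eq_PiM'[of ?I "\<lambda>t \<omega>. (s t \<omega>, z t \<omega>)" "\<lambda>_. borel"] ind n R_t by (auto simp: lessThan_empty_iff)
    also have "\<dots> = ?Q" by (rule PiM_cong) (auto simp: law)
    finally show ?thesis .
  qed
  have "distr M ?PP (\<lambda>\<omega>. (\<lambda>t\<in>?I. s t \<omega>, \<lambda>t\<in>?I. z t \<omega>)) = distr (distr M ?Q ?R) ?PP ?unzip"
    by (subst distr_distr[OF unzip_m R_m]) (auto intro!: distr_cong simp: fun_eq_iff)
  \<comment> \<open>The law of the pairs is rewritten as a zipped law, so that unzipping becomes the
    inverse of zipping.\<close>
  also have "\<dots> = distr (distr ?PP ?Q ?zip) ?PP ?unzip"
    unfolding R_law using zip_PiM[OF _ \<mu>(1) \<nu>(1), of ?I] by simp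
  also have "\<dots> = distr ?PP ?PP (\<lambda>p. p)"
  proof (subst distr_distr[OF unzip_m zip_m], rule distr_cong)
    fix p assume "p \<in> space ?PP"
    then have "fst p \<in> extensional ?I" "snd p \<in> extensional ?I"
      by (auto simp: space_pair_measure space_PiM PiE_def)
    then show "(?unzip \<circ> ?zip) p = p"
      by (auto simp: prod_eq_iff extensional_def fun_eq_iff)
  qed simp_all
  also have "\<dots> = ?PP" by (rule distr_id2) simp
  finally show ?thesis .
qed

text \<open>Reindexing by \<open>e\<close>, then scaling each coordinate; \<open>e\<close> picks the
  channel coordinates out of the larger family.\<close>

lemma std_block_law:
  fixes e :: "nat \<Rightarrow> 'i"
  assumes I: "finite I" "e ` {..<n} \<subseteq> I" and e: "inj e" and N: "0 < N"
  shows "distr (std_on I) (Pi\<^sub>M {..<n} (\<lambda>_. density lborel (normal_density 0 (sqrt N)))) (\<lambda>\<zeta>. \<lambda>t\<in>{..<n}. sqrt N * \<zeta> (e t))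
    = Pi\<^sub>M {..<n} (\<lambda>_. density lborel (normal_density 0 (sqrt N)))"
proof -
  let ?\<nu> = "density lborel (normal_density 0 (sqrt N))" and ?J = "{..<n}"
  have aff: "distr std_normal ?\<nu> (\<lambda>z. sqrt N * z) = ?\<nu>"
  proof -
    have "distr std_normal ?\<nu> (\<lambda>z. sqrt N * z) = distr std_normal borel (\<lambda>z. 0 + sqrt N * z)"
      by (rule distr_cong) auto
    then show ?thesis using normal_affine[of "sqrt N" 0] N by simp
  qed
  have \<nu>: "prob_space ?\<nu>" using prob_space_normal_density[of "sqrt N" 0] N by simp
  have re: "distr (std_on I) (std_on ?J) (\<lambda>\<zeta>. \<lambda>t\<in>?J. \<zeta> (e t)) = std_on ?J"
    using distr_PiM_reindex[where K = I and I = ?J and f = e and M = "\<lambda>_. std_normal"] I inj_on_subset[OF e] std_normal.prob_space_axioms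
    by auto
  have rm: "(\<lambda>\<zeta>. \<lambda>t\<in>?J. \<zeta> (e t)) \<in> std_on I \<rightarrow>\<^sub>M std_on ?J"
    using I by (intro measurable_restrict measurable_component_singleton) auto
  have cm: "compose ?J (\<lambda>z. sqrt N * z) \<in> std_on ?J \<rightarrow>\<^sub>M Pi\<^sub>M ?J (\<lambda>_. ?\<nu>)"
    unfolding compose_def
    by (intro measurable_restrict) (auto intro!: borel_measurable_times PiM_component_measurable[OF measurable_ident_sets[OF refl]] cong: measurable_cong_sets)
  have "distr (std_on ?J) (Pi\<^sub>M ?J (\<lambda>_. ?\<nu>)) (compose ?J (\<lambda>z. sqrt N * z)) = Pi\<^sub>M ?J (\<lambda>_. distr std_normal ?\<nu> (\<lambda>z. sqrt N * z))"
    by (rule distr_PiM_finite_prob_space') (use \<nu> std_normal.prob_space_axioms in auto)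
  then have "Pi\<^sub>M ?J (\<lambda>_. ?\<nu>) = distr (std_on ?J) (Pi\<^sub>M ?J (\<lambda>_. ?\<nu>)) (compose ?J (\<lambda>z. sqrt N * z))" by (simp add: aff)
  also have "\<dots> = distr (distr (std_on I) (std_on ?J) (\<lambda>\<zeta>. \<lambda>t\<in>?J. \<zeta> (e t))) (Pi\<^sub>M ?J (\<lambda>_. ?\<nu>)) (compose ?J (\<lambda>z. sqrt N * z))"
    by (simp only: re)
  also have "\<dots> = distr (std_on I) (Pi\<^sub>M ?J (\<lambda>_. ?\<nu>)) (\<lambda>\<zeta>. \<lambda>t\<in>?J. sqrt N * \<zeta> (e t))"
    by (subst distr_distr[OF cm rm]) (auto intro!: distr_cong simp: compose_def)
  finally show ?thesis ..
qed

text \<open>The constant alternative acts as a normal of variance zero: the zero mean makes the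
  constant zero, and both sides are 1.\<close>

lemma (in prob_space) normal_or_constant_char:
  fixes X :: "'a \<Rightarrow> real"
  assumes X: "(\<exists>\<mu> \<sigma>. 0 < \<sigma> \<and> distributed M lborel X (normal_density \<mu> \<sigma>)) \<or> (\<exists>\<mu>. AE \<omega> in M. X \<omega> = \<mu>)"
    and m[measurable]: "X \<in> borel_measurable M" and e: "expectation X = 0"
  shows "(\<integral>\<omega>. iexp (X \<omega>) \<partial>M) = complex_of_real (exp (- expectation (\<lambda>\<omega>. (X \<omega>)\<^sup>2) / 2))"
  using X
proof (elim disjE exE conjE)
  fix \<mu> \<sigma> assume s: "(0::real) < \<sigma>" and d: "distributed M lborel X (normal_density \<mu> \<sigma>)"
  have mu: "\<mu> = 0" using normal_distributed_expectation[OF s d] e by simp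
  have v: "expectation (\<lambda>\<omega>. (X \<omega>)\<^sup>2) = \<sigma>\<^sup>2" using normal_distributed_variance[OF s d] e by simp
  have "distr M borel X = distr M lborel X" by (rule distr_cong) auto
  also have "\<dots> = distr std_normal borel (\<lambda>z. \<sigma> * z)"
    using d normal_affine[OF s, of 0] by (simp add: distributed_def mu)
  finally have law: "distr M borel X = distr std_normal borel (\<lambda>z. \<sigma> * z)" .
  have "(\<integral>\<omega>. iexp (X \<omega>) \<partial>M) = (\<integral>y. iexp y \<partial>distr M borel X)" by (subst integral_distr) auto
  also have "\<dots> = (\<integral>z. iexp (\<sigma> * z) \<partial>std_normal)" unfolding law by (subst integral_distr) auto
  also have "\<dots> = char std_normal_distribution \<sigma>" by (simp add: char_def)
  finally show ?thesis by (simp add: char_std_normal_distribution v)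
next
  fix \<mu> assume c: "AE \<omega> in M. X \<omega> = \<mu>"
  have "expectation X = \<mu>" using integral_cong_AE[of X M "\<lambda>_. \<mu>"] c by (simp add: prob_space)
  then have c: "AE \<omega> in M. X \<omega> = 0" using c e by simp
  have "expectation (\<lambda>\<omega>. (X \<omega>)\<^sup>2) = expectation (\<lambda>\<omega>. 0)" by (rule integral_cong_AE) (use c in auto)
  moreover have "(\<integral>\<omega>. iexp (X \<omega>) \<partial>M) = (\<integral>\<omega>. 1 \<partial>M)" by (rule integral_cong_AE) (use c in auto)
  ultimately show ?thesis by (simp add: prob_space)
qed

section \<open>Second-moment matrices and stacked vectors\<close>

lemma quadratic_form_sum: "x \<bullet> (A *v x) = (\<Sum>i\<in>UNIV. \<Sum>j\<in>UNIV. x $ i * x $ j * A $ i $ j)" for x :: "real^'n"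
  by (simp add: inner_vec_def matrix_vector_mult_def sum_distrib_left mult_ac)

lemma bounded_linear_entry: "bounded_linear (\<lambda>A::real^'n^'m. A $ i $ j)"
  by (rule bounded_linear_compose[OF bounded_linear_vec_nth bounded_linear_vec_nth])

lemma second_moment_form:
  fixes V :: "'w \<Rightarrow> real^'n"
  assumes i: "integrable M (\<lambda>\<omega>. outer (V \<omega>) (V \<omega>))"
  shows "integrable M (\<lambda>\<omega>. (\<xi> \<bullet> V \<omega>)\<^sup>2)" "(\<integral>\<omega>. (\<xi> \<bullet> V \<omega>)\<^sup>2 \<partial>M) = \<xi> \<bullet> (second_moment M V *v \<xi>)"
proof -
  have c: "integrable M (\<lambda>\<omega>. V \<omega> $ a * V \<omega> $ b)" "(\<integral>\<omega>. V \<omega> $ a * V \<omega> $ b \<partial>M) = second_moment M V $ a $ b" for a b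
    using integrable_bounded_linear[OF bounded_linear_entry i, of a b] integral_bounded_linear[OF bounded_linear_entry i, of a b]
    by (simp_all add: outer_def second_moment_def)
  have e: "(\<xi> \<bullet> V \<omega>)\<^sup>2 = (\<Sum>a\<in>UNIV. \<Sum>b\<in>UNIV. \<xi> $ a * \<xi> $ b * (V \<omega> $ a * V \<omega> $ b))" for \<omega>
    by (simp add: inner_vec_def power2_eq_square sum_product mult_ac)
  show "integrable M (\<lambda>\<omega>. (\<xi> \<bullet> V \<omega>)\<^sup>2)" unfolding e using c(1) by auto
  show "(\<integral>\<omega>. (\<xi> \<bullet> V \<omega>)\<^sup>2 \<partial>M) = \<xi> \<bullet> (second_moment M V *v \<xi>)"
    unfolding e quadratic_form_sum using c by simp
qed

lemma stack_nth[simp]: "stack x y $ Inl a = x $ a" "stack x y $ Inr b = y $ b"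
  by (simp_all add: stack_def)

lemma sum_UNIV_sum: "(\<Sum>k\<in>(UNIV::('a::finite + 'b::finite) set). f k) = (\<Sum>a\<in>UNIV. f (Inl a)) + (\<Sum>b\<in>UNIV. f (Inr b))"
  unfolding UNIV_Plus_UNIV[symmetric] by (subst sum.Plus) auto

lemma inner_stack: "\<xi> \<bullet> stack x y = (\<chi> a. \<xi> $ Inl a) \<bullet> x + (\<chi> b. \<xi> $ Inr b) \<bullet> y"
  by (simp add: inner_vec_def sum_UNIV_sum)

context gaussian_broadcast
begin

definition src :: "nat \<Rightarrow> 'w \<Rightarrow> real^('m1 + 'm2)" where "src t \<omega> = stack (S1 t \<omega>) (S2 t \<omega>)"

lemma quad_measurable: "(\<lambda>\<omega>. (S1 t \<omega>, S2 t \<omega>, Z1 t \<omega>, Z2 t \<omega>)) \<in> borel_measurable M"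
  using indep_in_time by (auto simp: indep_vars_def)

lemma source_measurable[measurable]:
  "S1 t \<in> borel_measurable M" "S2 t \<in> borel_measurable M" "Z1 t \<in> borel_measurable M" "Z2 t \<in> borel_measurable M"
proof -
  have f: "(\<lambda>\<omega>. g (S1 t \<omega>, S2 t \<omega>, Z1 t \<omega>, Z2 t \<omega>)) \<in> borel_measurable M" if "continuous_on UNIV g"
    for g :: "(real^'m1) \<times> (real^'m2) \<times> real \<times> real \<Rightarrow> 'z::topological_space"
    by (rule measurable_compose[OF quad_measurable borel_measurable_continuous_onI[OF that]])
  show "S1 t \<in> borel_measurable M" using f[of fst] by (simp add: continuous_on_fst)
  show "S2 t \<in> borel_measurable M" using f[of "\<lambda>p. fst (snd p)"] by (simp add: continuous_on_fst continuous_on_snd)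
  show "Z1 t \<in> borel_measurable M" using f[of "\<lambda>p. fst (snd (snd p))"] by (simp add: continuous_on_fst continuous_on_snd)
  show "Z2 t \<in> borel_measurable M" using f[of "\<lambda>p. snd (snd (snd p))"] by (simp add: continuous_on_snd)
qed

lemma src_measurable[measurable]: "src t \<in> borel_measurable M"
proof (rule borel_measurable_vec)
  fix k show "(\<lambda>\<omega>. src t \<omega> $ k) \<in> borel_measurable M"
    by (cases k) (auto simp: src_def)
qed

lemma ident_law:
  fixes h :: "(real^'m1) \<times> (real^'m2) \<times> real \<times> real \<Rightarrow> 'z::topological_space"
  assumes h: "h \<in> borel_measurable borel"
  shows "distr M borel (\<lambda>\<omega>. h (S1 t \<omega>, S2 t \<omega>, Z1 t \<omega>, Z2 t \<omega>)) = distr M borel (\<lambda>\<omega>. h (S1 0 \<omega>, S2 0 \<omega>, Z1 0 \<omega>, Z2 0 \<omega>))"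
proof -
  have "distr (distr M borel (\<lambda>\<omega>. (S1 t \<omega>, S2 t \<omega>, Z1 t \<omega>, Z2 t \<omega>))) borel h = distr (distr M borel (\<lambda>\<omega>. (S1 0 \<omega>, S2 0 \<omega>, Z1 0 \<omega>, Z2 0 \<omega>))) borel h"
    by (simp only: ident_distributed[of t])
  then show ?thesis
    by (simp add: distr_distr[OF h quad_measurable] comp_def)
qed

lemma src_law: "distr M borel (src t) = distr M borel (src 0)"
proof -
  have "(\<lambda>p. stack (fst p) (fst (snd p))) \<in> borel_measurable (borel :: ((real^'m1) \<times> (real^'m2) \<times> real \<times> real) measure)"
  proof (rule borel_measurable_vec)
    fix k :: "'m1 + 'm2"
    show "(\<lambda>p. stack (fst p) (fst (snd p)) $ k) \<in> borel_measurable (borel :: ((real^'m1) \<times> (real^'m2) \<times> real \<times> real) measure)"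
      by (cases k) (auto intro!: borel_measurable_continuous_onI continuous_intros)
  qed
  from ident_law[OF this, of t] show ?thesis by (simp add: src_def[abs_def])
qed

context
  fixes \<Sigma> :: "real^('m1 + 'm2)^('m1 + 'm2)"
  assumes \<Sigma>: "\<Sigma> = second_moment M (src 0)" and pd: "pos_def \<Sigma>"
begin

text \<open>The integral of a non-integrable function is 0 by convention, and the zero matrix is not
  positive definite.\<close>

lemma outer_integrable: "integrable M (\<lambda>\<omega>. outer (src 0 \<omega>) (src 0 \<omega>))"
proof (rule ccontr)
  assume "\<not> ?thesis"
  then have "\<Sigma> = 0" unfolding \<Sigma> second_moment_def by (rule not_integrable_integral_eq)
  moreover have "axis undefined 1 \<noteq> (0 :: real^('m1 + 'm2))" by (simp add: axis_eq_0_iff)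
  ultimately show False using pd by (auto simp: pos_def_def)
qed

lemma src_moments:
  shows "integrable M (\<lambda>\<omega>. (\<xi> \<bullet> src t \<omega>)\<^sup>2)" "(\<integral>\<omega>. (\<xi> \<bullet> src t \<omega>)\<^sup>2 \<partial>M) = \<xi> \<bullet> (\<Sigma> *v \<xi>)"
    "(\<integral>\<omega>. iexp (\<xi> \<bullet> src t \<omega>) \<partial>M) = complex_of_real (exp (- (\<xi> \<bullet> (\<Sigma> *v \<xi>)) / 2))"
proof -
  have tr: "integrable M (\<lambda>\<omega>. F (src t \<omega>)) = integrable M (\<lambda>\<omega>. F (src 0 \<omega>))" "(\<integral>\<omega>. F (src t \<omega>) \<partial>M) = (\<integral>\<omega>. F (src 0 \<omega>) \<partial>M)"
    if F: "F \<in> borel_measurable borel" for F :: "_ \<Rightarrow> 'z::{banach, second_countable_topology}"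
    using integrable_distr_eq[OF src_measurable F, of t] integrable_distr_eq[OF src_measurable F, of 0]
      integral_distr[OF src_measurable F, of t] integral_distr[OF src_measurable F, of 0]
    by (simp_all add: src_law[of t])
  note m2 = second_moment_form[OF outer_integrable, of \<xi>, folded \<Sigma>]
  show "integrable M (\<lambda>\<omega>. (\<xi> \<bullet> src t \<omega>)\<^sup>2)" "(\<integral>\<omega>. (\<xi> \<bullet> src t \<omega>)\<^sup>2 \<partial>M) = \<xi> \<bullet> (\<Sigma> *v \<xi>)"
    using tr[of "\<lambda>x. (\<xi> \<bullet> x)\<^sup>2"] m2 by simp_all
  \<comment> \<open>Joint Gaussianity speaks of the pair, so a functional of the stacked vector is
    rewritten as one of the pair.\<close>
  define a where "a = ((\<chi> a. \<xi> $ Inl a) :: real^'m1, (\<chi> b. \<xi> $ Inr b) :: real^'m2)"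
  have a: "a \<bullet> (S1 0 \<omega>, S2 0 \<omega>) = \<xi> \<bullet> src 0 \<omega>" for \<omega>
    by (simp add: a_def src_def inner_stack)
  \<comment> \<open>First moments are finite because second moments are, on a probability space;
    this lets the zero means pass through the inner product.\<close>
  have comp: "integrable M (\<lambda>\<omega>. src 0 \<omega> $ k)" for k
  proof (rule square_integrable_imp_integrable)
    show "integrable M (\<lambda>\<omega>. (src 0 \<omega> $ k)\<^sup>2)"
      using second_moment_form(1)[OF outer_integrable, of "axis k 1"] by (simp add: inner_axis')
  qed measurable
  have int: "integrable M V" if V[measurable]: "V \<in> borel_measurable M" and c: "\<And>k. integrable M (\<lambda>\<omega>. V \<omega> $ k)" for V :: "'w \<Rightarrow> real^'z"
  proof (rule Bochner_Integration.integrable_bound)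
    show "integrable M (\<lambda>\<omega>. \<Sum>k\<in>UNIV. \<bar>V \<omega> $ k\<bar>)" using c by auto
    show "AE \<omega> in M. norm (V \<omega>) \<le> norm (\<Sum>k\<in>UNIV. \<bar>V \<omega> $ k\<bar>)"
      using norm_le_l1_cart by (auto intro: order_trans[OF _ abs_ge_self])
  qed simp
  have iS: "integrable M (S1 0)" "integrable M (S2 0)"
    by (rule int, use comp[of "Inl _"] comp[of "Inr _"] in \<open>auto simp: src_def\<close>)+
  have z: "expectation (\<lambda>\<omega>. \<xi> \<bullet> src 0 \<omega>) = 0"
    unfolding a[symmetric] using iS source_zero_mean by (simp add: a_def inner_prod_def)
  have "(\<integral>\<omega>. iexp (\<xi> \<bullet> src 0 \<omega>) \<partial>M) = complex_of_real (exp (- expectation (\<lambda>\<omega>. (\<xi> \<bullet> src 0 \<omega>)\<^sup>2) / 2))"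
  proof (rule normal_or_constant_char)
    show "(\<exists>\<mu> \<sigma>. 0 < \<sigma> \<and> distributed M lborel (\<lambda>\<omega>. \<xi> \<bullet> src 0 \<omega>) (normal_density \<mu> \<sigma>)) \<or> (\<exists>\<mu>. AE \<omega> in M. \<xi> \<bullet> src 0 \<omega> = \<mu>)"
      using source_gaussian unfolding jointly_gaussian_def a[symmetric] by blast
    show "(\<lambda>\<omega>. \<xi> \<bullet> src 0 \<omega>) \<in> borel_measurable M" by measurable
  qed (rule z)
  then show "(\<integral>\<omega>. iexp (\<xi> \<bullet> src t \<omega>) \<partial>M) = complex_of_real (exp (- (\<xi> \<bullet> (\<Sigma> *v \<xi>)) / 2))"
    using tr(2)[of "\<lambda>x. iexp (\<xi> \<bullet> x)"] m2(2) by simp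
qed

end

lemma sources_indep:
  "indep_vars (\<lambda>_. borel) (\<lambda>t. src t) {..<n}"
proof -
  have "indep_vars (\<lambda>_. borel) (\<lambda>t \<omega>. (\<lambda>p. stack (fst p) (fst (snd p))) (S1 t \<omega>, S2 t \<omega>, Z1 t \<omega>, Z2 t \<omega>)) {..<n}"
  proof (rule indep_vars_compose2[OF indep_vars_subset[OF indep_in_time]])
    show "(\<lambda>p. stack (fst p) (fst (snd p))) \<in> borel_measurable (borel :: ((real^'m1) \<times> (real^'m2) \<times> real \<times> real) measure)"
    proof (rule borel_measurable_vec)
      fix k :: "'m1 + 'm2"
      show "(\<lambda>p. stack (fst p) (fst (snd p)) $ k) \<in> borel_measurable (borel :: ((real^'m1) \<times> (real^'m2) \<times> real \<times> real) measure)"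
        by (cases k) (auto intro!: borel_measurable_continuous_onI continuous_intros)
    qed
  qed auto
  then show ?thesis by (simp add: src_def[abs_def])
qed

text \<open>A receiver sees its noise only through the joint law with the sources, and independence
  fixes this law by its marginals. Hence the true noise may be exchanged for scaled coordinates of
  an independent standard normal family, whatever the coupling of \<open>Z1\<close> and
  \<open>Z2\<close>.\<close>

lemma channel_law:
  fixes z :: "nat \<Rightarrow> 'w \<Rightarrow> real" and e :: "nat \<Rightarrow> 'i"
  assumes n: "0 < n" and z: "z = Z1 \<and> N = N1 \<or> z = Z2 \<and> N = N2" and N: "0 < N"
    and I: "finite I" "e ` {..<n} \<subseteq> I" and e: "inj e"
  defines "L \<equiv> (\<Pi>\<^sub>M t\<in>{..<n}. (borel :: ((real^'m1) \<times> (real^'m2)) measure)) \<Otimes>\<^sub>M (\<Pi>\<^sub>M t\<in>{..<n}. (borel :: real measure))"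
  shows "distr M L (\<lambda>\<omega>. (\<lambda>t\<in>{..<n}. (S1 t \<omega>, S2 t \<omega>), \<lambda>t\<in>{..<n}. z t \<omega>))
    = distr (M \<Otimes>\<^sub>M std_on I) L (\<lambda>p. (\<lambda>t\<in>{..<n}. (S1 t (fst p), S2 t (fst p)), \<lambda>t\<in>{..<n}. sqrt N * snd p (e t)))"
proof -
  \<comment> \<open>The projection to either noise, so that both receivers are treated at
    once.\<close>
  obtain pz :: "real \<times> real \<Rightarrow> real" where pz: "continuous_on UNIV pz" "\<And>t \<omega>. z t \<omega> = pz (Z1 t \<omega>, Z2 t \<omega>)"
    using z that[of fst] that[of snd] by (auto simp: continuous_on_fst continuous_on_snd)
  let ?J = "{..<n}"
  define \<mu> where "\<mu> = distr M borel (\<lambda>\<omega>. (S1 0 \<omega>, S2 0 \<omega>))"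
  define \<nu> where "\<nu> = density lborel (normal_density 0 (sqrt N))"
  have \<mu>: "prob_space \<mu>" "sets \<mu> = sets borel" unfolding \<mu>_def by (auto intro!: prob_space_distr)
  have \<nu>: "prob_space \<nu>" "sets \<nu> = sets borel" unfolding \<nu>_def using prob_space_normal_density[of "sqrt N" 0] N by auto
  interpret \<mu>: prob_space \<mu> by (rule \<mu>)
  interpret \<nu>: prob_space \<nu> by (rule \<nu>)
  have zm[measurable]: "z t \<in> borel_measurable M" for t using z by auto
  have z0: "distr M borel (z 0) = \<nu>"
    using z noise1 noise2 by (auto simp: \<nu>_def distributed_def distr_cong[OF refl sets_lborel[symmetric] refl])
  have hm: "(\<lambda>p. ((fst p, fst (snd p)), pz (snd (snd p)))) \<in> borel_measurable (borel :: ((real^'m1) \<times> (real^'m2) \<times> real \<times> real) measure)"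
    by (intro borel_measurable_continuous_onI continuous_intros continuous_on_compose2[OF pz(1)]) auto
  have R: "(\<lambda>\<omega>. ((S1 t \<omega>, S2 t \<omega>), z t \<omega>)) = (\<lambda>\<omega>. (\<lambda>p. ((fst p, fst (snd p)), pz (snd (snd p)))) (S1 t \<omega>, S2 t \<omega>, Z1 t \<omega>, Z2 t \<omega>))" for t
    by (simp add: pz(2))
  have ind: "indep_vars (\<lambda>_. borel) (\<lambda>t \<omega>. ((S1 t \<omega>, S2 t \<omega>), z t \<omega>)) ?J"
    unfolding R by (rule indep_vars_compose2[OF indep_vars_subset[OF indep_in_time]]) (use hm in auto)
  have law0: "distr M borel (\<lambda>\<omega>. ((S1 0 \<omega>, S2 0 \<omega>), z 0 \<omega>)) = \<mu> \<Otimes>\<^sub>M \<nu>"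
  proof -
    have "\<mu> \<Otimes>\<^sub>M \<nu> = distr M borel (\<lambda>\<omega>. ((S1 0 \<omega>, S2 0 \<omega>), z 0 \<omega>))"
    proof (rule pair_measure_eqI)
      show "sigma_finite_measure \<mu>" "sigma_finite_measure \<nu>" by unfold_locales
      show "sets (\<mu> \<Otimes>\<^sub>M \<nu>) = sets (distr M borel (\<lambda>\<omega>. ((S1 0 \<omega>, S2 0 \<omega>), z 0 \<omega>)))"
        using sets_pair_borel[OF \<mu>(2) \<nu>(2)] by simp
      fix A B assume "A \<in> sets \<mu>" "B \<in> sets \<nu>"
      then have A: "A \<in> sets borel" and B: "B \<in> sets borel" using \<mu> \<nu> by auto
      let ?A = "(\<lambda>\<omega>. (S1 0 \<omega>, S2 0 \<omega>)) -` A \<inter> space M" and ?B = "z 0 -` B \<inter> space M"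
      have A': "?A \<in> sets (vimage_algebra (space M) (\<lambda>\<omega>. (S1 0 \<omega>, S2 0 \<omega>)) borel)"
        using A by (rule in_vimage_algebra)
      \<comment> \<open>\<open>noise_indep\<close> concerns the pair of noises; an event about one
        of them lies in the same sigma-algebra.\<close>
      have B': "?B \<in> sets (vimage_algebra (space M) (\<lambda>\<omega>. (Z1 0 \<omega>, Z2 0 \<omega>)) borel)"
      proof -
        have "pz -` B \<in> sets borel"
          using measurable_sets[OF borel_measurable_continuous_onI[OF pz(1)] B] by simp
        from in_vimage_algebra[OF this, of "\<lambda>\<omega>. (Z1 0 \<omega>, Z2 0 \<omega>)" "space M"] show ?thesis
          by (simp add: pz(2)[abs_def] vimage_def)
      qed
      have p: "prob (?A \<inter> ?B) = prob ?A * prob ?B"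
        by (rule indep_setD[OF noise_indep A' B'])
      have AB: "A \<times> B \<in> sets borel" using A B by (simp add: borel_prod[symmetric])
      have "emeasure (distr M borel (\<lambda>\<omega>. ((S1 0 \<omega>, S2 0 \<omega>), z 0 \<omega>))) (A \<times> B) = emeasure M (?A \<inter> ?B)"
        by (subst emeasure_distr) (use AB in \<open>auto intro!: arg_cong[where f = "emeasure M"]\<close>)
      also have "\<dots> = emeasure M ?A * emeasure M ?B" by (simp add: emeasure_eq_measure p ennreal_mult)
      also have "emeasure M ?A = emeasure \<mu> A" unfolding \<mu>_def using A by (subst emeasure_distr) auto
      also have "emeasure M ?B = emeasure \<nu> B" unfolding z0[symmetric] using B by (subst emeasure_distr) auto
      finally show "emeasure \<mu> A * emeasure \<nu> B = emeasure (distr M borel (\<lambda>\<omega>. ((S1 0 \<omega>, S2 0 \<omega>), z 0 \<omega>))) (A \<times> B)" ..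
    qed
    then show ?thesis ..
  qed
  have law: "distr M borel (\<lambda>\<omega>. ((S1 t \<omega>, S2 t \<omega>), z t \<omega>)) = \<mu> \<Otimes>\<^sub>M \<nu>" for t
    using ident_law[OF hm, of t] law0 unfolding R by simp
  let ?PP = "Pi\<^sub>M ?J (\<lambda>_. \<mu>) \<Otimes>\<^sub>M Pi\<^sub>M ?J (\<lambda>_. \<nu>)"
  have setsL: "sets L = sets ?PP"
    unfolding L_def by (intro sets_pair_measure_cong sets_PiM_cong refl) (use \<mu> \<nu> in auto)
  let ?s = "\<lambda>\<omega>. \<lambda>t\<in>?J. (S1 t \<omega>, S2 t \<omega>)"
  have s_m: "?s \<in> M \<rightarrow>\<^sub>M Pi\<^sub>M ?J (\<lambda>_. \<mu>)"
    by (intro measurable_restrict) (auto cong: measurable_cong_sets simp: \<mu>)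
  have z_m: "(\<lambda>\<omega>. \<lambda>t\<in>?J. z t \<omega>) \<in> M \<rightarrow>\<^sub>M Pi\<^sub>M ?J (\<lambda>_. \<nu>)"
    by (intro measurable_restrict) (auto cong: measurable_cong_sets simp: \<nu>)
  note J = joint_block_law[OF n ind law \<mu> \<nu>]
  interpret P\<nu>: prob_space "Pi\<^sub>M ?J (\<lambda>_. \<nu>)" by (intro prob_space_PiM \<nu>)
  interpret P\<mu>: prob_space "Pi\<^sub>M ?J (\<lambda>_. \<mu>)" by (intro prob_space_PiM \<mu>)
  have s_law: "distr M (Pi\<^sub>M ?J (\<lambda>_. \<mu>)) ?s = Pi\<^sub>M ?J (\<lambda>_. \<mu>)"
  proof -
    have "Pi\<^sub>M ?J (\<lambda>_. \<mu>) = distr ?PP (Pi\<^sub>M ?J (\<lambda>_. \<mu>)) fst" by (rule P\<nu>.distr_pair_fst[symmetric])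
    also have "\<dots> = distr (distr M ?PP (\<lambda>\<omega>. (?s \<omega>, \<lambda>t\<in>?J. z t \<omega>))) (Pi\<^sub>M ?J (\<lambda>_. \<mu>)) fst" by (simp only: J)
    also have "\<dots> = distr M (Pi\<^sub>M ?J (\<lambda>_. \<mu>)) ?s"
      by (subst distr_distr[OF measurable_fst measurable_Pair[OF s_m z_m]]) (simp add: comp_def)
    finally show ?thesis ..
  qed
  have w_law: "distr (std_on I) (Pi\<^sub>M ?J (\<lambda>_. \<nu>)) (\<lambda>\<zeta>. \<lambda>t\<in>?J. sqrt N * \<zeta> (e t)) = Pi\<^sub>M ?J (\<lambda>_. \<nu>)"
    unfolding \<nu>_def by (rule std_block_law[OF I e N])
  have w_m: "(\<lambda>\<zeta>. \<lambda>t\<in>?J. sqrt N * \<zeta> (e t)) \<in> std_on I \<rightarrow>\<^sub>M Pi\<^sub>M ?J (\<lambda>_. \<nu>)"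
    using I(2) by (intro measurable_restrict)
      (auto cong: measurable_cong_sets simp: \<nu> intro!: borel_measurable_times PiM_component_measurable[OF measurable_ident_sets[OF refl]])
  have "distr M L (\<lambda>\<omega>. (?s \<omega>, \<lambda>t\<in>?J. z t \<omega>)) = distr M ?PP (\<lambda>\<omega>. (?s \<omega>, \<lambda>t\<in>?J. z t \<omega>))"
    by (rule distr_cong) (use setsL in auto)
  also have "\<dots> = ?PP" by (rule J)
  also have "\<dots> = distr M (Pi\<^sub>M ?J (\<lambda>_. \<mu>)) ?s \<Otimes>\<^sub>M distr (std_on I) (Pi\<^sub>M ?J (\<lambda>_. \<nu>)) (\<lambda>\<zeta>. \<lambda>t\<in>?J. sqrt N * \<zeta> (e t))"
    by (simp only: s_law w_law)
  also have "\<dots> = distr (M \<Otimes>\<^sub>M std_on I) ?PP (\<lambda>(x, y). (?s x, \<lambda>t\<in>?J. sqrt N * y (e t)))"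
    by (rule pair_measure_distr[OF s_m w_m]) (simp only: w_law P\<nu>.sigma_finite_measure_axioms)
  also have "\<dots> = distr (M \<Otimes>\<^sub>M std_on I) L (\<lambda>p. (?s (fst p), \<lambda>t\<in>?J. sqrt N * snd p (e t)))"
    by (rule distr_cong) (use setsL in auto)
  finally show ?thesis .
qed

end

section \<open>The mixture of a code\<close>

lemma square_integrable_add:
  fixes f g :: "'a \<Rightarrow> real"
  assumes f: "f \<in> borel_measurable N" "integrable N (\<lambda>x. (f x)\<^sup>2)"
    and g: "g \<in> borel_measurable N" "integrable N (\<lambda>x. (g x)\<^sup>2)"
  shows "integrable N (\<lambda>x. (f x + g x)\<^sup>2)"
proof -
  have e: "(f x + g x)\<^sup>2 = (f x)\<^sup>2 + (g x)\<^sup>2 + 2 * (f x * g x)" for x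
    by (simp add: power2_eq_square algebra_simps)
  show ?thesis unfolding e using f g integrable_mult_L2[OF f g] by auto
qed

text \<open>The adjoint of selecting the coordinates \<open>y $ sel j\<close>: forms in selected
  coordinates become forms in the full vector. The parameter \<open>sel\<close> thereby treats the
  first source, the second source and the whole vector uniformly.\<close>

definition lift_vec :: "('c::finite \<Rightarrow> 'k::finite) \<Rightarrow> real^'c \<Rightarrow> real^'k" where
  "lift_vec sel \<xi> = (\<Sum>j\<in>UNIV. \<xi> $ j *\<^sub>R axis (sel j) 1)"

definition sub_mat :: "('c::finite \<Rightarrow> 'k::finite) \<Rightarrow> real^'k^'k \<Rightarrow> real^'c^'c" where
  "sub_mat sel A = (\<chi> i j. A $ sel i $ sel j)"

lemma lift_vec_inner: "lift_vec sel \<xi> \<bullet> y = \<xi> \<bullet> (\<chi> j. y $ sel j)"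
  unfolding lift_vec_def inner_sum_left inner_scaleR_left inner_axis' by (simp add: inner_vec_def)

lemma lift_vec_form: "lift_vec sel \<xi> \<bullet> (A *v lift_vec sel \<xi>) = \<xi> \<bullet> (sub_mat sel A *v \<xi>)"
proof -
  have "(A *v lift_vec sel \<xi>) $ i = (\<Sum>j\<in>UNIV. A $ i $ sel j * \<xi> $ j)" for i
  proof -
    have "(A *v lift_vec sel \<xi>) $ i = lift_vec sel \<xi> \<bullet> (A $ i)"
      by (simp add: matrix_vector_mult_def inner_vec_def mult.commute)
    then show ?thesis by (simp add: lift_vec_inner) (simp add: inner_vec_def mult.commute)
  qed
  then show ?thesis
    unfolding lift_vec_inner by (simp add: sub_mat_def matrix_vector_mult_def inner_vec_def)
qed

lemma sub_mat_add: "sub_mat sel (A + B) = sub_mat sel A + sub_mat sel B"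
  by (simp add: sub_mat_def vec_eq_iff)

lemma sub_mat_scaled_id: "inj sel \<Longrightarrow> sub_mat sel (c *\<^sub>R mat 1) = c *\<^sub>R mat 1"
  by (auto simp: sub_mat_def vec_eq_iff mat_def inj_eq)

text \<open>Only the encoder is fixed; decoders, distortions and the power bound enter later.
  \<open>U'\<close> stands for U - s^2 I, so smoothing by \<open>U'\<close> and then by mixture
  noise of deviation \<open>s\<close> amounts to smoothing by U.\<close>

locale coded_broadcast = gaussian_broadcast M S1 S2 Z1 Z2 N1 N2
  for M :: "'w measure"
    and S1 :: "nat \<Rightarrow> 'w \<Rightarrow> real^'m1" and S2 :: "nat \<Rightarrow> 'w \<Rightarrow> real^'m2"
    and Z1 Z2 :: "nat \<Rightarrow> 'w \<Rightarrow> real" and N1 N2 :: real +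
  fixes n :: nat and f :: "(nat \<Rightarrow> real^'m1) \<times> (nat \<Rightarrow> real^'m2) \<Rightarrow> nat \<Rightarrow> real"
    and \<Sigma> U' Bg :: "real^('m1 + 'm2)^('m1 + 'm2)" and s :: real
  assumes n: "0 < n" and N: "0 < N1" "N1 < N2"
    and f[measurable]: "f \<in> block_space n \<Otimes>\<^sub>M block_space n \<rightarrow>\<^sub>M block_space n"
    and X_sq: "integrable M (\<lambda>\<omega>. \<Sum>t<n. (f (block n S1 \<omega>, block n S2 \<omega>) t)\<^sup>2)"
    and \<Sigma>: "\<Sigma> = second_moment M (src 0)" and pd: "pos_def \<Sigma>"
    and Bg: "whitens Bg U'" and s: "0 < s"
begin

abbreviation X :: "'w \<Rightarrow> nat \<Rightarrow> real" where "X \<omega> \<equiv> f (block n S1 \<omega>, block n S2 \<omega>)"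

definition Mx :: "('w \<times> (nat \<Rightarrow> real^('m1 + 'm2))) measure" where
  "Mx = M \<Otimes>\<^sub>M Pi\<^sub>M {..<n} (\<lambda>_. gauss Bg)"

text \<open>Index \<open>Inl (t, k)\<close> is coordinate \<open>k\<close> of the smoothed source at time \<open>t\<close>, before the isotropic part
  \<open>s\<^sup>2 I\<close> is added as mixture noise; \<open>Inr t\<close> is the channel input.\<close>

definition x :: "(nat \<times> ('m1 + 'm2)) + nat \<Rightarrow> 'w \<times> (nat \<Rightarrow> real^('m1 + 'm2)) \<Rightarrow> real" where
  "x i p = (case i of Inl (t, k) \<Rightarrow> if t < n then src t (fst p) $ k + snd p t $ k else 0
    | Inr t \<Rightarrow> if t < n then X (fst p) t else 0)"

lemma prob_space_gauss_Bg: "prob_space (gauss Bg)" by (rule prob_space_gauss[OF whitens_det(2)[OF Bg]])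

lemma prob_space_smoothing: "prob_space (Pi\<^sub>M {..<n} (\<lambda>_. gauss Bg))" by (intro prob_space_PiM prob_space_gauss_Bg)

lemma prob_space_Mx: "prob_space Mx"
proof -
  interpret G: prob_space "Pi\<^sub>M {..<n} (\<lambda>_. gauss Bg)" by (rule prob_space_smoothing)
  interpret P: pair_prob_space M "Pi\<^sub>M {..<n} (\<lambda>_. gauss Bg)" ..
  show ?thesis unfolding Mx_def by (rule P.prob_space_axioms)
qed

lemma block_measurable: "block n S1 \<in> M \<rightarrow>\<^sub>M block_space n" "block n S2 \<in> M \<rightarrow>\<^sub>M block_space n"
  unfolding block_def[abs_def] by (intro measurable_restrict; simp)+

lemma X_measurable: "t < n \<Longrightarrow> (\<lambda>\<omega>. X \<omega> t) \<in> borel_measurable M"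
  using measurable_compose[OF measurable_compose[OF measurable_Pair[OF block_measurable] f] measurable_component_singleton[of t "{..<n}"]]
  by simp

lemma smoothing_component:
  assumes "t < n"
  shows "(\<lambda>\<eta>. \<eta> t) \<in> Pi\<^sub>M {..<n} (\<lambda>_. gauss Bg) \<rightarrow>\<^sub>M borel"
    "distr (Pi\<^sub>M {..<n} (\<lambda>_. gauss Bg)) (gauss Bg) (\<lambda>\<eta>. \<eta> t) = gauss Bg"
    "(\<lambda>\<eta>. \<eta> t) \<in> Pi\<^sub>M {..<n} (\<lambda>_. gauss Bg) \<rightarrow>\<^sub>M gauss Bg"
proof -
  show m: "(\<lambda>\<eta>. \<eta> t) \<in> Pi\<^sub>M {..<n} (\<lambda>_. gauss Bg) \<rightarrow>\<^sub>M gauss Bg"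
    by (rule measurable_component_singleton) (use assms in simp)
  then show "(\<lambda>\<eta>. \<eta> t) \<in> Pi\<^sub>M {..<n} (\<lambda>_. gauss Bg) \<rightarrow>\<^sub>M borel" by (simp cong: measurable_cong_sets)
  show "distr (Pi\<^sub>M {..<n} (\<lambda>_. gauss Bg)) (gauss Bg) (\<lambda>\<eta>. \<eta> t) = gauss Bg"
    using distr_PiM_component[where M = "\<lambda>_. gauss Bg" and I = "{..<n}" and i = t] prob_space_gauss_Bg assms by simp
qed

lemma smoothing_moments:
  assumes "t < n"
  shows "(\<lambda>\<eta>. b \<bullet> \<eta> t) \<in> borel_measurable (Pi\<^sub>M {..<n} (\<lambda>_. gauss Bg))"
    "integrable (Pi\<^sub>M {..<n} (\<lambda>_. gauss Bg)) (\<lambda>\<eta>. (b \<bullet> \<eta> t)\<^sup>2)"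
    "(\<integral>\<eta>. (b \<bullet> \<eta> t)\<^sup>2 \<partial>Pi\<^sub>M {..<n} (\<lambda>_. gauss Bg)) = b \<bullet> (U' *v b)"
    "(\<integral>\<eta>. b \<bullet> \<eta> t \<partial>Pi\<^sub>M {..<n} (\<lambda>_. gauss Bg)) = 0"
proof -
  note m = smoothing_component[OF assms]
  show "(\<lambda>\<eta>. b \<bullet> \<eta> t) \<in> borel_measurable (Pi\<^sub>M {..<n} (\<lambda>_. gauss Bg))" using m(1) by simp
  have tr: "integrable (Pi\<^sub>M {..<n} (\<lambda>_. gauss Bg)) (\<lambda>\<eta>. F (\<eta> t)) = integrable (gauss Bg) F"
    "(\<integral>\<eta>. F (\<eta> t) \<partial>Pi\<^sub>M {..<n} (\<lambda>_. gauss Bg)) = (\<integral>u. F u \<partial>gauss Bg)"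
    if "F \<in> borel_measurable borel" for F :: "real^('m1 + 'm2) \<Rightarrow> real"
  proof -
    have F: "F \<in> borel_measurable (gauss Bg)" using that by (simp cong: measurable_cong_sets)
    show "integrable (Pi\<^sub>M {..<n} (\<lambda>_. gauss Bg)) (\<lambda>\<eta>. F (\<eta> t)) = integrable (gauss Bg) F"
      using integrable_distr_eq[OF m(3) F] by (simp add: m(2))
    show "(\<integral>\<eta>. F (\<eta> t) \<partial>Pi\<^sub>M {..<n} (\<lambda>_. gauss Bg)) = (\<integral>u. F u \<partial>gauss Bg)"
      using integral_distr[OF m(3) F] by (simp add: m(2))
  qed
  note gm = gauss_moments[OF Bg, of b]
  show "integrable (Pi\<^sub>M {..<n} (\<lambda>_. gauss Bg)) (\<lambda>\<eta>. (b \<bullet> \<eta> t)\<^sup>2)" using tr(1)[of "\<lambda>u. (b \<bullet> u)\<^sup>2"] gm by simp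
  show "(\<integral>\<eta>. (b \<bullet> \<eta> t)\<^sup>2 \<partial>Pi\<^sub>M {..<n} (\<lambda>_. gauss Bg)) = b \<bullet> (U' *v b)" using tr(2)[of "\<lambda>u. (b \<bullet> u)\<^sup>2"] gm by simp
  show "(\<integral>\<eta>. b \<bullet> \<eta> t \<partial>Pi\<^sub>M {..<n} (\<lambda>_. gauss Bg)) = 0" using tr(2)[of "\<lambda>u. b \<bullet> u"] gm by simp
qed

lemmas source_moments = src_moments[OF \<Sigma> pd]

lemma X_square: "t < n \<Longrightarrow> integrable M (\<lambda>\<omega>. (X \<omega> t)\<^sup>2)"
proof (rule Bochner_Integration.integrable_bound[OF X_sq])
  assume t: "t < n"
  show "(\<lambda>\<omega>. (X \<omega> t)\<^sup>2) \<in> borel_measurable M" using X_measurable[OF t] by simp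
  have "(X \<omega> t)\<^sup>2 \<le> (\<Sum>t<n. (X \<omega> t)\<^sup>2)" for \<omega>
    using t by (intro member_le_sum) auto
  then show "AE \<omega> in M. norm ((X \<omega> t)\<^sup>2) \<le> norm (\<Sum>t<n. (X \<omega> t)\<^sup>2)"
    by (auto intro: order_trans[OF _ abs_ge_self])
qed

text \<open>\<open>x\<close> vanishes from time \<open>n\<close> on, so the moment conditions hold
  at every index of the infinite index type.\<close>

lemma mixture: "gauss_mixture Mx x"
proof -
  interpret G: prob_space "Pi\<^sub>M {..<n} (\<lambda>_. gauss Bg)" by (rule prob_space_smoothing)
  have "x i \<in> borel_measurable Mx \<and> integrable Mx (\<lambda>p. (x i p)\<^sup>2)" for i
  proof (cases i)
    case (Inl tk)
    obtain t k where i: "i = Inl (t, k)" using Inl by (cases tk) auto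
    show ?thesis
    proof (cases "t < n")
      case True
      have xi: "x i = (\<lambda>p. axis k 1 \<bullet> src t (fst p) + axis k 1 \<bullet> snd p t)"
        using True by (auto simp: x_def i inner_axis')
      have m1: "(\<lambda>p. axis k 1 \<bullet> src t (fst p)) \<in> borel_measurable Mx" unfolding Mx_def by measurable
      have m2: "(\<lambda>p. axis k 1 \<bullet> snd p t) \<in> borel_measurable Mx"
        unfolding Mx_def by (rule measurable_compose[OF measurable_snd smoothing_moments(1)[OF True]])
      have i1: "integrable Mx (\<lambda>p. (axis k 1 \<bullet> src t (fst p))\<^sup>2)"
        unfolding Mx_def by (rule integrable_pair_fst[OF prob_space_axioms prob_space_smoothing source_moments(1)])
      have i2: "integrable Mx (\<lambda>p. (axis k 1 \<bullet> snd p t)\<^sup>2)"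
        unfolding Mx_def by (rule integrable_pair_snd[OF prob_space_axioms prob_space_smoothing smoothing_moments(2)[OF True]])
      show ?thesis unfolding xi using m1 m2 square_integrable_add[OF m1 i1 m2 i2] by auto
    qed (auto simp: x_def[abs_def] i)
  next
    case (Inr t)
    show ?thesis
    proof (cases "t < n")
      case True
      then have xi: "x i = (\<lambda>p. X (fst p) t)" by (auto simp: x_def Inr)
      have "(\<lambda>p. X (fst p) t) \<in> borel_measurable Mx"
        unfolding Mx_def by (rule measurable_compose[OF measurable_fst X_measurable[OF True]])
      moreover have "integrable Mx (\<lambda>p. (X (fst p) t)\<^sup>2)"
        unfolding Mx_def by (rule integrable_pair_fst[OF prob_space_axioms prob_space_smoothing X_square[OF True]])
      ultimately show ?thesis by (simp add: xi)
    qed (auto simp: x_def[abs_def] Inr)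
  qed
  then show ?thesis using prob_space_Mx by (simp add: gauss_mixture_def gauss_mixture_axioms_def)
qed

sublocale mixture: gauss_mixture Mx x by (rule mixture)

text \<open>Error, smoothing vector and isotropic noise are uncorrelated, so their second moments
  add, the last two contributing \<open>U'\<close> and s^2 I. \<open>ind\<close> records that
  \<open>p\<close> may read the channel coordinates but no source coordinate at time
  \<open>t\<close>.\<close>

lemma noisy_form_moment:
  fixes b :: "real^('m1 + 'm2)" and p :: "'w \<times> ((nat \<times> ('m1 + 'm2)) + nat \<Rightarrow> real) \<Rightarrow> real"
  assumes t: "t < n" and I: "finite I" "\<And>k. b $ k \<noteq> 0 \<Longrightarrow> Inl (t, k) \<in> I"
    and p: "p \<in> borel_measurable (M \<Otimes>\<^sub>M std_on I)" "integrable (M \<Otimes>\<^sub>M std_on I) (\<lambda>u. (p u)\<^sup>2)"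
    and ind: "\<And>\<omega> \<zeta> k y. p (\<omega>, \<zeta>(Inl (t, k) := y)) = p (\<omega>, \<zeta>)"
  defines "q \<equiv> \<lambda>u. p (fst (fst u), snd u) + b \<bullet> snd (fst u) t + s * (b \<bullet> (\<chi> k. snd u (Inl (t, k))))"
  shows "integrable (Mx \<Otimes>\<^sub>M std_on I) (\<lambda>u. (q u)\<^sup>2)"
    and "(\<integral>u. (q u)\<^sup>2 \<partial>(Mx \<Otimes>\<^sub>M std_on I)) = (\<integral>u. (p u)\<^sup>2 \<partial>(M \<Otimes>\<^sub>M std_on I)) + b \<bullet> ((U' + s\<^sup>2 *\<^sub>R mat 1) *v b)"
proof -
  interpret S: prob_space "std_on I" by (rule prob_space_std_on)
  interpret G: prob_space "Pi\<^sub>M {..<n} (\<lambda>_. gauss Bg)" by (rule prob_space_smoothing)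
  define q0 where "q0 u = p (fst (fst u), snd u) + b \<bullet> snd (fst u) t" for u :: "('w \<times> (nat \<Rightarrow> real^('m1 + 'm2))) \<times> ((nat \<times> ('m1 + 'm2)) + nat \<Rightarrow> real)"
  define e :: "('m1 + 'm2) \<Rightarrow> (nat \<times> ('m1 + 'm2)) + nat" where "e k = Inl (t, k)" for k
  \<comment> \<open>Only coordinates with nonzero weight must lie in \<open>I\<close>: a form in one
    source leaves the coordinates of the other out.\<close>
  define K where "K = e ` {k. b $ k \<noteq> 0}"
  define c where "c i = (case i of Inl (t, k) \<Rightarrow> s * b $ k | Inr _ \<Rightarrow> 0)" for i :: "(nat \<times> ('m1 + 'm2)) + nat"
  have inj: "inj_on e A" for A by (auto simp: e_def inj_on_def)
  have K: "K \<subseteq> I" using I by (auto simp: K_def e_def)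
  have A1: "integrable (Mx \<Otimes>\<^sub>M std_on I) (\<lambda>u. (q0 u)\<^sup>2)"
    "(\<integral>u. (q0 u)\<^sup>2 \<partial>(Mx \<Otimes>\<^sub>M std_on I)) = (\<integral>u. (p u)\<^sup>2 \<partial>(M \<Otimes>\<^sub>M std_on I)) + b \<bullet> (U' *v b)"
    using add_independent_middle[OF prob_space_axioms G.prob_space_axioms S.prob_space_axioms p, of "\<lambda>\<eta>. b \<bullet> \<eta> t"] smoothing_moments[OF t, of b]
    unfolding q0_def Mx_def by auto
  have q0m: "q0 \<in> borel_measurable (Mx \<Otimes>\<^sub>M std_on I)"
  proof -
    have "(\<lambda>u. p (fst (fst u), snd u)) \<in> borel_measurable (Mx \<Otimes>\<^sub>M std_on I)"
      unfolding Mx_def by (rule measurable_compose[OF _ p(1)]) measurable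
    moreover have "(\<lambda>u. b \<bullet> snd (fst u) t) \<in> borel_measurable (Mx \<Otimes>\<^sub>M std_on I)"
      unfolding Mx_def by (rule measurable_compose[OF measurable_compose[OF measurable_fst measurable_snd] smoothing_moments(1)[OF t]])
    ultimately show ?thesis unfolding q0_def by simp
  qed
  have q: "q u = q0 u + (\<Sum>i\<in>K. c i * snd u i)" for u
  proof -
    have "(\<Sum>i\<in>K. c i * snd u i) = (\<Sum>k\<in>{k. b $ k \<noteq> 0}. s * b $ k * snd u (Inl (t, k)))"
      unfolding K_def by (subst sum.reindex[OF inj]) (simp add: e_def c_def)
    also have "\<dots> = (\<Sum>k\<in>UNIV. s * b $ k * snd u (Inl (t, k)))"
      by (rule sum.mono_neutral_left) auto
    also have "\<dots> = s * (b \<bullet> (\<chi> k. snd u (Inl (t, k))))"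
      by (simp add: inner_vec_def sum_distrib_left mult.assoc)
    finally show ?thesis by (simp add: q_def q0_def)
  qed
  have c2: "(\<Sum>i\<in>K. (c i)\<^sup>2) = s\<^sup>2 * (b \<bullet> b)"
  proof -
    have "(\<Sum>i\<in>K. (c i)\<^sup>2) = (\<Sum>k\<in>{k. b $ k \<noteq> 0}. (s * b $ k)\<^sup>2)"
      unfolding K_def by (subst sum.reindex[OF inj]) (simp add: e_def c_def)
    also have "\<dots> = (\<Sum>k\<in>UNIV. (s * b $ k)\<^sup>2)" by (rule sum.mono_neutral_left) auto
    also have "\<dots> = s\<^sup>2 * (b \<bullet> b)" by (simp add: inner_vec_def sum_distrib_left power2_eq_square mult_ac)
    finally show ?thesis .
  qed
  have dep: "q0 (\<omega>, \<zeta>(k := y)) = q0 (\<omega>, \<zeta>)" if "k \<in> K" for \<omega> \<zeta> y k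
    using that ind by (auto simp: q0_def K_def e_def simp del: fun_upd_apply)
  show "integrable (Mx \<Otimes>\<^sub>M std_on I) (\<lambda>u. (q u)\<^sup>2)"
    unfolding q by (rule add_std_coordinates(1)[OF prob_space_Mx I(1) K q0m A1(1) dep])
  have "(\<integral>u. (q u)\<^sup>2 \<partial>(Mx \<Otimes>\<^sub>M std_on I)) = (\<integral>u. (q0 u)\<^sup>2 \<partial>(Mx \<Otimes>\<^sub>M std_on I)) + (\<Sum>i\<in>K. (c i)\<^sup>2)"
    unfolding q by (rule add_std_coordinates(2)[OF prob_space_Mx I(1) K q0m A1(1) dep])
  then show "(\<integral>u. (q u)\<^sup>2 \<partial>(Mx \<Otimes>\<^sub>M std_on I)) = (\<integral>u. (p u)\<^sup>2 \<partial>(M \<Otimes>\<^sub>M std_on I)) + b \<bullet> ((U' + s\<^sup>2 *\<^sub>R mat 1) *v b)"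
    unfolding A1 c2 by (simp add: matrix_vector_mult_add_rdistrib scaleR_matrix_vector_assoc[symmetric] inner_add_right)
qed

abbreviation W :: "('c \<Rightarrow> 'm1 + 'm2) \<Rightarrow> ((nat \<times> ('m1 + 'm2)) + nat) set" where
  "W sel \<equiv> (\<Union>t\<in>{..<n}. range (\<lambda>j. Inl (t, sel j)))"

lemma finite_W: "finite (W (sel :: 'c::finite \<Rightarrow> 'm1 + 'm2))" by auto

text \<open>Times are independent, and at each time source plus smoothing is Gaussian with
  covariance \<open>sub_mat sel (\<Sigma> + U')\<close>, to which the kernel adds s^2 I. Knowing
  this density exactly makes the source entropies computable.\<close>

lemma mix_factor:
  fixes sel :: "'c::finite \<Rightarrow> 'm1 + 'm2"
  assumes sel: "inj sel" and \<sigma>: "\<And>i. 0 < \<sigma> i" "\<And>tk. \<sigma> (Inl tk) = s"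
    and B: "whitens B (sub_mat sel (\<Sigma> + U') + s\<^sup>2 *\<^sub>R mat 1)"
  shows "mix Mx x \<sigma> (W sel) v = (\<Prod>t<n. gdens B (\<chi> j. v (Inl (t, sel j))))"
proof -
  interpret G: prob_space "gauss Bg" by (rule prob_space_gauss_Bg)
  interpret PG: prob_space "Pi\<^sub>M {..<n} (\<lambda>_. gauss Bg)" by (rule prob_space_smoothing)
  interpret PGf: product_sigma_finite "\<lambda>_::nat. gauss Bg" by standard
  interpret MG: pair_prob_space M "gauss Bg" ..
  have det: "det B \<noteq> 0" by (rule whitens_det(2)[OF B])
  define h where "h t y = (\<Prod>j\<in>UNIV. normal_density (y $ sel j) s (v (Inl (t, sel j))))" for t and y :: "real^('m1 + 'm2)"
  have hm[measurable]: "h t \<in> borel_measurable borel" for t unfolding h_def by measurable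
  have h0: "0 \<le> h t y" for t y unfolding h_def by (intro prod_nonneg) simp
  have kern: "gkern x \<sigma> (W sel) p v = (\<Prod>t<n. h t (src t (fst p) + snd p t))" for p
  proof -
    have "gkern x \<sigma> (W sel) p v = (\<Prod>t<n. \<Prod>i\<in>range (\<lambda>j. Inl (t, sel j)). normal_density (x i p) (\<sigma> i) (v i))"
      unfolding gkern_def by (rule prod.UNION_disjoint) auto
    also have "\<dots> = (\<Prod>t<n. h t (src t (fst p) + snd p t))"
    proof (rule prod.cong[OF refl])
      fix t assume t: "t \<in> {..<n}"
      have "inj (\<lambda>j. Inl (t, sel j) :: (nat \<times> ('m1 + 'm2)) + nat)" using sel by (auto simp: inj_def)
      then show "(\<Prod>i\<in>range (\<lambda>j. Inl (t, sel j)). normal_density (x i p) (\<sigma> i) (v i)) = h t (src t (fst p) + snd p t)"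
        using t by (subst prod.reindex) (auto simp: h_def x_def \<sigma>(2))
    qed
    finally show ?thesis .
  qed
  have step: "(\<integral>\<^sup>+\<omega>. \<integral>\<^sup>+u. ennreal (h t (src t \<omega> + u)) \<partial>gauss Bg \<partial>M) = ennreal (gdens B (\<chi> j. v (Inl (t, sel j))))" for t
  proof -
    define Q where "Q p = (\<chi> j. (src t (fst p) + snd p) $ sel j)" for p :: "'w \<times> (real^('m1 + 'm2))"
    have sm[measurable]: "(\<lambda>p. src t (fst p) + snd p) \<in> borel_measurable (M \<Otimes>\<^sub>M gauss Bg)" by measurable
    have Qm: "Q \<in> borel_measurable (M \<Otimes>\<^sub>M gauss Bg)"
      unfolding Q_def by (rule borel_measurable_vec) (simp, measurable)
    have char: "(\<integral>p. iexp (\<xi> \<bullet> Q p) \<partial>(M \<Otimes>\<^sub>M gauss Bg)) = complex_of_real (exp (- (\<xi> \<bullet> (sub_mat sel (\<Sigma> + U') *v \<xi>)) / 2))" for \<xi>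
    proof -
      define b where "b = lift_vec sel \<xi>"
      have bQ: "\<xi> \<bullet> Q p = b \<bullet> src t (fst p) + b \<bullet> snd p" for p
        unfolding Q_def b_def lift_vec_inner[symmetric] by (simp add: inner_add_right)
      have e: "iexp (\<xi> \<bullet> Q p) = iexp (b \<bullet> src t (fst p)) * iexp (b \<bullet> snd p)" for p
        unfolding bQ by (simp add: exp_add[symmetric] distrib_left)
      have i: "integrable (M \<Otimes>\<^sub>M gauss Bg) (\<lambda>p. iexp (b \<bullet> src t (fst p)) * iexp (b \<bullet> snd p))"
      proof (rule MG.P.integrable_const_bound[where B = 1])
        show "(\<lambda>p. iexp (b \<bullet> src t (fst p)) * iexp (b \<bullet> snd p)) \<in> borel_measurable (M \<Otimes>\<^sub>M gauss Bg)" by measurable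
      qed (simp add: norm_mult)
      have "(\<integral>p. iexp (\<xi> \<bullet> Q p) \<partial>(M \<Otimes>\<^sub>M gauss Bg)) = (\<integral>\<omega>. iexp (b \<bullet> src t \<omega>) * (\<integral>u. iexp (b \<bullet> u) \<partial>gauss Bg) \<partial>M)"
        unfolding e using MG.integral_fst'[OF i] by simp
      also have "\<dots> = complex_of_real (exp (- (b \<bullet> (\<Sigma> *v b)) / 2)) * complex_of_real (exp (- (b \<bullet> (U' *v b)) / 2))"
        unfolding gauss_char(1)[OF Bg] integral_mult_left_zero source_moments(3) ..
      also have "\<dots> = complex_of_real (exp (- (b \<bullet> ((\<Sigma> + U') *v b)) / 2))"
        unfolding of_real_mult[symmetric] exp_add[symmetric]
        by (simp add: matrix_vector_mult_add_rdistrib inner_add_right add_divide_distrib)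
      finally show ?thesis unfolding b_def lift_vec_form .
    qed
    have G: "(\<integral>p. (\<Prod>j\<in>UNIV. normal_density (Q p $ j) s ((\<chi> j. v (Inl (t, sel j))) $ j)) \<partial>(M \<Otimes>\<^sub>M gauss Bg)) = gdens B (\<chi> j. v (Inl (t, sel j)))"
      by (rule smoothed_gaussian_density[OF MG.P.prob_space_axioms Qm char s B])
    have hQ: "(\<Prod>j\<in>UNIV. normal_density (Q p $ j) s ((\<chi> j. v (Inl (t, sel j))) $ j)) = h t (src t (fst p) + snd p)" for p
      by (simp add: Q_def h_def)
    \<comment> \<open>Integrability comes for free: the integral equals a positive density value,
      whereas a non-integrable function would have integral 0.\<close>
    have hi: "integrable (M \<Otimes>\<^sub>M gauss Bg) (\<lambda>p. h t (src t (fst p) + snd p))"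
    proof (rule ccontr)
      assume "\<not> ?thesis"
      then have "gdens B (\<chi> j. v (Inl (t, sel j))) = 0" using G unfolding hQ by (simp add: not_integrable_integral_eq)
      then show False using gdens_pos[OF det, of "\<chi> j. v (Inl (t, sel j))"] by simp
    qed
    have "(\<integral>\<^sup>+\<omega>. \<integral>\<^sup>+u. ennreal (h t (src t \<omega> + u)) \<partial>gauss Bg \<partial>M) = (\<integral>\<^sup>+p. ennreal (h t (src t (fst p) + snd p)) \<partial>(M \<Otimes>\<^sub>M gauss Bg))"
      by (subst G.nn_integral_fst[symmetric]) auto
    also have "\<dots> = ennreal (\<integral>p. h t (src t (fst p) + snd p) \<partial>(M \<Otimes>\<^sub>M gauss Bg))"
      by (rule nn_integral_eq_integral[OF hi]) (use h0 in auto)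
    finally show ?thesis using G unfolding hQ by simp
  qed
  have cm: "(\<lambda>p. ennreal (h t (src t (fst p) + snd p t))) \<in> borel_measurable (M \<Otimes>\<^sub>M Pi\<^sub>M {..<n} (\<lambda>_. gauss Bg))" if "t < n" for t
  proof -
    have "(\<lambda>p. snd p t) \<in> borel_measurable (M \<Otimes>\<^sub>M Pi\<^sub>M {..<n} (\<lambda>_. gauss Bg))"
      by (rule measurable_compose[OF measurable_snd smoothing_component(1)[OF that]])
    then show ?thesis by measurable
  qed
  define Y where "Y t y = (\<integral>\<^sup>+u. ennreal (h t (y + u)) \<partial>gauss Bg)" for t y
  have Ym[measurable]: "Y t \<in> borel_measurable borel" for t unfolding Y_def by measurable
  have "ennreal (mix Mx x \<sigma> (W sel) v) = (\<integral>\<^sup>+p. ennreal (gkern x \<sigma> (W sel) p v) \<partial>Mx)"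
    by (rule mixture.mix_nn[where \<sigma> = \<sigma>, OF \<sigma>(1)])
  also have "\<dots> = (\<integral>\<^sup>+p. (\<Prod>t<n. ennreal (h t (src t (fst p) + snd p t))) \<partial>(M \<Otimes>\<^sub>M Pi\<^sub>M {..<n} (\<lambda>_. gauss Bg)))"
    unfolding kern Mx_def using h0 by (simp add: prod_ennreal)
  also have "\<dots> = (\<integral>\<^sup>+\<omega>. \<integral>\<^sup>+\<eta>. (\<Prod>t<n. ennreal (h t (src t \<omega> + \<eta> t))) \<partial>Pi\<^sub>M {..<n} (\<lambda>_. gauss Bg) \<partial>M)"
    using cm by (subst PG.nn_integral_fst[symmetric]) auto
  also have "\<dots> = (\<integral>\<^sup>+\<omega>. (\<Prod>t<n. Y t (src t \<omega>)) \<partial>M)"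
    unfolding Y_def by (intro nn_integral_cong PGf.product_nn_integral_prod) auto
  \<comment> \<open>Independence over time enters twice: through the product measure for the
    smoothing in the previous step, through \<open>sources_indep\<close> for the sources
    here.\<close>
  also have "\<dots> = (\<Prod>t<n. \<integral>\<^sup>+\<omega>. Y t (src t \<omega>) \<partial>M)"
    by (rule indep_vars_nn_integral) (auto intro!: indep_vars_compose2[OF sources_indep])
  also have "\<dots> = ennreal (\<Prod>t<n. gdens B (\<chi> j. v (Inl (t, sel j))))"
    unfolding Y_def step using gdens_pos[OF det] by (simp add: prod_ennreal less_imp_le)
  finally show ?thesis
    using mixture.mix_pos[where \<sigma> = \<sigma>, OF \<sigma>(1) finite_W, of sel v] gdens_pos[OF det]
    by (subst (asm) ennreal_inj) (auto intro!: prod_nonneg less_imp_le[OF gdens_pos[OF det]] intro: less_imp_le)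
qed

lemma mixlaw_integral:
  fixes F :: "((nat \<times> ('m1 + 'm2)) + nat \<Rightarrow> real) \<Rightarrow> real"
  assumes \<sigma>: "\<And>i. 0 < \<sigma> i" and J: "finite J" and F: "F \<in> borel_measurable (lborel_on J)"
  shows "integrable (mixlaw Mx x \<sigma> J) F \<longleftrightarrow> integrable (Mx \<Otimes>\<^sub>M std_on J) (\<lambda>u. F (\<lambda>i\<in>J. x i (fst u) + \<sigma> i * snd u i))"
    and "(\<integral>v. F v \<partial>mixlaw Mx x \<sigma> J) = (\<integral>u. F (\<lambda>i\<in>J. x i (fst u) + \<sigma> i * snd u i) \<partial>(Mx \<Otimes>\<^sub>M std_on J))"
proof -
  have m: "(\<lambda>u. \<lambda>i\<in>J. x i (fst u) + \<sigma> i * snd u i) \<in> Mx \<Otimes>\<^sub>M std_on J \<rightarrow>\<^sub>M lborel_on J"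
    using mixture.shift_measurable[where \<sigma> = \<sigma> and J = J, OF \<sigma> order_refl] by (simp add: case_prod_beta')
  have e: "mixlaw Mx x \<sigma> J = distr (Mx \<Otimes>\<^sub>M std_on J) (lborel_on J) (\<lambda>u. \<lambda>i\<in>J. x i (fst u) + \<sigma> i * snd u i)"
    using mixture.mixlaw_eq[where \<sigma> = \<sigma>, OF \<sigma> order_refl J] by (simp add: case_prod_beta')
  show "integrable (mixlaw Mx x \<sigma> J) F \<longleftrightarrow> integrable (Mx \<Otimes>\<^sub>M std_on J) (\<lambda>u. F (\<lambda>i\<in>J. x i (fst u) + \<sigma> i * snd u i))"
    unfolding e by (rule integrable_distr_eq[OF m F])
  show "(\<integral>v. F v \<partial>mixlaw Mx x \<sigma> J) = (\<integral>u. F (\<lambda>i\<in>J. x i (fst u) + \<sigma> i * snd u i) \<partial>(Mx \<Otimes>\<^sub>M std_on J))"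
    unfolding e by (rule integral_distr[OF m F])
qed

text \<open>Shared by the entropy of the smoothed sources (decoder 0, distortion 0) and by the decoder tests;
  \<open>c t j\<close> is the decoded value projected on the \<open>j\<close>-th whitening direction.\<close>

lemma log_gauss_expectation:
  fixes sel :: "'c::finite \<Rightarrow> 'm1 + 'm2" and B :: "real^'c^'c" and F :: "((nat \<times> ('m1 + 'm2)) + nat \<Rightarrow> real) \<Rightarrow> real"
    and c :: "nat \<Rightarrow> 'c \<Rightarrow> ((nat \<times> ('m1 + 'm2)) + nat \<Rightarrow> real) \<Rightarrow> real"
    and d :: "nat \<Rightarrow> 'c \<Rightarrow> 'w \<times> ((nat \<times> ('m1 + 'm2)) + nat \<Rightarrow> real) \<Rightarrow> real"
  assumes sel: "inj sel" and \<sigma>: "\<And>i. 0 < \<sigma> i" "\<And>tk. \<sigma> (Inl tk) = s" and J: "finite J" "W sel \<subseteq> J"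
    and B: "det B \<noteq> 0" and F: "F \<in> borel_measurable (lborel_on J)"
    and F_eq: "\<And>v. F v = (\<Sum>t<n. ln \<bar>det B\<bar> - real CARD('c) / 2 * ln (2 * pi) - (\<Sum>j\<in>UNIV. (column j B \<bullet> (\<chi> j. v (Inl (t, sel j))) - c t j v)\<^sup>2) / 2)"
    and d: "\<And>t j u. t < n \<Longrightarrow> c t j (\<lambda>i\<in>J. x i (fst u) + \<sigma> i * snd u i) = d t j (fst (fst u), snd u)"
    and p: "\<And>t j. t < n \<Longrightarrow> (\<lambda>u. lift_vec sel (column j B) \<bullet> src t (fst u) - d t j u) \<in> borel_measurable (M \<Otimes>\<^sub>M std_on J)"
      "\<And>t j. t < n \<Longrightarrow> integrable (M \<Otimes>\<^sub>M std_on J) (\<lambda>u. (lift_vec sel (column j B) \<bullet> src t (fst u) - d t j u)\<^sup>2)"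
    and ind: "\<And>t t' j k \<omega> \<zeta> y. d t j (\<omega>, \<zeta>(Inl (t', k) := y)) = d t j (\<omega>, \<zeta>)"
  shows "integrable (mixlaw Mx x \<sigma> J) F"
    and "(\<integral>v. F v \<partial>mixlaw Mx x \<sigma> J) = (\<Sum>t<n. ln \<bar>det B\<bar> - real CARD('c) / 2 * ln (2 * pi)
      - (\<Sum>j\<in>UNIV. (\<integral>u. (lift_vec sel (column j B) \<bullet> src t (fst u) - d t j u)\<^sup>2 \<partial>(M \<Otimes>\<^sub>M std_on J))
          + column j B \<bullet> ((sub_mat sel U' + s\<^sup>2 *\<^sub>R mat 1) *v column j B)) / 2)"
proof -
  interpret Q: prob_space "Mx \<Otimes>\<^sub>M std_on J"
  proof -
    interpret S: prob_space "std_on J" by (rule prob_space_std_on)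
    interpret P: pair_prob_space Mx "std_on J" ..
    show "prob_space (Mx \<Otimes>\<^sub>M std_on J)" by (rule P.prob_space_axioms)
  qed
  define a where "a = ln \<bar>det B\<bar> - real CARD('c) / 2 * ln (2 * pi)"
  \<comment> \<open>The error at time \<open>t\<close> along whitening direction \<open>j\<close>,
    split into source minus estimate, smoothing and isotropic noise, the shape that
    \<open>noisy_form_moment\<close> expects.\<close>
  define q where "q t j u = (lift_vec sel (column j B) \<bullet> src t (fst (fst u)) - d t j (fst (fst u), snd u)) + lift_vec sel (column j B) \<bullet> snd (fst u) t
    + s * (lift_vec sel (column j B) \<bullet> (\<chi> k. snd u (Inl (t, k))))" for t j and u :: "('w \<times> (nat \<Rightarrow> real^('m1 + 'm2))) \<times> ((nat \<times> ('m1 + 'm2)) + nat \<Rightarrow> real)"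
  have VF: "F (\<lambda>i\<in>J. x i (fst u) + \<sigma> i * snd u i) = (\<Sum>t<n. a - (\<Sum>j\<in>UNIV. (q t j u)\<^sup>2) / 2)" for u
    unfolding F_eq a_def[symmetric]
  proof (intro sum.cong refl arg_cong2[where f = "(-)"] arg_cong2[where f = "(/)"])
    fix t j assume t: "t \<in> {..<n}"
    let ?V = "\<lambda>i\<in>J. x i (fst u) + \<sigma> i * snd u i"
    have V: "(\<chi> j. ?V (Inl (t, sel j))) = (\<chi> j. (src t (fst (fst u)) + snd (fst u) t + s *\<^sub>R (\<chi> k. snd u (Inl (t, k)))) $ sel j)"
      using t J(2) by (subst vec_eq_iff) (auto simp: x_def \<sigma>(2))
    have "column j B \<bullet> (\<chi> j. ?V (Inl (t, sel j))) - c t j ?V = q t j u"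
      using t unfolding V lift_vec_inner[symmetric] q_def by (simp add: d inner_add_right)
    then show "(column j B \<bullet> (\<chi> j. ?V (Inl (t, sel j))) - c t j ?V)\<^sup>2 = (q t j u)\<^sup>2" by simp
  qed
  have nz: "Inl (t, k) \<in> J" if "t < n" "lift_vec sel (column j B) $ k \<noteq> 0" for t j k
  proof -
    have "k \<in> range sel"
    proof (rule ccontr)
      assume "k \<notin> range sel"
      then have "lift_vec sel (column j B) $ k = 0"
        by (auto simp: lift_vec_def axis_def intro!: sum.neutral)
      then show False using that by simp
    qed
    then show ?thesis using that(1) J(2) by auto
  qed
  have sub: "sub_mat sel (U' + s\<^sup>2 *\<^sub>R mat 1) = sub_mat sel U' + s\<^sup>2 *\<^sub>R mat 1"
    by (simp add: sub_mat_add sub_mat_scaled_id[OF sel])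
  have qi: "integrable (Mx \<Otimes>\<^sub>M std_on J) (\<lambda>u. (q t j u)\<^sup>2)"
    and qv: "(\<integral>u. (q t j u)\<^sup>2 \<partial>(Mx \<Otimes>\<^sub>M std_on J)) = (\<integral>u. (lift_vec sel (column j B) \<bullet> src t (fst u) - d t j u)\<^sup>2 \<partial>(M \<Otimes>\<^sub>M std_on J))
          + column j B \<bullet> ((sub_mat sel U' + s\<^sup>2 *\<^sub>R mat 1) *v column j B)" if t: "t < n" for t j
  proof -
    have dep: "(\<lambda>u. lift_vec sel (column j B) \<bullet> src t (fst u) - d t j u) (\<omega>, \<zeta>(Inl (t, k) := y))
      = (\<lambda>u. lift_vec sel (column j B) \<bullet> src t (fst u) - d t j u) (\<omega>, \<zeta>)" for \<omega> \<zeta> k y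
      using ind[of t j \<omega> \<zeta> t k y] by simp
    note nm = noisy_form_moment[where b = "lift_vec sel (column j B)", OF t J(1) nz[OF t, of j] p(1)[OF t, of j] p(2)[OF t, of j] dep]
    show "integrable (Mx \<Otimes>\<^sub>M std_on J) (\<lambda>u. (q t j u)\<^sup>2)" unfolding q_def using nm(1) by simp
    show "(\<integral>u. (q t j u)\<^sup>2 \<partial>(Mx \<Otimes>\<^sub>M std_on J)) = (\<integral>u. (lift_vec sel (column j B) \<bullet> src t (fst u) - d t j u)\<^sup>2 \<partial>(M \<Otimes>\<^sub>M std_on J))
          + column j B \<bullet> ((sub_mat sel U' + s\<^sup>2 *\<^sub>R mat 1) *v column j B)"
      unfolding q_def sub[symmetric] lift_vec_form[symmetric] using nm(2) by simp
  qed
  have i: "integrable (Mx \<Otimes>\<^sub>M std_on J) (\<lambda>u. \<Sum>t<n. a - (\<Sum>j\<in>UNIV. (q t j u)\<^sup>2) / 2)"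
    using qi by auto
  show "integrable (mixlaw Mx x \<sigma> J) F"
    unfolding mixlaw_integral(1)[OF \<sigma>(1) J(1) F] VF by (rule i)
  have "(\<integral>v. F v \<partial>mixlaw Mx x \<sigma> J) = (\<Sum>t<n. a - (\<Sum>j\<in>UNIV. (\<integral>u. (q t j u)\<^sup>2 \<partial>(Mx \<Otimes>\<^sub>M std_on J))) / 2)"
    unfolding mixlaw_integral(2)[OF \<sigma>(1) J(1) F] VF using qi Q.prob_space by simp
  also have "\<dots> = (\<Sum>t<n. a - (\<Sum>j\<in>UNIV. (\<integral>u. (lift_vec sel (column j B) \<bullet> src t (fst u) - d t j u)\<^sup>2 \<partial>(M \<Otimes>\<^sub>M std_on J))
          + column j B \<bullet> ((sub_mat sel U' + s\<^sup>2 *\<^sub>R mat 1) *v column j B)) / 2)"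
    by (intro sum.cong refl) (simp add: qv)
  finally show "(\<integral>v. F v \<partial>mixlaw Mx x \<sigma> J) = (\<Sum>t<n. ln \<bar>det B\<bar> - real CARD('c) / 2 * ln (2 * pi)
      - (\<Sum>j\<in>UNIV. (\<integral>u. (lift_vec sel (column j B) \<bullet> src t (fst u) - d t j u)\<^sup>2 \<partial>(M \<Otimes>\<^sub>M std_on J))
          + column j B \<bullet> ((sub_mat sel U' + s\<^sup>2 *\<^sub>R mat 1) *v column j B)) / 2)" unfolding a_def .
qed

end

section \<open>Error matrices and their quadratic forms\<close>

lemma bounded_linear_quadratic_form: "bounded_linear (\<lambda>A. \<xi> \<bullet> (A *v \<xi>))" for \<xi> :: "real^'n"
  unfolding quadratic_form_sum
  by (intro bounded_linear_sum bounded_linear_compose[OF bounded_linear_mult_right bounded_linear_entry])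

lemma outer_form: "\<xi> \<bullet> (outer y y *v \<xi>) = (\<xi> \<bullet> y)\<^sup>2" for \<xi> :: "real^'n"
  by (simp add: outer_def matrix_vector_mult_def inner_vec_def power2_eq_square sum_distrib_left sum_distrib_right mult_ac)

lemma error_form:
  fixes e :: "'w \<Rightarrow> nat \<Rightarrow> real^'n"
  assumes i: "integrable M (\<lambda>\<omega>. \<Sum>t<n. outer (e \<omega> t) (e \<omega> t))"
  shows "integrable M (\<lambda>\<omega>. \<Sum>t<n. (\<xi> \<bullet> e \<omega> t)\<^sup>2)"
    and "(\<integral>\<omega>. (\<Sum>t<n. (\<xi> \<bullet> e \<omega> t)\<^sup>2) \<partial>M) = \<xi> \<bullet> ((\<integral>\<omega>. (\<Sum>t<n. outer (e \<omega> t) (e \<omega> t)) \<partial>M) *v \<xi>)"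
proof -
  interpret q: bounded_linear "\<lambda>A. \<xi> \<bullet> (A *v \<xi>)" by (rule bounded_linear_quadratic_form)
  have e: "\<xi> \<bullet> ((\<Sum>t<n. outer (e \<omega> t) (e \<omega> t)) *v \<xi>) = (\<Sum>t<n. (\<xi> \<bullet> e \<omega> t)\<^sup>2)" for \<omega>
    unfolding q.sum outer_form ..
  show "integrable M (\<lambda>\<omega>. \<Sum>t<n. (\<xi> \<bullet> e \<omega> t)\<^sup>2)"
    using integrable_bounded_linear[OF bounded_linear_quadratic_form i, of \<xi>] unfolding e .
  show "(\<integral>\<omega>. (\<Sum>t<n. (\<xi> \<bullet> e \<omega> t)\<^sup>2) \<partial>M) = \<xi> \<bullet> ((\<integral>\<omega>. (\<Sum>t<n. outer (e \<omega> t) (e \<omega> t)) \<partial>M) *v \<xi>)"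
    using integral_bounded_linear[OF bounded_linear_quadratic_form i, of \<xi>] unfolding e .
qed

lemma distortion_bound:
  fixes e :: "'w \<Rightarrow> nat \<Rightarrow> real^'n"
  assumes n: "0 < n" and i: "integrable M (\<lambda>\<omega>. \<Sum>t<n. outer (e \<omega> t) (e \<omega> t))"
    and D: "loewner_le ((1 / real n) *\<^sub>R (\<integral>\<omega>. (\<Sum>t<n. outer (e \<omega> t) (e \<omega> t)) \<partial>M)) D"
  shows "(\<integral>\<omega>. (\<Sum>t<n. (\<xi> \<bullet> e \<omega> t)\<^sup>2) \<partial>M) \<le> real n * (\<xi> \<bullet> (D *v \<xi>))"
proof -
  let ?I = "\<integral>\<omega>. (\<Sum>t<n. outer (e \<omega> t) (e \<omega> t)) \<partial>M"
  interpret q: bounded_linear "\<lambda>A. \<xi> \<bullet> (A *v \<xi>)" by (rule bounded_linear_quadratic_form)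
  have "0 \<le> \<xi> \<bullet> ((D - (1 / real n) *\<^sub>R ?I) *v \<xi>)"
    using D unfolding loewner_le_def pos_semidef_def by blast
  then have "(1 / real n) * (\<xi> \<bullet> (?I *v \<xi>)) \<le> \<xi> \<bullet> (D *v \<xi>)"
    unfolding q.diff q.scaleR by simp
  then show ?thesis unfolding error_form(2)[OF i] using n by (simp add: field_simps)
qed

text \<open>The mean of the whitened sum of squares is the dimension; this supplies the factor
  \<open>exp 1\<close> in \<open>2 * pi * exp 1\<close>.\<close>

lemma whitens_trace:
  fixes B :: "real^'n^'n"
  assumes "whitens B K"
  shows "(\<Sum>j\<in>UNIV. column j B \<bullet> (K *v column j B)) = real CARD('n)"
  by (simp add: whitens_column[OF assms])

context coded_broadcast
begin

text \<open>The entropy of \<open>n\<close> independent Gaussian vectors: by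
  \<open>mix_factor\<close> the log-density is a constant minus half a quadratic form, and the mean
  of that form is a trace.\<close>

lemma nent_value:
  fixes sel :: "'c::finite \<Rightarrow> 'm1 + 'm2"
  assumes sel: "inj sel" and \<sigma>: "\<And>i. 0 < \<sigma> i" "\<And>tk. \<sigma> (Inl tk) = s"
    and B: "whitens B (sub_mat sel (\<Sigma> + U') + s\<^sup>2 *\<^sub>R mat 1)"
  shows "nent Mx x \<sigma> (W sel) = - real n / 2 * ln ((2 * pi * exp 1) ^ CARD('c) * det (sub_mat sel (\<Sigma> + U') + s\<^sup>2 *\<^sub>R mat 1))"
proof -
  let ?K = "sub_mat sel (\<Sigma> + U') + s\<^sup>2 *\<^sub>R mat 1"
  note det = whitens_det[OF B]
  define F where "F v = ln (mix Mx x \<sigma> (W sel) v)" for v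
  have Fm: "F \<in> borel_measurable (lborel_on (W sel))"
    unfolding F_def by (rule borel_measurable_ln[OF mixture.mix_measurable[where \<sigma> = \<sigma>, OF \<sigma>(1)]])
  have F_eq: "F v = (\<Sum>t<n. ln \<bar>det B\<bar> - real CARD('c) / 2 * ln (2 * pi) - (\<Sum>j\<in>UNIV. (column j B \<bullet> (\<chi> j. v (Inl (t, sel j))) - 0)\<^sup>2) / 2)" for v
    unfolding F_def mix_factor[where \<sigma> = \<sigma>, OF sel \<sigma> B]
    by (subst ln_prod) (auto intro!: gdens_pos det(2) less_imp_neq[symmetric] simp: ln_gdens[OF det(2)] order.strict_iff_not)
  have p: "(\<lambda>u. lift_vec sel (column j B) \<bullet> src t (fst u) - 0) \<in> borel_measurable (M \<Otimes>\<^sub>M std_on (W sel))"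
    "integrable (M \<Otimes>\<^sub>M std_on (W sel)) (\<lambda>u. (lift_vec sel (column j B) \<bullet> src t (fst u) - 0)\<^sup>2)" for t j
    using integrable_pair_fst[OF prob_space_axioms prob_space_std_on source_moments(1), of "W sel" "lift_vec sel (column j B)" t] by simp_all
  have v: "(\<integral>u. (lift_vec sel (column j B) \<bullet> src t (fst u) - 0)\<^sup>2 \<partial>(M \<Otimes>\<^sub>M std_on (W sel)))
      = column j B \<bullet> (sub_mat sel \<Sigma> *v column j B)" for t j
    using integral_pair_fst[OF prob_space_axioms prob_space_std_on, of "\<lambda>\<omega>. (lift_vec sel (column j B) \<bullet> src t \<omega>)\<^sup>2" "W sel"]
    by (simp add: source_moments(2) lift_vec_form)
  have "nent Mx x \<sigma> (W sel) = (\<integral>v. F v \<partial>mixlaw Mx x \<sigma> (W sel))" by (simp add: nent_def F_def)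
  also have "\<dots> = (\<Sum>t<n. ln \<bar>det B\<bar> - real CARD('c) / 2 * ln (2 * pi)
      - (\<Sum>j\<in>UNIV. (\<integral>u. (lift_vec sel (column j B) \<bullet> src t (fst u) - 0)\<^sup>2 \<partial>(M \<Otimes>\<^sub>M std_on (W sel)))
          + column j B \<bullet> ((sub_mat sel U' + s\<^sup>2 *\<^sub>R mat 1) *v column j B)) / 2)"
    by (rule log_gauss_expectation(2)[where \<sigma> = \<sigma> and F = F and c = "\<lambda>_ _ _. 0" and d = "\<lambda>_ _ _. 0", OF sel \<sigma> finite_W order_refl det(2) Fm F_eq]) (use p in auto)
  also have "\<dots> = (\<Sum>t<n. ln \<bar>det B\<bar> - real CARD('c) / 2 * ln (2 * pi) - (\<Sum>j\<in>UNIV. column j B \<bullet> (?K *v column j B)) / 2)"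
    unfolding v by (simp add: sub_mat_add matrix_vector_mult_add_rdistrib inner_add_right add.assoc)
  also have "\<dots> = real n * (- ln (det ?K) / 2 - real CARD('c) / 2 * ln (2 * pi) - real CARD('c) / 2)"
    unfolding whitens_trace[OF B] det(4) by simp
  also have "\<dots> = - real n / 2 * ln ((2 * pi * exp 1) ^ CARD('c) * det ?K)"
    using det(3) by (simp add: ln_mult_pos ln_realpow algebra_simps)
  finally show ?thesis .
qed

text \<open>For given channel coordinates, the normal density with whitening matrix \<open>B\<close>
  centred at the decoder's estimate: a conditional test density for the smoothed source given the
  output.\<close>

definition test_density :: "real^'c^'c \<Rightarrow> ('c::finite \<Rightarrow> 'm1 + 'm2) \<Rightarrow> ((nat \<Rightarrow> real) \<Rightarrow> nat \<Rightarrow> real^'c) \<Rightarrow> ((nat \<times> ('m1 + 'm2)) + nat \<Rightarrow> real) \<Rightarrow> real"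
  where "test_density B sel g v = (\<Prod>t<n. gdens B ((\<chi> j. v (Inl (t, sel j))) - g (\<lambda>t\<in>{..<n}. v (Inr t)) t))"

text \<open>With the channel coordinates held fixed the estimate is a constant shift, and the
  integral is that of a shifted Gaussian block.\<close>

lemma test_density_kernel:
  fixes sel :: "'c::finite \<Rightarrow> 'm1 + 'm2"
  assumes B: "det B \<noteq> 0" and sel: "inj sel" and Y: "Inr ` {..<n} \<subseteq> Y"
  shows "(\<integral>\<^sup>+w. ennreal (test_density B sel g (merge (W sel) Y (w, y))) \<partial>lborel_on (W sel)) = 1"
proof -
  have "test_density B sel g (merge (W sel) Y (w, y)) = (\<Prod>t<n. gdens B ((\<chi> j. w (Inl (t, sel j))) - g (\<lambda>t\<in>{..<n}. y (Inr t)) t))" for w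
  proof -
    have 1: "(\<lambda>t\<in>{..<n}. merge (W sel) Y (w, y) (Inr t)) = (\<lambda>t\<in>{..<n}. y (Inr t))"
      using Y by (intro restrict_ext) (auto simp: merge_def)
    have 2: "(\<chi> j. merge (W sel) Y (w, y) (Inl (t, sel j))) = (\<chi> j. w (Inl (t, sel j)))" if "t < n" for t
      using that by (subst vec_eq_iff) (auto simp: merge_def)
    show ?thesis unfolding test_density_def 1 by (intro prod.cong refl) (simp add: 2)
  qed
  then show ?thesis
    using gdens_block(2)[OF B finite_lessThan[of n], of "\<lambda>t j. Inl (t, sel j) :: (nat \<times> ('m1 + 'm2)) + nat" "\<lambda>t. g (\<lambda>t\<in>{..<n}. y (Inr t)) t"] sel
    by (simp add: inj_def)
qed

text \<open>Moves the error moments from the actual noise to the normals of the mixture.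
  \<open>channel_law\<close> is an equality of laws only, so the error is first written as one
  function of the source block and the noise block.\<close>

lemma decoder_moments:
  fixes sel :: "'c::finite \<Rightarrow> 'm1 + 'm2" and \<xi> :: "real^'c" and z :: "nat \<Rightarrow> 'w \<Rightarrow> real"
  assumes z: "z = Z1 \<and> \<nu> = N1 \<or> z = Z2 \<and> \<nu> = N2" and \<nu>: "0 < \<nu>"
    and J: "finite J" "Inr ` {..<n} \<subseteq> J" and t: "t < n"
    and g[measurable]: "g \<in> block_space n \<rightarrow>\<^sub>M block_space n"
  defines "p \<equiv> \<lambda>u :: 'w \<times> ((nat \<times> ('m1 + 'm2)) + nat \<Rightarrow> real).
      lift_vec sel \<xi> \<bullet> src t (fst u) - \<xi> \<bullet> g (\<lambda>t\<in>{..<n}. X (fst u) t + sqrt \<nu> * snd u (Inr t)) t"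
    and "q \<equiv> \<lambda>\<omega>. (\<xi> \<bullet> ((\<chi> j. src t \<omega> $ sel j) - g (channel_output n X z \<omega>) t))\<^sup>2"
  shows "p \<in> borel_measurable (M \<Otimes>\<^sub>M std_on J)"
    and "integrable (M \<Otimes>\<^sub>M std_on J) (\<lambda>u. (p u)\<^sup>2) \<longleftrightarrow> integrable M q"
    and "(\<integral>u. (p u)\<^sup>2 \<partial>(M \<Otimes>\<^sub>M std_on J)) = (\<integral>\<omega>. q \<omega> \<partial>M)"
proof -
  let ?J = "{..<n}"
  define L where "L = (\<Pi>\<^sub>M t\<in>?J. (borel :: ((real^'m1) \<times> (real^'m2)) measure)) \<Otimes>\<^sub>M (\<Pi>\<^sub>M t\<in>?J. (borel :: real measure))"
  \<comment> \<open>The channel input is recomputed from the source block, so that the error depends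
    on nothing else than the two blocks.\<close>
  define \<Phi> where "\<Phi> l = lift_vec sel \<xi> \<bullet> stack (fst (fst l t)) (snd (fst l t))
    - \<xi> \<bullet> g (\<lambda>t'\<in>?J. f (\<lambda>t\<in>?J. fst (fst l t), \<lambda>t\<in>?J. snd (fst l t)) t' + snd l t') t"
    for l :: "(nat \<Rightarrow> (real^'m1) \<times> (real^'m2)) \<times> (nat \<Rightarrow> real)"
  have c1: "(\<lambda>l. fst l t') \<in> borel_measurable L" if "t' < n" for t'
    unfolding L_def by (rule measurable_compose[OF measurable_fst measurable_component_singleton]) (use that in simp)
  have c2: "(\<lambda>l. snd l t') \<in> borel_measurable L" if "t' < n" for t'
    unfolding L_def by (rule measurable_compose[OF measurable_snd measurable_component_singleton]) (use that in simp)
  have cf: "(\<lambda>l. fst (fst l t')) \<in> borel_measurable L" "(\<lambda>l. snd (fst l t')) \<in> borel_measurable L" if "t' < n" for t'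
    using c1[OF that] by (auto intro: measurable_compose[OF _ borel_measurable_continuous_onI] simp: continuous_on_fst continuous_on_snd)
  have st: "(\<lambda>l. stack (fst (fst l t)) (snd (fst l t))) \<in> borel_measurable L"
  proof (rule borel_measurable_vec)
    fix k :: "'m1 + 'm2"
    show "(\<lambda>l. stack (fst (fst l t)) (snd (fst l t)) $ k) \<in> borel_measurable L"
      by (cases k) (auto intro!: measurable_compose[OF cf(1)[OF t] borel_measurable_vec_nth] measurable_compose[OF cf(2)[OF t] borel_measurable_vec_nth])
  qed
  have fl: "(\<lambda>l. (\<lambda>t\<in>?J. fst (fst l t), \<lambda>t\<in>?J. snd (fst l t))) \<in> L \<rightarrow>\<^sub>M block_space n \<Otimes>\<^sub>M block_space n"
    by (intro measurable_Pair measurable_restrict cf) auto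
  have Xl: "(\<lambda>l. f (\<lambda>t\<in>?J. fst (fst l t), \<lambda>t\<in>?J. snd (fst l t)) t') \<in> borel_measurable L" if "t' < n" for t'
    by (rule measurable_compose[OF measurable_compose[OF fl f] measurable_component_singleton]) (use that in simp)
  have Yl: "(\<lambda>l. \<lambda>t'\<in>?J. f (\<lambda>t\<in>?J. fst (fst l t), \<lambda>t\<in>?J. snd (fst l t)) t' + snd l t') \<in> L \<rightarrow>\<^sub>M block_space n"
    by (intro measurable_restrict borel_measurable_add Xl c2) auto
  have gl: "(\<lambda>l. g (\<lambda>t'\<in>?J. f (\<lambda>t\<in>?J. fst (fst l t), \<lambda>t\<in>?J. snd (fst l t)) t' + snd l t') t) \<in> borel_measurable L"
    by (rule measurable_compose[OF measurable_compose[OF Yl g] measurable_component_singleton]) (use t in simp)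
  have \<Phi>: "\<Phi> \<in> borel_measurable L"
    unfolding \<Phi>_def by (intro borel_measurable_diff borel_measurable_inner borel_measurable_const st gl)
  then have \<Phi>2: "(\<lambda>l. (\<Phi> l)\<^sup>2) \<in> borel_measurable L" by simp
  let ?a = "\<lambda>\<omega>. (\<lambda>t\<in>?J. (S1 t \<omega>, S2 t \<omega>), \<lambda>t\<in>?J. z t \<omega>)"
  let ?b = "\<lambda>u :: 'w \<times> ((nat \<times> ('m1 + 'm2)) + nat \<Rightarrow> real). (\<lambda>t\<in>?J. (S1 t (fst u), S2 t (fst u)), \<lambda>t\<in>?J. sqrt \<nu> * snd u (Inr t))"
  have law: "distr M L ?a = distr (M \<Otimes>\<^sub>M std_on J) L ?b"
    unfolding L_def by (rule channel_law[OF n z \<nu> J]) simp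
  have am: "?a \<in> M \<rightarrow>\<^sub>M L" unfolding L_def
    by (intro measurable_Pair measurable_restrict) (use z in auto)
  have bm: "?b \<in> M \<Otimes>\<^sub>M std_on J \<rightarrow>\<^sub>M L" unfolding L_def
  proof (intro measurable_Pair measurable_restrict)
    show "(\<lambda>u. (S1 t (fst u), S2 t (fst u))) \<in> borel_measurable (M \<Otimes>\<^sub>M std_on J)" for t by measurable
    fix t assume "t \<in> ?J"
    then have "Inr t \<in> J" using J by auto
    then show "(\<lambda>u. sqrt \<nu> * snd u (Inr t)) \<in> borel_measurable (M \<Otimes>\<^sub>M std_on J)"
      by (intro borel_measurable_times borel_measurable_const PiM_component_measurable[OF measurable_snd]) auto
  qed
  have bS: "(\<lambda>t\<in>?J. fst ((\<lambda>t\<in>?J. (S1 t \<omega>, S2 t \<omega>)) t)) = block n S1 \<omega>"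
    "(\<lambda>t\<in>?J. snd ((\<lambda>t\<in>?J. (S1 t \<omega>, S2 t \<omega>)) t)) = block n S2 \<omega>" for \<omega>
    unfolding block_def by (auto intro: restrict_ext)
  have pb: "p u = \<Phi> (?b u)" for u
    using t unfolding p_def \<Phi>_def fst_conv snd_conv bS by (auto simp: src_def cong: restrict_cong)
  have qa: "q \<omega> = (\<Phi> (?a \<omega>))\<^sup>2" for \<omega>
    using t unfolding q_def \<Phi>_def fst_conv snd_conv bS channel_output_def lift_vec_inner inner_diff_right
    by (auto simp: src_def cong: restrict_cong)
  show "p \<in> borel_measurable (M \<Otimes>\<^sub>M std_on J)"
    unfolding pb[abs_def] by (rule measurable_compose[OF bm \<Phi>])
  show "integrable (M \<Otimes>\<^sub>M std_on J) (\<lambda>u. (p u)\<^sup>2) \<longleftrightarrow> integrable M q"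
    unfolding pb qa[abs_def] using integrable_distr_eq[OF am \<Phi>2] integrable_distr_eq[OF bm \<Phi>2] law by simp
  show "(\<integral>u. (p u)\<^sup>2 \<partial>(M \<Otimes>\<^sub>M std_on J)) = (\<integral>\<omega>. q \<omega> \<partial>M)"
    unfolding pb qa using integral_distr[OF am \<Phi>2] integral_distr[OF bm \<Phi>2] law by simp
qed

text \<open>The distortion constraint bounds the mean of the quadratic form in the log-density by a
  trace against \<open>D\<close>. Smoothing adds its own covariance, and the total per channel use
  is at most the trace of the whitened sum, which is the dimension.\<close>

lemma decoder_test:
  fixes sel :: "'c::finite \<Rightarrow> 'm1 + 'm2" and z :: "nat \<Rightarrow> 'w \<Rightarrow> real" and g :: "(nat \<Rightarrow> real) \<Rightarrow> nat \<Rightarrow> real^'c"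
  assumes sel: "inj sel" and \<sigma>: "\<And>i. 0 < \<sigma> i" "\<And>tk. \<sigma> (Inl tk) = s" "\<And>t. t < n \<Longrightarrow> \<sigma> (Inr t) = sqrt \<nu>"
    and z: "z = Z1 \<and> \<nu> = N1 \<or> z = Z2 \<and> \<nu> = N2"
    and J: "finite J" "W sel \<subseteq> J" "Inr ` {..<n} \<subseteq> J"
    and g[measurable]: "g \<in> block_space n \<rightarrow>\<^sub>M block_space n"
  defines "e \<equiv> \<lambda>\<omega> t. (\<chi> j. src t \<omega> $ sel j) - g (channel_output n X z \<omega>) t"
  assumes ei: "integrable M (\<lambda>\<omega>. \<Sum>t<n. outer (e \<omega> t) (e \<omega> t))"
    and D: "loewner_le ((1 / real n) *\<^sub>R (\<integral>\<omega>. (\<Sum>t<n. outer (e \<omega> t) (e \<omega> t)) \<partial>M)) D"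
    and B: "whitens B (D + (sub_mat sel U' + s\<^sup>2 *\<^sub>R mat 1))"
  shows "test_density B sel g \<in> borel_measurable (lborel_on J)"
    and "0 < test_density B sel g v"
    and "integrable (mixlaw Mx x \<sigma> J) (\<lambda>v. ln (test_density B sel g v))"
    and "(\<integral>v. ln (test_density B sel g v) \<partial>mixlaw Mx x \<sigma> J)
      \<ge> - real n / 2 * ln ((2 * pi * exp 1) ^ CARD('c) * det (D + (sub_mat sel U' + s\<^sup>2 *\<^sub>R mat 1)))"
proof -
  let ?K = "sub_mat sel U' + s\<^sup>2 *\<^sub>R mat 1"
  note det = whitens_det[OF B]
  have \<nu>: "0 < \<nu>" using z N by auto
  have ym: "(\<lambda>v. \<lambda>t\<in>{..<n}. v (Inr t)) \<in> lborel_on J \<rightarrow>\<^sub>M block_space n"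
  proof (intro measurable_restrict)
    fix t assume "t \<in> {..<n}"
    then have "Inr t \<in> J" using J by auto
    then show "(\<lambda>v. v (Inr t)) \<in> borel_measurable (lborel_on J)"
      by (intro PiM_component_measurable[OF measurable_ident_sets[OF refl]]) auto
  qed
  have gm: "(\<lambda>v. g (\<lambda>t\<in>{..<n}. v (Inr t)) t) \<in> borel_measurable (lborel_on J)" if "t < n" for t
    by (rule measurable_compose[OF measurable_compose[OF ym g] measurable_component_singleton]) (use that in simp)
  have wm: "(\<lambda>v. \<chi> j. v (Inl (t, sel j))) \<in> borel_measurable (lborel_on J)" if "t < n" for t
  proof (rule borel_measurable_vec)
    fix j
    have "Inl (t, sel j) \<in> J" using J(2) that by auto
    then have "(\<lambda>v. v (Inl (t, sel j))) \<in> borel_measurable (lborel_on J)"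
      by (intro PiM_component_measurable[OF measurable_ident_sets[OF refl]]) auto
    then show "(\<lambda>v. (\<chi> j. v (Inl (t, sel j))) $ j) \<in> borel_measurable (lborel_on J)" by simp
  qed
  show tm: "test_density B sel g \<in> borel_measurable (lborel_on J)"
    unfolding test_density_def[abs_def]
    by (intro borel_measurable_prod measurable_compose[OF borel_measurable_diff gdens_measurable] wm gm) auto
  show "0 < test_density B sel g v"
    unfolding test_density_def by (intro prod_pos ballI gdens_pos det(2))
  define F where "F v = ln (test_density B sel g v)" for v
  have Fm: "F \<in> borel_measurable (lborel_on J)"
    unfolding F_def by (rule borel_measurable_ln[OF tm])
  define c where "c t j v = column j B \<bullet> g (\<lambda>t\<in>{..<n}. v (Inr t)) t" for t j and v :: "(nat \<times> ('m1 + 'm2)) + nat \<Rightarrow> real"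
  define d where "d t j u = column j B \<bullet> g (\<lambda>t\<in>{..<n}. X (fst u) t + sqrt \<nu> * snd u (Inr t)) t"
    for t j and u :: "'w \<times> ((nat \<times> ('m1 + 'm2)) + nat \<Rightarrow> real)"
  have F_eq: "F v = (\<Sum>t<n. ln \<bar>det B\<bar> - real CARD('c) / 2 * ln (2 * pi) - (\<Sum>j\<in>UNIV. (column j B \<bullet> (\<chi> j. v (Inl (t, sel j))) - c t j v)\<^sup>2) / 2)" for v
    unfolding F_def test_density_def c_def inner_diff_right[symmetric]
    by (subst ln_prod) (auto intro!: gdens_pos det(2) less_imp_neq[symmetric] simp: ln_gdens[OF det(2)] order.strict_iff_not)
  have cd: "c t j (\<lambda>i\<in>J. x i (fst u) + \<sigma> i * snd u i) = d t j (fst (fst u), snd u)" if "t < n" for t j u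
  proof -
    have "(\<lambda>t\<in>{..<n}. (\<lambda>i\<in>J. x i (fst u) + \<sigma> i * snd u i) (Inr t)) = (\<lambda>t\<in>{..<n}. X (fst (fst u)) t + sqrt \<nu> * snd u (Inr t))"
      using J(3) by (intro restrict_ext) (auto simp: x_def \<sigma>(3))
    then show ?thesis by (simp add: c_def d_def)
  qed
  note dm = decoder_moments[OF z \<nu> J(1,3) _ g, where sel = sel]
  have qi: "integrable M (\<lambda>\<omega>. (\<xi> \<bullet> e \<omega> t)\<^sup>2)" if t: "t < n" for t \<xi>
  proof (rule Bochner_Integration.integrable_bound[OF error_form(1)[OF ei, of \<xi>]])
    have Ym: "channel_output n X z \<in> M \<rightarrow>\<^sub>M block_space n"
      unfolding channel_output_def[abs_def] using z X_measurable by (intro measurable_restrict) auto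
    have "(\<lambda>\<omega>. g (channel_output n X z \<omega>) t) \<in> borel_measurable M"
      by (rule measurable_compose[OF measurable_compose[OF Ym g] measurable_component_singleton]) (use t in simp)
    moreover have "(\<lambda>\<omega>. \<chi> j. src t \<omega> $ sel j) \<in> borel_measurable M"
      by (rule borel_measurable_vec) simp
    ultimately show "(\<lambda>\<omega>. (\<xi> \<bullet> e \<omega> t)\<^sup>2) \<in> borel_measurable M" unfolding e_def by simp
    have "(\<xi> \<bullet> e \<omega> t)\<^sup>2 \<le> (\<Sum>t<n. (\<xi> \<bullet> e \<omega> t)\<^sup>2)" for \<omega>
      using t by (intro member_le_sum) auto
    then show "AE \<omega> in M. norm ((\<xi> \<bullet> e \<omega> t)\<^sup>2) \<le> norm (\<Sum>t<n. (\<xi> \<bullet> e \<omega> t)\<^sup>2)"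
      by (auto intro: order_trans[OF _ abs_ge_self])
  qed
  have p: "(\<lambda>u. lift_vec sel (column j B) \<bullet> src t (fst u) - d t j u) \<in> borel_measurable (M \<Otimes>\<^sub>M std_on J)"
    "integrable (M \<Otimes>\<^sub>M std_on J) (\<lambda>u. (lift_vec sel (column j B) \<bullet> src t (fst u) - d t j u)\<^sup>2)"
    "(\<integral>u. (lift_vec sel (column j B) \<bullet> src t (fst u) - d t j u)\<^sup>2 \<partial>(M \<Otimes>\<^sub>M std_on J)) = (\<integral>\<omega>. (column j B \<bullet> e \<omega> t)\<^sup>2 \<partial>M)"
    if t: "t < n" for t j
    using dm[OF t, of "column j B"] qi[OF t, of "column j B"] unfolding d_def e_def by simp_all
  have ind: "d t j (\<omega>, \<zeta>(Inl (t', k) := y)) = d t j (\<omega>, \<zeta>)" for t t' j k \<omega> \<zeta> y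
    by (simp add: d_def)
  note lg = log_gauss_expectation[where \<sigma> = \<sigma> and F = F and c = c and d = d, OF sel \<sigma>(1,2) J(1,2) det(2) Fm F_eq cd p(1,2) ind]
  show "integrable (mixlaw Mx x \<sigma> J) (\<lambda>v. ln (test_density B sel g v))"
    using lg(1) unfolding F_def by simp
  have le: "(\<Sum>t<n. \<integral>\<omega>. (\<xi> \<bullet> e \<omega> t)\<^sup>2 \<partial>M) \<le> real n * (\<xi> \<bullet> (D *v \<xi>))" for \<xi>
    using distortion_bound[OF n ei D, of \<xi>] qi by (subst (asm) Bochner_Integration.integral_sum) auto
  define a where "a = ln \<bar>det B\<bar> - real CARD('c) / 2 * ln (2 * pi)"
  \<comment> \<open>The claimed value is what errors of covariance exactly \<open>D\<close> would
    give; the later inequality in this chain is the distortion constraint along each column of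
    \<open>B\<close>.\<close>
  have "- real n / 2 * ln ((2 * pi * exp 1) ^ CARD('c) * det (D + ?K)) = real n * a - real n * (\<Sum>j\<in>UNIV. column j B \<bullet> ((D + ?K) *v column j B)) / 2"
    unfolding whitens_trace[OF B] a_def det(4) using det(3) by (simp add: ln_mult_pos ln_realpow algebra_simps)
  also have "\<dots> = real n * a - (\<Sum>j\<in>UNIV. real n * (column j B \<bullet> (D *v column j B)) + real n * (column j B \<bullet> (?K *v column j B))) / 2"
    by (simp add: matrix_vector_mult_add_rdistrib inner_add_right sum_distrib_left distrib_left sum.distrib)
  also have "\<dots> \<le> real n * a - (\<Sum>j\<in>UNIV. (\<Sum>t<n. \<integral>\<omega>. (column j B \<bullet> e \<omega> t)\<^sup>2 \<partial>M) + real n * (column j B \<bullet> (?K *v column j B))) / 2"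
    using le by (intro diff_left_mono divide_right_mono sum_mono add_right_mono) auto
  also have "\<dots> = (\<Sum>t<n. a - (\<Sum>j\<in>UNIV. (\<integral>\<omega>. (column j B \<bullet> e \<omega> t)\<^sup>2 \<partial>M) + column j B \<bullet> (?K *v column j B)) / 2)"
    by (simp add: sum_subtractf sum.distrib sum_divide_distrib[symmetric] add_divide_distrib sum_distrib_left)
       (rule sum.swap)
  also have "\<dots> = (\<Sum>t<n. a - (\<Sum>j\<in>UNIV. (\<integral>u. (lift_vec sel (column j B) \<bullet> src t (fst u) - d t j u)\<^sup>2 \<partial>(M \<Otimes>\<^sub>M std_on J)) + column j B \<bullet> (?K *v column j B)) / 2)"
    by (intro sum.cong refl) (simp add: p(3))
  also have "\<dots> = (\<integral>v. F v \<partial>mixlaw Mx x \<sigma> J)"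
    unfolding a_def by (rule lg(2)[symmetric])
  finally show "(\<integral>v. ln (test_density B sel g v) \<partial>mixlaw Mx x \<sigma> J) \<ge> - real n / 2 * ln ((2 * pi * exp 1) ^ CARD('c) * det (D + ?K))"
    unfolding F_def .
qed

end

section \<open>The power bound\<close>

text \<open>In whitened coordinates \<open>U\<close> is the identity form, so an isotropic form that
  is small against the operator norm of \<open>B\<close> can be subtracted.\<close>

lemma pos_def_shift:
  fixes U :: "real^'n^'n"
  assumes U: "pos_def U"
  obtains s where "0 < s" "pos_def (U - s\<^sup>2 *\<^sub>R mat 1)"
proof -
  obtain B where B: "whitens B U" using whitening_exists[OF U] by blast
  have "invertible B" using whitens_det(2)[OF B] by (simp add: invertible_det_nz)
  then obtain B' where B': "B ** B' = mat 1" unfolding invertible_def by blast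
  obtain K where K: "0 < K" "\<And>y. norm (B *v y) \<le> norm y * K"
    using bounded_linear.pos_bounded[OF matrix_vector_mul_bounded_linear[of B]] by blast
  \<comment> \<open>At this size \<open>s\<^sup>2 * (x \<bullet> x)\<close> is at most
    \<open>(y \<bullet> y) / 4\<close>, a quarter of the form
    \<open>x \<bullet> (U *v x)\<close>.\<close>
  define s where "s = 1 / (2 * K)"
  have "transpose (U - s\<^sup>2 *\<^sub>R mat 1) = U - s\<^sup>2 *\<^sub>R mat 1"
    using U by (auto simp: pos_def_def transpose_def vec_eq_iff mat_def)
  moreover have "0 < x \<bullet> ((U - s\<^sup>2 *\<^sub>R mat 1) *v x)" if x: "x \<noteq> 0" for x
  proof -
    define y where "y = B' *v x"
    have By: "B *v y = x" unfolding y_def by (simp add: matrix_vector_mul_assoc B')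
    then have "y \<noteq> 0" using x by auto
    then have y: "0 < y \<bullet> y" by simp
    have "(norm x)\<^sup>2 \<le> (norm y * K)\<^sup>2" using K(2)[of y] unfolding By by (intro power_mono) auto
    then have "s\<^sup>2 * (x \<bullet> x) \<le> s\<^sup>2 * ((y \<bullet> y) * K\<^sup>2)"
      by (intro mult_left_mono) (simp_all add: power_mult_distrib power2_norm_eq_inner)
    also have "\<dots> = (y \<bullet> y) / 4" using K(1) by (simp add: s_def power2_eq_square field_simps)
    also have "\<dots> < y \<bullet> y" using y by simp
    also have "\<dots> = x \<bullet> (U *v x)" using whitens_quadratic[OF B, of y] By by simp
    finally show ?thesis
      by (simp add: matrix_vector_mult_diff_rdistrib inner_diff_right scaleR_matrix_vector_assoc[symmetric])
  qed
  moreover have "0 < s" using K(1) by (simp add: s_def)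
  ultimately show ?thesis using that unfolding pos_def_def by blast
qed

text \<open>The form restricted to vectors supported on the selected coordinates; injectivity of
  \<open>sel\<close> keeps a lifted nonzero vector nonzero.\<close>

lemma pos_def_sub_mat:
  fixes sel :: "'c::finite \<Rightarrow> 'k::finite"
  assumes K: "pos_def K" and sel: "inj sel"
  shows "pos_def (sub_mat sel K)"
proof -
  have "transpose (sub_mat sel K) = sub_mat sel K"
    using K by (auto simp: pos_def_def transpose_def vec_eq_iff sub_mat_def)
  moreover have "0 < \<xi> \<bullet> (sub_mat sel K *v \<xi>)" if "\<xi> \<noteq> 0" for \<xi>
  proof -
    have "lift_vec sel \<xi> \<bullet> axis (sel j) 1 = \<xi> $ j" for j
    proof -
      have "(\<chi> j'. axis (sel j) 1 $ sel j') = (axis j 1 :: real^'c)"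
        using sel by (auto simp: vec_eq_iff axis_def inj_eq)
      then show ?thesis unfolding lift_vec_inner by (simp add: inner_axis)
    qed
    then have "lift_vec sel \<xi> \<noteq> 0" using that by (metis inner_zero_left vec_eq_iff zero_index)
    then show ?thesis using K unfolding lift_vec_form[symmetric] pos_def_def by blast
  qed
  ultimately show ?thesis unfolding pos_def_def by blast
qed

lemma pos_semidef_add_pos_def:
  assumes A: "pos_semidef A" and K: "pos_def K"
  shows "pos_def (A + K)"
proof -
  have "transpose (A + K) = transpose A + transpose K" by (simp add: transpose_def vec_eq_iff)
  then have "transpose (A + K) = A + K" using A K by (simp add: pos_semidef_def pos_def_def)
  moreover have "0 < y \<bullet> ((A + K) *v y)" if "y \<noteq> 0" for y
    using A K that unfolding pos_semidef_def pos_def_def matrix_vector_mult_add_rdistrib inner_add_right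
    by (intro add_nonneg_pos) auto
  ultimately show ?thesis unfolding pos_def_def by blast
qed

lemma pos_def_imp_semidef:
  assumes "pos_def A" shows "pos_semidef A"
proof -
  have "0 \<le> y \<bullet> (A *v y)" for y using assms by (cases "y = 0") (auto simp: pos_def_def less_imp_le)
  then show ?thesis using assms by (simp add: pos_def_def pos_semidef_def)
qed

text \<open>Codes approximating a point of the closure need not have positive definite distortion
  matrices. Dominating an error matrix makes them semidefinite, and adding a positive definite block
  then gives positive determinants. Symmetry of \<open>D\<close> has to be recovered from that of
  the error matrix.\<close>

lemma distortion_semidef:
  fixes e :: "'w \<Rightarrow> nat \<Rightarrow> real^'n"
  assumes n: "0 < n" and i: "integrable M (\<lambda>\<omega>. \<Sum>t<n. outer (e \<omega> t) (e \<omega> t))"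
    and D: "loewner_le ((1 / real n) *\<^sub>R (\<integral>\<omega>. (\<Sum>t<n. outer (e \<omega> t) (e \<omega> t)) \<partial>M)) D"
  shows "pos_semidef D"
proof -
  let ?I = "\<integral>\<omega>. (\<Sum>t<n. outer (e \<omega> t) (e \<omega> t)) \<partial>M"
  have entry: "?I $ a $ b = (\<integral>\<omega>. (\<Sum>t<n. outer (e \<omega> t) (e \<omega> t)) $ a $ b \<partial>M)" for a b
    by (rule integral_bounded_linear[OF bounded_linear_entry i, symmetric])
  have I: "?I $ a $ b = ?I $ b $ a" for a b
    unfolding entry by (simp add: outer_def mult.commute)
  have "transpose (D - (1 / real n) *\<^sub>R ?I) = D - (1 / real n) *\<^sub>R ?I"
    using D by (simp add: loewner_le_def pos_semidef_def)
  then have h: "(D - (1 / real n) *\<^sub>R ?I) $ b $ a = (D - (1 / real n) *\<^sub>R ?I) $ a $ b" for a b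
    by (drule_tac arg_cong[where f = "\<lambda>A. A $ a $ b"]) (simp add: transpose_def)
  have "D $ b $ a = D $ a $ b" for a b using h[of b a] I[of a b] by simp
  then have "transpose D = D" by (simp add: transpose_def vec_eq_iff)
  moreover have "0 \<le> \<xi> \<bullet> (D *v \<xi>)" for \<xi>
  proof -
    have "0 \<le> (\<integral>\<omega>. (\<Sum>t<n. (\<xi> \<bullet> e \<omega> t)\<^sup>2) \<partial>M)" by (intro integral_nonneg_AE AE_I2 sum_nonneg) simp
    then show ?thesis using distortion_bound[OF n i D, of \<xi>] n
      by (smt (verit) of_nat_0_less_iff zero_le_mult_iff)
  qed
  ultimately show ?thesis by (simp add: pos_semidef_def)
qed

text \<open>Named as a function of \<open>D1\<close> and \<open>D2\<close> for the sake of its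
  continuity: \<open>code_bound\<close> applies to approximating triples, whose distortions differ
  from the target.\<close>

definition converse_bound :: "real \<Rightarrow> real \<Rightarrow> real^('m1 + 'm2)^('m1 + 'm2) \<Rightarrow> real^('m1::finite + 'm2::finite)^('m1 + 'm2) \<Rightarrow> real^'m1^'m1 \<Rightarrow> real^'m2^'m2 \<Rightarrow> real"
  where "converse_bound N1 N2 \<Sigma> U D1 D2 =
    N1 * (det (\<Sigma> + U) / (det (D1 + upper_left U) * det (D2 + lower_right U)))
      + (N2 - N1) * (det (lower_right \<Sigma> + lower_right U) / det (D2 + lower_right U)) - N2"

context gaussian_broadcast
begin

lemma code_bound:
  assumes \<Sigma>: "\<Sigma> = second_moment M (src 0)" and pd: "pos_def \<Sigma>" and N: "0 < N1" "N1 < N2" and U: "pos_def U"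
    and n: "0 < n" and code: "broadcast_code M S1 S2 Z1 Z2 n P D1 D2 f g1 g2"
  shows "converse_bound N1 N2 \<Sigma> U D1 D2 \<le> P"
proof -
  obtain s where s: "0 < s" and U': "pos_def (U - s\<^sup>2 *\<^sub>R mat 1)" by (rule pos_def_shift[OF U])
  define U' where "U' = U - s\<^sup>2 *\<^sub>R mat 1"
  obtain Bg where Bg: "whitens Bg U'" using whitening_exists[OF U'] unfolding U'_def by blast
  have f: "f \<in> block_space n \<Otimes>\<^sub>M block_space n \<rightarrow>\<^sub>M block_space n"
    and g1: "g1 \<in> block_space n \<rightarrow>\<^sub>M block_space n" and g2: "g2 \<in> block_space n \<rightarrow>\<^sub>M block_space n"
    and pow: "meets_power M n (\<lambda>\<omega>. f (block n S1 \<omega>, block n S2 \<omega>)) P"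
    and d1: "meets_distortion M n (block n S1) (\<lambda>\<omega>. g1 (channel_output n (\<lambda>\<omega>. f (block n S1 \<omega>, block n S2 \<omega>)) Z1 \<omega>)) D1"
    and d2: "meets_distortion M n (block n S2) (\<lambda>\<omega>. g2 (channel_output n (\<lambda>\<omega>. f (block n S1 \<omega>, block n S2 \<omega>)) Z2 \<omega>)) D2"
    using code unfolding broadcast_code_def Let_def by auto
  have X_sq: "integrable M (\<lambda>\<omega>. \<Sum>t<n. (f (block n S1 \<omega>, block n S2 \<omega>) t)\<^sup>2)"
    and X_pow: "(1 / real n) * (\<integral>\<omega>. (\<Sum>t<n. (f (block n S1 \<omega>, block n S2 \<omega>) t)\<^sup>2) \<partial>M) \<le> P"
    using pow unfolding meets_power_def by auto
  interpret C: coded_broadcast M S1 S2 Z1 Z2 N1 N2 n f \<Sigma> U' Bg s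
    by unfold_locales (fact n N f X_sq \<Sigma> pd Bg s)+
  define e1 where "e1 \<omega> t = (\<chi> j. src t \<omega> $ Inl j) - g1 (channel_output n C.X Z1 \<omega>) t" for \<omega> t
  define e2 where "e2 \<omega> t = (\<chi> j. src t \<omega> $ Inr j) - g2 (channel_output n C.X Z2 \<omega>) t" for \<omega> t
  have S: "(\<chi> j. src t \<omega> $ Inl j) = S1 t \<omega>" "(\<chi> j. src t \<omega> $ Inr j) = S2 t \<omega>" for t \<omega>
    by (simp_all add: src_def vec_eq_iff)
  have E1: "integrable M (\<lambda>\<omega>. \<Sum>t<n. outer (e1 \<omega> t) (e1 \<omega> t))"
      "loewner_le ((1 / real n) *\<^sub>R (\<integral>\<omega>. (\<Sum>t<n. outer (e1 \<omega> t) (e1 \<omega> t)) \<partial>M)) D1"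
    and E2: "integrable M (\<lambda>\<omega>. \<Sum>t<n. outer (e2 \<omega> t) (e2 \<omega> t))"
      "loewner_le ((1 / real n) *\<^sub>R (\<integral>\<omega>. (\<Sum>t<n. outer (e2 \<omega> t) (e2 \<omega> t)) \<partial>M)) D2"
    using d1 d2 unfolding meets_distortion_def e1_def e2_def S by (simp_all add: block_def)
  have ul: "sub_mat Inl A = upper_left A" and lr: "sub_mat Inr A = lower_right A" and idm: "sub_mat (\<lambda>k. k) A = A"
    for A :: "real^('m1 + 'm2)^('m1 + 'm2)"
    by (simp_all add: sub_mat_def upper_left_def lower_right_def vec_eq_iff)
  \<comment> \<open>On every block of coordinates the two parts of the smoothing recombine to
    \<open>U\<close>.\<close>
  have shift: "sub_mat sel U' + s\<^sup>2 *\<^sub>R mat 1 = sub_mat sel U" if "inj sel" for sel :: "'c::finite \<Rightarrow> 'm1 + 'm2"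
  proof -
    have "sub_mat sel U' + s\<^sup>2 *\<^sub>R mat 1 = sub_mat sel (U' + s\<^sup>2 *\<^sub>R mat 1)"
      by (simp add: sub_mat_add sub_mat_scaled_id[OF that])
    then show ?thesis by (simp add: U'_def)
  qed
  have shift2: "sub_mat sel (\<Sigma> + U') + s\<^sup>2 *\<^sub>R mat 1 = sub_mat sel (\<Sigma> + U)" if "inj sel" for sel :: "'c::finite \<Rightarrow> 'm1 + 'm2"
    using shift[OF that] by (simp add: sub_mat_add add.assoc)
  have inj: "inj (Inl :: 'm1 \<Rightarrow> 'm1 + 'm2)" "inj (Inr :: 'm2 \<Rightarrow> 'm1 + 'm2)" "inj (\<lambda>k :: 'm1 + 'm2. k)"
    by (auto simp: inj_def)
  have pSU: "pos_def (\<Sigma> + U)" by (rule pos_semidef_add_pos_def[OF pos_def_imp_semidef[OF pd] U])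
  have pd1: "pos_def (D1 + sub_mat Inl U)"
    by (rule pos_semidef_add_pos_def[OF distortion_semidef[OF n E1] pos_def_sub_mat[OF U inj(1)]])
  have pd2: "pos_def (D2 + sub_mat Inr U)"
    by (rule pos_semidef_add_pos_def[OF distortion_semidef[OF n E2] pos_def_sub_mat[OF U inj(2)]])
  obtain BW where BW: "whitens BW (sub_mat (\<lambda>k. k) (\<Sigma> + U))"
    using whitening_exists[OF pos_def_sub_mat[OF pSU inj(3)]] by blast
  obtain B2 where B2: "whitens B2 (sub_mat Inr (\<Sigma> + U))"
    using whitening_exists[OF pos_def_sub_mat[OF pSU inj(2)]] by blast
  obtain T1 where T1: "whitens T1 (D1 + sub_mat Inl U)" using whitening_exists[OF pd1] by blast
  obtain T2 where T2: "whitens T2 (D2 + sub_mat Inr U)" using whitening_exists[OF pd2] by blast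
  let ?A = "C.W (Inl :: 'm1 \<Rightarrow> 'm1 + 'm2)" and ?B = "C.W (Inr :: 'm2 \<Rightarrow> 'm1 + 'm2)"
  let ?C = "Inr ` {..<n} :: ((nat \<times> ('m1 + 'm2)) + nat) set"
  have AB: "?A \<union> ?B = C.W (\<lambda>k. k)" by (auto simp: UNIV_sum image_Un)
  \<comment> \<open>One definition for both channels: variance \<open>r\<close> at the channel
    coordinates in use and deviation \<open>s\<close> elsewhere, also at channel indices from
    \<open>n\<close> on, so that all deviations are positive.\<close>
  define \<sigma> where "\<sigma> r = (\<lambda>i. if i \<in> ?C then sqrt r else s)" for r
  have \<sigma>: "0 < \<sigma> r i" "\<sigma> r (Inl tk) = s" "t < n \<Longrightarrow> \<sigma> r (Inr t) = sqrt r" if "0 < r" for r i tk t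
    using that s by (auto simp: \<sigma>_def)
  have N2: "0 < N2" using N by simp
  define k :: real where "k = 2 * pi * exp 1"
  have k: "0 < k" by (simp add: k_def)
  have t1: "C.test_density T1 Inl g1 \<in> borel_measurable (lborel_on (?A \<union> (?B \<union> ?C)))" "0 < C.test_density T1 Inl g1 v"
    "integrable (mixlaw C.Mx C.x (\<sigma> N1) (?A \<union> (?B \<union> ?C))) (\<lambda>v. ln (C.test_density T1 Inl g1 v))"
    "(\<integral>v. ln (C.test_density T1 Inl g1 v) \<partial>mixlaw C.Mx C.x (\<sigma> N1) (?A \<union> (?B \<union> ?C)))
      \<ge> - real n / 2 * ln (k ^ CARD('m1) * det (D1 + sub_mat Inl U))" for v
    unfolding shift[OF inj(1), symmetric] k_def
    by (rule C.decoder_test[where \<sigma> = "\<sigma> N1" and \<nu> = N1 and z = Z1 and J = "?A \<union> (?B \<union> ?C)", OF inj(1) \<sigma>[OF N(1)] _ _ _ _ g1 E1[unfolded e1_def] T1[folded shift[OF inj(1)]]]; auto)+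
  have t2: "C.test_density T2 Inr g2 \<in> borel_measurable (lborel_on (?B \<union> ?C))" "0 < C.test_density T2 Inr g2 v"
    "integrable (mixlaw C.Mx C.x (\<sigma> N2) (?B \<union> ?C)) (\<lambda>v. ln (C.test_density T2 Inr g2 v))"
    "(\<integral>v. ln (C.test_density T2 Inr g2 v) \<partial>mixlaw C.Mx C.x (\<sigma> N2) (?B \<union> ?C))
      \<ge> - real n / 2 * ln (k ^ CARD('m2) * det (D2 + sub_mat Inr U))" for v
    unfolding shift[OF inj(2), symmetric] k_def
    by (rule C.decoder_test[where \<sigma> = "\<sigma> N2" and \<nu> = N2 and z = Z2 and J = "?B \<union> ?C", OF inj(2) \<sigma>[OF N2] _ _ _ _ g2 E2[unfolded e2_def] T2[folded shift[OF inj(2)]]]; auto)+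
  have hW: "nent C.Mx C.x (\<sigma> N1) (?A \<union> ?B) = - real n / 2 * ln (k ^ CARD('m1 + 'm2) * det (\<Sigma> + U))"
    unfolding AB using C.nent_value[where \<sigma> = "\<sigma> N1", OF inj(3) \<sigma>(1,2)[OF N(1)] BW[folded shift2[OF inj(3)]], unfolded shift2[OF inj(3)], unfolded idm]
    unfolding k_def .
  have h2: "nent C.Mx C.x (\<sigma> N1) ?B = - real n / 2 * ln (k ^ CARD('m2) * det (sub_mat Inr (\<Sigma> + U)))"
    using C.nent_value[where \<sigma> = "\<sigma> N1", OF inj(2) \<sigma>(1,2)[OF N(1)] B2[folded shift2[OF inj(2)]]]
    unfolding shift2[OF inj(2)] k_def .
  have pX: "(\<Sum>c\<in>?C. \<integral>p. (C.x c p)\<^sup>2 \<partial>C.Mx) \<le> real n * P"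
  proof -
    have "(\<Sum>c\<in>?C. \<integral>p. (C.x c p)\<^sup>2 \<partial>C.Mx) = (\<Sum>t<n. \<integral>p. (C.x (Inr t) p)\<^sup>2 \<partial>C.Mx)"
      by (subst sum.reindex) (auto simp: inj_on_def)
    also have "\<dots> = (\<Sum>t<n. \<integral>\<omega>. (C.X \<omega> t)\<^sup>2 \<partial>M)"
    proof (intro sum.cong refl)
      fix t assume t: "t \<in> {..<n}"
      then show "(\<integral>p. (C.x (Inr t) p)\<^sup>2 \<partial>C.Mx) = (\<integral>\<omega>. (C.X \<omega> t)\<^sup>2 \<partial>M)"
        using integral_pair_fst[OF prob_space_axioms C.prob_space_smoothing, of "\<lambda>\<omega>. (C.X \<omega> t)\<^sup>2"] C.X_measurable[of t]
        by (simp add: C.x_def C.Mx_def)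
    qed
    also have "\<dots> = (\<integral>\<omega>. (\<Sum>t<n. (C.X \<omega> t)\<^sup>2) \<partial>M)"
      using C.X_square by (subst Bochner_Integration.integral_sum) auto
    also have "\<dots> \<le> real n * P" using X_pow n by (simp add: field_simps)
    finally show ?thesis .
  qed
  note dW = whitens_det(3)[OF BW] and dB = whitens_det(3)[OF B2] and dT1 = whitens_det(3)[OF T1] and dT2 = whitens_det(3)[OF T2]
  \<comment> \<open>The bound with the powers of \<open>k\<close> still in place; they cancel
    afterwards because the exponent \<open>CARD('m1 + 'm2)\<close> is the sum of
    \<open>CARD('m1)\<close> and \<open>CARD('m2)\<close>.\<close>
  have "N1 * (k ^ CARD('m1 + 'm2) * det (\<Sigma> + U) / ((k ^ CARD('m1) * det (D1 + sub_mat Inl U)) * (k ^ CARD('m2) * det (D2 + sub_mat Inr U))))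
      + (N2 - N1) * (k ^ CARD('m2) * det (sub_mat Inr (\<Sigma> + U)) / (k ^ CARD('m2) * det (D2 + sub_mat Inr U))) - N2 \<le> P"
  proof (rule C.mixture.mixture_converse[where A = ?A and B = ?B and C = ?C and s = s, folded \<sigma>_def])
    show "finite ?A" "finite ?B" by (rule C.finite_W)+
    show "finite ?C" "?A \<inter> ?B = {}" "?A \<inter> ?C = {}" "?B \<inter> ?C = {}" by auto
    show "n = card ?C" by (simp add: card_image)
    show "(\<integral>\<^sup>+w. ennreal (C.test_density T1 Inl g1 (merge ?A (?B \<union> ?C) (w, y))) \<partial>lborel_on ?A) \<le> 1" for y
      by (subst C.test_density_kernel[OF whitens_det(2)[OF T1] inj(1)]) auto
    show "(\<integral>\<^sup>+w. ennreal (C.test_density T2 Inr g2 (merge ?B ?C (w, y))) \<partial>lborel_on ?B) \<le> 1" for y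
      by (subst C.test_density_kernel[OF whitens_det(2)[OF T2] inj(2)]) auto
  qed (use n N s pX t1 t2 hW h2 k dW dB dT1 dT2 in \<open>auto simp: idm\<close>)
  moreover have "k ^ CARD('m1 + 'm2) = k ^ CARD('m1) * k ^ CARD('m2)" by (simp add: power_add)
  ultimately show ?thesis
    using k by (simp add: converse_bound_def ul[symmetric] lr[symmetric] sub_mat_add mult_ac)
qed

text \<open>Taking a block commutes with the integral because the full integrand is integrable,
  which positive definiteness of \<open>\<Sigma>\<close> guarantees.\<close>

lemma lower_right_second_moment:
  assumes \<Sigma>: "\<Sigma> = second_moment M (src 0)" and pd: "pos_def \<Sigma>"
  shows "second_moment M (S2 0) = lower_right \<Sigma>"
proof -
  have "linear (lower_right :: real^('m1 + 'm2)^('m1 + 'm2) \<Rightarrow> real^'m2^'m2)"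
    by (rule linearI) (simp_all add: lower_right_def vec_eq_iff)
  then have l: "bounded_linear (lower_right :: real^('m1 + 'm2)^('m1 + 'm2) \<Rightarrow> real^'m2^'m2)"
    by (rule linear_conv_bounded_linear[THEN iffD1])
  have "outer (S2 0 \<omega>) (S2 0 \<omega>) = lower_right (outer (src 0 \<omega>) (src 0 \<omega>))" for \<omega>
    by (simp add: outer_def lower_right_def src_def vec_eq_iff)
  then show ?thesis
    unfolding \<Sigma> second_moment_def using integral_bounded_linear[OF l outer_integrable[OF \<Sigma> pd]] by simp
qed

end

section \<open>Passage to the closure of the achievable region\<close>

lemma tendsto_det:
  fixes A :: "nat \<Rightarrow> real^'n^'n"
  assumes "A \<longlonglongrightarrow> L" shows "(\<lambda>k. det (A k)) \<longlonglongrightarrow> det L"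
  unfolding det_def by (intro tendsto_sum tendsto_mult tendsto_const tendsto_prod tendsto_vec_nth assms)

theorem corollary1:
  fixes M :: "'w measure"
    and S1 :: "nat \<Rightarrow> 'w \<Rightarrow> real^'m1" and S2 :: "nat \<Rightarrow> 'w \<Rightarrow> real^'m2"
    and Z1 Z2 :: "nat \<Rightarrow> 'w \<Rightarrow> real"
    and N1 N2 :: real
    and \<Sigma> :: "real^('m1 + 'm2)^('m1 + 'm2)" and \<Sigma>2 :: "real^'m2^'m2"
    and D1 :: "real^'m1^'m1" and D2 :: "real^'m2^'m2"
  assumes "gaussian_broadcast M S1 S2 Z1 Z2 N1 N2"
    and "\<Sigma> = second_moment M (\<lambda>\<omega>. stack (S1 0 \<omega>) (S2 0 \<omega>))"
    and "\<Sigma>2 = second_moment M (S2 0)"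
    and "pos_def \<Sigma>"
    and "0 < N1" and "N1 < N2"
    and "pos_def D1" and "pos_def D2"
  shows "min_power M S1 S2 Z1 Z2 D1 D2 \<ge>
    (SUP U\<in>{U :: real^('m1 + 'm2)^('m1 + 'm2). pos_def U}.
      ereal (N1 * (det (\<Sigma> + U) / (det (D1 + upper_left U) * det (D2 + lower_right U)))
        + (N2 - N1) * (det (\<Sigma>2 + lower_right U) / det (D2 + lower_right U))
        - N2))"
proof -
  interpret gaussian_broadcast M S1 S2 Z1 Z2 N1 N2 by fact
  have \<Sigma>: "\<Sigma> = second_moment M (src 0)" using assms(2) by (simp add: src_def[abs_def])
  have \<Sigma>2: "\<Sigma>2 = lower_right \<Sigma>" using assms(3) lower_right_second_moment[OF \<Sigma> assms(4)] by simp
  have "converse_bound N1 N2 \<Sigma> U D1 D2 \<le> P"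
    if U: "pos_def U" and P: "(P, D1, D2) \<in> PD_region M S1 S2 Z1 Z2" for U P
  proof -
    \<comment> \<open>The approximating triples carry their own distortion matrices, so the bound is
      applied along the sequence before the limit is taken on both sides.\<close>
    obtain c where c: "\<And>i. c i \<in> achievable M S1 S2 Z1 Z2" "c \<longlonglongrightarrow> (P, D1, D2)"
      using P unfolding PD_region_def closure_sequential by blast
    have lim: "(\<lambda>i. fst (c i)) \<longlonglongrightarrow> P" "(\<lambda>i. fst (snd (c i))) \<longlonglongrightarrow> D1" "(\<lambda>i. snd (snd (c i))) \<longlonglongrightarrow> D2"
      using tendsto_fst[OF c(2)] tendsto_fst[OF tendsto_snd[OF c(2)]] tendsto_snd[OF tendsto_snd[OF c(2)]] by simp_all
    have le: "converse_bound N1 N2 \<Sigma> U (fst (snd (c i))) (snd (snd (c i))) \<le> fst (c i)" for i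
    proof -
      obtain n f g1 g2 where "1 \<le> n" "broadcast_code M S1 S2 Z1 Z2 n (fst (c i)) (fst (snd (c i))) (snd (snd (c i))) f g1 g2"
        using c(1)[of i] unfolding achievable_def by (auto simp: case_prod_beta')
      then show ?thesis using code_bound[OF \<Sigma> assms(4,5,6) U, of n] by simp
    qed
    have blocks: "upper_left U = sub_mat Inl U" "lower_right U = sub_mat Inr U"
      by (simp_all add: sub_mat_def upper_left_def lower_right_def)
    \<comment> \<open>Positive definiteness of the target distortions enters here: the limiting
      denominators are nonzero.\<close>
    have pos: "det (D1 + upper_left U) \<noteq> 0" "det (D2 + lower_right U) \<noteq> 0"
      using whitens_det(3) whitening_exists pos_semidef_add_pos_def[OF pos_def_imp_semidef pos_def_sub_mat[OF U]]
        assms(7,8) unfolding blocks by (metis inj_Inl inj_Inr less_irrefl)+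
    have "(\<lambda>i. converse_bound N1 N2 \<Sigma> U (fst (snd (c i))) (snd (snd (c i)))) \<longlonglongrightarrow> converse_bound N1 N2 \<Sigma> U D1 D2"
      unfolding converse_bound_def using pos by (intro tendsto_intros tendsto_det lim) auto
    then show ?thesis using lim(1) le by (intro LIMSEQ_le) auto
  qed
  \<comment> \<open>Each value under the supremum is below each admissible power. With extended
    reals this covers an empty set of powers, whose infimum is \<infinity>.\<close>
  then show ?thesis
    unfolding min_power_def \<Sigma>2 converse_bound_def by (intro SUP_least INF_greatest) simp
qed

end
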